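(* Let $L$ be a simple Lie algebra over the complex numbers and let $\phi$ be an irreducible (finite-dimensional) representation of $L$ with highest weight $\omega$. Suppose that the maximal weight multiplicity of $\phi$ equals $2$. Then the pair $(L,\omega)$ is one of the following: (i) $L$ of type $A_2$ and $\omega\in\{\omega_1+a\omega_2,\ a\omega_1+\omega_2\}$ for some integer $a\ge 1$; (ii) $L$ of type $A_3$ and $\omega\in\{\omega_1+\omega_2,\ \omega_2+\omega_3,\ 2\omega_2,\ 3\omega_2\}$; (iii) $L$ of type $A_n$ with $n>3$ and $\omega\in\{\omega_1+\omega_2,\ \omega_{n-1}+\omega_n,\ 2\omega_2,\ 2\omega_{n-1}\}$; (iv) $L$ of type $B_2=C_2$ and $\omega\in\{\omega_1+\omega_2,\ 2\omega_2,\ 2\omega_1,\ 3\omega_2,\ 3\omega_1\}$; (v) $L$ of type $C_3$ and $\omega=\omega_2$; (vi) $L$ of type $C_4$ and $\omega\in\{\omega_4,\ \omega_3\}$; (vii) $L$ of type $C_5$ and $\omega=\omega_5$; (viii) $L$ of type $F_4$ and $\omega=\omega_4$; (ix) $L$ of type $G_2$ and $\omega=\omega_2$.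
   Context: The simple Lie algebras are those of types $A_n$ ($n\ge1$), $B_n$ ($n\ge 2$), $C_n$ ($n\ge2$), $D_n$ ($n\ge4$), $E_6,E_7,E_8,F_4,G_2$, with $B_2\cong C_2$. Simple roots $\alpha_1,\ldots,\alpha_n$ and the corresponding fundamental weights $\omega_1,\ldots,\omega_n$ are numbered as in Bourbaki. The maximal weight multiplicity of $\phi$ is the maximum, over all weights $\mu$ of $\phi$, of the dimension of the $\mu$-weight space of $\phi$. *)

theory Defs
  imports Complex_Main "HOL-Library.Function_Algebras"
begin

section \<open>Complex Lie algebras\<close>

definition (in vector_space) finite_dim :: bool where
  "finite_dim \<longleftrightarrow> (\<exists>B. finite B \<and> span B = UNIV)"

locale lie_algebra = vector_space scale
  for scale :: "complex \<Rightarrow> 'l::ab_group_add \<Rightarrow> 'l" +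
  fixes br :: "'l \<Rightarrow> 'l \<Rightarrow> 'l"
  assumes br_linear_left: "Vector_Spaces.linear scale scale (\<lambda>x. br x y)"
    and br_linear_right: "Vector_Spaces.linear scale scale (br x)"
    and br_self: "br x x = 0"
    and jacobi: "br x (br y z) + br y (br z x) + br z (br x y) = 0"
begin

definition ideal :: "'l set \<Rightarrow> bool" where
  "ideal I \<longleftrightarrow> subspace I \<and> (\<forall>x. \<forall>y\<in>I. br x y \<in> I)"

definition simple :: bool where
  "simple \<longleftrightarrow> (\<exists>x y. br x y \<noteq> 0) \<and> (\<forall>I. ideal I \<longrightarrow> I = {0} \<or> I = UNIV)"

definition subalgebra :: "'l set \<Rightarrow> bool" where
  "subalgebra H \<longleftrightarrow> subspace H \<and> (\<forall>x\<in>H. \<forall>y\<in>H. br x y \<in> H)"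

primrec lower_central :: "'l set \<Rightarrow> nat \<Rightarrow> 'l set" where
  "lower_central H 0 = H"
| "lower_central H (Suc k) = span {br x y |x y. x \<in> H \<and> y \<in> lower_central H k}"

definition nilpotent :: "'l set \<Rightarrow> bool" where
  "nilpotent H \<longleftrightarrow> (\<exists>k. lower_central H k = {0})"

definition normalizer :: "'l set \<Rightarrow> 'l set" where
  "normalizer H = {x. \<forall>h\<in>H. br x h \<in> H}"

definition cartan_subalgebra :: "'l set \<Rightarrow> bool" where
  "cartan_subalgebra H \<longleftrightarrow> subalgebra H \<and> nilpotent H \<and> normalizer H = H"

end

section \<open>Weights\<close>

text \<open>A linear form on a subspace \<open>H\<close> is represented by a function on the whole space that is
  linear on \<open>H\<close> and zero outside \<open>H\<close>. This makes the representation unique, and it is preserved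
  by pointwise sums and multiples. Integer multiples of forms are written as pointwise products,
  numerals and \<open>of_nat\<close> being read as constant functions.\<close>

definition dual :: "(complex \<Rightarrow> 'l \<Rightarrow> 'l::ab_group_add) \<Rightarrow> 'l set \<Rightarrow> ('l \<Rightarrow> complex) set" where
  "dual scale H = {f. (\<forall>x\<in>H. \<forall>y\<in>H. f (x + y) = f x + f y) \<and>
      (\<forall>c. \<forall>x\<in>H. f (scale c x) = c * f x) \<and> (\<forall>x. x \<notin> H \<longrightarrow> f x = 0)}"

definition weight_space ::
  "(complex \<Rightarrow> 'v \<Rightarrow> 'v) \<Rightarrow> ('l \<Rightarrow> 'v \<Rightarrow> 'v) \<Rightarrow> 'l set \<Rightarrow> ('l \<Rightarrow> complex) \<Rightarrow> 'v set" where
  "weight_space scaleV act H \<mu> = {v. \<forall>h\<in>H. act h v = scaleV (\<mu> h) v}"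

context lie_algebra
begin

abbreviation root_space :: "'l set \<Rightarrow> ('l \<Rightarrow> complex) \<Rightarrow> 'l set" where
  "root_space \<equiv> weight_space scale br"

definition roots :: "'l set \<Rightarrow> ('l \<Rightarrow> complex) set" where
  "roots H = {\<alpha> \<in> dual scale H. \<alpha> \<noteq> 0 \<and> root_space H \<alpha> \<noteq> {0}}"

text \<open>The coroot of \<open>\<alpha>\<close> is the element of \<open>[L\<^sub>\<alpha>, L\<^sub>-\<^sub>\<alpha>]\<close> at which \<open>\<alpha>\<close> takes the value 2.\<close>

definition coroot :: "'l set \<Rightarrow> ('l \<Rightarrow> complex) \<Rightarrow> 'l" where
  "coroot H \<alpha> = (THE t. t \<in> span {br x y |x y. x \<in> root_space H \<alpha> \<and> y \<in> root_space H (- \<alpha>)} \<and>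
      \<alpha> t = 2)"

text \<open>\<open>\<Delta>\<close> is a base of the root system (a set of simple roots).\<close>

definition root_base :: "'l set \<Rightarrow> ('l \<Rightarrow> complex) set \<Rightarrow> bool" where
  "root_base H \<Delta> \<longleftrightarrow> finite \<Delta> \<and> \<Delta> \<subseteq> roots H \<and>
     (\<forall>c. (\<forall>h\<in>H. (\<Sum>\<alpha>\<in>\<Delta>. c \<alpha> * \<alpha> h) = 0) \<longrightarrow> (\<forall>\<alpha>\<in>\<Delta>. c \<alpha> = 0)) \<and>
     (\<forall>\<beta>\<in>roots H. \<exists>k :: ('l \<Rightarrow> complex) \<Rightarrow> nat.
        \<beta> = (\<Sum>\<alpha>\<in>\<Delta>. of_nat (k \<alpha>) * \<alpha>) \<or> \<beta> = - (\<Sum>\<alpha>\<in>\<Delta>. of_nat (k \<alpha>) * \<alpha>))"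

definition positive_roots :: "'l set \<Rightarrow> ('l \<Rightarrow> complex) set \<Rightarrow> ('l \<Rightarrow> complex) set" where
  "positive_roots H \<Delta> = {\<beta> \<in> roots H. \<exists>k :: ('l \<Rightarrow> complex) \<Rightarrow> nat.
     \<beta> = (\<Sum>\<alpha>\<in>\<Delta>. of_nat (k \<alpha>) * \<alpha>)}"

text \<open>The fundamental weights of the simple roots \<open>\<alpha> 1, \<dots>, \<alpha> n\<close> form the basis dual to the
  simple coroots.\<close>

definition fundamental_weight ::
  "'l set \<Rightarrow> (nat \<Rightarrow> 'l \<Rightarrow> complex) \<Rightarrow> nat \<Rightarrow> nat \<Rightarrow> 'l \<Rightarrow> complex" where
  "fundamental_weight H \<alpha> n i = (THE \<omega>. \<omega> \<in> dual scale H \<and>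
     (\<forall>j\<in>{1..n}. \<omega> (coroot H (\<alpha> j)) = (if i = j then 1 else 0)))"

end

section \<open>Types\<close>

datatype lie_type =
  TypeA nat | TypeB nat | TypeC nat | TypeD nat | TypeE nat | TypeF4 | TypeG2

fun simple_type :: "lie_type \<Rightarrow> bool" where
  "simple_type (TypeA n) \<longleftrightarrow> n \<ge> 1"
| "simple_type (TypeB n) \<longleftrightarrow> n \<ge> 2"
| "simple_type (TypeC n) \<longleftrightarrow> n \<ge> 2"
| "simple_type (TypeD n) \<longleftrightarrow> n \<ge> 4"
| "simple_type (TypeE n) \<longleftrightarrow> n \<in> {6, 7, 8}"
| "simple_type TypeF4 \<longleftrightarrow> True"
| "simple_type TypeG2 \<longleftrightarrow> True"

fun lie_rank :: "lie_type \<Rightarrow> nat" where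
  "lie_rank (TypeA n) = n"
| "lie_rank (TypeB n) = n"
| "lie_rank (TypeC n) = n"
| "lie_rank (TypeD n) = n"
| "lie_rank (TypeE n) = n"
| "lie_rank TypeF4 = 4"
| "lie_rank TypeG2 = 2"

text \<open>Cartan matrices with Bourbaki's numbering and Bourbaki's convention
  \<open>a\<^sub>i\<^sub>j = \<alpha>\<^sub>i(\<alpha>\<^sub>j\<^sup>\<or>)\<close>. Thus an entry \<open>-2\<close> or \<open>-3\<close> has a long \<open>\<alpha>\<^sub>i\<close> and a short \<open>\<alpha>\<^sub>j\<close>:
  the short simple roots are \<open>\<alpha>\<^sub>n\<close> in \<open>B\<^sub>n\<close>, all but \<open>\<alpha>\<^sub>n\<close> in \<open>C\<^sub>n\<close>, \<open>\<alpha>\<^sub>3, \<alpha>\<^sub>4\<close> in \<open>F\<^sub>4\<close>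
  and \<open>\<alpha>\<^sub>1\<close> in \<open>G\<^sub>2\<close>. In \<open>D\<^sub>n\<close> the node \<open>n - 2\<close> is joined to \<open>n - 1\<close> and to \<open>n\<close>;
  in \<open>E\<^sub>n\<close> the nodes \<open>1, 3, 4, \<dots>, n\<close> form a chain and \<open>2\<close> is joined to \<open>4\<close>.\<close>

fun cartan_matrix :: "lie_type \<Rightarrow> nat \<Rightarrow> nat \<Rightarrow> int" where
  "cartan_matrix (TypeA n) i j =
     (if i = j then 2 else if i = j + 1 \<or> j = i + 1 then -1 else 0)"
| "cartan_matrix (TypeB n) i j =
     (if i = j then 2 else if i + 1 = n \<and> j = n then -2
      else if i = j + 1 \<or> j = i + 1 then -1 else 0)"
| "cartan_matrix (TypeC n) i j =
     (if i = j then 2 else if i = n \<and> j + 1 = n then -2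
      else if i = j + 1 \<or> j = i + 1 then -1 else 0)"
| "cartan_matrix (TypeD n) i j =
     (if i = j then 2 else if {i, j} \<in> {{k, k + 1} |k. k + 1 < n} \<union> {{n - 2, n}} then -1 else 0)"
| "cartan_matrix (TypeE n) i j =
     (if i = j then 2
      else if {i, j} \<in> {{1, 3}, {2, 4}} \<union> {{k, k + 1} |k. 3 \<le> k \<and> k < n} then -1 else 0)"
| "cartan_matrix TypeF4 i j =
     (if i = j then 2 else if i = 2 \<and> j = 3 then -2
      else if i = j + 1 \<or> j = i + 1 then -1 else 0)"
| "cartan_matrix TypeG2 i j =
     (if i = j then 2 else if i = 2 \<and> j = 1 then -3 else -1)"

text \<open>The algebra has type \<open>t\<close>, and \<open>\<alpha> 1, \<dots>, \<alpha> n\<close> is a Bourbaki numbering of the base \<open>\<Delta>\<close>.\<close>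

definition (in lie_algebra) bourbaki_numbering ::
  "'l set \<Rightarrow> ('l \<Rightarrow> complex) set \<Rightarrow> lie_type \<Rightarrow> (nat \<Rightarrow> 'l \<Rightarrow> complex) \<Rightarrow> bool" where
  "bourbaki_numbering H \<Delta> t \<alpha> \<longleftrightarrow> simple_type t \<and> bij_betw \<alpha> {1..lie_rank t} \<Delta> \<and>
     (\<forall>i\<in>{1..lie_rank t}. \<forall>j\<in>{1..lie_rank t}.
        \<alpha> i (coroot H (\<alpha> j)) = of_int (cartan_matrix t i j))"

section \<open>Representations\<close>

locale lie_representation = lie_algebra scale br + V: vector_space scaleV
  for scale :: "complex \<Rightarrow> 'l::ab_group_add \<Rightarrow> 'l" and br :: "'l \<Rightarrow> 'l \<Rightarrow> 'l"
    and scaleV :: "complex \<Rightarrow> 'v::ab_group_add \<Rightarrow> 'v" +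
  fixes act :: "'l \<Rightarrow> 'v \<Rightarrow> 'v"
  assumes act_linear: "Vector_Spaces.linear scaleV scaleV (act x)"
    and act_linear_left: "Vector_Spaces.linear scale scaleV (\<lambda>x. act x v)"
    and act_br: "act (br x y) v = act x (act y v) - act y (act x v)"
begin

definition irreducible :: bool where
  "irreducible \<longleftrightarrow> (\<exists>v::'v. v \<noteq> 0) \<and>
     (\<forall>W. V.subspace W \<and> (\<forall>x. \<forall>w\<in>W. act x w \<in> W) \<longrightarrow> W = {0} \<or> W = UNIV)"

definition weights :: "'l set \<Rightarrow> ('l \<Rightarrow> complex) set" where
  "weights H = {\<mu> \<in> dual scale H. weight_space scaleV act H \<mu> \<noteq> {0}}"

definition max_weight_multiplicity :: "'l set \<Rightarrow> nat" where
  "max_weight_multiplicity H = Max {V.dim (weight_space scaleV act H \<mu>) |\<mu>. \<mu> \<in> weights H}"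

text \<open>\<open>\<omega>\<close> is the weight of a highest weight vector; in an irreducible finite-dimensional
  representation there is exactly one such \<open>\<omega>\<close>.\<close>

definition highest_weight ::
  "'l set \<Rightarrow> ('l \<Rightarrow> complex) set \<Rightarrow> ('l \<Rightarrow> complex) \<Rightarrow> bool" where
  "highest_weight H \<Delta> \<omega> \<longleftrightarrow> \<omega> \<in> dual scale H \<and>
     (\<exists>v \<in> weight_space scaleV act H \<omega>. v \<noteq> 0 \<and>
        (\<forall>\<beta>\<in>positive_roots H \<Delta>. \<forall>x\<in>root_space H \<beta>. act x v = 0))"

end

end

theory Submission
  imports Defs "HOL-Computational_Algebra.Fundamental_Theorem_Algebra"
begin

text \<open>Let \<open>v\<close> be a highest weight vector. For positive roots whose pairwise differences are not roots,
  raising and lowering operators of different roots commute. So the pairings between the monomials in the lowering operators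
  applied to \<open>v\<close> and the monomials in the raising operators depend only on the Cartan matrix and the labels of these roots,
  and a non-zero \<open>3 \<times> 3\<close> minor of the pairing matrix produces a weight of multiplicity at least 3. Sums of simple roots
  over consecutive nodes of the diagram are such systems of roots; this reduces the exclusion of highest weights to finitely many
  minors of rank at most 6. The remaining weights outside the list are multiplicity free: a weight of multiplicity 2
  closest to the highest one is dominant, and there is either no such weight or only one simple root that leads up from it
  (for multiples of the first fundamental weight of \<open>A\<^sub>n\<close>, ordered monomials span). Diagrams are
  determined by positivity of an invariant form on the marks of affine diagrams.\<close>

section \<open>Linear algebra: traces, direct sums, generalized eigenspaces\<close>

section \<open>Traces on subspaces\<close>

text \<open>The labels and the rank are both unbounded, and each is made finite in its own way. A
  minor is a polynomial in the labels; shifting them to the smallest excluded values, as in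
  \<open>2 + x\<close>, leaves non-negative coefficients only, so its sign is visible for the whole
  family at once. For the rank, the point is that a sum of consecutive simple roots joined by simple
  bonds has the sum of their coroots as its coroot: labels add up, and the bonds to the outside
  persist. The converse bound, multiplicity at most 1, is always proved by contradiction at a weight
  of multiplicity 2 and least height, where dominance is a small system of integer inequalities. The
  Cartan subalgebra is given as a self-normalizing nilpotent subalgebra. Its diagonal action,
  linearity of the weights and one-dimensional root spaces are obtained from traces of commutators;
  simplicity enters mainly through the Killing form, whose radical is an ideal. Symmetry of
  multiplicities under reflections rests on injectivity of powers of root operators on single weight
  spaces.\<close>

definition (in vector_space) tr :: "'b set => ('b => 'b) => 'a" where
  "tr S f = (let B = (SOME B. independent B \<and> span B = S) in \<Sum>b\<in>B. representation B (f b) b)"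

context finite_dimensional_vector_space
begin

abbreviation lin :: "('b => 'b) => bool" where "lin \<equiv> Vector_Spaces.linear scale scale"

lemma lin_sum: "lin f ==> f (sum g A) = (\<Sum>a\<in>A. f (g a))"
  by (metis Vector_Spaces.linear.axioms(3) module_hom.sum)

lemma lin_scale: "lin f ==> f (scale c x) = scale c (f x)"
  by (metis Vector_Spaces.linear.axioms(3) module_hom.scale)

lemma lin_add: "lin f ==> f (x + y) = f x + f y"
  by (metis Vector_Spaces.linear.axioms(3) module_hom.add)

lemma lin_diff: "lin f ==> f (x - y) = f x - f y"
  by (metis Vector_Spaces.linear.axioms(3) module_hom.diff)

lemma lin_zero: "lin f ==> f 0 = 0"
  by (metis Vector_Spaces.linear.axioms(3) module_hom.zero)

lemma linI: "(!!x y. f (x + y) = f x + f y) ==> (!!c x. f (scale c x) = scale c (f x)) ==> lin f"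
  by (simp add: Vector_Spaces.linear_iff vector_space_axioms)

lemma lin_comp: "lin f ==> lin g ==> lin (\<lambda>x. f (g x))"
  by (rule linI) (simp_all add: lin_add lin_scale)

lemma lin_plus: "lin f ==> lin g ==> lin (\<lambda>x. f x + g x)"
  by (rule linI) (simp_all add: lin_add lin_scale scale_right_distrib)

lemma lin_minus: "lin f ==> lin g ==> lin (\<lambda>x. f x - g x)"
  by (rule linI) (simp_all add: lin_add lin_scale scale_right_diff_distrib)

lemma lin_smult: "lin f ==> lin (\<lambda>x. scale c (f x))"
  by (rule linI) (simp_all add: lin_add lin_scale scale_right_distrib mult.commute)

lemma lin_id: "lin (\<lambda>x. x)" and lin_const_smult: "lin (scale c)" and lin_0: "lin (\<lambda>x. 0)"
  by (rule linI; simp add: scale_right_distrib mult.commute)+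

lemma lin_pow: "lin f ==> lin (f ^^ n)"
  by (induction n) (auto intro!: linI simp: lin_add lin_scale)

lemma lin_span_image: "lin f ==> (!!b. b \<in> B ==> f b \<in> S) ==> subspace S ==> x \<in> span B ==> f x \<in> S"
  by (metis (no_types, lifting) Vector_Spaces.linear.axioms(3) image_subset_iff module_hom.span_image span_minimal image_eqI)

lemma subspace_image: "lin f ==> subspace S ==> subspace (f ` S)"
  by (metis Vector_Spaces.linear.axioms(3) module_hom.subspace_image)

lemma rep_expand: "independent B ==> x \<in> span B ==> (\<Sum>b\<in>B. scale (representation B x b) b) = x"
  by (rule sum_representation_eq) (auto intro: finiteI_independent)

lemma rep_sum_scale:
  assumes "independent B" "!!a. a \<in> A ==> g a \<in> span B"
  shows "representation B (\<Sum>a\<in>A. scale (c a) (g a)) b = (\<Sum>a\<in>A. c a * representation B (g a) b)"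
proof -
  have "representation B (\<Sum>a\<in>A. scale (c a) (g a)) b = (\<Sum>a\<in>A. representation B (scale (c a) (g a)) b)"
    using assms by (subst representation_sum) (auto intro: span_scale)
  also have "\<dots> = (\<Sum>a\<in>A. c a * representation B (g a) b)"
    using assms by (intro sum.cong refl) (simp add: representation_scale)
  finally show ?thesis .
qed

text \<open>Expanding each \<open>b\<close> over \<open>C\<close> and each \<open>f c\<close> over
  \<open>B\<close> turns both diagonal sums into the same double sum. It makes the arbitrary choice
  of a basis in \<open>tr\<close> harmless on subspaces invariant under \<open>f\<close>.\<close>

lemma trace_basis_indep:
  assumes B: "independent B" and C: "independent C" and BC: "span B = span C"
    and f: "lin f" and inv: "!!x. x \<in> span B ==> f x \<in> span B"
  shows "(\<Sum>b\<in>B. representation B (f b) b) = (\<Sum>c\<in>C. representation C (f c) c)"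
proof -
  have fb: "f b = (\<Sum>c\<in>C. scale (representation C b c) (f c))" if "b \<in> B" for b
  proof -
    have "b \<in> span C" using that BC span_base by blast
    then have "f b = f (\<Sum>c\<in>C. scale (representation C b c) c)" using rep_expand[OF C] by simp
    then show ?thesis by (simp add: lin_sum[OF f] lin_scale[OF f])
  qed
  have sp: "f c \<in> span B" "f c \<in> span C" if "c \<in> C" for c using that BC inv span_base by blast+
  have "(\<Sum>b\<in>B. representation B (f b) b) = (\<Sum>b\<in>B. \<Sum>c\<in>C. representation C b c * representation B (f c) b)"
    by (intro sum.cong refl) (subst fb, assumption, subst rep_sum_scale, auto simp: B sp)
  also have "\<dots> = (\<Sum>c\<in>C. \<Sum>b\<in>B. representation B (f c) b * representation C b c)"
    by (subst sum.swap) (simp add: mult.commute)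
  also have "\<dots> = (\<Sum>c\<in>C. representation C (\<Sum>b\<in>B. scale (representation B (f c) b) b) c)"
    by (intro sum.cong refl, subst rep_sum_scale) (use C BC span_base in auto)
  also have "\<dots> = (\<Sum>c\<in>C. representation C (f c) c)"
    using rep_expand[OF B] sp by (intro sum.cong refl) auto
  finally show ?thesis .
qed

lemma tr_eq:
  assumes B: "independent B" "span B = S" and f: "lin f" and inv: "!!x. x \<in> S ==> f x \<in> S"
  shows "tr S f = (\<Sum>b\<in>B. representation B (f b) b)"
proof -
  let ?C = "SOME B. independent B \<and> span B = S"
  have C: "independent ?C \<and> span ?C = S" by (rule someI[of _ B]) (use B in auto)
  show ?thesis unfolding tr_def Let_def
    by (rule trace_basis_indep) (use C B f inv in auto)
qed

lemma tr_comm: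
  assumes S: "subspace S" and f: "lin f" "!!x. x \<in> S ==> f x \<in> S" and g: "lin g" "!!x. x \<in> S ==> g x \<in> S"
  shows "tr S (\<lambda>x. f (g x)) = tr S (\<lambda>x. g (f x))"
proof -
  obtain B where B: "finite B" "B \<subseteq> S" "independent B" "span B = S" using basis_subspace_exists[OF S] by metis
  have ex: "representation B (h (k b)) b = (\<Sum>c\<in>B. representation B (k b) c * representation B (h c) b)"
    if h: "lin h" "!!x. x \<in> S ==> h x \<in> S" and k: "!!x. x \<in> S ==> k x \<in> S" and b: "b \<in> B" for h k b
  proof -
    have "k b = (\<Sum>c\<in>B. scale (representation B (k b) c) c)"
      using rep_expand[OF B(3)] k b B by (metis subsetD)
    then have "h (k b) = (\<Sum>c\<in>B. scale (representation B (k b) c) (h c))"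
      using lin_sum[OF h(1)] lin_scale[OF h(1)] by (metis (no_types, lifting) sum.cong)
    then show ?thesis using B h by (simp add: rep_sum_scale subset_iff)
  qed
  have "tr S (\<lambda>x. f (g x)) = (\<Sum>b\<in>B. \<Sum>c\<in>B. representation B (g b) c * representation B (f c) b)"
    by (subst tr_eq[OF B(3,4) lin_comp[OF f(1) g(1)]]) (auto simp: ex f g)
  also have "\<dots> = (\<Sum>c\<in>B. \<Sum>b\<in>B. representation B (f c) b * representation B (g b) c)"
    by (subst sum.swap) (simp add: mult.commute)
  also have "\<dots> = tr S (\<lambda>x. g (f x))"
    by (subst tr_eq[OF B(3,4) lin_comp[OF g(1) f(1)]]) (auto simp: ex f g)
  finally show ?thesis .
qed

lemma tr_add:
  assumes S: "subspace S" and f: "lin f" "!!x. x \<in> S ==> f x \<in> S" and g: "lin g" "!!x. x \<in> S ==> g x \<in> S"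
  shows "tr S (\<lambda>x. f x + g x) = tr S f + tr S g"
proof -
  obtain B where B: "finite B" "B \<subseteq> S" "independent B" "span B = S" using basis_subspace_exists[OF S] by metis
  show ?thesis
    using B f g S
    by (simp add: tr_eq[OF B(3,4)] lin_plus subspace_add representation_add subset_iff sum.distrib)
qed

lemma tr_scale:
  assumes S: "subspace S" and f: "lin f" "!!x. x \<in> S ==> f x \<in> S"
  shows "tr S (\<lambda>x. scale c (f x)) = c * tr S f"
proof -
  obtain B where B: "finite B" "B \<subseteq> S" "independent B" "span B = S" using basis_subspace_exists[OF S] by metis
  show ?thesis
    using B f S
    by (simp add: tr_eq[OF B(3,4)] lin_smult subspace_scale representation_scale subset_iff sum_distrib_left)
qed

lemma tr_diff:
  assumes S: "subspace S" and f: "lin f" "!!x. x \<in> S ==> f x \<in> S" and g: "lin g" "!!x. x \<in> S ==> g x \<in> S"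
  shows "tr S (\<lambda>x. f x - g x) = tr S f - tr S g"
proof -
  obtain B where B: "finite B" "B \<subseteq> S" "independent B" "span B = S" using basis_subspace_exists[OF S] by metis
  show ?thesis
    using B f g S
    by (simp add: tr_eq[OF B(3,4)] lin_minus subspace_diff representation_diff subset_iff sum_subtractf)
qed

lemma tr_ident:
  assumes S: "subspace S"
  shows "tr S (\<lambda>x. scale c x) = c * of_nat (dim S)"
proof -
  obtain B where B: "finite B" "B \<subseteq> S" "independent B" "span B = S" using basis_subspace_exists[OF S] by metis
  have d: "dim S = card B" using B dim_eq_card_independent by (metis dim_span)
  have "representation B (scale c b) b = c" if "b \<in> B" for b
    using that B(3) by (simp add: representation_scale representation_basis span_base)
  then show ?thesis
    using d S by (simp add: tr_eq[OF B(3,4)] lin_const_smult subspace_scale mult.commute)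
qed

lemma tr_cong:
  assumes S: "subspace S" and f: "lin f" "!!x. x \<in> S ==> f x \<in> S" and g: "lin g" "!!x. x \<in> S ==> g x = f x"
  shows "tr S f = tr S g"
proof -
  obtain B where B: "finite B" "B \<subseteq> S" "independent B" "span B = S" using basis_subspace_exists[OF S] by metis
  show ?thesis using B f g by (simp add: tr_eq[OF B(3,4)] subset_iff)
qed

text \<open>In a basis of \<open>S\<close> extending a basis of \<open>T\<close>, the added vectors
  contribute no diagonal entries, because their images lie in \<open>T\<close>.\<close>

lemma tr_image_subset:
  assumes S: "subspace S" "subspace T" "T \<subseteq> S" and f: "lin f" "!!x. x \<in> S ==> f x \<in> T"
  shows "tr S f = tr T f"
proof -
  obtain C where C: "finite C" "C \<subseteq> T" "independent C" "span C = T" using basis_subspace_exists[OF S(2)] by metis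
  obtain B where B: "C \<subseteq> B" "B \<subseteq> S" "independent B" "S \<subseteq> span B"
    using maximal_independent_subset_extend[of C S] C S by auto
  have SB: "span B = S" using B S(1) span_subspace by blast
  have fin: "finite B" using B finiteI_independent by auto
  have rep: "representation B (f b) = representation C (f b)" if "b \<in> B" for b
    using representation_extend[of B "f b" C] B C f that by auto
  have "tr S f = (\<Sum>b\<in>B. representation B (f b) b)"
    by (rule tr_eq[OF B(3) SB f(1)]) (use f S in auto)
  also have "\<dots> = (\<Sum>b\<in>C. representation C (f b) b)"
    using fin B(1) by (simp add: rep sum.mono_neutral_right representation_ne_zero subset_iff)
      (metis (no_types, lifting) DiffD2 representation_ne_zero sum.mono_neutral_right[OF fin B(1)])
  also have "\<dots> = tr T f"
    by (rule tr_eq[OF C(3,4) f(1), symmetric]) (use f S in auto)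
  finally show ?thesis .
qed

text \<open>Passing from \<open>S\<close> to its image under \<open>f\<close> keeps the trace and
  lowers the exponent by one.\<close>

lemma tr_nilpotent:
  assumes S: "subspace S" and f: "lin f" "!!x. x \<in> S ==> f x \<in> S" and nil: "!!x. x \<in> S ==> (f ^^ n) x = 0"
  shows "tr S f = 0"
  using S f(2) nil
proof (induction n arbitrary: S)
  case 0
  then have "S = {0}" using subspace_0 by auto
  then show ?case
    by (subst tr_eq[of "{}"]) (auto simp: f lin_zero independent_empty)
next
  case (Suc n)
  have "tr S f = tr (f ` S) f"
    by (rule tr_image_subset) (use Suc f subspace_image in auto)
  also have "\<dots> = 0"
    by (rule Suc.IH) (use Suc f subspace_image in "auto simp: funpow_Suc_right simp del: funpow.simps")
  finally show ?case .
qed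

lemma tr_scalar_nilpotent:
  assumes S: "subspace S" and f: "lin f" "!!x. x \<in> S ==> f x \<in> S"
    and nil: "!!x. x \<in> S ==> ((\<lambda>x. f x - scale c x) ^^ n) x = 0"
  shows "tr S f = c * of_nat (dim S)"
proof -
  have "tr S (\<lambda>x. (f x - scale c x) + scale c x) = tr S (\<lambda>x. f x - scale c x) + tr S (scale c)"
    by (rule tr_add) (use S f in "auto intro: lin_minus lin_const_smult subspace_diff subspace_scale")
  moreover have "tr S (\<lambda>x. f x - scale c x) = 0"
    by (rule tr_nilpotent[OF S _ _ nil]) (use S f in "auto intro: lin_minus lin_const_smult subspace_diff subspace_scale")
  ultimately show ?thesis using tr_ident[OF S] by simp
qed

section \<open>Finite direct sums\<close>

text \<open>Finite subfamilies are quantified over, so that the notion applies to the infinite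
  family of all candidate weights, most of whose spaces vanish.\<close>

definition indep_family :: "'i set => ('i => 'b set) => bool" where
  "indep_family I S \<longleftrightarrow> (\<forall>J x. finite J \<longrightarrow> J \<subseteq> I \<longrightarrow> (\<forall>i\<in>J. x i \<in> S i) \<longrightarrow> (\<Sum>i\<in>J. x i) = 0 \<longrightarrow> (\<forall>i\<in>J. x i = 0))"

lemma indep_familyD:
  "indep_family I S ==> finite J ==> J \<subseteq> I ==> (!!i. i \<in> J ==> x i \<in> S i) ==> (\<Sum>i\<in>J. x i) = 0 ==> i \<in> J ==> x i = 0"
  unfolding indep_family_def by blast

lemma indep_family_disjoint:
  assumes ind: "indep_family I S" and ij: "i \<in> I" "j \<in> I" "i ~= j" and sub: "subspace (S j)" and x: "x \<in> S i" "x \<in> S j"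
  shows "x = 0"
proof -
  have "(\<lambda>k. if k = i then x else - x) i = 0"
    by (rule indep_familyD[OF ind, of "{i,j}"]) (use ij x subspace_neg[OF sub x(2)] in auto)
  then show ?thesis by simp
qed

lemma span_UN_sum:
  assumes "finite I" "!!i. i \<in> I ==> subspace (S i)" "x \<in> span (\<Union>i\<in>I. S i)"
  shows "\<exists>y. (\<forall>i\<in>I. y i \<in> S i) \<and> x = (\<Sum>i\<in>I. y i)"
  using assms(3)
proof (induction rule: span_induct_alt)
  case base
  then show ?case by (rule exI[of _ "\<lambda>_. 0"]) (use assms in "auto intro: subspace_0")
next
  case (step c a z)
  then obtain i y where i: "i \<in> I" "a \<in> S i" and y: "\<forall>i\<in>I. y i \<in> S i" "z = (\<Sum>i\<in>I. y i)" by auto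
  have "(\<Sum>j\<in>I. (if j = i then scale c a else 0) + y j) = scale c a + z"
    using i assms(1) y by (simp add: sum.distrib)
  moreover have "\<forall>j\<in>I. (if j = i then scale c a else 0) + y j \<in> S j"
    using i y assms(2) by (auto intro!: subspace_add subspace_scale subspace_0)
  ultimately show ?case by (intro exI[of _ "\<lambda>j. (if j = i then scale c a else 0) + y j"]) simp
qed

lemma direct_sum_basis:
  assumes fin: "finite I" and sub: "!!i. i \<in> I ==> subspace (S i)" and ind: "indep_family I S"
    and B: "!!i. i \<in> I ==> independent (B i)" "!!i. i \<in> I ==> span (B i) = S i"
  shows "independent (\<Union>i\<in>I. B i)" "!!i j. i \<in> I ==> j \<in> I ==> i ~= j ==> B i \<inter> B j = {}"
    "span (\<Union>i\<in>I. B i) = span (\<Union>i\<in>I. S i)"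
proof -
  have sub1: "B i \<subseteq> S i" if "i \<in> I" for i using B(2)[OF that] span_superset by blast
  show disj: "B i \<inter> B j = {}" if ij: "i \<in> I" "j \<in> I" "i ~= j" for i j
  proof (rule ccontr)
    assume "B i \<inter> B j ~= {}"
    then obtain b where b: "b \<in> B i" "b \<in> B j" by auto
    have "b ~= 0" using B(1)[OF ij(1)] b dependent_zero by blast
    moreover have "b = 0"
      by (rule indep_family_disjoint[OF ind ij]) (use ij b sub1 sub in auto)
    ultimately show False by auto
  qed
  have finB: "finite (B i)" if "i \<in> I" for i using B(1)[OF that] finiteI_independent by auto
  show "independent (\<Union>i\<in>I. B i)"
  proof (rule independent_if_scalars_zero)
    show "finite (\<Union>i\<in>I. B i)" using fin finB by auto
    fix f b assume z: "(\<Sum>x\<in>(\<Union>i\<in>I. B i). scale (f x) x) = 0" and b: "b \<in> (\<Union>i\<in>I. B i)"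
    then obtain i where i: "i \<in> I" "b \<in> B i" by auto
    have "(\<Sum>x\<in>(\<Union>i\<in>I. B i). scale (f x) x) = (\<Sum>i\<in>I. \<Sum>x\<in>B i. scale (f x) x)"
      by (rule sum.UNION_disjoint) (use fin finB disj in auto)
    then have "(\<Sum>i\<in>I. \<Sum>x\<in>B i. scale (f x) x) = 0" using z by simp
    moreover have "(\<Sum>x\<in>B i. scale (f x) x) \<in> S i" if "i \<in> I" for i
      using that sub sub1 by (intro subspace_sum) (auto intro!: subspace_scale)
    ultimately have "(\<Sum>x\<in>B i. scale (f x) x) = 0"
      using ind[unfolded indep_family_def, rule_format, of I "\<lambda>i. \<Sum>x\<in>B i. scale (f x) x" i] fin i by auto
    then show "f b = 0" using B(1)[OF i(1)] i(2) finB[OF i(1)] independent_explicit_finite_subsets by blast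
  qed
  show "span (\<Union>i\<in>I. B i) = span (\<Union>i\<in>I. S i)"
  proof
    show "span (\<Union>i\<in>I. B i) \<subseteq> span (\<Union>i\<in>I. S i)" by (rule span_mono) (use sub1 in auto)
    have "S i \<subseteq> span (\<Union>i\<in>I. B i)" if "i \<in> I" for i
      using B(2)[OF that] span_mono[of "B i" "\<Union>i\<in>I. B i"] that by auto
    then show "span (\<Union>i\<in>I. S i) \<subseteq> span (\<Union>i\<in>I. B i)"
      by (intro span_minimal) auto
  qed
qed

lemma tr_direct_sum:
  assumes fin: "finite I" and sub: "!!i. i \<in> I ==> subspace (S i)" and ind: "indep_family I S"
    and f: "lin f" "!!i x. i \<in> I ==> x \<in> S i ==> f x \<in> S i"
  shows "tr (span (\<Union>i\<in>I. S i)) f = (\<Sum>i\<in>I. tr (S i) f)"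
proof -
  have "\<forall>i\<in>I. \<exists>B. independent B \<and> span B = S i"
    using basis_subspace_exists sub by metis
  then obtain B where B: "!!i. i \<in> I ==> independent (B i)" "!!i. i \<in> I ==> span (B i) = S i" by metis
  note D = direct_sum_basis[OF fin sub ind B, simplified]
  have finB: "finite (B i)" if "i \<in> I" for i using B(1)[OF that] finiteI_independent by auto
  have sub1: "B i \<subseteq> S i" if "i \<in> I" for i using B(2)[OF that] span_superset by blast
  have "tr (span (\<Union>i\<in>I. S i)) f = (\<Sum>b\<in>(\<Union>i\<in>I. B i). representation (\<Union>i\<in>I. B i) (f b) b)"
  proof (rule tr_eq)
    show "f x \<in> span (\<Union> (S ` I))" if "x \<in> span (\<Union> (S ` I))" for x
      by (rule lin_span_image[OF f(1) _ _ that]) (use f(2) span_base in blast)+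
  qed (use D f in auto)
  also have "\<dots> = (\<Sum>i\<in>I. \<Sum>b\<in>B i. representation (\<Union>i\<in>I. B i) (f b) b)"
    by (rule sum.UNION_disjoint) (use fin finB D in auto)
  also have "\<dots> = (\<Sum>i\<in>I. \<Sum>b\<in>B i. representation (B i) (f b) b)"
  proof (intro sum.cong refl)
    fix i b assume i: "i \<in> I" "b \<in> B i"
    have "representation (\<Union>i\<in>I. B i) (f b) = representation (B i) (f b)"
      by (rule representation_extend) (use D i B f(2)[OF i(1)] sub1[OF i(1)] in auto)
    then show "representation (\<Union>i\<in>I. B i) (f b) b = representation (B i) (f b) b" by simp
  qed
  also have "\<dots> = (\<Sum>i\<in>I. tr (S i) f)"
    by (intro sum.cong refl tr_eq[symmetric]) (use B f in auto)
  finally show ?thesis .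
qed

text \<open>One non-zero vector from each member gives an independent set, bounded by the dimension.
  This is the source of finiteness for weights and for eigenvalues.\<close>

lemma indep_family_card:
  assumes sub: "!!i. i \<in> I ==> subspace (S i)" and ind: "indep_family I S" and nz: "!!i. i \<in> I ==> S i ~= {0}"
  shows "finite I"
proof (rule ccontr)
  assume "infinite I"
  then obtain J where J: "J \<subseteq> I" "finite J" "card J = Suc dimension"
    using infinite_arbitrarily_large by blast
  have "\<forall>i\<in>I. \<exists>x. x \<in> S i \<and> x ~= 0" using nz sub subspace_0 by blast
  then obtain x where x: "!!i. i \<in> I ==> x i \<in> S i \<and> x i ~= 0" by metis
  have inj: "inj_on x J"
  proof (rule inj_onI, rule ccontr)
    fix i j assume ij: "i \<in> J" "j \<in> J" "x i = x j" "i ~= j"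
    have "x i = 0"
      by (rule indep_family_disjoint[OF ind, of i j]) (use ij J x[of i] x[of j] sub in auto)
    then show False using x ij J by auto
  qed
  have "independent (x ` J)"
  proof (rule independent_if_scalars_zero)
    fix f y assume z: "(\<Sum>y\<in>x ` J. scale (f y) y) = 0" and y: "y \<in> x ` J"
    then obtain i where i: "i \<in> J" "y = x i" by auto
    have "(\<Sum>i\<in>J. scale (f (x i)) (x i)) = 0" using z inj by (simp add: sum.reindex)
    then have "scale (f (x i)) (x i) = 0"
      using ind[unfolded indep_family_def, rule_format, of J "\<lambda>i. scale (f (x i)) (x i)" i] i J x sub
      by (auto intro!: subspace_scale)
    then show "f y = 0" using i x J by auto
  qed (use J in auto)
  then have "card (x ` J) \<le> dimension" using independent_card_le_dim[of "x ` J" UNIV] by (simp add: dimension_def)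
  then show False using J inj by (simp add: card_image)
qed

end

section \<open>Generalized eigenspaces\<close>

locale fd_complex = finite_dimensional_vector_space scale Basis
  for scale :: "complex => 'b::ab_group_add => 'b" (infixr \<open>*s\<close> 75) and Basis :: "'b set"
begin

text \<open>\<open>papp f p x\<close> is \<open>p(f) x\<close>, evaluated by Horner's
  scheme.\<close>

definition papp :: "('b => 'b) => complex poly => 'b => 'b" where
  "papp f p x = fold_coeffs (\<lambda>a y. a *s x + f y) p 0"

lemma papp_0: "papp f 0 x = 0"
  by (simp add: papp_def)

lemma papp_pCons: "lin f ==> papp f (pCons a p) x = a *s x + f (papp f p x)"
  by (cases "a = 0 \<and> p = 0") (auto simp: papp_def lin_zero)

lemma papp_add: "lin f ==> papp f (p + q) x = papp f p x + papp f q x"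
  by (induction p q rule: poly_induct2) (simp_all add: papp_0 papp_pCons lin_add scale_left_distrib)

lemma papp_smult: "lin f ==> papp f (smult c p) x = c *s papp f p x"
  by (induction p) (simp_all add: papp_0 papp_pCons lin_scale scale_right_distrib)

lemma papp_monom: "lin f ==> papp f (monom a n) x = a *s (f ^^ n) x"
  by (induction n) (simp_all add: papp_0 papp_pCons lin_scale lin_zero monom_Suc monom_0)

lemma papp_sum: "lin f ==> papp f (\<Sum>i\<in>A. p i) x = (\<Sum>i\<in>A. papp f (p i) x)"
  by (induction A rule: infinite_finite_induct) (simp_all add: papp_0 papp_add)

lemma papp_in: "lin f ==> subspace S ==> (!!x. x \<in> S ==> f x \<in> S) ==> x \<in> S ==> papp f p x \<in> S"
  by (induction p) (auto simp: papp_0 papp_pCons subspace_0 subspace_add subspace_scale)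

text \<open>Otherwise the vectors \<open>(f ^^ i) x\<close> for \<open>i \<le> dimension\<close>
  would be distinct and independent, one more than the dimension permits.\<close>

lemma annihilating_poly:
  assumes f: "lin f" shows "\<exists>p. p ~= 0 \<and> papp f p x = 0"
proof (rule ccontr)
  assume "\<not> ?thesis"
  then have nz: "p = 0" if "papp f p x = 0" for p using that by blast
  have inj: "inj (\<lambda>i. (f ^^ i) x)"
  proof (rule injI)
    fix i j assume "(f ^^ i) x = (f ^^ j) x"
    then have "papp f (monom 1 i + monom (-1) j) x = 0" by (simp add: papp_add papp_monom f)
    then have "monom 1 i + monom (-1) j = (0 :: complex poly)" by (rule nz)
    then have "coeff (monom 1 i + monom (-1) j) i = (0 :: complex)" by simp
    then show "i = j" by (auto split: if_splits)
  qed
  have "independent ((\<lambda>i. (f ^^ i) x) ` {..dimension})"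
  proof (rule independent_if_scalars_zero)
    fix u y assume z: "(\<Sum>y\<in>(\<lambda>i. (f ^^ i) x) ` {..dimension}. u y *s y) = 0"
      and y: "y \<in> (\<lambda>i. (f ^^ i) x) ` {..dimension}"
    let ?p = "\<Sum>i\<le>dimension. monom (u ((f ^^ i) x)) i"
    have "papp f ?p x = 0"
      using z by (simp add: papp_sum papp_monom f sum.reindex[OF inj_on_subset[OF inj subset_UNIV]])
    then have "?p = 0" by (rule nz)
    from y obtain i where i: "i \<le> dimension" "y = (f ^^ i) x" by auto
    have "coeff ?p i = u y" using i by (simp add: coeff_sum)
    then show "u y = 0" using \<open>?p = 0\<close> by simp
  qed simp
  then have "card ((\<lambda>i. (f ^^ i) x) ` {..dimension}) \<le> dimension"
    using independent_card_le_dim[of _ UNIV] by (simp add: dimension_def)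
  then show False by (simp add: card_image inj_on_subset[OF inj subset_UNIV])
qed

text \<open>An annihilating polynomial of least degree for some \<open>x\<close> in \<open>S\<close>
  has a root \<open>c\<close>; its cofactor after splitting off the linear factor does not
  annihilate \<open>x\<close>, and sends \<open>x\<close> to an eigenvector for
  \<open>c\<close>.\<close>

lemma eigenvector_exists:
  assumes f: "lin f" and S: "subspace S" "!!x. x \<in> S ==> f x \<in> S" "S ~= {0}"
  shows "\<exists>c x. x \<in> S \<and> x ~= 0 \<and> f x = c *s x"
proof -
  obtain x where x: "x \<in> S" "x ~= 0" using S subspace_0 by blast
  obtain p where p: "p ~= 0" "papp f p x = 0" and min: "!!q. q ~= 0 ==> papp f q x = 0 ==> degree p \<le> degree q"
    using ex_has_least_nat[of "\<lambda>p. p ~= 0 \<and> papp f p x = 0" _ degree] annihilating_poly[OF f, of x] by blast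
  have "degree p ~= 0"
  proof
    assume "degree p = 0"
    then obtain a where "p = [:a:]" using degree_eq_zeroE by blast
    then show False using p x by (simp add: papp_pCons papp_0 f lin_zero)
  qed
  then obtain c where "poly p c = 0"
    using fundamental_theorem_of_algebra[of p] by (auto simp: constant_degree)
  then obtain q where q: "p = [:-c, 1:] * q" by (auto simp: poly_eq_0_iff_dvd)
  have "q ~= 0" using p q by auto
  then have "degree q < degree p" unfolding q by (subst degree_mult_eq) auto
  then have y: "papp f q x ~= 0" using min \<open>q ~= 0\<close> leD by blast
  have "papp f p x = f (papp f q x) - c *s papp f q x"
    by (simp add: q papp_add[of f "pCons 0 q" "smult (- c) q", simplified] papp_smult[of f "- c" q, simplified] papp_pCons f)
  then have "f (papp f q x) = c *s papp f q x" using p by simp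
  then show ?thesis using y papp_in[OF f S(1,2) x(1)] by blast
qed

definition geig :: "('b => 'b) => complex => 'b set" where
  "geig f c = {x. \<exists>k. ((\<lambda>x. f x - c *s x) ^^ k) x = 0}"

lemma pow_zero_mono: "lin g ==> (g ^^ k) x = 0 ==> k \<le> m ==> (g ^^ m) x = 0"
  by (metis le_add_diff_inverse2 comp_apply funpow_add lin_pow lin_zero)

lemma lin_shift: "lin f ==> lin (\<lambda>x. f x - c *s x)"
  by (intro lin_minus lin_const_smult)

lemma subspace_geig: assumes f: "lin f" shows "subspace (geig f c)"
proof (rule subspaceI)
  note g = lin_shift[OF f, of c]
  show "0 \<in> geig f c" unfolding geig_def by (auto intro: exI[of _ 0])
  fix x y assume "x \<in> geig f c" "y \<in> geig f c"
  then obtain k m where "((\<lambda>x. f x - c *s x) ^^ k) x = 0" "((\<lambda>x. f x - c *s x) ^^ m) y = 0"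
    unfolding geig_def by auto
  then have "((\<lambda>x. f x - c *s x) ^^ max k m) (x + y) = 0"
    using pow_zero_mono[OF g] by (simp add: lin_add[OF lin_pow[OF g]])
  then show "x + y \<in> geig f c" unfolding geig_def by blast
next
  note g = lin_shift[OF f, of c]
  fix a x assume "x \<in> geig f c"
  then show "a *s x \<in> geig f c" unfolding geig_def by (auto simp: lin_scale[OF lin_pow[OF g]])
qed

lemma shift_pow_commute:
  "lin f ==> f (((\<lambda>x. f x - c *s x) ^^ k) x) = ((\<lambda>x. f x - c *s x) ^^ k) (f x)"
  by (induction k) (simp_all add: lin_diff lin_scale)

lemma geig_inv: assumes f: "lin f" and "x \<in> geig f c" shows "f x \<in> geig f c"
  using assms(2) unfolding geig_def mem_Collect_eq
  by (metis f lin_zero shift_pow_commute)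

lemma shift_pow_in: "subspace S ==> (!!x. x \<in> S ==> f x \<in> S) ==> x \<in> S ==> ((\<lambda>x. f x - c *s x) ^^ k) x \<in> S"
  by (induction k) (auto intro: subspace_diff subspace_scale)

lemma geig_eigenvector:
  assumes "x \<in> geig f c" "x ~= 0"
  obtains k where "((\<lambda>x. f x - c *s x) ^^ k) x ~= 0" "f (((\<lambda>x. f x - c *s x) ^^ k) x) = c *s ((\<lambda>x. f x - c *s x) ^^ k) x"
proof -
  let ?k = "LEAST k. ((\<lambda>x. f x - c *s x) ^^ k) x = 0"
  have k: "((\<lambda>x. f x - c *s x) ^^ ?k) x = 0" using assms unfolding geig_def by (auto intro: LeastI)
  with assms obtain m where m: "?k = Suc m" by (cases ?k) auto
  have "((\<lambda>x. f x - c *s x) ^^ m) x ~= 0" using m not_less_Least[of m "\<lambda>k. ((\<lambda>x. f x - c *s x) ^^ k) x = 0"] by auto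
  then show ?thesis using that[of m] k m by auto
qed

text \<open>A common non-zero vector yields a true eigenvector for \<open>c\<close> that still lies
  in the space for \<open>d\<close>. There \<open>f - d\<close> acts by the non-zero scalar
  \<open>c - d\<close>, so no power of it vanishes.\<close>

lemma geig_disjoint:
  assumes f: "lin f" and x: "x \<in> geig f c" "x \<in> geig f d" and cd: "c ~= d"
  shows "x = 0"
proof (rule ccontr)
  assume "x ~= 0"
  then obtain k where k: "((\<lambda>x. f x - c *s x) ^^ k) x ~= 0" "f (((\<lambda>x. f x - c *s x) ^^ k) x) = c *s ((\<lambda>x. f x - c *s x) ^^ k) x"
    using geig_eigenvector x by metis
  let ?y = "((\<lambda>x. f x - c *s x) ^^ k) x"
  have y: "?y \<in> geig f d"
    by (rule shift_pow_in) (use subspace_geig geig_inv f x in auto)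
  have "((\<lambda>x. f x - d *s x) ^^ n) ?y = (c - d) ^ n *s ?y" for n
  proof (induction n)
    case (Suc n)
    have "((\<lambda>x. f x - d *s x) ^^ Suc n) ?y = (c - d) ^ n *s (f ?y - d *s ?y)"
      using Suc by (simp add: lin_scale[OF f] scale_right_diff_distrib mult.commute)
    also have "\<dots> = (c - d) ^ n *s ((c - d) *s ?y)" using k(2) by (simp only: scale_left_diff_distrib)
    finally show ?case by (simp add: mult.commute)
  qed simp
  then show False using y k(1) cd unfolding geig_def by auto
qed

text \<open>A basis of \<open>S\<close> containing a kernel vector \<open>x\<close> would have an
  image that spans \<open>S\<close> with one element fewer.\<close>

lemma surj_on_inj_on:
  assumes g: "lin g" and S: "subspace S" "g ` S = S" and x: "x \<in> S" "g x = 0"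
  shows "x = 0"
proof (rule ccontr)
  assume nz: "x ~= 0"
  obtain B where B: "{x} \<subseteq> B" "B \<subseteq> S" "independent B" "S \<subseteq> span B"
    using maximal_independent_subset_extend[of "{x}" S] x nz by auto
  have finB: "finite B" using B finiteI_independent by auto
  have "S \<subseteq> span (g ` (B - {x}))"
  proof -
    have "S = g ` span B" using S B span_subspace by (metis)
    also have "\<dots> = span (g ` B)" using g by (metis Vector_Spaces.linear.axioms(3) module_hom.span_image)
    also have "g ` B = insert 0 (g ` (B - {x}))" using B x by auto
    finally show ?thesis by simp
  qed
  then have "dim S \<le> card (g ` (B - {x}))" using dim_le_card finB by auto
  also have "\<dots> \<le> card (B - {x})" using finB card_image_le by auto
  also have "\<dots> < card B" using finB B by (intro psubset_card_mono) auto
  also have "card B = dim S" using basis_card_eq_dim B by auto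
  finally show False by simp
qed

text \<open>Fitting decomposition, one eigenvalue \<open>c\<close> at a time. The image
  \<open>M\<close> of least dimension under the powers of \<open>f - c\<close> is mapped bijectively
  to itself, so it contains no eigenvector for \<open>c\<close> and is smaller than
  \<open>S\<close>; every vector of \<open>S\<close> differs from one of \<open>M\<close> by a
  generalized eigenvector for \<open>c\<close>.\<close>

lemma geig_decomposition:
  assumes f: "lin f"
  shows "subspace S ==> (!!x. x \<in> S ==> f x \<in> S) ==> S \<subseteq> span (\<Union>c. S \<inter> geig f c)"
proof (induction "dim S" arbitrary: S rule: less_induct)
  case (less S)
  show ?case
  proof (cases "S = {0}")
    case True then show ?thesis by (auto simp: span_zero)
  next
    case False
    obtain c x where x: "x \<in> S" "x ~= 0" "f x = c *s x" using eigenvector_exists[OF f less.prems False] by blast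
    let ?g = "\<lambda>x. f x - c *s x"
    have g: "lin ?g" by (rule lin_shift[OF f])
    have gS: "?g y \<in> S" if "y \<in> S" for y using that less.prems by (auto intro: subspace_diff subspace_scale)
    have gpS: "(?g ^^ n) y \<in> S" if "y \<in> S" for n y using shift_pow_in less.prems that by blast
    have sub: "subspace ((?g ^^ n) ` S)" for n using subspace_image lin_pow g less.prems by blast
    obtain n where n: "!!m. dim ((?g ^^ n) ` S) \<le> dim ((?g ^^ m) ` S)"
      using ex_has_least_nat[of "\<lambda>_. True" _ "\<lambda>n. dim ((?g ^^ n) ` S)"] by blast
    define M where "M = (?g ^^ n) ` S"
    have M: "subspace M" "M \<subseteq> S" using sub gpS by (auto simp: M_def)
    have gM: "?g ` M = (?g ^^ Suc n) ` S" unfolding M_def image_comp by simp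
    have gMM: "?g ` M = M"
    proof (rule subspace_dim_equal)
      show "?g ` M \<subseteq> M"
      proof
        fix z assume "z \<in> ?g ` M"
        then obtain s where s: "s \<in> S" "z = ?g ((?g ^^ n) s)" unfolding M_def by blast
        then have "z = (?g ^^ n) (?g s)" using funpow_swap1[of ?g n s] by simp
        then show "z \<in> M" unfolding M_def using gS[OF s(1)] by blast
      qed
      show "dim M \<le> dim (?g ` M)" using n gM by (metis M_def)
    qed (use M g subspace_image in auto)
    have "M ~= S" using surj_on_inj_on[OF g M(1) gMM] x by force
    then have "dim M < dim S" using M less.prems by (metis dim_psubset psubsetI span_eq_iff)
    moreover have fM: "f y \<in> M" if "y \<in> M" for y
    proof -
      have "f y = ?g y + c *s y" by simp
      moreover have "?g y \<in> M" using gMM that by blast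
      ultimately show ?thesis using subspace_add[OF M(1) _ subspace_scale[OF M(1) that]] by metis
    qed
    ultimately have IH: "M \<subseteq> span (\<Union>c. M \<inter> geig f c)" using less.hyps M by blast
    have gnM: "(?g ^^ k) ` M = M" for k
    proof (induction k)
      case (Suc k)
      have "(?g ^^ Suc k) ` M = ?g ` ((?g ^^ k) ` M)" unfolding image_comp by simp
      then show ?case using Suc gMM by (simp only:)
    qed simp
    show ?thesis
    proof
      fix y assume y: "y \<in> S"
      then have "(?g ^^ n) y \<in> M" by (auto simp: M_def)
      then have "(?g ^^ n) y \<in> (?g ^^ n) ` M" using gnM[of n] by (simp only:)
      then obtain z where z: "z \<in> M" "(?g ^^ n) y = (?g ^^ n) z" by (elim imageE)
      have "(?g ^^ n) (y - z) = 0" using z by (simp add: lin_diff[OF lin_pow[OF g]])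
      then have "y - z \<in> S \<inter> geig f c" using y z M less.prems(1) by (auto simp: geig_def intro: subspace_diff)
      then have "y - z \<in> span (\<Union>c. S \<inter> geig f c)" by (intro span_base) auto
      moreover have "z \<in> span (\<Union>c. S \<inter> geig f c)"
        using IH z M span_mono[of "\<Union>c. M \<inter> geig f c" "\<Union>c. S \<inter> geig f c"] by blast
      ultimately show "y \<in> span (\<Union>c. S \<inter> geig f c)" using span_add by fastforce
    qed
  qed
qed

lemma geig_uniform:
  assumes f: "lin f" and S: "subspace S" "S \<subseteq> geig f c"
  shows "\<exists>n. \<forall>x\<in>S. ((\<lambda>x. f x - c *s x) ^^ n) x = 0"
proof -
  let ?g = "\<lambda>x. f x - c *s x"
  obtain B where B: "finite B" "B \<subseteq> S" "span B = S" using basis_subspace_exists[OF S(1)] by metis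
  have "\<forall>b\<in>B. \<exists>k. (?g ^^ k) b = 0" using B S unfolding geig_def by auto
  then obtain k where k: "!!b. b \<in> B ==> (?g ^^ k b) b = 0" by metis
  have mx: "(?g ^^ Max (k ` B)) b = 0" if "b \<in> B" for b
    by (rule pow_zero_mono[OF lin_shift[OF f] k[OF that]]) (use B that in auto)
  have "(?g ^^ Max (k ` B)) x = 0" if "x \<in> S" for x
  proof -
    have "(?g ^^ Max (k ` B)) x \<in> {0}"
      by (rule lin_span_image[OF lin_pow[OF lin_shift[OF f]], of B])
        (use B that mx in auto)
    then show ?thesis by simp
  qed
  then show ?thesis by blast
qed

lemma tr_geig:
  assumes f: "lin f" and S: "subspace S" "S \<subseteq> geig f c" "!!x. x \<in> S ==> f x \<in> S"
  shows "tr S f = c * of_nat (dim S)"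
  using geig_uniform[OF f S(1,2)] tr_scalar_nilpotent[OF S(1) f S(3)] by blast

text \<open>The square of \<open>f\<close> is \<open>f (f - c) + c f\<close>, and the first summand
  is nilpotent because \<open>f\<close> commutes with \<open>f - c\<close>.\<close>

lemma tr_geig_square:
  assumes f: "lin f" and S: "subspace S" "S \<subseteq> geig f c" "!!x. x \<in> S ==> f x \<in> S"
  shows "tr S (\<lambda>x. f (f x)) = c\<^sup>2 * of_nat (dim S)"
proof -
  let ?g = "\<lambda>x. f x - c *s x"
  obtain n where n: "!!x. x \<in> S ==> (?g ^^ n) x = 0" using geig_uniform[OF f S(1,2)] by blast
  have com: "((\<lambda>x. f (?g x)) ^^ k) x = (f ^^ k) ((?g ^^ k) x)" for k x
  proof (induction k arbitrary: x)
    case (Suc k)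
    have "((\<lambda>x. f (?g x)) ^^ Suc k) x = (f ^^ k) ((?g ^^ k) (f (?g x)))"
      using Suc by (simp only: funpow_Suc_right comp_apply)
    also have "(?g ^^ k) (f (?g x)) = f ((?g ^^ k) (?g x))" by (rule shift_pow_commute[OF f, symmetric])
    finally show ?case by (simp only: funpow_Suc_right comp_apply)
  qed simp
  have fg: "f (?g x) = f (f x) - c *s f x" for x by (simp add: lin_diff[OF f] lin_scale[OF f])
  have gl: "lin (\<lambda>x. f (?g x))" by (rule lin_comp[OF f lin_shift[OF f]])
  have gS: "f (?g x) \<in> S" if "x \<in> S" for x using that S(1,3) by (auto intro!: S(3) subspace_diff subspace_scale)
  have 0: "tr S (\<lambda>x. f (?g x)) = 0"
    by (rule tr_nilpotent[OF S(1) gl gS, of n]) (simp_all only: com n lin_zero[OF lin_pow[OF f]])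
  have "tr S (\<lambda>x. f (?g x) + c *s f x) = tr S (\<lambda>x. f (?g x)) + tr S (\<lambda>x. c *s f x)"
    by (rule tr_add[OF S(1) gl gS]) (use f S in "auto intro: lin_smult subspace_scale")
  also have "\<dots> = c * (c * of_nat (dim S))"
    using 0 tr_scale[OF S(1) f S(3)] tr_geig[OF f S] by simp
  finally show ?thesis by (simp add: fg power2_eq_square mult.assoc)
qed

lemma indep_family_cong_subset:
  assumes "indep_family I S" "J \<subseteq> I" "!!i. i \<in> J ==> T i \<subseteq> S i"
  shows "indep_family J T"
  using assms unfolding indep_family_def by (meson subset_iff)

text \<open>Induction on the number of summands. If \<open>h\<close> separates \<open>l\<close> from
  \<open>m\<close>, a power of \<open>\<rho> h - m h\<close> kills the summand of \<open>m\<close>;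
  by induction it kills that of \<open>l\<close> as well, which then lies in two generalized
  eigenspaces of \<open>\<rho> h\<close>.\<close>

lemma gen_weight_indep:
  assumes \<rho>: "!!h. h \<in> H ==> lin (\<rho> h)"
    and sub: "!!l. l \<in> W ==> subspace (S l)"
    and S: "!!l h x. l \<in> W ==> h \<in> H ==> x \<in> S l ==> x \<in> geig (\<rho> h) (l h)"
    and inv: "!!l h x. l \<in> W ==> h \<in> H ==> x \<in> S l ==> \<rho> h x \<in> S l"
    and sep: "!!l m. l \<in> W ==> m \<in> W ==> l ~= m ==> \<exists>h\<in>H. l h ~= m h"
  shows "indep_family W S"
proof -
  have "finite J ==> J \<subseteq> W ==> (!!l. l \<in> J ==> x l \<in> S l) ==> (\<Sum>l\<in>J. x l) = 0 ==> \<forall>l\<in>J. x l = 0" for J x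
  proof (induction J arbitrary: x rule: finite_induct)
    case (insert m J)
    have z: "x l = 0" if lJ: "l \<in> J" for l
    proof -
      obtain h where h: "h \<in> H" "l h ~= m h" using sep[of l m] lJ insert.hyps insert.prems(1) by blast
      obtain k where k: "((\<lambda>x. \<rho> h x - m h *s x) ^^ k) (x m) = 0"
        using S[of m h "x m"] insert.prems h unfolding geig_def by auto
      let ?g = "(\<lambda>x. \<rho> h x - m h *s x) ^^ k"
      have g: "lin ?g" using lin_pow lin_shift \<rho> h by blast
      have "?g (\<Sum>l\<in>insert m J. x l) = (\<Sum>l\<in>insert m J. ?g (x l))" by (rule lin_sum[OF g])
      then have "(\<Sum>l\<in>J. ?g (x l)) = 0"
        using insert.prems insert.hyps k lin_zero[OF g] by simp
      moreover have "?g (x n) \<in> S n" if "n \<in> J" for n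
        using that insert.prems h by (intro shift_pow_in) (auto simp: sub inv)
      ultimately have "?g (x l) = 0" using insert.IH[of "\<lambda>n. ?g (x n)"] insert.prems lJ by auto
      then have "x l \<in> geig (\<rho> h) (m h)" unfolding geig_def by auto
      moreover have "x l \<in> geig (\<rho> h) (l h)" using S insert.prems lJ h by auto
      ultimately show ?thesis using geig_disjoint[OF \<rho>[OF h(1)]] h(2) by metis
    qed
    then have "x m = 0" using insert by simp
    then show ?case using z by auto
  qed simp
  then show ?thesis unfolding indep_family_def by blast
qed

end

section \<open>The Cartan subalgebra: weight spaces and the Killing form\<close>

section \<open>Root space decomposition\<close>

lemma of_int_fun: "(of_int k :: 'a => 'b::comm_ring_1) x = of_int k"
  by (induction k) (simp_all add: one_fun_def)

locale simple_lie = lie_algebra scale br + fd_complex scale Basis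
  for scale :: "complex => 'l::ab_group_add => 'l" (infixr \<open>*s\<close> 75) and br :: "'l => 'l => 'l" and Basis :: "'l set" +
  fixes H :: "'l set"
  assumes simple: "simple" and cartan: "cartan_subalgebra H"
begin

lemma br_lin: "lin (br x)" and br_lin_left: "lin (\<lambda>x. br x y)"
  by (rule br_linear_right br_linear_left)+

lemmas br_simps = lin_add[OF br_lin] lin_diff[OF br_lin] lin_scale[OF br_lin] lin_zero[OF br_lin]
  lin_add[OF br_lin_left] lin_diff[OF br_lin_left] lin_scale[OF br_lin_left] lin_zero[OF br_lin_left]

lemma br_anti: "br x y = - br y x"
proof -
  have "br (x + y) (x + y) = 0" by (rule br_self)
  then have "br x y + br y x = 0" unfolding br_simps by (simp add: br_self add.commute)
  then show ?thesis by (simp add: eq_neg_iff_add_eq_0)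
qed

lemma br_minus: "br (- x) y = - br x y" "br x (- y) = - br x y"
  using br_simps(6)[of 0 x y] br_simps(2)[of x 0 y] by (simp_all add: br_simps)

lemma jac: "br (br x y) z = br x (br y z) - br y (br x z)"
proof -
  have "br x (br y z) + br y (br z x) = - br z (br x y)"
    using jacobi[of x y z] by (simp add: eq_neg_iff_add_eq_0)
  then show ?thesis using br_anti[of "br x y" z] br_anti[of z x] by (simp add: br_minus)
qed

lemma jac': "br x (br y z) = br (br x y) z + br y (br x z)"
  by (simp add: jac)

lemma H_sub: "subspace H" and H_br: "x \<in> H ==> y \<in> H ==> br x y \<in> H"
  and H_normalizer: "(!!h. h \<in> H ==> br x h \<in> H) ==> x \<in> H"
  and H_nil: "\<exists>k. lower_central H k = {0}"
  using cartan unfolding cartan_subalgebra_def subalgebra_def nilpotent_def normalizer_def by auto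

text \<open>\<open>D (a + b)\<close> satisfies a Leibniz rule with \<open>D a\<close> and
  \<open>D b\<close> on the two factors, so in its power with exponent \<open>k + m\<close> every
  term has a factor that is already killed.\<close>

lemma geig_br:
  assumes "x \<in> geig (br h) a" "y \<in> geig (br h) b"
  shows "br x y \<in> geig (br h) (a + b)"
proof -
  define D where "D c = (\<lambda>x. br h x - c *s x)" for c
  have D: "lin (D c)" for c unfolding D_def by (rule lin_shift[OF br_lin])
  have der: "D (a + b) (br x y) = br (D a x) y + br x (D b y)" for x y
    unfolding D_def jac'[of h x y] by (simp add: br_simps scale_left_distrib)
  have "(D a ^^ k) x = 0 ==> (D b ^^ m) y = 0 ==> k + m = n ==> (D (a + b) ^^ n) (br x y) = 0" for k m n x y
  proof (induction n arbitrary: k m x y)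
    case (Suc n)
    consider "k = 0" | "m = 0" | k' m' where "k = Suc k'" "m = Suc m'" by (meson not0_implies_Suc)
    then show ?case
    proof cases
      case 3
      have "(D a ^^ k') (D a x) = 0" "(D b ^^ m') (D b y) = 0"
        using Suc.prems(1,2) 3 by (simp_all add: funpow_swap1)
      then have "(D (a + b) ^^ n) (br (D a x) y) = 0" "(D (a + b) ^^ n) (br x (D b y)) = 0"
        using Suc.IH[of k' "D a x" m y] Suc.IH[of k x m' "D b y"] Suc.prems 3 by auto
      moreover have "(D (a + b) ^^ Suc n) (br x y) = (D (a + b) ^^ n) (D (a + b) (br x y))"
        by (simp only: funpow_Suc_right comp_apply)
      ultimately show ?thesis
        unfolding der lin_add[OF lin_pow[OF D]] by simp
    next
      case 1
      then have "x = 0" using Suc.prems(1) by simp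
      then show ?thesis using lin_zero[OF lin_pow[OF D]] by (simp only: br_simps)
    next
      case 2
      then have "y = 0" using Suc.prems(2) by simp
      then show ?thesis using lin_zero[OF lin_pow[OF D]] by (simp only: br_simps)
    qed
  qed (simp add: br_simps)
  then show ?thesis using assms unfolding geig_def D_def by blast
qed

lemma lc_sub: "subspace (lower_central H k)"
  by (cases k) (auto simp: H_sub)

lemma lc_in: "lower_central H k \<subseteq> H"
proof (induction k)
  case (Suc k)
  have "{br x y |x y. x \<in> H \<and> y \<in> lower_central H k} \<subseteq> H" using Suc H_br by blast
  then show ?case unfolding lower_central.simps by (rule span_minimal[OF _ H_sub])
qed simp

lemma lc_br: "x \<in> H ==> y \<in> lower_central H k ==> br x y \<in> lower_central H (Suc k)"
  by (auto intro!: span_base)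

lemma H_geig: assumes "h \<in> H" "x \<in> H" shows "x \<in> geig (br h) 0"
proof -
  obtain k where k: "lower_central H k = {0}" using H_nil by blast
  have "(br h ^^ n) x \<in> lower_central H n" for n
  proof (induction n)
    case (Suc n)
    then show ?case using lc_br[OF assms(1) Suc] by simp
  qed (use assms in simp)
  then have "(br h ^^ k) x = 0" using k by blast
  then show ?thesis unfolding geig_def by auto
qed

definition gw :: "('l => complex) => 'l set" where
  "gw a = {x. \<forall>h\<in>H. x \<in> geig (br h) (a h)}"

lemma gwD: "x \<in> gw a ==> h \<in> H ==> x \<in> geig (br h) (a h)"
  by (simp add: gw_def)

lemma gw_sub: "subspace (gw a)"
proof -
  have "gw a = (\<Inter>h\<in>H. geig (br h) (a h))" by (auto simp: gw_def)
  then show ?thesis using subspace_Int[of H] subspace_geig[OF br_lin] by metis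
qed

lemma gw_br: "x \<in> gw a ==> y \<in> gw b ==> br x y \<in> gw (a + b)"
  unfolding gw_def by (auto intro: geig_br)

lemma H_gw0: "H \<subseteq> gw 0"
  using H_geig by (auto simp: gw_def)

lemma gw_H: "h \<in> H ==> x \<in> gw a ==> br h x \<in> gw a"
  using gw_br[of h 0 x a] H_gw0 by auto

text \<open>Candidate weights are arbitrary functions that vanish outside \<open>H\<close>, hence
  are determined by their values on \<open>H\<close>. That the actual weights are linear on
  \<open>H\<close> is the theorem \<open>wts_linear\<close>.\<close>

definition ext :: "('l => complex) set" where "ext = {a. \<forall>x. x \<notin> H \<longrightarrow> a x = 0}"

lemma ext_add: "a \<in> ext ==> b \<in> ext ==> a + b \<in> ext" and ext_0: "0 \<in> ext"
  and ext_uminus: "a \<in> ext ==> - a \<in> ext"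
  by (auto simp: ext_def)

lemma ext_mult: "a \<in> ext ==> c * a \<in> ext"
  by (auto simp: ext_def)

text \<open>While some \<open>h\<close> has several eigenvalues on \<open>S\<close>, the pieces
  \<open>S \<inter> geig (br h) c\<close> are smaller. They remain stable under \<open>H\<close>,
  because \<open>H\<close> lies in the generalized eigenspace of \<open>br h\<close> for 0 and
  brackets add eigenvalues.\<close>

lemma gw_decomposition_aux:
  "subspace S ==> (!!h x. h \<in> H ==> x \<in> S ==> br h x \<in> S) ==> S \<subseteq> span (\<Union>a\<in>ext. gw a)"
proof (induction "dim S" arbitrary: S rule: less_induct)
  case (less S)
  show ?case
  proof (cases "\<exists>h\<in>H. \<forall>c. \<not> S \<subseteq> geig (br h) c")
    case True
    then obtain h where h: "h \<in> H" "!!c. \<not> S \<subseteq> geig (br h) c" by blast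
    have "S \<inter> geig (br h) c \<subseteq> span (\<Union>a\<in>ext. gw a)" for c
    proof (rule less.hyps)
      show sub: "subspace (S \<inter> geig (br h) c)"
        using less.prems subspace_geig[OF br_lin] by (intro subspace_inter) auto
      have "S \<inter> geig (br h) c \<subset> S" using h(2)[of c] by auto
      then show "dim (S \<inter> geig (br h) c) < dim S"
        using dim_psubset[of "S \<inter> geig (br h) c" S] sub less.prems(1) by (metis span_eq_iff)
      fix h' x assume h': "h' \<in> H" and x: "x \<in> S \<inter> geig (br h) c"
      then show "br h' x \<in> S \<inter> geig (br h) c"
        using geig_br[of h' h 0 x c] H_geig[OF h(1) h'] less.prems(2) by auto
    qed
    then have "(\<Union>c. S \<inter> geig (br h) c) \<subseteq> span (\<Union>a\<in>ext. gw a)" by blast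
    moreover have "S \<subseteq> span (\<Union>c. S \<inter> geig (br h) c)"
      by (rule geig_decomposition[OF br_lin]) (use less.prems h in auto)
    ultimately show ?thesis using span_minimal[OF _ subspace_span] by blast
  next
    case False
    then obtain c where c: "!!h. h \<in> H ==> S \<subseteq> geig (br h) (c h)" by metis
    let ?a = "\<lambda>h. if h \<in> H then c h else 0"
    have "S \<subseteq> gw ?a" "?a \<in> ext" using c by (auto simp: gw_def ext_def)
    then have "S \<subseteq> (\<Union>a\<in>ext. gw a)" by blast
    then show ?thesis using span_superset by blast
  qed
qed

definition wts :: "('l => complex) set" where "wts = {a \<in> ext. gw a ~= {0}}"

lemma gw_not_wts: "a \<in> ext ==> a \<notin> wts ==> x \<in> gw a ==> x = 0"
  by (auto simp: wts_def)

lemma wts_ext: "a \<in> wts ==> a \<in> ext" by (auto simp: wts_def)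

lemma gw_indep_ext: "indep_family ext gw"
proof (rule gen_weight_indep[of H br])
  fix l m :: "'l => complex" assume "l \<in> ext" "m \<in> ext" "l ~= m"
  then show "\<exists>h\<in>H. l h ~= m h" by (auto simp: ext_def fun_eq_iff) metis
qed (auto intro: br_lin gw_sub gw_H gwD)

lemma gw_indep: "J \<subseteq> ext ==> indep_family J gw"
  using indep_family_cong_subset[OF gw_indep_ext] by blast

lemma finite_wts: "finite wts"
  by (rule indep_family_card[of wts gw]) (auto simp: gw_sub wts_def intro!: gw_indep)

lemma gw_span: "span (\<Union>a\<in>wts. gw a) = UNIV"
proof -
  have "gw a \<subseteq> insert 0 (\<Union>a\<in>wts. gw a)" if "a \<in> ext" for a
    using that gw_not_wts by blast
  then have "span (\<Union>a\<in>ext. gw a) \<subseteq> span (insert 0 (\<Union>a\<in>wts. gw a))" by (intro span_mono) blast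
  moreover have "UNIV \<subseteq> span (\<Union>a\<in>ext. gw a)" by (rule gw_decomposition_aux) auto
  ultimately show ?thesis by auto
qed

text \<open>Engel's theorem for the action of the nilpotent algebra \<open>H\<close> on \<open>gw 0 / H\<close>, by descent along
  the lower central series: modulo \<open>H\<close>, each term commutes with itself once the next term acts as zero.\<close>

lemma engel_step:
  assumes N: "subspace N" "H \<subseteq> N" "!!h x. h \<in> H ==> x \<in> N ==> br h x \<in> N"
    and nil: "!!h x. h \<in> H ==> x \<in> N ==> \<exists>k. (br h ^^ k) x \<in> H"
    and x: "x \<in> N" "x \<notin> H" "!!c. c \<in> lower_central H (Suc k) ==> br c x \<in> H"
  shows "\<exists>x. x \<in> N \<and> x \<notin> H \<and> (\<forall>c\<in>lower_central H k. br c x \<in> H)"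
proof -
  define N' where "N' = {x \<in> N. \<forall>c\<in>lower_central H (Suc k). br c x \<in> H}"
  have N'_br: "br c y \<in> N'" if "c \<in> H" "y \<in> N'" for c y
  proof -
    have "br d (br c y) \<in> H" if d: "d \<in> lower_central H (Suc k)" for d
    proof -
      have "br c d \<in> lower_central H (Suc k)"
      proof -
        have "br c d \<in> lower_central H (Suc (Suc k))" using lc_br \<open>c \<in> H\<close> d by blast
        moreover have "lower_central H (Suc (Suc j)) \<subseteq> lower_central H (Suc j)" for j
        proof (induction j)
          case 0
          show ?case using lc_in[of "Suc 0"] by (simp, intro span_mono) (auto simp: span_base)
        next
          case (Suc j)
          have "{br x y |x y. x \<in> H \<and> y \<in> lower_central H (Suc (Suc j))} \<subseteq> {br x y |x y. x \<in> H \<and> y \<in> lower_central H (Suc j)}"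
            using Suc by blast
          from span_mono[OF this] show ?case
            using lower_central.simps(2)[of H "Suc (Suc j)"] lower_central.simps(2)[of H "Suc j"] by argo
        qed
        ultimately show ?thesis by blast
      qed
      then have "br d c \<in> lower_central H (Suc k)" using br_anti[of d c] lc_sub subspace_neg by metis
      then have "br (br d c) y \<in> H" "br c (br d y) \<in> H"
        using \<open>y \<in> N'\<close> d \<open>c \<in> H\<close> H_br unfolding N'_def by auto
      then show ?thesis using jac'[of d c y] H_sub subspace_add by metis
    qed
    then show ?thesis using that N by (auto simp: N'_def)
  qed
  obtain F where F: "finite F" "F \<subseteq> lower_central H k" "span F = lower_central H k"
    using basis_subspace_exists[OF lc_sub] by metis
  \<comment> \<open>Generators are added one at a time. The last iterate of \<open>br c\<close> on
    \<open>y\<close> outside \<open>H\<close> is sent into \<open>H\<close> by \<open>c\<close>; the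
    earlier generators \<open>d\<close> still send it into \<open>H\<close>, because the bracket of
    \<open>d\<close> and \<open>c\<close> lies in the next term of the series.\<close>
  have "finite F ==> F \<subseteq> lower_central H k ==> \<exists>x. x \<in> N' \<and> x \<notin> H \<and> (\<forall>c\<in>F. br c x \<in> H)" for F
  proof (induction F rule: finite_induct)
    case empty
    then show ?case using x by (auto simp: N'_def)
  next
    case (insert c F)
    then obtain y where y: "y \<in> N'" "y \<notin> H" "\<forall>c\<in>F. br c y \<in> H" by auto
    have c: "c \<in> H" using insert lc_in by auto
    let ?k = "LEAST k. (br c ^^ k) y \<in> H"
    have "y \<in> N" using y(1) unfolding N'_def by blast
    from nil[OF c this] have "(br c ^^ ?k) y \<in> H" by (rule LeastI_ex)
    moreover from this obtain m where m: "?k = Suc m" using y(2) by (cases ?k) auto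
    ultimately have z: "br c ((br c ^^ m) y) \<in> H" by simp
    have z': "(br c ^^ m) y \<notin> H" using not_less_Least[of m "\<lambda>k. (br c ^^ k) y \<in> H"] m by auto
    have "(br c ^^ j) y \<in> N' \<and> (\<forall>d\<in>F. br d ((br c ^^ j) y) \<in> H)" for j
    proof (induction j)
      case (Suc j)
      let ?z = "(br c ^^ j) y"
      have "br d (br c ?z) \<in> H" if d: "d \<in> F" for d
      proof -
        have dH: "d \<in> H" using d insert lc_in by auto
        have "br d c \<in> lower_central H (Suc k)" using lc_br[OF dH] insert by auto
        then have "br (br d c) ?z \<in> H" using Suc unfolding N'_def by auto
        moreover have "br c (br d ?z) \<in> H" using Suc d c H_br by auto
        ultimately show ?thesis using jac'[of d c ?z] H_sub subspace_add by metis
      qed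
      then show ?case using Suc N'_br c by simp
    qed (use y in auto)
    then show ?case using z z' by blast
  qed
  from this[OF F(1,2)] obtain y where y: "y \<in> N'" "y \<notin> H" "\<forall>c\<in>F. br c y \<in> H" by blast
  have "br c y \<in> H" if "c \<in> lower_central H k" for c
    by (rule lin_span_image[OF br_lin_left, of F]) (use y F H_sub that in auto)
  then show ?thesis using y unfolding N'_def by blast
qed

text \<open>\<open>engel_step\<close> is climbed along the lower central series from its zero term
  up to \<open>H\<close> itself; the resulting element outside \<open>H\<close> would normalize
  \<open>H\<close>.\<close>

lemma gw0: "gw 0 = H"
proof (rule ccontr)
  assume "gw 0 ~= H"
  then obtain x where x: "x \<in> gw 0" "x \<notin> H" using H_gw0 by blast
  obtain k where k: "lower_central H k = {0}" using H_nil by blast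
  have "\<exists>x. x \<in> gw 0 \<and> x \<notin> H \<and> (\<forall>c\<in>lower_central H (k - j). br c x \<in> H)" if "j \<le> k" for j
    using that
  proof (induction j)
    case 0
    have "\<forall>c\<in>lower_central H (k - 0). br c x \<in> H" using k by (simp add: br_simps subspace_0[OF H_sub])
    then show ?case using x by blast
  next
    case (Suc j)
    then obtain y where y: "y \<in> gw 0" "y \<notin> H" "\<forall>c\<in>lower_central H (Suc (k - Suc j)). br c y \<in> H"
      using Suc_diff_Suc[of j k] by (metis Suc_le_lessD Suc_leD)
    show ?case
    proof (rule engel_step[OF gw_sub H_gw0 _ _ y(1,2)])
      fix h x assume hx: "h \<in> H" "x \<in> gw 0"
      have "x \<in> geig (br h) 0" using gwD[OF hx(2,1)] by simp
      then obtain n where "(br h ^^ n) x = 0" by (auto simp: geig_def)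
      then show "\<exists>k. (br h ^^ k) x \<in> H" using subspace_0[OF H_sub] by metis
    next
      fix c assume "c \<in> lower_central H (Suc (k - Suc j))"
      then show "br c y \<in> H" using y(3) by blast
    qed (rule gw_H)
  qed
  from this[of k] obtain x where "x \<in> gw 0" "x \<notin> H" "\<forall>c\<in>H. br c x \<in> H"
    using lower_central.simps(1)[of H] by (metis diff_self_eq_0 order_refl)
  then show False using H_normalizer[of x] br_anti[of x] subspace_neg[OF H_sub] by metis
qed

lemma tr_gw: assumes "h \<in> H" shows "tr (gw a) (br h) = a h * of_nat (dim (gw a))"
  by (rule tr_geig[OF br_lin gw_sub]) (use assms gw_H in "auto simp: gw_def")

lemma dim_gw: "a \<in> wts ==> dim (gw a) > 0"
  using gw_sub subspace_0 by (fastforce simp: wts_def)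

lemma gw_nz: "a \<in> wts ==> \<not> gw a \<subseteq> {0}"
  using gw_sub subspace_0 by (fastforce simp: wts_def)

text \<open>The trace of \<open>br h\<close> on \<open>gw a\<close> is \<open>a h\<close> times the
  dimension, and the trace is linear in \<open>h\<close>; the dimension may be cancelled.\<close>

lemma wts_linear:
  assumes a: "a \<in> wts" and h: "h \<in> H" "k \<in> H"
  shows "a (h + k) = a h + a k" "a (c *s h) = c * a h"
proof -
  have "tr (gw a) (\<lambda>x. br h x + br k x) = tr (gw a) (br h) + tr (gw a) (br k)"
    by (rule tr_add) (auto simp: gw_sub br_lin gw_H h)
  moreover have "(\<lambda>x. br h x + br k x) = br (h + k)" by (rule HOL.ext) (simp add: br_simps)
  ultimately show "a (h + k) = a h + a k"
    using gw_nz[OF a] h H_sub by (simp add: tr_gw subspace_add flip: distrib_right)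
  have "tr (gw a) (\<lambda>x. c *s br h x) = c * tr (gw a) (br h)"
    by (rule tr_scale) (auto simp: gw_sub br_lin gw_H h)
  moreover have "(\<lambda>x. c *s br h x) = br (c *s h)" by (rule HOL.ext) (simp add: br_simps)
  ultimately show "a (c *s h) = c * a h"
    using gw_nz[OF a] h H_sub by (simp add: tr_gw subspace_scale flip: mult.assoc)
qed

lemma wts_0: "a \<in> wts ==> a 0 = 0"
  using wts_linear(2)[of a 0 0 0] subspace_0[OF H_sub] by simp

text \<open>The same comparison of traces: \<open>br h k\<close> acts as a commutator, so its trace
  on \<open>gw a\<close> vanishes.\<close>

lemma wts_br:
  assumes a: "a \<in> wts" and h: "h \<in> H" "k \<in> H"
  shows "a (br h k) = 0"
proof -
  have "tr (gw a) (\<lambda>x. br h (br k x) - br k (br h x)) = tr (gw a) (\<lambda>x. br h (br k x)) - tr (gw a) (\<lambda>x. br k (br h x))"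
    by (rule tr_diff) (auto simp: gw_sub br_lin gw_H h intro: lin_comp)
  also have "\<dots> = 0" using tr_comm[of "gw a" "br h" "br k"] by (simp add: gw_sub br_lin gw_H h)
  also have "(\<lambda>x. br h (br k x) - br k (br h x)) = br (br h k)" by (rule HOL.ext) (simp only: jac)
  finally show ?thesis using gw_nz[OF a] h by (simp add: tr_gw H_br)
qed

lemma subspace_wts_ker: "a \<in> wts ==> subspace {h \<in> H. a h = 0}"
  by (rule subspaceI) (auto simp: wts_0 wts_linear subspace_0[OF H_sub] subspace_add[OF H_sub] subspace_scale[OF H_sub])

lemma derived: "span {br x y |x y. True} = UNIV"
proof -
  let ?D = "span {br x y |x y. True}"
  have "ideal ?D" unfolding ideal_def by (auto intro: span_base)
  then have "?D = {0} \<or> ?D = UNIV" using simple unfolding simple_def by blast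
  moreover obtain x y where xy: "br x y ~= 0" using simple unfolding simple_def by blast
  moreover have "br x y \<in> ?D" by (rule span_base) blast
  ultimately show ?thesis by auto
qed

lemma not_nilpotent: "H ~= UNIV"
proof
  assume H: "H = UNIV"
  have "lower_central H k = UNIV" for k
    by (induction k) (use H derived in auto)
  moreover obtain k where "lower_central H k = {0}" using H_nil by blast
  moreover obtain x y where "br x y ~= 0" using simple unfolding simple_def by blast
  ultimately show False by (metis UNIV_I singletonD)
qed

lemma gw_inter:
  assumes J: "J \<subseteq> wts" "a \<in> ext" "a \<notin> J" and x: "x \<in> gw a" "x \<in> span (\<Union>b\<in>J. gw b)"
  shows "x = 0"
proof -
  have fin: "finite J" using J finite_wts finite_subset by auto
  obtain y where y: "\<forall>b\<in>J. y b \<in> gw b" "x = (\<Sum>b\<in>J. y b)"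
    using span_UN_sum[OF fin _ x(2)] gw_sub by auto
  have "(\<lambda>b. if b = a then x else - y b) a = 0"
  proof (rule indep_familyD[OF gw_indep_ext, of "insert a J" "\<lambda>b. if b = a then x else - y b" a])
    have "(\<Sum>b\<in>insert a J. if b = a then x else - y b) = x + (\<Sum>b\<in>J. if b = a then x else - y b)"
      using fin J by simp
    also have "(\<Sum>b\<in>J. if b = a then x else - y b) = (\<Sum>b\<in>J. - y b)" using J by (intro sum.cong) auto
    finally show "(\<Sum>b\<in>insert a J. if b = a then x else - y b) = 0" using y by (simp add: sum_negf)
  qed (use fin J x y wts_ext gw_sub in "auto intro: subspace_neg")
  then show ?thesis by simp
qed

text \<open>A simple algebra is spanned by its brackets. A bracket of weight vectors whose weights
  do not cancel has non-zero weight, so the component in \<open>H\<close> comes from opposite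
  weights only.\<close>

lemma H_span: "H \<subseteq> span {br x y |x y a. a \<in> wts \<and> x \<in> gw a \<and> y \<in> gw (- a)}"
proof
  fix h assume h: "h \<in> H"
  let ?A = "{br x y |x y a. a \<in> wts \<and> x \<in> gw a \<and> y \<in> gw (- a)}"
  let ?B = "\<Union>b\<in>wts - {0}. gw b"
  have br_in: "br x y \<in> span (?A \<union> ?B)" if x: "x \<in> gw a" "a \<in> wts" and y: "y \<in> gw b" "b \<in> wts" for x y a b
  proof (cases "a + b = 0")
    case True
    then have "b = - a" by (simp add: eq_neg_iff_add_eq_0 add.commute)
    then have "br x y \<in> ?A" using x y by blast
    then show ?thesis by (intro span_base UnI1)
  next
    case False
    have "br x y \<in> gw (a + b)" using gw_br x y by blast
    show ?thesis
    proof (cases "a + b \<in> wts")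
      case True
      then have "br x y \<in> ?B" using \<open>br x y \<in> gw (a + b)\<close> False by blast
      then show ?thesis by (intro span_base UnI2)
    next
      case False
      have "a + b \<in> ext" by (intro ext_add wts_ext x y)
      then have "br x y = 0" using gw_not_wts False \<open>br x y \<in> gw (a + b)\<close> by blast
      then show ?thesis by (simp add: span_zero)
    qed
  qed
  have "br x y \<in> span (?A \<union> ?B)" for x y
  proof -
    have y: "y \<in> span (\<Union>a\<in>wts. gw a)" and x: "x \<in> span (\<Union>a\<in>wts. gw a)" using gw_span by auto
    have 1: "br x' y \<in> span (?A \<union> ?B)" if "x' \<in> gw a" "a \<in> wts" for x' a
    proof (rule lin_span_image[OF br_lin _ subspace_span y])
      fix w assume "w \<in> (\<Union>a\<in>wts. gw a)"
      then obtain b where "b \<in> wts" "w \<in> gw b" by blast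
      then show "br x' w \<in> span (?A \<union> ?B)" using br_in that by blast
    qed
    show ?thesis
    proof (rule lin_span_image[OF br_lin_left _ subspace_span x])
      fix w assume "w \<in> (\<Union>a\<in>wts. gw a)"
      then show "br w y \<in> span (?A \<union> ?B)" using 1 by blast
    qed
  qed
  then have "{br x y |x y. True} \<subseteq> span (?A \<union> ?B)" by blast
  from span_minimal[OF this subspace_span] have "h \<in> span (?A \<union> ?B)" unfolding derived by (rule subsetD) simp
  then obtain p q where pq: "p \<in> span ?A" "q \<in> span ?B" "h = p + q" unfolding span_Un by (elim CollectE exE conjE)
  have "p \<in> H"
  proof -
    have "?A \<subseteq> H"
    proof
      fix z assume "z \<in> ?A"
      then obtain x y a where "z = br x y" "x \<in> gw a" "y \<in> gw (- a)" by blast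
      then show "z \<in> H" using gw_br[of x a y "- a"] gw0 by simp
    qed
    from span_minimal[OF this H_sub] pq(1) show ?thesis by (rule subsetD)
  qed
  then have "h - p \<in> H" using h by (intro subspace_diff[OF H_sub])
  then have "q \<in> gw 0" using pq(3) gw0 by simp
  then have "q = 0" by (rule gw_inter[of "wts - {0}" 0 q, rotated 3]) (use pq(2) ext_0 in auto)
  then show "h \<in> span ?A" using pq by simp
qed

lemma wts_nonzero_exists: "\<exists>a\<in>wts. \<exists>h\<in>H. a h ~= 0"
proof (rule ccontr)
  assume c: "\<not> ?thesis"
  then have "a = 0" if "a \<in> wts" for a using that wts_ext[OF that] by (auto simp: ext_def fun_eq_iff)
  then have "span (\<Union>a\<in>wts. gw a) \<subseteq> H" using gw0 H_sub by (intro span_minimal) blast+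
  then show False using not_nilpotent gw_span by auto
qed

definition strg :: "('l => complex) => ('l => complex) => ('l => complex) set" where
  "strg a b = {c \<in> wts. \<exists>k::int. c = b + of_int k * a}"

text \<open>Both \<open>x\<close> and \<open>y\<close> preserve the sum of the weight spaces along
  the string, so their commutator has trace 0 there, while \<open>tr_gw\<close> gives its trace on
  each weight space.\<close>

lemma string_sum:
  assumes a: "a \<in> ext" and b: "b \<in> ext" and x: "x \<in> gw a" and y: "y \<in> gw (- a)"
  shows "(\<Sum>c\<in>strg a b. c (br x y) * of_nat (dim (gw c))) = 0"
proof -
  let ?J = "strg a b"
  have J: "?J \<subseteq> wts" by (auto simp: strg_def)
  have fin: "finite ?J" using J finite_wts finite_subset by auto
  let ?U = "span (\<Union>c\<in>?J. gw c)"
  have step: "z \<in> ?U" if z: "z \<in> gw (c + of_int k * a)" and c: "c \<in> ?J" for z c k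
  proof (cases "c + of_int k * a \<in> wts")
    case True
    obtain m where "c = b + of_int m * a" using c by (auto simp: strg_def)
    then have "c + of_int k * a = b + of_int (m + k) * a" by (simp add: algebra_simps)
    then have "c + of_int k * a \<in> ?J" using True unfolding strg_def by blast
    then show ?thesis using z by (intro span_base) blast
  next
    case False
    then have "z = 0" using gw_not_wts z c J a by (metis ext_add ext_mult subsetD wts_ext)
    then show ?thesis by (simp add: span_zero)
  qed
  have ix: "br x z \<in> ?U" if "z \<in> ?U" for z
  proof (rule lin_span_image[OF br_lin _ _ that])
    fix w assume "w \<in> (\<Union>c\<in>?J. gw c)"
    then obtain c where c: "c \<in> ?J" "w \<in> gw c" by blast
    then have "br x w \<in> gw (c + of_int 1 * a)" using gw_br[OF x c(2)] by (simp add: add.commute)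
    then show "br x w \<in> ?U" using step c by blast
  qed simp
  have iy: "br y z \<in> ?U" if "z \<in> ?U" for z
  proof (rule lin_span_image[OF br_lin _ _ that])
    fix w assume "w \<in> (\<Union>c\<in>?J. gw c)"
    then obtain c where c: "c \<in> ?J" "w \<in> gw c" by blast
    then have "br y w \<in> gw (c + of_int (-1) * a)" using gw_br[OF y c(2)] by (simp add: add.commute)
    then show "br y w \<in> ?U" using step c by blast
  qed simp
  have h: "br x y \<in> H" using gw_br[OF x y] gw0 by simp
  have "tr ?U (\<lambda>z. br x (br y z) - br y (br x z)) = tr ?U (\<lambda>z. br x (br y z)) - tr ?U (\<lambda>z. br y (br x z))"
    by (rule tr_diff) (auto simp: ix iy br_lin intro: lin_comp)
  also have "\<dots> = 0" using tr_comm[of ?U "br x" "br y"] by (simp add: ix iy br_lin)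
  also have "(\<lambda>z. br x (br y z) - br y (br x z)) = br (br x y)" by (rule HOL.ext) (simp only: jac)
  also have "tr ?U (br (br x y)) = (\<Sum>c\<in>?J. tr (gw c) (br (br x y)))"
    by (rule tr_direct_sum[OF fin gw_sub _ br_lin]) (use J wts_ext h gw_H in "auto intro: gw_indep")
  finally show ?thesis by (simp add: tr_gw h)
qed

text \<open>Weights on the string differ from \<open>b\<close> by integer multiples of
  \<open>a\<close>, so \<open>string_sum\<close> can be solved for \<open>b (br x y)\<close>. That
  the factor is real makes a sum of squares available for the Killing form.\<close>

lemma string_ratio:
  assumes a: "a \<in> wts" and b: "b \<in> wts" and x: "x \<in> gw a" and y: "y \<in> gw (- a)"
  shows "\<exists>r::real. b (br x y) = of_real r * a (br x y)"
proof -
  let ?J = "strg a b" and ?h = "br x y"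
  have fin: "finite ?J" using finite_wts by (rule finite_subset[rotated]) (auto simp: strg_def)
  have "\<forall>c\<in>?J. \<exists>k::int. c = b + of_int k * a" by (auto simp: strg_def)
  then obtain k where k: "!!c. c \<in> ?J ==> c = b + of_int (k c) * a" by metis
  have kh: "c ?h = b ?h + of_int (k c) * a ?h" if "c \<in> ?J" for c
    by (subst k[OF that]) (simp add: of_int_fun)
  define D where "D = (\<Sum>c\<in>?J. real (dim (gw c)))"
  define K where "K = (\<Sum>c\<in>?J. real_of_int (k c) * real (dim (gw c)))"
  have "b \<in> ?J" using b by (auto simp: strg_def intro: exI[of _ 0])
  then have D: "D > 0" unfolding D_def using dim_gw[OF b] fin by (intro sum_pos2[of _ b]) auto
  have "0 = (\<Sum>c\<in>?J. c ?h * of_nat (dim (gw c)))" using string_sum a b x y wts_ext by simp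
  also have "\<dots> = (\<Sum>c\<in>?J. b ?h * of_nat (dim (gw c)) + a ?h * (of_int (k c) * of_nat (dim (gw c))))"
  proof (intro sum.cong refl)
    fix c assume c: "c \<in> ?J"
    show "c ?h * of_nat (dim (gw c)) = b ?h * of_nat (dim (gw c)) + a ?h * (of_int (k c) * of_nat (dim (gw c)))"
      unfolding kh[OF c] by (simp add: algebra_simps)
  qed
  also have "\<dots> = b ?h * of_real D + a ?h * of_real K"
    by (simp add: sum.distrib sum_distrib_left D_def K_def)
  finally have "b ?h * of_real D = - (a ?h * of_real K)" by (simp add: eq_neg_iff_add_eq_0)
  then have "b ?h = of_real (- K / D) * a ?h" using D by (simp add: field_simps)
  then show ?thesis by blast
qed

end

context simple_lie
begin

section \<open>The Killing form\<close>

definition kil :: "'l => 'l => complex" where "kil x y = tr UNIV (\<lambda>z. br x (br y z))"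

lemma kil_add: "kil (x + y) z = kil x z + kil y z"
  using tr_add[of UNIV "\<lambda>w. br x (br z w)" "\<lambda>w. br y (br z w)"]
  by (simp add: kil_def br_simps lin_comp br_lin)

lemma kil_scale: "kil (c *s x) z = c * kil x z"
  using tr_scale[of UNIV "\<lambda>w. br x (br z w)" c]
  by (simp add: kil_def br_simps lin_comp br_lin)

lemma kil_sym: "kil x y = kil y x"
  unfolding kil_def by (rule tr_comm) (auto simp: br_lin)

lemma kil_add': "kil z (x + y) = kil z x + kil z y" and kil_scale': "kil z (c *s x) = c * kil z x"
  using kil_add kil_scale kil_sym by simp_all

lemma kil_diff: "kil (x - y) z = kil x z - kil y z" and kil_minus: "kil (- x) z = - kil x z"
  and kil_0: "kil 0 z = 0"
proof -
  show 0: "kil 0 z = 0" for z using kil_add[of 0 0 z] by simp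
  show "kil (x - y) z = kil x z - kil y z" for x y z using kil_add[of "x - y" y z] by simp
  then show "kil (- x) z = - kil x z" using 0 by (metis diff_0)
qed

lemma kil_inv: "kil (br x y) z = kil x (br y z)"
proof -
  have "kil (br x y) z = tr UNIV (\<lambda>w. br x (br y (br z w)) - br y (br x (br z w)))"
    by (simp add: kil_def jac)
  also have "\<dots> = tr UNIV (\<lambda>w. br x (br y (br z w))) - tr UNIV (\<lambda>w. br y (br x (br z w)))"
    by (rule tr_diff) (auto simp: br_lin intro!: lin_comp[OF br_lin] lin_id)
  also have "tr UNIV (\<lambda>w. br y (br x (br z w))) = tr UNIV (\<lambda>w. br x (br z (br y w)))"
    by (rule tr_comm[of UNIV "br y" "\<lambda>w. br x (br z w)"]) (auto simp: br_lin intro!: lin_comp[OF br_lin] lin_id)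
  also have "tr UNIV (\<lambda>w. br x (br y (br z w))) - \<dots> = tr UNIV (\<lambda>w. br x (br y (br z w)) - br x (br z (br y w)))"
    by (rule tr_diff[symmetric]) (auto simp: br_lin intro!: lin_comp[OF br_lin] lin_id)
  also have "\<dots> = kil x (br y z)" by (simp add: kil_def jac br_simps)
  finally show ?thesis .
qed

lemma kil_H_square:
  assumes h: "h \<in> H" shows "kil h h = (\<Sum>a\<in>wts. (a h)\<^sup>2 * of_nat (dim (gw a)))"
proof -
  have "kil h h = tr (span (\<Union>a\<in>wts. gw a)) (\<lambda>z. br h (br h z))" by (simp add: kil_def gw_span)
  also have "\<dots> = (\<Sum>a\<in>wts. tr (gw a) (\<lambda>z. br h (br h z)))"
    by (rule tr_direct_sum) (use finite_wts wts_ext gw_sub gw_H h br_lin in "auto intro: gw_indep lin_comp")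
  also have "\<dots> = (\<Sum>a\<in>wts. (a h)\<^sup>2 * of_nat (dim (gw a)))"
    by (intro sum.cong refl tr_geig_square[OF br_lin gw_sub]) (use h gw_H gwD in auto)
  finally show ?thesis .
qed

text \<open>Polarization of \<open>kil_H_square\<close>.\<close>

lemma kil_H:
  assumes h: "h \<in> H" "k \<in> H" shows "kil h k = (\<Sum>a\<in>wts. a h * a k * of_nat (dim (gw a)))"
proof -
  have "kil (h + k) (h + k) = kil h h + 2 * kil h k + kil k k"
    by (simp add: kil_add kil_add' kil_sym[of k h])
  moreover have "kil (h + k) (h + k) = kil h h + 2 * (\<Sum>a\<in>wts. a h * a k * of_nat (dim (gw a))) + kil k k"
    using h subspace_add[OF H_sub h]
    by (simp add: kil_H_square wts_linear sum_distrib_left flip: sum.distrib)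
      (intro sum.cong refl, simp add: power2_eq_square algebra_simps)
  ultimately show ?thesis by simp
qed

text \<open>At a bracket \<open>z\<close> of vectors of weights \<open>a\<close> and
  \<open>- a\<close>, all weights are real multiples of \<open>a z\<close>, so
  \<open>kil z z\<close> is the square of \<open>a z\<close> times a positive real. If it vanished
  for all such \<open>z\<close>, every weight would vanish on a spanning set of
  \<open>H\<close>.\<close>

lemma kil_nondeg_H_exists: "\<exists>h\<in>H. kil h h ~= 0"
proof (rule ccontr)
  assume c: "\<not> ?thesis"
  let ?A = "{br x y |x y a. a \<in> wts \<and> x \<in> gw a \<and> y \<in> gw (- a)}"
  have "b z = 0" if z: "z \<in> ?A" and b: "b \<in> wts" for z b
  proof -
    obtain x y a where a: "z = br x y" "a \<in> wts" "x \<in> gw a" "y \<in> gw (- a)" using z by blast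
    have zH: "z \<in> H" using gw_br[OF a(3,4)] gw0 a(1) by simp
    have "\<exists>r::real. b z = of_real r * a z \<and> (b = a \<longrightarrow> r = 1)" if "b \<in> wts" for b
      using string_ratio[OF a(2) that a(3,4)] a(1) by (cases "b = a") auto
    then obtain r where r: "!!b. b \<in> wts ==> b z = of_real (r b) * a z \<and> (b = a \<longrightarrow> r b = 1)" by metis
    define S where "S = (\<Sum>b\<in>wts. (r b)\<^sup>2 * real (dim (gw b)))"
    have "0 = kil z z" using c zH by simp
    also have "\<dots> = (\<Sum>b\<in>wts. (b z)\<^sup>2 * of_nat (dim (gw b)))" by (rule kil_H_square[OF zH])
    also have "\<dots> = (\<Sum>b\<in>wts. (a z)\<^sup>2 * of_real ((r b)\<^sup>2 * real (dim (gw b))))"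
    proof (intro sum.cong refl)
      fix b assume b: "b \<in> wts"
      show "(b z)\<^sup>2 * of_nat (dim (gw b)) = (a z)\<^sup>2 * of_real ((r b)\<^sup>2 * real (dim (gw b)))"
        unfolding conjunct1[OF r[OF b]] by (simp add: power_mult_distrib)
    qed
    also have "\<dots> = (a z)\<^sup>2 * of_real S"
      by (simp add: sum_distrib_left S_def)
    finally have "a z = 0 \<or> S = 0" by simp
    moreover have "S > 0"
      unfolding S_def using finite_wts a(2) r[of a] dim_gw[OF a(2)] by (intro sum_pos2[of _ a]) auto
    ultimately have "a z = 0" by simp
    then show ?thesis using r[OF b] by simp
  qed
  moreover have "?A \<subseteq> H"
  proof
    fix z assume "z \<in> ?A"
    then obtain x y a where "z = br x y" "x \<in> gw a" "y \<in> gw (- a)" by blast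
    then show "z \<in> H" using gw_br[of x a y "- a"] gw0 by simp
  qed
  ultimately have "?A \<subseteq> {h \<in> H. b h = 0}" if "b \<in> wts" for b using that by blast
  then have sp: "span ?A \<subseteq> {h \<in> H. b h = 0}" if "b \<in> wts" for b
    by (rule span_minimal[OF _ subspace_wts_ker]) (use that in auto)
  obtain a h where ah: "a \<in> wts" "h \<in> H" "a h ~= 0" using wts_nonzero_exists by blast
  have "h \<in> span ?A" using H_span ah(2) by (rule subsetD)
  then show False using sp[OF ah(1)] ah(3) by blast
qed

text \<open>The radical is an ideal by invariance, and \<open>kil_nondeg_H_exists\<close> prevents
  it from being everything.\<close>

lemma kil_nondeg: assumes "!!y. kil x y = 0" shows "x = 0"
proof -
  let ?R = "{x. \<forall>y. kil x y = 0}"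
  have "ideal ?R" unfolding ideal_def
  proof (intro conjI allI ballI)
    show "subspace ?R" by (rule subspaceI) (auto simp: kil_0 kil_add kil_scale)
    fix x y assume y: "y \<in> ?R"
    have "kil (br x y) z = 0" for z
      using y kil_inv[of y x z] br_anti[of x y] by (simp add: kil_minus)
    then show "br x y \<in> ?R" by simp
  qed
  then have "?R = {0} \<or> ?R = UNIV" using simple unfolding simple_def by blast
  moreover have "?R ~= UNIV" using kil_nondeg_H_exists by blast
  ultimately show ?thesis using assms by blast
qed

text \<open>The composite of \<open>br x\<close> and \<open>br y\<close> shifts every weight by
  \<open>a + b\<close>; as there are finitely many weights, it is nilpotent.\<close>

lemma kil_orth:
  assumes x: "x \<in> gw a" and y: "y \<in> gw b" and ab: "a \<in> ext" "b \<in> ext" "a + b ~= 0"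
  shows "kil x y = 0"
proof -
  let ?f = "\<lambda>z. br x (br y z)"
  have f: "lin ?f" by (rule lin_comp[OF br_lin br_lin])
  have pw: "(?f ^^ n) z \<in> gw (c + of_nat n * (a + b))" if "z \<in> gw c" for n z c
  proof (induction n)
    case (Suc n)
    have "?f ((?f ^^ n) z) \<in> gw (a + (b + (c + of_nat n * (a + b))))" by (intro gw_br x y Suc)
    moreover have "a + (b + (c + of_nat n * (a + b))) = c + of_nat (Suc n) * (a + b)"
      by (rule HOL.ext) (simp add: algebra_simps)
    ultimately show ?case by (simp only: funpow.simps comp_apply)
  qed (use that in simp)
  have "\<exists>n. \<forall>z\<in>gw c. (?f ^^ n) z = 0" if c: "c \<in> wts" for c
  proof -
    have "inj (\<lambda>n. c + of_nat n * (a + b))"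
    proof (rule injI)
      fix m n :: nat assume eq: "c + of_nat m * (a + b) = c + of_nat n * (a + b)"
      obtain h where h: "(a + b) h ~= 0" using ab(3) by (auto simp: fun_eq_iff)
      have "of_nat m * (a + b) h = of_nat n * (a + b) h"
        using fun_cong[OF eq, of h] by simp
      then show "m = n" using h by simp
    qed
    then have "\<not> range (\<lambda>n. c + of_nat n * (a + b)) \<subseteq> wts"
      using finite_wts finite_subset infinite_UNIV_nat finite_imageD by blast
    then obtain n where n: "c + of_nat n * (a + b) \<notin> wts" by auto
    have "c + of_nat n * (a + b) \<in> ext" using ab wts_ext[OF c] by (intro ext_add ext_mult)
    then show ?thesis using pw[of _ c n] gw_not_wts n by blast
  qed
  then obtain n where n: "!!c z. c \<in> wts ==> z \<in> gw c ==> (?f ^^ n c) z = 0" by metis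
  let ?N = "Max (n ` wts)"
  have 0: "(?f ^^ ?N) z = 0" if "c \<in> wts" "z \<in> gw c" for z c
    by (rule pow_zero_mono[OF f n[OF that]]) (use finite_wts that in auto)
  have "(?f ^^ ?N) z \<in> {0}" for z
    by (rule lin_span_image[OF lin_pow[OF f], of "\<Union>c\<in>wts. gw c"]) (use 0 gw_span in auto)
  then show ?thesis unfolding kil_def by (intro tr_nilpotent[OF _ f, of _ ?N]) auto
qed

lemma kil_nondeg_gw:
  assumes x: "x \<in> gw a" "a \<in> ext" and z: "!!y. y \<in> gw (- a) ==> kil x y = 0"
  shows "x = 0"
proof (rule kil_nondeg)
  fix y
  have sub: "subspace {y. kil x y = 0}" by (rule subspaceI) (auto simp: kil_add' kil_scale' kil_0 kil_sym[of x 0])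
  have "kil x y = 0" if y: "b \<in> wts" "y \<in> gw b" for b y
  proof (cases "a + b = 0")
    case True
    then have "b = - a" by (simp add: eq_neg_iff_add_eq_0 add.commute)
    then show ?thesis using z y by blast
  next
    case False
    then show ?thesis using kil_orth x y wts_ext by blast
  qed
  then have "(\<Union>b\<in>wts. gw b) \<subseteq> {y. kil x y = 0}" by blast
  from span_minimal[OF this sub] show "kil x y = 0" unfolding gw_span by blast
qed

lemma kil_nondeg_H: "h \<in> H ==> (!!k. k \<in> H ==> kil h k = 0) ==> h = 0"
  using kil_nondeg_gw[of h 0] gw0 ext_0 by simp

text \<open>On \<open>H\<close> the Killing form is a combination of products of weights, and
  weights vanish on brackets of \<open>H\<close>, so such a bracket is orthogonal to all of
  \<open>H\<close>.\<close>

lemma H_abelian: assumes h: "h \<in> H" "k \<in> H" shows "br h k = 0"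
  by (rule kil_nondeg_H) (use h in "auto simp: H_br kil_H wts_br intro!: sum.neutral")

lemma weights_separate: assumes h: "h \<in> H" and z: "!!a. a \<in> wts ==> a h = 0" shows "h = 0"
  by (rule kil_nondeg_H) (use h z in "auto simp: kil_H intro!: sum.neutral")

text \<open>In a non-zero \<open>H\<close>-stable subspace of least dimension, the eigenspace of
  each \<open>h\<close> is non-zero and again \<open>H\<close>-stable, since \<open>H\<close> is
  abelian. It is therefore the whole subspace.\<close>

lemma gw_eigenvector:
  assumes a: "a \<in> wts"
  obtains x where "x \<in> gw a" "x ~= 0" "!!h. h \<in> H ==> br h x = a h *s x"
proof -
  let ?P = "\<lambda>S. subspace S \<and> S \<subseteq> gw a \<and> S ~= {0} \<and> (\<forall>h\<in>H. \<forall>x\<in>S. br h x \<in> S)"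
  have "?P (gw a)" using a gw_sub gw_H by (auto simp: wts_def)
  then obtain S where S: "?P S" and min: "!!T. ?P T ==> dim S \<le> dim T"
    using ex_has_least_nat[of ?P "gw a" dim] by blast
  have eig: "br h x = a h *s x" if h: "h \<in> H" and x: "x \<in> S" for h x
  proof -
    let ?K = "{x \<in> S. br h x = a h *s x}"
    obtain y where y: "y \<in> S" "y ~= 0" using S subspace_0 by blast
    have "y \<in> geig (br h) (a h)" using y S gwD h by blast
    then obtain k where k: "((\<lambda>x. br h x - a h *s x) ^^ k) y ~= 0"
      "br h (((\<lambda>x. br h x - a h *s x) ^^ k) y) = a h *s ((\<lambda>x. br h x - a h *s x) ^^ k) y"
      using geig_eigenvector y(2) by metis
    have "((\<lambda>x. br h x - a h *s x) ^^ k) y \<in> S" by (rule shift_pow_in) (use S h y in auto)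
    then have "?K ~= {0}" using k by blast
    moreover have "subspace ?K"
      using S by (intro subspaceI) (auto simp: br_simps subspace_0 subspace_add subspace_scale scale_right_distrib mult.commute)
    moreover have "br g x \<in> ?K" if g: "g \<in> H" and x: "x \<in> ?K" for g x
      using S g x jac'[of h g x] H_abelian[OF h g] by (auto simp: br_simps)
    ultimately have "dim S \<le> dim ?K" using S by (intro min) auto
    then have "?K = S" using S \<open>subspace ?K\<close> by (intro subspace_dim_equal) auto
    then show ?thesis using x by blast
  qed
  obtain x where "x \<in> S" "x ~= 0" using S subspace_0 by blast
  then show ?thesis using that[of x] S eig by blast
qed

text \<open>With \<open>y\<close> scaled to \<open>kil x y = 1\<close>, invariance makes
  \<open>br x y\<close> represent \<open>a\<close> under the Killing form. If \<open>a\<close>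
  vanished on \<open>br x y\<close>, then by \<open>string_ratio\<close> all weights would, forcing
  \<open>br x y = 0\<close> and hence \<open>a = 0\<close>.\<close>

lemma root_vectors:
  assumes a: "a \<in> wts"
  obtains x y where "x \<in> gw a" "x ~= 0" "y \<in> gw (- a)" "y ~= 0" "br x y \<in> H"
    "!!h. h \<in> H ==> br h x = a h *s x" "!!h. h \<in> H ==> kil (br x y) h = a h"
    "a ~= 0 ==> a (br x y) ~= 0"
proof -
  obtain x where x: "x \<in> gw a" "x ~= 0" "!!h. h \<in> H ==> br h x = a h *s x" using gw_eigenvector[OF a] by blast
  obtain y' where y': "y' \<in> gw (- a)" "kil x y' ~= 0" using kil_nondeg_gw[OF x(1) wts_ext[OF a]] x by blast
  define y where "y = (1 / kil x y') *s y'"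
  have y: "y \<in> gw (- a)" "kil x y = 1" using y' gw_sub by (auto simp: y_def subspace_scale kil_scale')
  have tH: "br x y \<in> H" using gw_br[OF x(1) y(1)] gw0 by simp
  have t: "kil (br x y) h = a h" if "h \<in> H" for h
  proof -
    have "kil (br x y) h = kil h (br x y)" by (rule kil_sym)
    also have "\<dots> = kil (br h x) y" by (rule kil_inv[symmetric])
    finally show ?thesis using x(3)[OF that] y by (simp add: kil_scale)
  qed
  have "a (br x y) ~= 0" if "a ~= 0"
  proof
    assume 0: "a (br x y) = 0"
    have "b (br x y) = 0" if "b \<in> wts" for b using string_ratio[OF a that x(1) y(1)] 0 by auto
    then have "br x y = 0" by (rule weights_separate[OF tH])
    then have "a h = 0" if "h \<in> H" for h using t[OF that] by (simp add: kil_0)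
    then have "a h = 0" for h using wts_ext[OF a] by (cases "h \<in> H") (auto simp: ext_def)
    then show False using \<open>a ~= 0\<close> by (auto simp: fun_eq_iff)
  qed
  moreover have "y ~= 0" using y kil_0 kil_sym[of x 0] by auto
  ultimately show ?thesis using that x y tH t by blast
qed

text \<open>With \<open>t = br x y\<close>, the trace of \<open>t\<close> on the line of
  \<open>x\<close>, \<open>H\<close> and the spaces of \<open>- a\<close>, \<open>- 2 a\<close>, ...
  together is \<open>a t\<close> times \<open>1 - \<Sum> k dim (gw (- k a))\<close>, and it is 0 for
  a commutator. So the sum equals 1, which leaves \<open>k = 1\<close> with dimension 1.\<close>

lemma neg_root_dim:
  assumes a: "a \<in> wts" "a ~= 0"
  shows "dim (gw (- a)) = 1" "m \<ge> 2 ==> - (of_nat m * a) \<notin> wts"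
proof -
  obtain x y where xy: "x \<in> gw a" "x ~= 0" "y \<in> gw (- a)" "y ~= 0" "br x y \<in> H"
    "!!h. h \<in> H ==> br h x = a h *s x" "!!h. h \<in> H ==> kil (br x y) h = a h" "a (br x y) ~= 0"
    using root_vectors[OF a(1)] a(2) by metis
  let ?t = "br x y"
  define J where "J = {c \<in> wts. \<exists>k::nat. c = - (of_nat k * a)}"
  \<comment> \<open>At weight \<open>a\<close> only the line of the eigenvector \<open>x\<close> is
    taken: \<open>y\<close> maps it into \<open>H\<close>, \<open>x\<close> maps it to 0, and
    \<open>H\<close> acts on it by scalars, so the sum stays stable.\<close>
  define S where "S c = (if c = a then span {x} else gw c)" for c
  have J: "J \<subseteq> wts" "finite J" using finite_wts finite_subset by (auto simp: J_def)
  obtain h0 where h0: "a h0 ~= 0" using a(2) by (auto simp: fun_eq_iff)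
  have inj: "k = m" if "- (of_nat k * a) = - (of_nat m * a)" for k m :: nat
    using fun_cong[OF that, of h0] h0 by simp
  have aJ: "a \<notin> J"
  proof
    assume "a \<in> J"
    then obtain k :: nat where "a = - (of_nat k * a)" by (auto simp: J_def)
    from fun_cong[OF this, of h0] have "(1 + of_nat k) * a h0 = 0" by (simp add: eq_neg_iff_add_eq_0 distrib_right)
    then show False using h0 of_nat_eq_0_iff[of "Suc k", where ?'a = complex] by simp
  qed
  have Ssub: "subspace (S c)" for c by (simp add: S_def gw_sub)
  have Sgw: "S c \<subseteq> gw c" for c using span_minimal[OF _ gw_sub, of "{x}" a] xy(1) by (simp add: S_def)
  let ?U = "span (\<Union>c\<in>insert a J. S c)"
  have inU: "z \<in> ?U" if "z \<in> gw (- (of_nat k * a))" for z and k :: nat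
  proof (cases "- (of_nat k * a) \<in> wts")
    case True
    then have "- (of_nat k * a) \<in> J" by (auto simp: J_def)
    then have "z \<in> (\<Union>c\<in>insert a J. S c)" using that aJ by (auto simp: S_def)
    then show ?thesis by (rule span_base)
  next
    case False
    then have "z = 0" using gw_not_wts that a by (metis ext_mult ext_uminus wts_ext)
    then show ?thesis by (simp add: span_zero)
  qed
  have xU: "x \<in> ?U" by (intro span_base UN_I[of a]) (auto simp: S_def intro: span_base)
  have sxU: "z \<in> ?U" if "z \<in> span {x}" for z using that xU span_minimal[of "{x}" ?U] by auto
  have HU: "z \<in> ?U" if "z \<in> H" for z using inU[of z 0] that gw0 by simp
  have brU: "br g w \<in> ?U" if g: "g = x \<or> g = y" and w: "w \<in> S c" "c \<in> insert a J" for g w c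
  proof (cases "c = a")
    case True
    then obtain e where e: "w = e *s x" using w by (auto simp: S_def span_singleton)
    have "- ?t \<in> H" using subspace_neg[OF H_sub xy(5)] .
    then have "br y x \<in> H" using br_anti[of y x] by simp
    then have "br y w \<in> ?U" using HU subspace_scale[OF H_sub] by (simp only: e br_simps)
    moreover have "br x w \<in> ?U" by (simp only: e br_simps br_self scale_zero_right span_zero)
    ultimately show ?thesis using g by blast
  next
    case False
    then obtain k :: nat where k: "c = - (of_nat k * a)" "w \<in> gw c" using w by (auto simp: J_def S_def)
    show ?thesis
    proof (cases "g = y")
      case True
      have "br y w \<in> gw (- a + c)" by (rule gw_br[OF xy(3) k(2)])
      also have "- a + c = - (of_nat (Suc k) * a)" by (simp add: k algebra_simps)
      finally show ?thesis using inU True by blast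
    next
      case False
      then have g: "g = x" using g by simp
      show ?thesis
      proof (cases k)
        case 0
        then have "w \<in> H" using k gw0 by simp
        then have "br x w = - (a w *s x)" using xy(6)[of w] br_anti[of x w] by simp
        also have "\<dots> \<in> span {x}" by (intro span_neg span_scale span_base) simp
        finally show ?thesis using sxU g by blast
      next
        case (Suc m)
        have "br x w \<in> gw (a + c)" by (rule gw_br[OF xy(1) k(2)])
        also have "a + c = - (of_nat m * a)" by (simp add: k Suc algebra_simps)
        finally show ?thesis using inU g by blast
      qed
    qed
  qed
  have inv: "br g z \<in> ?U" if g: "g = x \<or> g = y" and z: "z \<in> ?U" for g z
    by (rule lin_span_image[OF br_lin _ _ z]) (use brU[OF g] in auto)
  have invx: "br x z \<in> ?U" and invy: "br y z \<in> ?U" if "z \<in> ?U" for z using inv[OF _ that] by blast+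
  have Sinv: "br ?t z \<in> S c" if "z \<in> S c" for z c
  proof (cases "c = a")
    case True
    then have "z \<in> span {x}" using \<open>z \<in> S c\<close> by (simp add: S_def)
    then obtain e where e: "z = e *s x" unfolding span_singleton by (elim rangeE)
    have "br ?t z \<in> span {x}" unfolding e br_simps xy(6)[OF xy(5)] by (intro span_scale span_base) simp
    then show ?thesis using True by (simp add: S_def)
  qed (use that gw_H xy(5) in "auto simp: S_def")
  have "tr ?U (\<lambda>z. br x (br y z) - br y (br x z)) = tr ?U (\<lambda>z. br x (br y z)) - tr ?U (\<lambda>z. br y (br x z))"
    by (rule tr_diff[OF subspace_span lin_comp[OF br_lin br_lin] invx[OF invy] lin_comp[OF br_lin br_lin] invy[OF invx]])
  also have "\<dots> = 0" using tr_comm[OF subspace_span br_lin invx br_lin invy] by (simp only: diff_self)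
  also have "(\<lambda>z. br x (br y z) - br y (br x z)) = br ?t" by (rule HOL.ext) (simp only: jac)
  also have "tr ?U (br ?t) = (\<Sum>c\<in>insert a J. tr (S c) (br ?t))"
  proof (rule tr_direct_sum)
    have "insert a J \<subseteq> ext" using J a wts_ext by blast
    then show "indep_family (insert a J) S"
      using indep_family_cong_subset[OF gw_indep_ext _ Sgw] by blast
  qed (use J Ssub br_lin Sinv in auto)
  also have "\<dots> = tr (S a) (br ?t) + (\<Sum>c\<in>J. tr (gw c) (br ?t))"
    using aJ J by (simp add: S_def) (intro sum.cong refl; auto)
  also have "tr (S a) (br ?t) = a ?t * of_nat (dim (S a))"
  proof (rule tr_geig[OF br_lin Ssub])
    show "S a \<subseteq> geig (br ?t) (a ?t)" using Sgw gwD xy(5) by blast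
  qed (rule Sinv)
  also have "dim (S a) = 1" using xy(2) by (simp add: S_def)
  finally have *: "a ?t + (\<Sum>c\<in>J. c ?t * of_nat (dim (gw c))) = 0" using xy(5) by (simp add: tr_gw)
  have "\<forall>c\<in>J. \<exists>k::nat. c = - (of_nat k * a)" by (auto simp: J_def)
  then obtain k where k: "!!c. c \<in> J ==> c = - (of_nat (k c) * a)" by metis
  have "(\<Sum>c\<in>J. c ?t * of_nat (dim (gw c))) = (\<Sum>c\<in>J. - a ?t * of_nat (k c * dim (gw c)))"
  proof (intro sum.cong refl)
    fix c assume c: "c \<in> J"
    have "c ?t = - (of_nat (k c) * a ?t)" by (subst k[OF c]) simp
    then show "c ?t * of_nat (dim (gw c)) = - a ?t * of_nat (k c * dim (gw c))" by simp
  qed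
  also have "\<dots> = - a ?t * of_nat (\<Sum>c\<in>J. k c * dim (gw c))" by (simp add: sum_distrib_left)
  finally have "a ?t * of_nat (\<Sum>c\<in>J. k c * dim (gw c)) = a ?t" using * by simp
  then have "of_nat (\<Sum>c\<in>J. k c * dim (gw c)) = (1 :: complex)" using xy(8) by simp
  then have sum1: "(\<Sum>c\<in>J. k c * dim (gw c)) = 1" by (metis of_nat_1 of_nat_eq_iff)
  have naw: "- a \<in> wts" using xy(3,4) wts_ext a ext_uminus by (auto simp: wts_def)
  then have naJ: "- a \<in> J" by (auto simp: J_def intro: exI[of _ 1])
  have k1: "k (- a) = 1" using k[OF naJ] inj[of 1 "k (- a)"] by simp
  have sums: "(\<Sum>c\<in>J. k c * dim (gw c)) = dim (gw (- a)) + (\<Sum>c\<in>J - {- a}. k c * dim (gw c))"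
    using naJ J k1 by (simp add: sum.remove)
  have "dim (gw (- a)) > 0" using naw dim_gw by blast
  then show "dim (gw (- a)) = 1" using sums sum1 by linarith
  then have rest: "(\<Sum>c\<in>J - {- a}. k c * dim (gw c)) = 0" using sums sum1 by linarith
  show "- (of_nat m * a) \<notin> wts" if m: "m \<ge> 2"
  proof
    let ?c = "- (of_nat m * a)"
    assume w: "?c \<in> wts"
    then have cJ: "?c \<in> J" by (auto simp: J_def)
    then have km: "k ?c = m" using k[OF cJ] inj[of m "k ?c"] by simp
    have "?c ~= - a" using inj[of m 1] m by auto
    then have "k ?c * dim (gw ?c) = 0" using rest cJ J(2) by (simp add: sum_eq_0_iff)
    then show False using km m gw_nz[OF w] by simp
  qed
qed

end

section \<open>Finite-dimensional modules of sl2, one eigenvector at a time\<close>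

section \<open>Representations of sl2\<close>

context fd_complex
begin

lemma inj_dim_le:
  assumes f: "lin f" and S: "subspace S" and inj: "!!x. x \<in> S ==> f x = 0 ==> x = 0" and T: "!!x. x \<in> S ==> f x \<in> T"
  shows "dim S \<le> dim T"
proof -
  obtain B where B: "finite B" "B \<subseteq> S" "independent B" "span B = S" "card B = dim S"
    using basis_subspace_exists[OF S] by metis
  have injB: "inj_on f B"
  proof (rule inj_onI)
    fix x y assume "x \<in> B" "y \<in> B" "f x = f y"
    then show "x = y" using inj[of "x - y"] B S lin_diff[OF f] subspace_diff by fastforce
  qed
  have "independent (f ` B)"
  proof (rule independent_if_scalars_zero)
    fix u y assume z: "(\<Sum>y\<in>f ` B. u y *s y) = 0" and y: "y \<in> f ` B"
    have "f (\<Sum>b\<in>B. u (f b) *s b) = 0"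
      using z injB by (simp add: sum.reindex lin_sum[OF f] lin_scale[OF f])
    moreover have "(\<Sum>b\<in>B. u (f b) *s b) \<in> S"
      using B S by (intro subspace_sum subspace_scale) auto
    ultimately have "(\<Sum>b\<in>B. u (f b) *s b) = 0" using inj by blast
    then have "u (f b) = 0" if "b \<in> B" for b using independentD[OF B(3) B(1) order_refl, of "\<lambda>b. u (f b)"] that by blast
    then show "u y = 0" using y by blast
  qed (use B in auto)
  then have "card (f ` B) \<le> dim T" using independent_card_le_dim[of "f ` B" T] B T by blast
  then show ?thesis using B injB by (simp add: card_image)
qed

lemma finite_eigenvalues:
  assumes f: "lin f" shows "finite {c. \<exists>x. x ~= 0 \<and> f x = c *s x}"
proof -
  let ?I = "{c. \<exists>x. x ~= 0 \<and> f x = c *s x}"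
  \<comment> \<open>Eigenvalues are coded as functions on a one-point type, which turns a single
    operator into a case of \<open>gen_weight_indep\<close>.\<close>
  let ?S = "\<lambda>l::unit => complex. {x. f x = l () *s x}"
  have sub: "subspace (?S l)" for l
    by (rule subspaceI) (auto simp: lin_add[OF f] lin_scale[OF f] lin_zero[OF f] scale_right_distrib mult.commute)
  have "finite {l. l () \<in> ?I}"
  proof (rule indep_family_card[of _ ?S])
    show "indep_family {l. l () \<in> ?I} ?S"
    proof (rule gen_weight_indep[of UNIV "\<lambda>_. f"])
      fix l :: "unit => complex" and h :: unit and x assume "x \<in> ?S l"
      then show "x \<in> geig f (l h)" "f x \<in> ?S l"
        unfolding geig_def by (auto intro!: exI[of _ 1] simp: lin_scale[OF f])
    qed (use sub f in auto)
  qed (use sub in auto)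
  moreover have "?I \<subseteq> (\<lambda>l. l ()) ` {l. l () \<in> ?I}" by (auto intro!: image_eqI[of _ _ "\<lambda>_. c" for c])
  ultimately show ?thesis using finite_surj by blast
qed

end

locale sl2 = fd_complex scale Basis
  for scale :: "complex => 'b::ab_group_add => 'b" (infixr \<open>*s\<close> 75) and Basis :: "'b set" +
  fixes E F K :: "'b => 'b"
  assumes linE: "lin E" and linF: "lin F" and linK: "lin K"
    and KE: "K (E x) = E (K x) + 2 *s E x" and KF: "K (F x) = F (K x) - 2 *s F x"
    and EF: "E (F x) = F (E x) + K x"
begin

text \<open>Exchanging raising and lowering transfers every statement about lowest weights to
  highest weights and back.\<close>

lemma opposite: "sl2 scale Basis F E (\<lambda>x. - K x)"
proof -
  have "lin (\<lambda>x. (-1) *s K x)" by (rule lin_smult[OF linK])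
  then have l: "lin (\<lambda>x. - K x)" by simp
  have neg: "F (- y) = - F y" "E (- y) = - E y" for y
    using lin_diff[OF linF, of 0 y] lin_diff[OF linE, of 0 y] by (simp_all add: lin_zero[OF linF] lin_zero[OF linE])
  show ?thesis
  proof (intro sl2.intro sl2_axioms.intro fd_complex_axioms linE linF l)
    show "- K (F x) = F (- K x) + 2 *s F x" for x unfolding neg KF by simp
    show "- K (E x) = E (- K x) - 2 *s E x" for x unfolding neg KE by simp
    show "F (E x) = E (F x) + - K x" for x unfolding EF by simp
  qed
qed

lemma K_pow_E: "K x = c *s x ==> K ((E ^^ n) x) = (c + 2 * of_nat n) *s (E ^^ n) x"
  by (induction n) (simp_all add: KE lin_scale[OF linE] lin_add[OF linE] algebra_simps scale_left_distrib)

lemma F_pow_E: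
  assumes "K y = d *s y"
  shows "F ((E ^^ Suc n) y) = (E ^^ Suc n) (F y) - (of_nat (Suc n) * (d + of_nat n)) *s (E ^^ n) y"
proof (induction n)
  case 0
  have "F (E y) = E (F y) - K y" by (simp add: EF)
  then show ?case using assms by simp
next
  case (Suc n)
  let ?z = "(E ^^ Suc n) y"
  have "F (E ?z) = E (F ?z) - K ?z" by (simp add: EF)
  also have "K ?z = (d + 2 * of_nat (Suc n)) *s ?z" by (rule K_pow_E[OF assms])
  also have "E (F ?z) = E ((E ^^ Suc n) (F y)) - (of_nat (Suc n) * (d + of_nat n)) *s ?z"
    unfolding Suc by (simp add: lin_diff[OF linE] lin_scale[OF linE])
  finally have "F ((E ^^ Suc (Suc n)) y) = (E ^^ Suc (Suc n)) (F y)
      - ((of_nat (Suc n) * (d + of_nat n)) *s ?z + (d + 2 * of_nat (Suc n)) *s ?z)"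
    by (simp only: funpow.simps comp_apply diff_diff_eq)
  also have "(of_nat (Suc n) * (d + of_nat n)) *s ?z + (d + 2 * of_nat (Suc n)) *s ?z
      = (of_nat (Suc (Suc n)) * (d + of_nat (Suc n))) *s ?z"
    unfolding scale_left_distrib[symmetric] by (rule arg_cong[of _ _ "\<lambda>c. c *s ?z"]) (simp add: algebra_simps)
  finally show ?case .
qed

text \<open>Non-vanishing powers would produce the infinitely many eigenvalues
  \<open>c + 2 n\<close> of \<open>K\<close>.\<close>

lemma E_nilpotent:
  assumes "K x = c *s x" obtains n where "(E ^^ n) x = 0"
proof -
  have "\<exists>n. (E ^^ n) x = 0"
  proof (rule ccontr)
    assume "\<not> ?thesis"
    then have "range (\<lambda>n. c + 2 * of_nat n) \<subseteq> {c. \<exists>x. x ~= 0 \<and> K x = c *s x}"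
      using K_pow_E[OF assms] by auto
    then have "finite (range (\<lambda>n::nat. c + 2 * of_nat n))" using finite_eigenvalues[OF linK] finite_subset by blast
    moreover have "inj (\<lambda>n::nat. c + 2 * of_nat n)" by (rule injI) simp
    ultimately show False using finite_imageD infinite_UNIV_nat by blast
  qed
  then show ?thesis using that by blast
qed

lemma E_last:
  assumes "K x = c *s x" "x ~= 0" obtains n where "(E ^^ n) x ~= 0" "(E ^^ Suc n) x = 0"
proof -
  obtain m where m: "(E ^^ m) x = 0" using E_nilpotent assms by blast
  let ?k = "LEAST k. (E ^^ k) x = 0"
  have k: "(E ^^ ?k) x = 0" using m by (rule LeastI)
  with assms obtain n where n: "?k = Suc n" by (cases ?k) auto
  have "(E ^^ n) x ~= 0" using n not_less_Least[of n "\<lambda>k. (E ^^ k) x = 0"] by auto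
  then show ?thesis using that k n by metis
qed

text \<open>At the last non-zero power \<open>(E ^^ n) x\<close>, applying \<open>F\<close> to the
  next power, which is 0, gives \<open>(n + 1) (c + n) = 0\<close> by
  \<open>F_pow_E\<close>.\<close>

lemma lowest_weight:
  assumes x: "K x = c *s x" "x ~= 0" "F x = 0" shows "\<exists>n. c = - of_nat n"
proof -
  obtain n where n: "(E ^^ n) x ~= 0" "(E ^^ Suc n) x = 0" using E_last x by metis
  have "F ((E ^^ Suc n) x) = - (of_nat (Suc n) * (c + of_nat n)) *s (E ^^ n) x"
    using F_pow_E[OF x(1), of n] x(3) lin_zero[OF lin_pow[OF linE], of "Suc n"] by simp
  then have "of_nat (Suc n) * (c + of_nat n) = 0"
    using n lin_zero[OF linF] by (metis neg_equal_0_iff_equal scale_eq_0_iff)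
  then have "c + of_nat n = 0" by (metis mult_eq_0_iff of_nat_neq_0)
  then have "c = - of_nat n" by (simp add: eq_neg_iff_add_eq_0)
  then show ?thesis by blast
qed

lemma highest_weight_nat:
  assumes x: "K x = c *s x" "x ~= 0" "E x = 0" shows "\<exists>n. c = of_nat n"
proof -
  interpret op: sl2 scale Basis F E "\<lambda>x. - K x" by (rule opposite)
  have "- K x = (- c) *s x" using x by simp
  then obtain n where "- c = - of_nat n" using op.lowest_weight[of x "- c"] x by blast
  then show ?thesis by auto
qed

lemma weight_int:
  assumes x: "K x = c *s x" "x ~= 0" shows "\<exists>k::int. c = of_int k"
proof -
  obtain n where n: "(E ^^ n) x ~= 0" "(E ^^ Suc n) x = 0" using E_last x by metis
  obtain m where "c + 2 * of_nat n = of_nat m"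
    using highest_weight_nat[OF K_pow_E[OF x(1)] n(1)] n(2) by auto
  then have "c = of_int (int m - 2 * int n)" by (simp add: algebra_simps)
  then show ?thesis by blast
qed

text \<open>The eigenvalue of \<open>F E\<close> is followed up to the last non-zero power
  \<open>(E ^^ j) x\<close>. There \<open>F E\<close> gives 0, whereas the formula yields the
  negative number \<open>- (d + j (m + j + 1))\<close>.\<close>

lemma casimir_inj:
  assumes x: "K x = of_nat m *s x" and d: "d > (0::real)" and z: "F (E x) + of_real d *s x = 0"
  shows "x = 0"
proof (rule ccontr)
  assume "x ~= 0"
  then obtain j where j: "(E ^^ j) x ~= 0" "(E ^^ Suc j) x = 0" using E_last x by metis
  have FE: "F (E x) = - (of_real d *s x)" using z by (simp add: eq_neg_iff_add_eq_0)
  have "F ((E ^^ Suc j) x) = - ((of_real d + of_nat j * (of_nat m + of_nat j + 1)) *s (E ^^ j) x)"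
  proof (cases j)
    case 0
    then show ?thesis using FE by simp
  next
    case (Suc i)
    have K: "K (E x) = (of_nat m + 2) *s E x" using K_pow_E[OF x, of 1] by simp
    have sh: "(E ^^ Suc i) (E x) = (E ^^ Suc j) x" "(E ^^ i) (E x) = (E ^^ j) x"
      using Suc by (simp_all add: funpow_swap1)
    have "F ((E ^^ Suc j) x) = (E ^^ j) (F (E x)) - (of_nat j * (of_nat m + 2 + of_nat i)) *s (E ^^ j) x"
      using F_pow_E[OF K, of i] unfolding sh Suc[symmetric] by (simp only: funpow_Suc_right comp_apply)
    also have "(E ^^ j) (F (E x)) = - (of_real d *s (E ^^ j) x)"
      unfolding FE using lin_scale[OF lin_pow[OF linE, of j], of "- of_real d" x] by simp
    finally have *: "F ((E ^^ Suc j) x) = - (of_real d *s (E ^^ j) x) - (of_nat j * (of_nat m + 2 + of_nat i)) *s (E ^^ j) x" .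
    have "of_nat j * (of_nat m + 2 + of_nat i) = (of_nat j * (of_nat m + of_nat j + 1) :: complex)"
      using Suc by simp
    with * show ?thesis by (simp only: scale_left_distrib minus_add_distrib diff_conv_add_uminus)
  qed
  then have "(of_real d + of_nat j * (of_nat m + of_nat j + 1) :: complex) = 0"
    using j lin_zero[OF linF] by (metis neg_equal_0_iff_equal scale_eq_0_iff)
  then have "complex_of_real (d + real j * (real m + real j + 1)) = 0" by simp
  then have "d + real j * (real m + real j + 1) = 0" by (simp only: of_real_eq_0_iff)
  moreover have "real j * (real m + real j + 1) \<ge> 0" by simp
  ultimately show False using d by linarith
qed

text \<open>Applying \<open>E\<close> to \<open>(F ^^ Suc k) x = 0\<close> and commuting shows that
  \<open>F ^^ k\<close> kills \<open>F E x + (k + 1) (n - k) x\<close>, a vector of the same weight.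
  By induction this vector is 0, and \<open>casimir_inj\<close> finishes, as
  \<open>(k + 1) (n - k)\<close> is positive.\<close>

lemma F_pow_inj:
  assumes "K x = of_nat n *s x" "k \<le> n" "(F ^^ k) x = 0"
  shows "x = 0"
  using assms
proof (induction k arbitrary: x)
  case (Suc k)
  interpret op: sl2 scale Basis F E "\<lambda>x. - K x" by (rule opposite)
  have Kx: "- K x = (- of_nat n) *s x" using Suc.prems by simp
  have "E ((F ^^ Suc k) x) = (F ^^ Suc k) (E x) - (of_nat (Suc k) * (- of_nat n + of_nat k)) *s (F ^^ k) x"
    by (rule op.F_pow_E[OF Kx])
  then have "(F ^^ k) (F (E x)) - (of_nat (Suc k) * (- of_nat n + of_nat k)) *s (F ^^ k) x = 0"
    using Suc.prems(3) lin_zero[OF linE] by (simp only: funpow_Suc_right comp_apply)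
  moreover have "- (of_nat (Suc k) * (- of_nat n + of_nat k)) = complex_of_real (real (Suc k) * (real n - real k))"
    by (simp add: algebra_simps)
  ultimately have "(F ^^ k) (F (E x)) + of_real (real (Suc k) * (real n - real k)) *s (F ^^ k) x = 0"
    by (metis add_uminus_conv_diff scale_minus_left)
  then have z: "(F ^^ k) (F (E x) + of_real (real (Suc k) * (real n - real k)) *s x) = 0"
    by (simp only: lin_add[OF lin_pow[OF linF]] lin_scale[OF lin_pow[OF linF]])
  have "K (F (E x)) = of_nat n *s F (E x)"
    using Suc.prems(1) by (simp add: KF KE lin_add[OF linF] lin_scale[OF linF] lin_scale[OF linE])
  then have "K (F (E x) + of_real (real (Suc k) * (real n - real k)) *s x) = of_nat n *s (F (E x) + of_real (real (Suc k) * (real n - real k)) *s x)"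
    using Suc.prems(1) by (simp add: lin_add[OF linK] lin_scale[OF linK] scale_right_distrib mult.commute)
  then have "F (E x) + of_real (real (Suc k) * (real n - real k)) *s x = 0"
    using Suc.IH z Suc.prems(2) by auto
  moreover have "real (Suc k) * (real n - real k) > 0" using Suc.prems(2) by (intro mult_pos_pos) auto
  ultimately show ?case using casimir_inj Suc.prems(1) by blast
qed simp

lemma E_pow_inj:
  assumes "K x = (- of_nat n) *s x" "k \<le> n" "(E ^^ k) x = 0"
  shows "x = 0"
proof -
  interpret op: sl2 scale Basis F E "\<lambda>x. - K x" by (rule opposite)
  have "- K x = of_nat n *s x" using assms by simp
  then show ?thesis using op.F_pow_inj assms by blast
qed

end

section \<open>The root system of L and its reflections\<close>

section \<open>Roots and coroots\<close>

context simple_lie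
begin

abbreviation "R \<equiv> wts - {0}"

lemma R_ext: "a \<in> R ==> a \<in> ext" by (auto simp: wts_ext)

lemma R_neg: assumes a: "a \<in> R" shows "- a \<in> R"
proof -
  have "dim (gw (- a)) = 1" using neg_root_dim(1) a by blast
  then have "gw (- a) ~= {0}" by auto
  then have "- a \<in> wts" using ext_uminus[OF R_ext[OF a]] by (simp add: wts_def)
  then show ?thesis using a by auto
qed

lemma dim_root: assumes a: "a \<in> R" shows "dim (gw a) = 1"
  using neg_root_dim(1)[of "- a"] R_neg[OF a] by simp

lemma root_span:
  assumes a: "a \<in> R" and x: "x \<in> gw a" "x ~= 0" shows "gw a = span {x}"
proof (rule sym, rule subspace_dim_equal)
  show "span {x} \<subseteq> gw a" using x gw_sub by (intro span_minimal) auto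
  show "dim (gw a) \<le> dim (span {x})" using x dim_root[OF a] by simp
qed (auto simp: gw_sub)

text \<open>Root spaces are lines and \<open>H\<close> is abelian, so generalized eigenvectors are
  eigenvectors.\<close>

lemma true_weight:
  assumes a: "a \<in> wts" and h: "h \<in> H" and x: "x \<in> gw a" shows "br h x = a h *s x"
proof (cases "a = 0")
  case True
  then have "x \<in> H" using x gw0 by simp
  then show ?thesis using H_abelian[OF h] True by simp
next
  case False
  obtain y where y: "y \<in> gw a" "y ~= 0" "!!h. h \<in> H ==> br h y = a h *s y" using gw_eigenvector[OF a] by blast
  have "x \<in> span {y}" using root_span[of a y] a False x y by blast
  then obtain c where "x = c *s y" unfolding span_singleton by (elim rangeE)
  then show ?thesis using y(3)[OF h] by (simp add: br_simps mult.commute)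
qed

lemma gw_root_space: assumes a: "a \<in> ext" shows "root_space H a = gw a"
proof
  show "root_space H a \<subseteq> gw a"
    unfolding weight_space_def gw_def geig_def by (auto intro!: exI[of _ 1])
  show "gw a \<subseteq> root_space H a"
  proof
    fix x assume x: "x \<in> gw a"
    show "x \<in> root_space H a"
    proof (cases "a \<in> wts")
      case True
      then show ?thesis using true_weight x by (auto simp: weight_space_def)
    next
      case False
      then show ?thesis using gw_not_wts[OF a False x] by (auto simp: weight_space_def br_simps)
    qed
  qed
qed

lemma wts_dual: "a \<in> wts ==> a \<in> dual scale H"
  using wts_linear subspace_0[OF H_sub] wts_ext unfolding dual_def ext_def by auto

lemma dual_ext: "a \<in> dual scale H ==> a \<in> ext"
  unfolding dual_def ext_def by auto

lemma roots_eq: "roots H = R"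
proof -
  have "a \<in> roots H \<longleftrightarrow> a \<in> R" for a
  proof
    assume "a \<in> roots H"
    then have "a \<in> dual scale H" "a ~= 0" "root_space H a ~= {0}" unfolding roots_def by auto
    then show "a \<in> R" using dual_ext gw_root_space unfolding wts_def by auto
  next
    assume a: "a \<in> R"
    then have "gw a ~= {0}" unfolding wts_def by blast
    then show "a \<in> roots H" using a wts_dual gw_root_space[OF R_ext[OF a]] unfolding roots_def by auto
  qed
  then show ?thesis by blast
qed

text \<open>The vector usually written \<open>t_a\<close>, which represents \<open>a\<close> under
  the Killing form. That it is a bracket of root vectors is recorded because \<open>coroot\<close>
  is described through such brackets.\<close>

definition tt :: "('l => complex) => 'l" where
  "tt a = (SOME t. t \<in> H \<and> (\<forall>h\<in>H. kil t h = a h) \<and> (\<exists>x\<in>gw a. \<exists>y\<in>gw (- a). t = br x y))"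

lemma tt:
  assumes a: "a \<in> R"
  shows "tt a \<in> H" "h \<in> H ==> kil (tt a) h = a h" "\<exists>x\<in>gw a. \<exists>y\<in>gw (- a). tt a = br x y" "a (tt a) ~= 0"
proof -
  have aw: "a \<in> wts" "a ~= 0" using a by auto
  obtain x y where xy: "x \<in> gw a" "x ~= 0" "y \<in> gw (- a)" "y ~= 0" "br x y \<in> H"
    "!!h. h \<in> H ==> br h x = a h *s x" "!!h. h \<in> H ==> kil (br x y) h = a h"
    "a ~= 0 ==> a (br x y) ~= 0" by (rule root_vectors[OF aw(1)]) (rule that; blast)
  then have "\<exists>t. t \<in> H \<and> (\<forall>h\<in>H. kil t h = a h) \<and> (\<exists>x\<in>gw a. \<exists>y\<in>gw (- a). t = br x y)" by blast
  from someI_ex[OF this] have t: "tt a \<in> H \<and> (\<forall>h\<in>H. kil (tt a) h = a h) \<and> (\<exists>x\<in>gw a. \<exists>y\<in>gw (- a). tt a = br x y)"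
    unfolding tt_def .
  then show "tt a \<in> H" "h \<in> H ==> kil (tt a) h = a h" "\<exists>x\<in>gw a. \<exists>y\<in>gw (- a). tt a = br x y" by blast+
  have "tt a - br x y = 0"
    by (rule kil_nondeg_H) (use t xy in "auto simp: kil_diff intro: subspace_diff[OF H_sub]")
  then show "a (tt a) ~= 0" using xy(8) aw(2) by simp
qed

lemma tt_unique:
  assumes a: "a \<in> R" and t: "t \<in> H" "!!h. h \<in> H ==> kil t h = a h" shows "t = tt a"
proof -
  have "t - tt a = 0"
    by (rule kil_nondeg_H) (use t tt[OF a] in "auto simp: kil_diff intro: subspace_diff[OF H_sub]")
  then show ?thesis by simp
qed

lemma br_root_neg:
  assumes a: "a \<in> R" and x: "x \<in> gw a" and y: "y \<in> gw (- a)" shows "br x y = kil x y *s tt a"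
proof -
  have "br x y - kil x y *s tt a = 0"
  proof (rule kil_nondeg_H)
    show "br x y - kil x y *s tt a \<in> H"
      using gw_br[OF x y] gw0 tt(1)[OF a] subspace_diff[OF H_sub] subspace_scale[OF H_sub] by simp
    fix h assume h: "h \<in> H"
    have "kil (br x y) h = kil h (br x y)" by (rule kil_sym)
    also have "\<dots> = kil (br h x) y" by (rule kil_inv[symmetric])
    also have "\<dots> = a h * kil x y" using true_weight[OF _ h x] a by (simp add: kil_scale)
    finally show "kil (br x y - kil x y *s tt a) h = 0"
      using tt(2)[OF a h] by (simp add: kil_diff kil_scale)
  qed
  then show ?thesis by simp
qed

abbreviation "co \<equiv> coroot H"

text \<open>By \<open>br_root_neg\<close> all brackets of opposite root vectors are multiples of
  \<open>tt a\<close>, so the value 2 at \<open>a\<close> singles out one element and the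
  description in \<open>coroot\<close> is met uniquely.\<close>

lemma co_eq: assumes a: "a \<in> R" shows "co a = (2 / a (tt a)) *s tt a"
proof -
  let ?S = "span {br x y |x y. x \<in> root_space H a \<and> y \<in> root_space H (- a)}"
  have rs: "root_space H a = gw a" "root_space H (- a) = gw (- a)"
    by (rule gw_root_space R_ext[OF a] ext_uminus[OF R_ext[OF a]])+
  have 1: "?S \<subseteq> span {tt a}"
  proof (rule span_minimal)
    show "{br x y |x y. x \<in> root_space H a \<and> y \<in> root_space H (- a)} \<subseteq> span {tt a}"
    proof
      fix z assume "z \<in> {br x y |x y. x \<in> root_space H a \<and> y \<in> root_space H (- a)}"
      then obtain x y where z: "z = br x y" "x \<in> gw a" "y \<in> gw (- a)" unfolding rs by blast
      show "z \<in> span {tt a}" unfolding z(1) br_root_neg[OF a z(2,3)] by (intro span_scale span_base) simp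
    qed
  qed simp
  obtain x y where xy: "x \<in> gw a" "y \<in> gw (- a)" "tt a = br x y" using tt(3)[OF a] by blast
  then have "tt a \<in> ?S" unfolding rs by (intro span_base) blast
  then have 2: "(2 / a (tt a)) *s tt a \<in> ?S" by (rule span_scale)
  have al: "a (c *s tt a) = c * a (tt a)" for c using wts_linear(2)[of a "tt a"] a tt(1)[OF a] by blast
  show ?thesis unfolding coroot_def
  proof (rule the_equality)
    show "(2 / a (tt a)) *s tt a \<in> ?S \<and> a ((2 / a (tt a)) *s tt a) = 2" using 2 al tt(4)[OF a] by simp
    fix t assume t: "t \<in> ?S \<and> a t = 2"
    then have "t \<in> span {tt a}" using 1 by blast
    then obtain c where c: "t = c *s tt a" unfolding span_singleton by (elim rangeE)
    then have "c * a (tt a) = 2" using t al by simp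
    then show "t = (2 / a (tt a)) *s tt a" using c tt(4)[OF a] by (simp add: field_simps)
  qed
qed

lemma co_H: "a \<in> R ==> co a \<in> H"
  using co_eq tt(1) subspace_scale[OF H_sub] by simp

lemma wt_add: "a \<in> wts ==> h \<in> H ==> k \<in> H ==> a (h + k) = a h + a k"
  and wt_scale: "a \<in> wts ==> h \<in> H ==> a (c *s h) = c * a h"
  using wts_linear by blast+

lemma co_self: "a \<in> R ==> a (co a) = 2"
  using co_eq[of a] tt[of a] wt_scale[of a] by simp

lemma wt_co: assumes "b \<in> R" "a \<in> R" shows "b (co a) = 2 * kil (tt a) (tt b) / kil (tt a) (tt a)"
proof -
  have "b (co a) = 2 / a (tt a) * b (tt a)" using co_eq[OF assms(2)] wt_scale[of b] assms tt(1) by simp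
  also have "b (tt a) = kil (tt b) (tt a)" using tt(2)[OF assms(1)] tt(1)[OF assms(2)] by simp
  also have "a (tt a) = kil (tt a) (tt a)" using tt(2)[OF assms(2)] tt(1)[OF assms(2)] by simp
  finally show ?thesis by (simp add: kil_sym)
qed

lemma kil_tt_nz: "a \<in> R ==> kil (tt a) (tt a) ~= 0"
  using tt by metis

lemma tt_neg: assumes a: "a \<in> R" shows "tt (- a) = - tt a"
  by (rule tt_unique[OF R_neg[OF a], symmetric])
    (use tt[OF a] in "auto simp: kil_minus intro: subspace_neg[OF H_sub]")

lemma co_neg: assumes a: "a \<in> R" shows "co (- a) = - co a"
proof -
  have "a (- tt a) = - a (tt a)" using wt_scale[of a "tt a" "-1"] a tt(1) by simp
  then show ?thesis using co_eq[OF R_neg[OF a]] co_eq[OF a] tt_neg[OF a] by simp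
qed

definition triple :: "('l => complex) => 'l => 'l => bool" where
  "triple a e f \<longleftrightarrow> e \<in> gw a \<and> f \<in> gw (- a) \<and> br e f = co a"

lemma triple_exists: assumes a: "a \<in> R" shows "\<exists>e f. triple a e f"
proof -
  obtain x y where xy: "x \<in> gw a" "y \<in> gw (- a)" "tt a = br x y" using tt(3)[OF a] by blast
  then have "triple a x ((2 / a (tt a)) *s y)"
    using co_eq[OF a] subspace_scale[OF gw_sub] unfolding triple_def by (simp add: br_simps)
  then show ?thesis by blast
qed

lemma triple_opposite: "a \<in> R ==> triple a e f ==> triple (- a) f e"
  unfolding triple_def using co_neg[of a] br_anti[of f e] by simp

lemma triple_nz: "a \<in> R ==> triple a e f ==> e ~= 0"
  unfolding triple_def using co_self[of a] wts_0[of a] by (auto simp: br_simps)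

end

section \<open>Weights of representations\<close>

locale rep = simple_lie scale br Basis H + lie_representation scale br scaleV act + V: fd_complex scaleV BasisV
  for scale :: "complex => 'l::ab_group_add => 'l" (infixr \<open>*s\<close> 75) and br :: "'l => 'l => 'l" and Basis H
    and scaleV :: "complex => 'v::ab_group_add => 'v" (infixr \<open>*v\<close> 75) and act :: "'l => 'v => 'v" and BasisV
begin

abbreviation "M \<equiv> weight_space scaleV act H"

lemma act_linl: "act (x + y) v = act x v + act y v" "act (c *s x) v = c *v act x v" "act (x - y) v = act x v - act y v"
    "act 0 v = 0" "act (- x) v = - act x v"
proof -
  interpret l: Vector_Spaces.linear scale scaleV "\<lambda>x. act x v" by (rule act_linear_left)
  show "act (x + y) v = act x v + act y v" "act (c *s x) v = c *v act x v" "act (x - y) v = act x v - act y v"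
    "act 0 v = 0" "act (- x) v = - act x v" by (rule l.add l.scale l.diff l.zero l.neg)+
qed

lemmas act_simps = V.lin_add[OF act_linear] V.lin_diff[OF act_linear] V.lin_scale[OF act_linear] V.lin_zero[OF act_linear] act_linl

lemma M_D: "v \<in> M m ==> h \<in> H ==> act h v = m h *v v"
  by (auto simp: weight_space_def)

lemma M_sub: "V.subspace (M m)"
  by (rule V.subspaceI) (auto simp: weight_space_def act_simps V.scale_right_distrib mult.commute)

lemma act_swap: "act x (act y v) = act y (act x v) + act (br x y) v"
  by (simp add: act_br)

lemma act_gw: assumes a: "a \<in> wts" and x: "x \<in> gw a" and v: "v \<in> M m" shows "act x v \<in> M (m + a)"
  unfolding weight_space_def
proof (intro CollectI ballI)
  fix h assume h: "h \<in> H"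
  have "act h (act x v) = act x (m h *v v) + act (a h *s x) v"
    unfolding act_swap[of h x] M_D[OF v h] true_weight[OF a h x] ..
  also have "\<dots> = (m + a) h *v act x v" by (simp add: act_simps V.scale_left_distrib)
  finally show "act h (act x v) = (m + a) h *v act x v" .
qed

lemma triple_sl2:
  assumes a: "a \<in> R" and t: "triple a e f"
  shows "sl2 scaleV BasisV (act e) (act f) (act (co a))"
proof (intro sl2.intro sl2_axioms.intro V.fd_complex_axioms act_linear)
  have e: "e \<in> gw a" "f \<in> gw (- a)" "br e f = co a" using t by (auto simp: triple_def)
  have "br (co a) e = 2 *s e" "br (co a) f = (-2) *s f"
    using true_weight[OF _ co_H[OF a] e(1)] true_weight[OF _ co_H[OF a] e(2)] a R_neg[OF a] co_self[OF a] by auto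
  then show "act (co a) (act e v) = act e (act (co a) v) + 2 *v act e v"
    "act (co a) (act f v) = act f (act (co a) v) - 2 *v act f v" for v
    using act_swap[of "co a" e v] act_swap[of "co a" f v] by (simp_all add: act_simps)
  show "act e (act f v) = act f (act e v) + act (co a) v" for v using act_swap[of e f v] e by simp
qed

lemma weight_int:
  assumes a: "a \<in> R" and v: "v \<in> M m" "v ~= 0" shows "\<exists>k::int. m (co a) = of_int k"
proof -
  obtain e f where t: "triple a e f" using triple_exists[OF a] by blast
  interpret sl2 scaleV BasisV "act e" "act f" "act (co a)" by (rule triple_sl2[OF a t])
  show ?thesis by (rule weight_int[OF M_D[OF v(1) co_H[OF a]] v(2)])
qed

lemma act_pow: "a \<in> wts ==> x \<in> gw a ==> v \<in> M m ==> (act x ^^ n) v \<in> M (m + of_nat n * a)"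
proof (induction n)
  case (Suc n)
  then have "act x ((act x ^^ n) v) \<in> M (m + of_nat n * a + a)" by (intro act_gw)
  moreover have "m + of_nat n * a + a = m + of_nat (Suc n) * a" by (simp add: algebra_simps)
  ultimately show ?case by (simp only: funpow.simps comp_apply)
qed simp

text \<open>The power of the lowering operator, or of the raising operator if \<open>k\<close> is
  negative, that carries a weight to its reflection is injective on the weight space.\<close>

lemma dim_reflect_le:
  assumes a: "a \<in> R" and k: "m (co a) = of_int k" shows "V.dim (M m) \<le> V.dim (M (m - of_int k * a))"
proof -
  obtain e f where t: "triple a e f" using triple_exists[OF a] by blast
  interpret sl2 scaleV BasisV "act e" "act f" "act (co a)" by (rule triple_sl2[OF a t])
  have e: "e \<in> gw a" "f \<in> gw (- a)" using t by (auto simp: triple_def)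
  show ?thesis
  proof (cases "k \<ge> 0")
    case True
    have eq: "m + of_nat (nat k) * (- a) = m - of_int k * a" using True by (simp add: of_nat_nat)
    show ?thesis
    proof (rule V.inj_dim_le[OF V.lin_pow[OF act_linear, of "nat k" f] M_sub])
      fix v assume v: "v \<in> M m"
      show "(act f ^^ nat k) v \<in> M (m - of_int k * a)" using act_pow[OF _ e(2) v, of "nat k"] R_neg[OF a] unfolding eq by blast
      assume "(act f ^^ nat k) v = 0"
      then show "v = 0" using F_pow_inj[of v "nat k" "nat k"] M_D[OF v co_H[OF a]] k True by (simp add: of_nat_nat)
    qed
  next
    case False
    have eq: "m + of_nat (nat (- k)) * a = m - of_int k * a" using False by (simp add: of_nat_nat)
    show ?thesis
    proof (rule V.inj_dim_le[OF V.lin_pow[OF act_linear, of "nat (- k)" e] M_sub])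
      fix v assume v: "v \<in> M m"
      show "(act e ^^ nat (- k)) v \<in> M (m - of_int k * a)" using act_pow[OF _ e(1) v, of "nat (- k)"] a unfolding eq by blast
      assume "(act e ^^ nat (- k)) v = 0"
      then show "v = 0" using E_pow_inj[of v "nat (- k)" "nat (- k)"] M_D[OF v co_H[OF a]] k False by (simp add: of_nat_nat)
    qed
  qed
qed

lemma up_inj:
  assumes a: "a \<in> R" and e: "e \<in> gw a" "e ~= 0" and v: "v \<in> M m" "act e v = 0" and k: "m (co a) = of_int k" "k < 0"
  shows "v = 0"
proof -
  obtain e' f where t: "triple a e' f" using triple_exists[OF a] by blast
  interpret sl2 scaleV BasisV "act e'" "act f" "act (co a)" by (rule triple_sl2[OF a t])
  have "e' \<in> span {e}" using root_span[OF a e] t by (auto simp: triple_def)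
  then obtain c where "e' = c *s e" unfolding span_singleton by (elim rangeE)
  then have "act e' v = 0" using v(2) by (simp add: act_simps)
  then show ?thesis using E_pow_inj[of v "nat (- k)" 1] M_D[OF v(1) co_H[OF a]] k by (simp add: of_nat_nat)
qed

end

lemma sum_fun_apply: "(\<Sum>a\<in>A. f a) x = (\<Sum>a\<in>A. f a x)" for f :: "'i => 'a => 'b::comm_monoid_add"
  by (induction A rule: infinite_finite_induct) auto

context fd_complex
begin

lemma indep_span_disjoint:
  assumes ind: "indep_family I S" and sub: "!!i. subspace (S i)" and J: "J \<subseteq> I" "i \<in> I" "i \<notin> J"
    and x: "x \<in> S i" "x \<in> span (\<Union>j\<in>J. S j)"
  shows "x = 0"
proof -
  let ?J = "{j \<in> J. S j ~= {0}}"
  have fin: "finite ?J"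
    by (rule indep_family_card[of _ S])
      (use sub indep_family_cong_subset[OF ind, of ?J S] J in auto)
  have "span (\<Union>j\<in>J. S j) \<subseteq> span (insert 0 (\<Union>j\<in>?J. S j))"
    by (rule span_mono) blast
  then have "x \<in> span (\<Union>j\<in>?J. S j)" using x(2) by auto
  then obtain y where y: "\<forall>j\<in>?J. y j \<in> S j" "x = (\<Sum>j\<in>?J. y j)"
    using span_UN_sum[of ?J S x, OF fin sub] by blast
  have iJ: "i \<notin> ?J" using J by blast
  have "(\<lambda>j. if j = i then x else - y j) i = 0"
  proof (rule indep_familyD[OF ind, of "insert i ?J" "\<lambda>j. if j = i then x else - y j" i])
    have "(\<Sum>j\<in>insert i ?J. if j = i then x else - y j) = x + (\<Sum>j\<in>?J. if j = i then x else - y j)"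
      using fin iJ by simp
    also have "(\<Sum>j\<in>?J. if j = i then x else - y j) = (\<Sum>j\<in>?J. - y j)" using iJ by (intro sum.cong) auto
    finally show "(\<Sum>j\<in>insert i ?J. if j = i then x else - y j) = 0" using y by (simp add: sum_negf)
  qed (use fin J x y subspace_neg[OF sub] in auto)
  then show ?thesis by simp
qed

end

context simple_lie
begin

text \<open>Its weights are the roots and 0, so the results on representations turn into
  integrality, reflections and strings of roots.\<close>

lemma adjoint: "rep scale br Basis H scale br Basis"
proof (intro rep.intro simple_lie_axioms lie_representation.intro lie_representation_axioms.intro
    lie_algebra_axioms fd_complex_axioms vector_space_axioms)
  show "Vector_Spaces.linear scale scale (br x)" "Vector_Spaces.linear scale scale (\<lambda>x. br x v)" for x v
    by (rule br_lin br_lin_left)+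
  show "br (br x y) v = br x (br y v) - br y (br x v)" for x y v by (rule jac)
qed

lemma root_int: assumes "a \<in> R" "b \<in> wts" shows "\<exists>k::int. b (co a) = of_int k"
proof -
  interpret adj: rep scale br Basis H scale br Basis by (rule adjoint)
  obtain x where x: "x \<in> gw b" "x ~= 0" using assms(2) gw_sub subspace_0 unfolding wts_def by blast
  have "x \<in> root_space H b" using x gw_root_space wts_ext assms by simp
  then show ?thesis using adj.weight_int[OF assms(1) _ x(2)] by blast
qed

lemma root_reflect: assumes a: "a \<in> R" and b: "b \<in> R" and k: "b (co a) = of_int k" shows "b - of_int k * a \<in> R"
proof -
  interpret adj: rep scale br Basis H scale br Basis by (rule adjoint)
  let ?c = "b - of_int k * a"
  have c: "?c \<in> ext" using R_ext[OF a] R_ext[OF b] by (auto simp: ext_def of_int_fun)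
  have "dim (root_space H b) \<le> dim (root_space H ?c)" by (rule adj.dim_reflect_le[of a b k, OF a k])
  then have "1 \<le> dim (gw ?c)" unfolding gw_root_space[OF c] gw_root_space[OF R_ext[OF b]] dim_root[OF b] .
  then have "gw ?c ~= {0}" by auto
  then have w: "?c \<in> wts" using c unfolding wts_def by blast
  have "?c ~= 0"
  proof
    assume "?c = 0"
    then have e: "b = of_int k * a" by simp
    have "b (co a) = of_int k * 2" using co_self[OF a] by (subst e) (simp add: of_int_fun)
    then have "complex_of_int k = of_int k * 2" using k by simp
    then have "k = 0" by simp
    then show False using e b by simp
  qed
  then show ?thesis using w by blast
qed

text \<open>In the adjoint representation the raising operator for \<open>a\<close> is injective on
  a weight space whose weight is negative at the coroot of \<open>a\<close>.\<close>

lemma root_string: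
  assumes a: "a \<in> R" and b: "b \<in> R" and k: "b (co a) = of_int k" "k < 0" and ne: "b ~= - a"
  shows "a + b \<in> R" "x \<in> gw a ==> x ~= 0 ==> y \<in> gw b ==> y ~= 0 ==> br x y ~= 0"
proof -
  interpret adj: rep scale br Basis H scale br Basis by (rule adjoint)
  have nz: "br x y ~= 0" if "x \<in> gw a" "x ~= 0" "y \<in> gw b" "y ~= 0" for x y
    using adj.up_inj[OF a that(1,2), of y b k] that(3,4) k gw_root_space[OF R_ext[OF b]] by blast
  then show "x \<in> gw a ==> x ~= 0 ==> y \<in> gw b ==> y ~= 0 ==> br x y ~= 0" by blast
  obtain x y where "x \<in> gw a" "x ~= 0" "y \<in> gw b" "y ~= 0"
    using a b gw_sub subspace_0 unfolding wts_def by blast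
  then have "gw (a + b) ~= {0}" using nz gw_br by blast
  then have "a + b \<in> wts" using ext_add R_ext a b unfolding wts_def by blast
  moreover have "a + b ~= 0" using ne by (simp add: add.commute eq_neg_iff_add_eq_0)
  ultimately show "a + b \<in> R" by blast
qed

text \<open>\<open>root_string\<close> is applied to \<open>- b\<close> and \<open>a\<close>. For
  \<open>z\<close> of weight \<open>- b\<close>, the vector \<open>br z x\<close> of weight
  \<open>a - b\<close> is non-zero, so it pairs non-trivially with \<open>y\<close>; by invariance
  of the Killing form \<open>br x y\<close> cannot vanish.\<close>

lemma root_subtract:
  assumes a: "a \<in> R" and b: "b \<in> R" and k: "a (co b) = of_int k" "k > 0" and ne: "a ~= b"
  shows "b - a \<in> R" "x \<in> gw a ==> x ~= 0 ==> y \<in> gw (b - a) ==> y ~= 0 ==> br x y ~= 0"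
proof -
  have "a (- co b) = - a (co b)" using wt_scale[of a "co b" "-1"] a co_H[OF b] by simp
  then have k': "a (co (- b)) = of_int (- k)" using k co_neg[OF b] by simp
  have "a ~= - (- b)" using ne by simp
  note st = root_string[OF R_neg[OF b] a k' _ this]
  have "- b + a \<in> R" using st(1) k(2) by simp
  from R_neg[OF this] show ba: "b - a \<in> R" by simp
  assume x: "x \<in> gw a" "x ~= 0" and y: "y \<in> gw (b - a)" "y ~= 0"
  obtain z where z: "z \<in> gw (- b)" "z ~= 0" using R_neg[OF b] gw_sub subspace_0 unfolding wts_def by blast
  have u: "br z x \<in> gw (a - b)" using gw_br[OF z(1) x(1)] by simp
  have unz: "br z x ~= 0" using st(2)[of z x] z x k(2) by simp
  have ext: "a - b \<in> ext" using R_neg[OF ba] R_ext by fastforce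
  obtain y' where y': "y' \<in> gw (b - a)" "kil (br z x) y' ~= 0"
    using kil_nondeg_gw[OF u ext] unz by auto
  have "y' \<in> span {y}" using root_span[OF ba y] y' by simp
  then obtain c where "y' = c *s y" unfolding span_singleton by (elim rangeE)
  then have "kil (br z x) y ~= 0" using y' by (auto simp: kil_scale')
  then show "br x y ~= 0" by (auto simp: kil_inv kil_sym[of z 0] kil_0)
qed

lemma co_reflect:
  assumes a: "a \<in> R" and b: "b \<in> R" and k: "b (co a) = of_int k"
  shows "co (b - of_int k * a) = co b - a (co b) *s co a"
proof -
  let ?c = "b - of_int k * a"
  have c: "?c \<in> R" by (rule root_reflect[OF a b k])
  define t where "t = tt b - of_int k *s tt a"
  have tH: "t \<in> H" unfolding t_def using tt(1) a b subspace_diff[OF H_sub] subspace_scale[OF H_sub] by simp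
  have tc: "tt ?c = t"
  proof (rule tt_unique[OF c tH, symmetric])
    fix h assume h: "h \<in> H"
    show "kil t h = ?c h" using tt(2)[OF a h] tt(2)[OF b h] by (simp add: t_def kil_diff kil_scale of_int_fun)
  qed
  let ?A = "kil (tt a) (tt a)" and ?B = "kil (tt b) (tt b)" and ?C = "kil (tt a) (tt b)"
  have A: "?A ~= 0" and B: "?B ~= 0" using kil_tt_nz a b by auto
  have kC: "of_int k = 2 * ?C / ?A" using wt_co[OF b a] k by simp
  have "kil t t = ?B - 2 * of_int k * ?C + of_int k * of_int k * ?A"
  proof -
    have l: "kil t x = kil (tt b) x - of_int k * kil (tt a) x" for x
      unfolding t_def kil_diff kil_scale ..
    have r: "kil x t = kil x (tt b) - of_int k * kil x (tt a)" for x
      using l[of x] unfolding kil_sym[of t x] kil_sym[of _ x] .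
    show ?thesis unfolding l[of t] r[of "tt b"] r[of "tt a"] kil_sym[of "tt b" "tt a"] by (simp add: algebra_simps)
  qed
  also have "\<dots> = ?B" using A kC by (simp add: field_simps)
  finally have tB: "kil t t = ?B" .
  have cos: "co d = (2 / kil (tt d) (tt d)) *s tt d" if "d \<in> R" for d
    using co_eq[OF that] tt[OF that] by simp
  have "co ?c = (2 / ?B) *s (tt b - of_int k *s tt a)" unfolding cos[OF c] tc tB by (simp only: t_def)
  also have "\<dots> = co b - (2 / ?B * of_int k) *s tt a" unfolding cos[OF b] by (simp only: scale_right_diff_distrib scale_scale)
  also have "2 / ?B * of_int k = a (co b) * (2 / ?A)"
    unfolding wt_co[OF a b] kC kil_sym[of "tt b" "tt a"] using A B by (simp add: field_simps)
  also have "(a (co b) * (2 / ?A)) *s tt a = a (co b) *s co a" unfolding cos[OF a] by simp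
  finally show ?thesis .
qed

lemma H_co: "H = span (co ` R)"
proof
  show "span (co ` R) \<subseteq> H" using co_H by (intro span_minimal H_sub) blast
  have "{br x y |x y a. a \<in> wts \<and> x \<in> gw a \<and> y \<in> gw (- a)} \<subseteq> span (co ` R)"
  proof
    fix z assume "z \<in> {br x y |x y a. a \<in> wts \<and> x \<in> gw a \<and> y \<in> gw (- a)}"
    then obtain x y a where z: "z = br x y" "a \<in> wts" "x \<in> gw a" "y \<in> gw (- a)" by blast
    show "z \<in> span (co ` R)"
    proof (cases "a = 0")
      case True
      then have "z = 0" using z gw0 H_abelian by simp
      then show ?thesis by (simp add: span_zero)
    next
      case False
      then have a: "a \<in> R" using z by blast
      have "tt a = (a (tt a) / 2) *s co a" using co_eq[OF a] tt(4)[OF a] by simp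
      from arg_cong[OF this, of "\<lambda>t. kil x y *s t"]
      have "z = (kil x y * (a (tt a) / 2)) *s co a" using br_root_neg[OF a z(3,4)] z(1) by (simp only: scale_scale)
      then show ?thesis using a by (auto intro: span_scale span_base)
    qed
  qed
  from span_minimal[OF this subspace_span] show "H \<subseteq> span (co ` R)" using H_span by blast
qed

end

section \<open>Bases and generation by simple root vectors\<close>

locale based = simple_lie scale br Basis H
  for scale :: "complex => 'l::ab_group_add => 'l" (infixr \<open>*s\<close> 75) and br :: "'l => 'l => 'l" and Basis H +
  fixes D :: "('l => complex) set"
  assumes base: "root_base H D"
begin

lemma base_finite: "finite D" and base_R: "D \<subseteq> R"
  and base_indep: "(!!h. h \<in> H ==> (\<Sum>a\<in>D. c a * a h) = 0) ==> a \<in> D ==> c a = 0"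
  using base unfolding root_base_def roots_eq by blast+

abbreviation cmb :: "(('l => complex) => int) => 'l => complex" where
  "cmb c \<equiv> \<Sum>a\<in>D. of_int (c a) * a"

lemma cmb_apply: "cmb c h = (\<Sum>a\<in>D. of_int (c a) * a h)"
  by (simp add: sum_fun_apply of_int_fun)

lemma cmb_unique:
  assumes "cmb c = cmb d" "a \<in> D" shows "c a = d a"
proof -
  have "of_int (c a) - of_int (d a) = (0 :: complex)"
  proof (rule base_indep[of "\<lambda>a. of_int (c a) - of_int (d a)", OF _ assms(2)])
    fix h
    have "(\<Sum>a\<in>D. of_int (c a) * a h) = (\<Sum>a\<in>D. of_int (d a) * a h)"
      using fun_cong[OF assms(1), of h] unfolding cmb_apply .
    then show "(\<Sum>a\<in>D. (of_int (c a) - of_int (d a)) * a h) = 0"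
      by (simp add: left_diff_distrib sum_subtractf)
  qed
  then show ?thesis by simp
qed

lemma root_cmb:
  assumes "b \<in> R" shows "\<exists>c. b = cmb c \<and> ((\<forall>a\<in>D. c a \<ge> 0) \<or> (\<forall>a\<in>D. c a \<le> 0))"
proof -
  obtain k :: "('l => complex) => nat" where
    "b = (\<Sum>a\<in>D. of_nat (k a) * a) \<or> b = - (\<Sum>a\<in>D. of_nat (k a) * a)"
    using base assms unfolding root_base_def roots_eq by blast
  then consider "b = cmb (\<lambda>a. int (k a))" | "b = cmb (\<lambda>a. - int (k a))" by (auto simp: sum_negf)
  then show ?thesis
  proof cases
    case 1
    then show ?thesis by (intro exI[of _ "\<lambda>a. int (k a)"]) simp
  next
    case 2
    then show ?thesis by (intro exI[of _ "\<lambda>a. - int (k a)"]) simp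
  qed
qed

lemma cmb_sign: "cmb c \<in> R ==> (\<forall>a\<in>D. c a \<ge> 0) \<or> (\<forall>a\<in>D. c a \<le> 0)"
proof -
  assume "cmb c \<in> R"
  from root_cmb[OF this] obtain d where d: "cmb c = cmb d" "(\<forall>a\<in>D. d a \<ge> 0) \<or> (\<forall>a\<in>D. d a \<le> 0)" by blast
  have "c a = d a" if "a \<in> D" for a by (rule cmb_unique[OF d(1) that])
  then show ?thesis using d(2) by simp
qed

lemma cmb_single: "r \<in> D ==> cmb (\<lambda>b. if b = r then 1 else 0) = r"
proof -
  assume a: "r \<in> D"
  have "cmb (\<lambda>b. if b = r then 1 else 0) = (\<Sum>b\<in>D. if b = r then b else 0)"
    by (intro sum.cong) auto
  then show ?thesis using a base_finite by simp
qed

lemma cmb_add: "cmb c + cmb d = cmb (\<lambda>a. c a + d a)" and cmb_diff: "cmb c - cmb d = cmb (\<lambda>a. c a - d a)"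
  and cmb_neg: "- cmb c = cmb (\<lambda>a. - c a)"
  by (simp_all add: distrib_right left_diff_distrib sum.distrib sum_subtractf sum_negf)

lemma positive_eq: "positive_roots H D = {b \<in> R. \<exists>c. b = cmb c \<and> (\<forall>a\<in>D. c a \<ge> 0)}"
proof -
  have "(\<exists>k :: ('l => complex) => nat. b = (\<Sum>a\<in>D. of_nat (k a) * a)) \<longleftrightarrow> (\<exists>c. b = cmb c \<and> (\<forall>a\<in>D. c a \<ge> 0))" for b
  proof
    assume "\<exists>k :: ('l => complex) => nat. b = (\<Sum>a\<in>D. of_nat (k a) * a)"
    then obtain k :: "('l => complex) => nat" where "b = (\<Sum>a\<in>D. of_nat (k a) * a)" by blast
    then show "\<exists>c. b = cmb c \<and> (\<forall>a\<in>D. c a \<ge> 0)" by (intro exI[of _ "\<lambda>a. int (k a)"]) simp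
  next
    assume "\<exists>c. b = cmb c \<and> (\<forall>a\<in>D. c a \<ge> 0)"
    then obtain c where c: "b = cmb c" "\<forall>a\<in>D. c a \<ge> 0" by blast
    then have "b = (\<Sum>a\<in>D. of_nat (nat (c a)) * a)" by (simp add: of_nat_nat)
    then show "\<exists>k :: ('l => complex) => nat. b = (\<Sum>a\<in>D. of_nat (k a) * a)" by (rule exI[of _ "\<lambda>a. nat (c a)"])
  qed
  then show ?thesis unfolding positive_roots_def roots_eq by blast
qed

text \<open>Roots are integral on coroots, so a real relation there is a complex one, and it extends
  to the span of the coroots, which is \<open>H\<close>.\<close>

lemma H_indep_real:
  fixes x :: "('l => complex) => real"
  assumes z: "!!u. u \<in> R ==> (\<Sum>r\<in>D. x r * Re (r (co u))) = 0" and a: "r \<in> D"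
  shows "x r = 0"
proof -
  let ?K = "{h \<in> H. (\<Sum>r\<in>D. of_real (x r) * r h) = 0}"
  have D: "r \<in> wts" if "r \<in> D" for r using that base_R by blast
  have sub: "subspace ?K"
  proof (rule subspaceI)
    show "0 \<in> ?K" using subspace_0[OF H_sub] by (auto simp: wts_0[OF D] intro!: sum.neutral)
    fix h k assume "h \<in> ?K" "k \<in> ?K"
    then show "h + k \<in> ?K" using subspace_add[OF H_sub]
      by (simp add: wt_add[OF D] distrib_left sum.distrib)
  next
    fix c h assume "h \<in> ?K"
    then have h: "h \<in> H" "(\<Sum>r\<in>D. of_real (x r) * r h) = 0" by blast+
    have "(\<Sum>r\<in>D. of_real (x r) * r (c *s h)) = c * (\<Sum>r\<in>D. of_real (x r) * r h)"
      by (simp add: wt_scale[OF D h(1)] sum_distrib_left mult.left_commute)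
    then have "(\<Sum>r\<in>D. of_real (x r) * r (c *s h)) = 0" unfolding h(2) by simp
    then show "c *s h \<in> ?K" using subspace_scale[OF H_sub h(1)] by blast
  qed
  have "co ` R \<subseteq> ?K"
  proof
    fix h assume "h \<in> co ` R"
    then obtain u where g: "u \<in> R" "h = co u" by (elim imageE)
    have re: "r h = of_real (Re (r h))" if al: "r \<in> D" for r
    proof -
      obtain k :: int where "r (co u) = of_int k" using root_int[OF g(1) D[OF al]] by blast
      then show ?thesis using g by simp
    qed
    have "(\<Sum>r\<in>D. of_real (x r) * r h) = (\<Sum>r\<in>D. of_real (x r * Re (r h)))"
      using re by (intro sum.cong refl) simp
    also have "\<dots> = of_real (\<Sum>r\<in>D. x r * Re (r h))" by simp
    finally show "h \<in> ?K" using z[OF g(1)] g co_H by simp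
  qed
  from span_minimal[OF this sub] have HK: "H \<subseteq> ?K" unfolding H_co[symmetric] .
  have "complex_of_real (x r) = 0"
  proof (rule base_indep[of "\<lambda>r. of_real (x r)", OF _ a])
    fix h assume "h \<in> H"
    then have "h \<in> ?K" using HK by (rule rev_subsetD)
    then show "(\<Sum>r\<in>D. of_real (x r) * r h) = 0" by blast
  qed
  then show ?thesis by simp
qed

text \<open>Evaluated at its own coroot, \<open>cmb c\<close> gives 2, so some term
  \<open>c r * r (co (cmb c))\<close> is positive.\<close>

lemma positive_descent:
  assumes c: "cmb c \<in> R" "!!r. r \<in> D ==> c r \<ge> 0" "cmb c \<notin> D"
  obtains r k where "r \<in> D" "c r \<ge> 1" "r (co (cmb c)) = of_int k" "k > 0" "r ~= cmb c"
proof -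
  let ?b = "cmb c"
  have "\<forall>r\<in>D. \<exists>k::int. r (co ?b) = of_int k" using root_int[OF c(1)] base_R by blast
  then obtain k :: "('l => complex) => int" where k: "!!r. r \<in> D ==> r (co ?b) = of_int (k r)" by metis
  have "(2 :: complex) = of_int (\<Sum>r\<in>D. c r * k r)"
    using co_self[OF c(1)] cmb_apply[of c "co ?b"] k by simp
  then have "(\<Sum>r\<in>D. c r * k r) = 2" by (metis of_int_eq_iff of_int_numeral)
  then have "\<exists>r\<in>D. c r * k r > 0" using sum_nonpos[of D "\<lambda>r. c r * k r"] by fastforce
  then obtain r where a: "r \<in> D" "c r * k r > 0" by blast
  then have "c r \<ge> 1" "k r > 0" using c(2)[OF a(1)] by (auto simp: zero_less_mult_iff)
  moreover have "r ~= cmb c" using a(1) c(3) by blast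
  ultimately show ?thesis using a(1) k by (intro that[of r "k r"])
qed

text \<open>Induction on the height: \<open>positive_descent\<close> supplies a simple
  \<open>r\<close> to subtract, and the bracket of the root spaces of \<open>r\<close> and
  \<open>b - r\<close> is non-zero, so it fills the line of \<open>b\<close>. The negative roots are
  carried along.\<close>

lemma generated:
  assumes A: "subspace A" "!!x y. x \<in> A ==> y \<in> A ==> br x y \<in> A" "H \<subseteq> A"
    and s: "!!r. r \<in> D ==> gw r \<subseteq> A" "!!r. r \<in> D ==> gw (- r) \<subseteq> A"
  shows "A = UNIV"
proof -
  have step: "gw b \<subseteq> A" if a: "a \<in> R" "b \<in> R" "a (co b) = of_int k" "k > 0" "a ~= b" and
    sub: "gw a \<subseteq> A" "gw (b - a) \<subseteq> A" for a b k
  proof -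
    obtain x where x: "x \<in> gw a" "x ~= 0" using a(1) gw_sub subspace_0 unfolding wts_def by blast
    obtain y where y: "y \<in> gw (b - a)" "y ~= 0" using root_subtract(1)[OF a] gw_sub subspace_0 unfolding wts_def by blast
    have "br x y \<in> gw (a + (b - a))" by (rule gw_br[OF x(1) y(1)])
    also have "a + (b - a) = b" by simp
    finally have z: "br x y \<in> gw b" .
    have "gw b = span {br x y}" by (rule root_span[OF a(2) z root_subtract(2)[OF a x y]])
    moreover have "{br x y} \<subseteq> A" using A(2) sub x y by blast
    ultimately show ?thesis using span_minimal[OF _ A(1)] by simp
  qed
  have pos: "cmb c \<in> R ==> (!!r. r \<in> D ==> c r \<ge> 0) ==> gw (cmb c) \<subseteq> A \<and> gw (- cmb c) \<subseteq> A" for c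
  proof (induction "nat (\<Sum>r\<in>D. c r)" arbitrary: c rule: less_induct)
    case less
    show ?case
    proof (cases "cmb c \<in> D")
      case True
      then show ?thesis using s by blast
    next
      case False
      obtain r k where a: "r \<in> D" "c r \<ge> 1" "r (co (cmb c)) = of_int k" "k > 0" "r ~= cmb c"
        by (rule positive_descent[OF less.prems(1) less.prems(2) False])
      have aR: "r \<in> R" using a base_R by blast
      let ?d = "\<lambda>t. c t - (if t = r then 1 else 0)"
      have d: "cmb c - r = cmb ?d" using cmb_single[OF a(1)] cmb_diff[of c "\<lambda>t. if t = r then 1 else 0"] by simp
      have dR: "cmb ?d \<in> R" using root_subtract(1)[OF aR less.prems(1) a(3,4,5)] d by simp
      have d0: "?d t \<ge> 0" if "t \<in> D" for t using less.prems(2)[OF that] a(2) by auto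
      have "(\<Sum>t\<in>D. ?d t) = (\<Sum>t\<in>D. c t) - 1" using a(1) base_finite by (simp add: sum_subtractf)
      moreover have "(\<Sum>t\<in>D. ?d t) \<ge> 0" using d0 by (intro sum_nonneg)
      ultimately have "nat (\<Sum>t\<in>D. ?d t) < nat (\<Sum>t\<in>D. c t)" by linarith
      from less.hyps[OF this dR d0] have IH: "gw (cmb c - r) \<subseteq> A" "gw (- (cmb c - r)) \<subseteq> A" unfolding d by blast+
      have "gw (cmb c) \<subseteq> A" by (rule step[OF aR less.prems(1) a(3,4,5) s(1)[OF a(1)] IH(1)])
      moreover have "gw (- cmb c) \<subseteq> A"
      proof (rule step[OF R_neg[OF aR] R_neg[OF less.prems(1)] _ a(4) _ s(2)[OF a(1)]])
        have "r (- co (cmb c)) = - r (co (cmb c))" using wt_scale[of r "co (cmb c)" "-1"] aR co_H[OF less.prems(1)] by simp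
        then show "(- r) (co (- cmb c)) = of_int k" using a(3) co_neg[OF less.prems(1)] by simp
        show "- r ~= - cmb c" using a(5) by simp
        have "- cmb c - - r = - (cmb c - r)" by simp
        then show "gw (- cmb c - - r) \<subseteq> A" using IH(2) by simp
      qed
      ultimately show ?thesis by blast
    qed
  qed
  have "gw a \<subseteq> A" if a: "a \<in> wts" for a
  proof (cases "a = 0")
    case True
    then show ?thesis using gw0 A(3) by simp
  next
    case False
    then have aR: "a \<in> R" using a by blast
    then obtain c where c: "a = cmb c" "(\<forall>r\<in>D. c r \<ge> 0) \<or> (\<forall>r\<in>D. c r \<le> 0)" using root_cmb by blast
    show ?thesis
    proof (cases "\<forall>r\<in>D. c r \<ge> 0")
      case True
      then show ?thesis using pos[of c] aR c(1) by simp
    next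
      case False
      then have "\<forall>r\<in>D. - c r \<ge> 0" using c(2) by auto
      moreover have n: "cmb (\<lambda>r. - c r) = - a" using cmb_neg[of c] c(1) by simp
      ultimately have "gw (- cmb (\<lambda>r. - c r)) \<subseteq> A" using pos[of "\<lambda>r. - c r"] R_neg[OF aR] by simp
      then show ?thesis unfolding n by simp
    qed
  qed
  then have "(\<Union>a\<in>wts. gw a) \<subseteq> A" by blast
  from span_minimal[OF this A(1)] show ?thesis using gw_span by blast
qed

end

lemma diff_fixed: "x = x - y ==> y = 0" for x y :: "'a::ab_group_add"
  by simp

context based
begin

lemma cmb_root_nonzero:
  assumes "cmb c \<in> R" obtains a where "a \<in> D" "c a ~= 0"
proof -
  have "\<exists>a\<in>D. c a ~= 0"
  proof (rule ccontr)
    assume "\<not> ?thesis"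
    then have "cmb c = 0" by (intro sum.neutral) simp
    then show False using assms by simp
  qed
  then show ?thesis using that by blast
qed

lemma simple_diff: assumes "a \<in> D" "b \<in> D" "a ~= b" shows "a - b \<notin> wts"
proof
  assume w: "a - b \<in> wts"
  let ?c = "\<lambda>g. (if g = a then 1 else 0) - (if g = b then 1 else (0::int))"
  have "a - b = cmb (\<lambda>g. if g = a then 1 else 0) - cmb (\<lambda>g. if g = b then 1 else 0)"
    unfolding cmb_single[OF assms(1)] cmb_single[OF assms(2)] ..
  also have "\<dots> = cmb ?c" by (rule cmb_diff)
  finally have e: "a - b = cmb ?c" .
  have "a - b ~= 0" using assms(3) unfolding right_minus_eq .
  then have "a - b \<in> R" using w by blast
  then have "cmb ?c \<in> R" unfolding e .
  from cmb_sign[OF this] have "?c b \<ge> 0 \<or> ?c a \<le> 0" using assms(1,2) by blast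
  then show False using assms(3) by simp
qed

text \<open>Reflecting \<open>r + b\<close> in \<open>b\<close> would give the root
  \<open>r - b\<close>, whose coefficients have both signs.\<close>

lemma orth_sum:
  assumes a: "r \<in> D" "b \<in> D" "r ~= b" "r (co b) = 0" shows "r + b \<notin> wts"
proof
  assume w: "r + b \<in> wts"
  have bR: "b \<in> R" using base_R a(2) by (rule subsetD)
  have v: "(r + b) (co b) = of_int 2" using a(4) co_self[OF bR] by simp
  have "r + b ~= 0"
  proof
    assume "r + b = 0"
    then have "(r + b) (co b) = 0" by simp
    then show False using v by simp
  qed
  then have "r + b - of_int 2 * b \<in> R" using w v by (intro root_reflect[of b "r + b" 2, OF bR]) simp_all
  moreover have "r + b - of_int 2 * b = r - b" by (rule ext) simp
  ultimately show False using simple_diff[OF a(1-3)] by simp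
qed

text \<open>If \<open>D\<close> is the union of orthogonal sets \<open>A\<close> and \<open>B\<close>, then the subalgebra generated by the root spaces
  of \<open>\<plusminus> A\<close> commutes with those of \<open>\<plusminus> B\<close>, so it is an ideal.\<close>

lemma connected:
  assumes AB: "A \<union> B = D" "A \<inter> B = {}" "A ~= {}" "B ~= {}"
  shows "\<exists>a\<in>A. \<exists>b\<in>B. a (co b) ~= 0"
proof (rule ccontr)
  assume n: "\<not> ?thesis"
  have inR: "a \<in> R" if "a \<in> A \<or> a \<in> B" for a by (rule subsetD[OF base_R]) (use that AB(1) in blast)
  have nw: "s + t \<notin> wts" if ab: "a \<in> A" "b \<in> B" "s = a \<or> s = - a" "t = b \<or> t = - b" for a b s t
  proof -
    have D: "a \<in> D" "b \<in> D" "a ~= b" using ab(1,2) AB by auto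
    have "a (co b) = 0" using n ab by blast
    then have "a + b \<notin> wts" "a - b \<notin> wts" "b - a \<notin> wts" using orth_sum[OF D] simple_diff D by auto
    moreover have "- (a + b) \<notin> wts"
    proof
      assume "- (a + b) \<in> wts"
      moreover have "- (a + b) ~= 0"
      proof
        assume "- (a + b) = 0"
        then have "a = - b" by (metis add_eq_0_iff2 neg_equal_0_iff_equal)
        then have "a (co b) = - 2" using co_self[OF inR[of b]] ab by simp
        then show False using \<open>a (co b) = 0\<close> by simp
      qed
      ultimately have "- (a + b) \<in> R" by blast
      then have "- (- (a + b)) \<in> R" by (rule R_neg)
      then show False using \<open>a + b \<notin> wts\<close> by (simp add: add.commute)
    qed
    moreover have "- a + - b = - (a + b)" "a + - b = a - b" "- a + b = b - a" by (rule ext, simp)+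
    ultimately show ?thesis using ab(3,4) by auto
  qed
  define G where "G = {x. \<exists>a\<in>A. x \<in> gw a \<or> x \<in> gw (- a)}"
  define C where "C T \<longleftrightarrow> subspace T \<and> (\<forall>x\<in>T. \<forall>y\<in>T. br x y \<in> T) \<and> (\<forall>h\<in>H. \<forall>x\<in>T. br h x \<in> T) \<and> G \<subseteq> T" for T
  define K where "K = \<Inter>(Collect C)"
  have K_le: "K \<subseteq> T" if "C T" for T using that unfolding K_def by blast
  have CK: "C K" unfolding C_def
  proof (intro conjI ballI)
    show "subspace K" unfolding K_def by (rule subspace_Inter) (auto simp: C_def)
    show "br x y \<in> K" if "x \<in> K" "y \<in> K" for x y using that unfolding K_def by (auto simp: C_def)
    show "br h x \<in> K" if "h \<in> H" "x \<in> K" for h x using that unfolding K_def by (auto simp: C_def)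
    show "G \<subseteq> K" unfolding K_def by (auto simp: C_def)
  qed
  have comm: "br z x = 0" if b: "b \<in> B" "t = b \<or> t = - b" "z \<in> gw t" and x: "x \<in> K" for b t z x
  proof -
    have tw: "t \<in> wts" using b R_neg[OF inR[of b]] inR[of b] by auto
    have "C {x. br z x = 0}" unfolding C_def
    proof (intro conjI ballI)
      show "subspace {x. br z x = 0}" by (auto simp: subspace_def br_simps)
      fix x y assume "x \<in> {x. br z x = 0}" "y \<in> {x. br z x = 0}"
      then show "br x y \<in> {x. br z x = 0}" using jac'[of z x y] by (simp add: br_simps)
    next
      fix h x assume h: "h \<in> H" and x: "x \<in> {x. br z x = 0}"
      have e: "br z h = (- t h) *s z" using br_anti[of z h] true_weight[OF tw h b(3)] by simp
      have "br z (br h x) = 0" using jac'[of z h x] x unfolding e by (simp only: br_simps mem_Collect_eq) simp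
      then show "br h x \<in> {x. br z x = 0}" by simp
    next
      show "G \<subseteq> {x. br z x = 0}"
      proof
        fix x assume "x \<in> G"
        then obtain a s where a: "a \<in> A" "s = a \<or> s = - a" "x \<in> gw s" unfolding G_def by blast
        have sw: "s \<in> wts" using a R_neg[OF inR[of a]] inR[of a] by auto
        have "br x z \<in> gw (s + t)" by (rule gw_br[OF a(3) b(3)])
        moreover have "s + t \<in> ext" by (rule ext_add[OF wts_ext[OF sw] wts_ext[OF tw]])
        ultimately have "br x z = 0" using gw_not_wts nw[OF a(1) b(1) a(2) b(2)] by blast
        then show "x \<in> {x. br z x = 0}" using br_anti[of z x] by simp
      qed
    qed
    then show ?thesis using K_le x by blast
  qed
  have GK: "gw a \<subseteq> K" "gw (- a) \<subseteq> K" if "a \<in> A" for a using CK that unfolding C_def G_def by blast+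
  have Ks: "subspace K" and Kb: "!!x y. x \<in> K ==> y \<in> K ==> br x y \<in> K" using CK unfolding C_def by blast+
  \<comment> \<open>The idealizer of \<open>K\<close> contains \<open>H\<close>, the root spaces of
    \<open>A\<close> because \<open>K\<close> is a subalgebra, and those of \<open>B\<close> because
    they commute with \<open>K\<close>; \<open>generated\<close> makes it everything.\<close>
  have "{x. \<forall>y\<in>K. br x y \<in> K} = UNIV"
  proof (rule generated)
    show "subspace {x. \<forall>y\<in>K. br x y \<in> K}"
      using subspace_0[OF Ks] subspace_add[OF Ks] subspace_scale[OF Ks] by (auto simp: subspace_def br_simps)
    show "br x y \<in> {x. \<forall>y\<in>K. br x y \<in> K}" if "x \<in> {x. \<forall>y\<in>K. br x y \<in> K}" "y \<in> {x. \<forall>y\<in>K. br x y \<in> K}" for x y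
      using that subspace_diff[OF Ks] by (simp add: jac)
    show "H \<subseteq> {x. \<forall>y\<in>K. br x y \<in> K}" using CK unfolding C_def by blast
    fix r assume "r \<in> D"
    then consider "r \<in> A" | "r \<in> B" using AB(1) by blast
    then have "br x y \<in> K" if "x \<in> gw r \<or> x \<in> gw (- r)" "y \<in> K" for x y
    proof cases
      case 1
      then show ?thesis using GK[OF 1] that by (intro Kb) auto
    next
      case 2
      then have "br x y = 0" using comm[OF 2, of r x y] comm[OF 2, of "- r" x y] that by auto
      then show ?thesis using subspace_0[OF Ks] by simp
    qed
    then show "gw r \<subseteq> {x. \<forall>y\<in>K. br x y \<in> K}" "gw (- r) \<subseteq> {x. \<forall>y\<in>K. br x y \<in> K}" by auto
  qed
  then have "ideal K" unfolding ideal_def using Ks by blast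
  then have K01: "K = {0} \<or> K = UNIV" using simple unfolding simple_def by blast
  obtain a b where ab: "a \<in> A" "b \<in> B" using AB by blast
  have "K ~= {0}"
  proof
    assume "K = {0}"
    then have "gw a \<subseteq> {0}" using GK(1)[OF ab(1)] by simp
    then show False using gw_nz[of a] inR[of a] ab(1) by blast
  qed
  then have KU: "K = UNIV" using K01 by blast
  obtain e f where t: "triple b e f" using triple_exists[OF inR[of b]] ab(2) by blast
  have "br e f = 0" by (rule comm[OF ab(2), of b]) (use t KU in "simp_all add: triple_def")
  then have "co b = 0" using t by (simp add: triple_def)
  moreover have "b (co b) = 2" using co_self inR ab(2) by blast
  moreover have "b 0 = 0" using wt_scale[of b 0 0] inR[of b] ab(2) subspace_0[OF H_sub] by simp
  ultimately show False by simp
qed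

text \<open>A triple is chosen for each positive root only, and its second entry serves the negative
  root. Independent choices for \<open>a\<close> and \<open>- a\<close> need not satisfy
  \<open>br (ev a) (ev (- a)) = co a\<close>.\<close>

definition ev :: "('l => complex) => 'l" where
  "ev a = (if a \<in> positive_roots H D then fst (SOME p. triple a (fst p) (snd p))
     else snd (SOME p. triple (- a) (fst p) (snd p)))"

lemma positive_cmb: assumes "cmb c \<in> R" shows "cmb c \<in> positive_roots H D \<longleftrightarrow> (\<forall>a\<in>D. c a \<ge> 0)"
proof
  assume "cmb c \<in> positive_roots H D"
  then obtain d where d: "cmb c = cmb d" "\<forall>a\<in>D. d a \<ge> 0" unfolding positive_eq by blast
  then show "\<forall>a\<in>D. c a \<ge> 0" using cmb_unique[OF d(1)] by simp
next
  assume "\<forall>a\<in>D. c a \<ge> 0"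
  then show "cmb c \<in> positive_roots H D" unfolding positive_eq using assms by blast
qed

lemma positive_or: assumes a: "a \<in> R" shows "a \<in> positive_roots H D \<longleftrightarrow> - a \<notin> positive_roots H D"
proof -
  obtain c where c: "a = cmb c" "(\<forall>r\<in>D. c r \<ge> 0) \<or> (\<forall>r\<in>D. c r \<le> 0)" using root_cmb[OF a] by blast
  have pa: "a \<in> positive_roots H D \<longleftrightarrow> (\<forall>r\<in>D. c r \<ge> 0)"
    using positive_cmb[of c] a c(1) by simp
  have n: "- a = cmb (\<lambda>r. - c r)" using cmb_neg[of c] c(1) by simp
  have pn: "- a \<in> positive_roots H D \<longleftrightarrow> (\<forall>r\<in>D. - c r \<ge> 0)"
    using positive_cmb[of "\<lambda>r. - c r"] R_neg[OF a] n by simp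
  obtain r where "r \<in> D" "c r ~= 0" using cmb_root_nonzero[of c] a c(1) by blast
  then show ?thesis unfolding pa pn using c(2) by force
qed

lemma triple_ev: assumes a: "a \<in> R" shows "triple a (ev a) (ev (- a))"
proof -
  have ex: "\<exists>p. triple b (fst p) (snd p)" if "b \<in> R" for b using triple_exists[OF that] by (metis fst_conv snd_conv)
  show ?thesis
  proof (cases "a \<in> positive_roots H D")
    case True
    then have "- a \<notin> positive_roots H D" using positive_or[OF a] by blast
    then show ?thesis using True someI_ex[OF ex[OF a]] by (simp add: ev_def)
  next
    case False
    then have "- a \<in> positive_roots H D" using positive_or[OF a] by blast
    then have "triple (- a) (ev (- a)) (ev a)" using False someI_ex[OF ex[OF R_neg[OF a]]] by (simp add: ev_def)
    then show ?thesis using triple_opposite[OF R_neg[OF a]] by simp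
  qed
qed

lemma ev_gw: "a \<in> R ==> ev a \<in> gw a" and ev_br: "a \<in> R ==> br (ev a) (ev (- a)) = co a" and ev_nz: "a \<in> R ==> ev a ~= 0"
  using triple_ev triple_nz unfolding triple_def by blast+


end

locale hw_rep = rep scale br Basis H scaleV act BasisV + based scale br Basis H D
  for scale :: "complex => 'l::ab_group_add => 'l" (infixr \<open>*s\<close> 75) and br :: "'l => 'l => 'l" and Basis H
    and scaleV :: "complex => 'v::ab_group_add => 'v" (infixr \<open>*v\<close> 75) and act :: "'l => 'v => 'v" and BasisV D +
  fixes \<omega> :: "'l => complex" and u0 :: 'v
  assumes irr: "irreducible" and om: "\<omega> \<in> dual scale H" and u0: "u0 \<in> M \<omega>" "u0 ~= 0"
    and u0_killed: "!!b x. b \<in> positive_roots H D ==> x \<in> root_space H b ==> act x u0 = 0"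
begin

inductive words :: "'v => ('l => complex) => 'v => ('l => complex) => bool" for x0 m where
  words_start: "words x0 m x0 m"
| words_step: "words x0 m x n ==> a \<in> D ==> words x0 m (act (ev (- a)) x) (n - a)"

lemma act_ev: "a \<in> R ==> x \<in> M m ==> act (ev a) x \<in> M (m + a)"
  using act_gw[of a "ev a" x m] ev_gw[of a] by blast

lemma neg_base: "a \<in> D ==> - a \<in> R"
  using base_R R_neg by blast

lemma words_M: "words x0 m x n ==> x0 \<in> M m ==> x \<in> M n"
proof (induction rule: words.induct)
  case (words_step x n a)
  then have "act (ev (- a)) x \<in> M (n + - a)" by (intro act_ev neg_base)
  then show ?case unfolding add_uminus_conv_diff .
qed

lemma words_weight: "words x0 m x n ==> \<exists>c. (\<forall>a. c a \<ge> 0) \<and> n = m - cmb c"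
proof (induction rule: words.induct)
  case words_start
  show ?case by (intro exI[of _ "\<lambda>_. 0"]) simp
next
  case (words_step x n a)
  then obtain c where c: "\<forall>a. c a \<ge> 0" "n = m - cmb c" by blast
  have "n - a = m - (cmb c + cmb (\<lambda>g. if g = a then 1 else 0))"
    unfolding cmb_single[OF words_step(2)] c(2) by (simp only: diff_diff_add)
  then have "n - a = m - cmb (\<lambda>g. c g + (if g = a then 1 else 0))" unfolding cmb_add .
  moreover have "\<forall>g. c g + (if g = a then 1 else 0) \<ge> 0" using c(1) by simp
  ultimately show ?case by (intro exI[of _ "\<lambda>g. c g + (if g = a then 1 else 0)"] conjI)
qed

text \<open>Stability under the simple raising operators goes by induction on the word, moving
  \<open>ev r\<close> inwards: each commutator is 0 or lies in \<open>H\<close>, and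
  \<open>x0\<close> is killed. With \<open>generated\<close> and irreducibility the span is
  everything. It is stated for any such \<open>x0\<close>, since \<open>primitive\<close> applies it
  away from the highest weight.\<close>

lemma words_span:
  assumes x0: "x0 \<in> M m" "x0 ~= 0" and k: "!!r. r \<in> D ==> act (ev r) x0 = 0"
  shows "V.span {x. \<exists>n. words x0 m x n} = UNIV"
proof -
  let ?S = "{x. \<exists>n. words x0 m x n}"
  let ?W = "V.span ?S"
  let ?A = "{y. \<forall>w\<in>?W. act y w \<in> ?W}"
  have inA: "y \<in> ?A" if "!!x n. words x0 m x n ==> act y x \<in> ?W" for y
  proof (intro CollectI ballI)
    fix w assume w: "w \<in> ?W"
    show "act y w \<in> ?W"
      by (rule V.lin_span_image[OF act_linear _ V.subspace_span w]) (use that in blast)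
  qed
  have Ssub: "x \<in> ?W" if "words x0 m x n" for x n using that by (intro V.span_base) blast
  have HA: "H \<subseteq> ?A"
  proof
    fix h assume h: "h \<in> H"
    show "h \<in> ?A"
    proof (rule inA)
      fix x n assume w: "words x0 m x n"
      have "act h x = n h *v x" by (rule M_D[OF words_M[OF w x0(1)] h])
      then show "act h x \<in> ?W" using Ssub[OF w] V.span_scale by simp
    qed
  qed
  have fA: "ev (- r) \<in> ?A" if a: "r \<in> D" for r
  proof (rule inA)
    fix x n assume w: "words x0 m x n"
    show "act (ev (- r)) x \<in> ?W" by (rule Ssub[OF words_step[OF w a]])
  qed
  have eA: "ev r \<in> ?A" if a: "r \<in> D" for r
  proof (rule inA)
    fix x n assume "words x0 m x n"
    then show "act (ev r) x \<in> ?W"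
    proof (induction rule: words.induct)
      case words_start
      then show ?case using k[OF a] V.span_zero by simp
    next
      case (words_step x n t)
      have 1: "act (ev (- t)) (act (ev r) x) \<in> ?W" using fA[OF words_step(2)] words_step(3) by blast
      have 2: "act (br (ev r) (ev (- t))) x \<in> ?W"
      proof (cases "r = t")
        case True
        have aR: "r \<in> R" using a base_R by blast
        have "br (ev r) (ev (- t)) \<in> H" using ev_br[OF aR] co_H[OF aR] True by simp
        then show ?thesis using HA Ssub[OF words_step(1)] by blast
      next
        case False
        have aR: "r \<in> R" using a base_R by blast
        have "br (ev r) (ev (- t)) \<in> gw (r + - t)" by (rule gw_br[OF ev_gw[OF aR] ev_gw[OF neg_base[OF words_step(2)]]])
        then have "br (ev r) (ev (- t)) \<in> gw (r - t)" by (simp only: add_uminus_conv_diff)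
        moreover have "r - t \<in> ext" using ext_add[OF R_ext[OF aR] R_ext[OF neg_base[OF words_step(2)]]] by (simp only: add_uminus_conv_diff)
        ultimately have "br (ev r) (ev (- t)) = 0" using gw_not_wts simple_diff[OF a words_step(2) False] by blast
        then show ?thesis using V.span_zero by (simp add: act_simps)
      qed
      show ?case unfolding act_swap[of "ev r" "ev (- t)" x] by (rule V.span_add[OF 1 2])
    qed
  qed
  have "?A = UNIV"
  proof (rule generated[OF _ _ HA])
    show subA: "subspace ?A"
      by (rule subspaceI) (auto simp: act_simps intro: V.span_zero V.span_add V.span_scale)
    fix x y assume "x \<in> ?A" "y \<in> ?A"
    then show "br x y \<in> ?A" by (auto simp: act_br intro!: V.span_diff)
  next
    have subA: "subspace ?A"
      by (rule subspaceI) (auto simp: act_simps intro: V.span_zero V.span_add V.span_scale)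
    have one: "gw b \<subseteq> ?A" if b: "b \<in> R" "ev b \<in> ?A" for b
    proof -
      have "gw b = span {ev b}" by (rule root_span[OF b(1) ev_gw[OF b(1)] ev_nz[OF b(1)]])
      then show ?thesis using span_minimal[OF _ subA, of "{ev b}"] b(2) by simp
    qed
    fix r assume a: "r \<in> D"
    show "gw r \<subseteq> ?A" using one[OF _ eA[OF a]] a base_R by blast
    show "gw (- r) \<subseteq> ?A" by (rule one[OF neg_base[OF a] fA[OF a]])
  qed
  then have "\<forall>x. \<forall>w\<in>?W. act x w \<in> ?W" by blast
  then have "?W = {0} \<or> ?W = UNIV" using irr V.subspace_span unfolding irreducible_def by blast
  moreover have "x0 \<in> ?W" by (rule Ssub[OF words_start])
  ultimately show ?thesis using x0(2) by blast
qed

lemma M_indep: "V.indep_family ext M"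
proof (rule V.gen_weight_indep[of H act])
  fix l m :: "'l => complex" assume lm: "l \<in> ext" "m \<in> ext" "l ~= m"
  show "\<exists>h\<in>H. l h ~= m h"
  proof (rule ccontr)
    assume "\<not> ?thesis"
    then have "l h = m h" for h using lm(1,2) by (cases "h \<in> H") (auto simp: ext_def)
    then show False using lm(3) by blast
  qed
next
  fix l h x assume h: "h \<in> H" and x: "x \<in> M l"
  have e: "act h x = l h *v x" by (rule M_D[OF x h])
  then show "x \<in> V.geig (act h) (l h)" unfolding V.geig_def by (auto intro!: exI[of _ 1])
  show "act h x \<in> M l" unfolding e by (rule V.subspace_scale[OF M_sub x])
qed (rule act_linear M_sub)+

lemma cmb_ext: "cmb c \<in> ext"
proof -
  have "cmb c x = 0" if x: "x \<notin> H" for x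
  proof -
    have "a x = 0" if "a \<in> D" for a using base_R R_ext[of a] that x unfolding ext_def by blast
    then show ?thesis unfolding cmb_apply by (intro sum.neutral) simp
  qed
  then show ?thesis unfolding ext_def by blast
qed

lemma om_ext: "\<omega> \<in> ext" using om by (rule dual_ext)

lemma ext_diff: "a \<in> ext ==> b \<in> ext ==> a - b \<in> ext"
  by (auto simp: ext_def)

text \<open>The words starting at \<open>x\<close> span the module too, so \<open>\<omega>\<close>
  is the weight of \<open>x\<close> minus a non-negative combination of the base. Both differences
  are non-negative and add up to 0.\<close>

lemma primitive:
  assumes x: "x \<in> M (\<omega> - cmb c)" "x ~= 0" and k: "!!r. r \<in> D ==> act (ev r) x = 0"
    and c: "!!r. r \<in> D ==> c r \<ge> 0"
  shows "\<omega> - cmb c = \<omega>"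
proof -
  let ?m = "\<omega> - cmb c"
  let ?J = "{?m - cmb d |d. \<forall>r. d r \<ge> 0}"
  have "u0 \<in> V.span {y. \<exists>n. words x ?m y n}" using words_span[OF x k] by simp
  moreover have "{y. \<exists>n. words x ?m y n} \<subseteq> (\<Union>n\<in>?J. M n)"
  proof
    fix y assume "y \<in> {y. \<exists>n. words x ?m y n}"
    then obtain n where w: "words x ?m y n" by blast
    obtain d where "\<forall>r. d r \<ge> 0" "n = ?m - cmb d" using words_weight[OF w] by blast
    then have "n \<in> ?J" by blast
    then show "y \<in> (\<Union>n\<in>?J. M n)" using words_M[OF w x(1)] by blast
  qed
  ultimately have uJ: "u0 \<in> V.span (\<Union>n\<in>?J. M n)" using V.span_mono by blast
  have J: "?J \<subseteq> ext" using ext_diff[OF ext_diff[OF om_ext cmb_ext] cmb_ext] by blast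
  have "\<omega> \<in> ?J"
  proof (rule ccontr)
    assume "\<omega> \<notin> ?J"
    then have "u0 = 0" by (rule V.indep_span_disjoint[OF M_indep M_sub J om_ext _ u0(1) uJ])
    then show False using u0(2) by blast
  qed
  then obtain d where d: "\<forall>r. d r \<ge> 0" "\<omega> = ?m - cmb d" by blast
  have "\<omega> = \<omega> - cmb (\<lambda>r. c r + d r)" using d(2) unfolding diff_diff_add cmb_add .
  then have "cmb (\<lambda>r. c r + d r) = 0" by (rule diff_fixed)
  also have "0 = cmb (\<lambda>_. 0)" by (rule sum.neutral[symmetric]) simp
  finally have z: "cmb (\<lambda>r. c r + d r) = cmb (\<lambda>_. 0)" .
  have "c r = 0" if a: "r \<in> D" for r
  proof -
    have "c r + d r = 0" by (rule cmb_unique[OF z a])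
    then show ?thesis using c[OF a] d(1)[rule_format, of r] by linarith
  qed
  then have "cmb c = 0" by (intro sum.neutral) simp
  then show ?thesis by (simp only: diff_zero)
qed

end

section \<open>Pairings of monomials and the abstract highest weight module\<close>

section \<open>Gram matrices of monomials\<close>

text \<open>A word \<open>[i\<^sub>1, \<dots>, i\<^sub>k]\<close> stands for \<open>f\<^sub>i\<^sub>1 \<cdots> f\<^sub>i\<^sub>k v\<close>, where \<open>v\<close> is a highest weight vector with labels \<open>m\<close>
  and \<open>C i j = \<alpha>\<^sub>i(\<alpha>\<^sub>j\<^sup>\<or>)\<close>. The function \<open>lower\<close> expands \<open>e\<^sub>i\<close> applied to a word, and \<open>pairing e w\<close> is
  the coefficient of \<open>v\<close> in \<open>\<cdots> e\<^sub>2 e\<^sub>1\<close> applied to \<open>w\<close>.\<close>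

primrec lower :: "(nat => nat => int) => (nat => int) => nat => nat list => (int \<times> nat list) list" where
  "lower C m i [] = []"
| "lower C m i (j # w) = (if i = j then [(m i - sum_list (map (\<lambda>k. C k i) w), w)] else []) @
     map (\<lambda>(c, u). (c, j # u)) (lower C m i w)"

primrec pairing :: "(nat => nat => int) => (nat => int) => nat list => nat list => int" where
  "pairing C m [] w = 1"
| "pairing C m (i # e) w = sum_list (map (\<lambda>(c, u). c * pairing C m e u) (lower C m i w))"

text \<open>Raising operators are applied from the head of the list, undoing the lowering operators
  in reverse order. \<open>pairing\<close> is thus the contravariant form, and the same three words
  serve as rows and columns.\<close>

definition gram3 :: "(nat => nat => int) => (nat => int) => nat list => nat list => nat list => int" where
  "gram3 C m a b c = (let P = pairing C m in
     P a a * (P b b * P c c - P b c * P c b) - P a b * (P b a * P c c - P b c * P c a) +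
     P a c * (P b a * P c b - P b b * P c a))"

lemma lower_length: "(c, u) \<in> set (lower C m i w) ==> length w = Suc (length u)"
  by (induction w arbitrary: c u) (auto split: if_splits)

lemma lower_set: "(c, u) \<in> set (lower C m i w) ==> set u \<subseteq> set w"
proof (induction w arbitrary: c u)
  case (Cons j w)
  then show ?case by (fastforce split: if_splits)
qed simp

section \<open>Highest weight modules\<close>

text \<open>Collects what the combinatorial part uses of the algebra and its module:
  \<open>pr m g\<close> stands for \<open>m (co g)\<close>, as a real number, and \<open>X g\<close>
  for the action of a chosen root vector. \<open>X_serre\<close> expresses
  \<open>[[X g, X d], X e] = 0\<close>. By \<open>prim\<close>, a non-zero vector below
  \<open>v\<close> killed by all simple raising operators has weight \<open>\<omega>\<close>. The
  last two assumptions encode maximal multiplicity 2.\<close>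

locale hwm = V: fd_complex scaleV BasisV
  for scaleV :: "complex => 'v::ab_group_add => 'v" (infixr \<open>*v\<close> 75) and BasisV +
  fixes R D :: "'w::comm_ring_1 set" and pr :: "'w => 'w => real" and X :: "'w => 'v => 'v"
    and M :: "'w => 'v set" and \<omega> :: 'w and v :: 'v
  assumes finR: "finite R" and R0: "0 \<notin> R" and R_neg: "g \<in> R ==> - g \<in> R" and D_R: "D \<subseteq> R"
    and pr_add: "pr (m + n) g = pr m g + pr n g"
    and pr_self: "g \<in> R ==> pr g g = 2"
    and pr_int: "g \<in> R ==> d \<in> R ==> pr g d \<in> \<int>"
    and refl_R: "g \<in> R ==> d \<in> R ==> g - of_int \<lfloor>pr g d\<rfloor> * d \<in> R"
    and co_refl: "g \<in> R ==> d \<in> R ==> pr m (g - of_int \<lfloor>pr g d\<rfloor> * d) = pr m g - pr d g * pr m d"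
    and string: "g \<in> R ==> d \<in> R ==> pr g d < 0 ==> g ~= - d ==> g + d \<in> R"
    and R_double: "g \<in> R ==> g + g \<notin> R"
    and base: "g \<in> R ==> \<exists>c::'w => int. g = (\<Sum>r\<in>D. of_int (c r) * r) \<and> ((\<forall>r\<in>D. c r \<ge> 0) \<or> (\<forall>r\<in>D. c r \<le> 0))"
    and indep: "(!!g. g \<in> R ==> (\<Sum>r\<in>D. y r * pr r g) = 0) ==> r \<in> D ==> y r = (0::real)"
    and conn: "A \<union> B = D ==> A \<inter> B = {} ==> A ~= {} ==> B ~= {} ==> \<exists>a\<in>A. \<exists>b\<in>B. pr a b ~= 0"
    and X_lin: "V.lin (X g)" and M_sub: "V.subspace (M m)"
    and X_M: "g \<in> R ==> x \<in> M m ==> X g x \<in> M (m + g)"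
    and X_opp: "g \<in> R ==> x \<in> M m ==> X g (X (- g) x) - X (- g) (X g x) = of_real (pr m g) *v x"
    and X_comm: "g \<in> R ==> d \<in> R ==> g + d \<notin> R ==> g + d ~= 0 ==> X g (X d x) = X d (X g x)"
    and X_serre: "g \<in> R ==> d \<in> R ==> e \<in> R ==> g + d + e \<notin> R ==> g + d + e ~= 0 ==>
      X g (X d (X e x)) - X d (X g (X e x)) = X e (X g (X d x) - X d (X g x))"
    and X_sl2: "g \<in> R ==> sl2 scaleV BasisV (X g) (X (- g)) (\<lambda>x. X g (X (- g) x) - X (- g) (X g x))"
    and M_indep: "V.indep_family {\<omega> - (\<Sum>r\<in>D. of_int (c r) * r) |c. True} M"
    and v_M: "v \<in> M \<omega>" and v_nz: "v ~= 0"
    and v_high: "g \<in> R ==> g = (\<Sum>r\<in>D. of_int (c r) * r) ==> (!!r. r \<in> D ==> c r \<ge> 0) ==> X g v = 0"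
    and gen: "V.subspace W ==> v \<in> W ==> (!!r x. r \<in> D ==> x \<in> W ==> X (- r) x \<in> W) ==> W = UNIV"
    and prim: "x \<in> M (\<omega> - (\<Sum>r\<in>D. of_int (c r) * r)) ==> x ~= 0 ==> (!!r. r \<in> D ==> c r \<ge> 0) ==>
      (!!r. r \<in> D ==> X r x = 0) ==> (\<Sum>r\<in>D. of_int (c r) * r) = 0"
    and dim_le: "V.dim (M m) \<le> 2"
    and dim_2: "\<exists>c. V.dim (M (\<omega> - (\<Sum>r\<in>D. of_int (c r) * r))) = 2"
begin

abbreviation cmb :: "('w => int) => 'w" where
  "cmb c \<equiv> \<Sum>a\<in>D. of_int (c a) * a"

lemma finD: "finite D" using finR D_R finite_subset by blast

lemma pr_0: "pr 0 g = 0" using pr_add[of 0 0 g] by simp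

lemma pr_minus: "pr (- m) g = - pr m g" using pr_add[of m "- m" g] pr_0 by simp

lemma pr_diff: "pr (m - n) g = pr m g - pr n g" using pr_add[of "m - n" n g] by simp

lemma pr_of_nat: "pr (of_nat k * m) g = real k * pr m g"
  by (induction k) (simp_all add: pr_0 pr_add distrib_right)

lemma pr_of_int: "pr (of_int k * m) g = real_of_int k * pr m g"
proof (cases "k \<ge> 0")
  case True
  then show ?thesis using pr_of_nat[of "nat k" m g] by (simp add: of_nat_nat)
next
  case False
  then show ?thesis using pr_of_nat[of "nat (- k)" m g] pr_minus[of "of_int k * m" g] by (simp add: of_nat_nat)
qed

lemma pr_sum: "pr (\<Sum>a\<in>A. f a) g = (\<Sum>a\<in>A. pr (f a) g)"
  by (induction A rule: infinite_finite_induct) (simp_all add: pr_0 pr_add)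

lemma pr_cmb: "pr (cmb c) g = (\<Sum>a\<in>D. real_of_int (c a) * pr a g)"
  by (simp add: pr_sum pr_of_int)

lemma pr_neg: assumes g: "r \<in> R" shows "pr m (- r) = - pr m r"
  using co_refl[OF g g, of m] pr_self[OF g] by simp

lemma cmb_indep: assumes "cmb c = cmb d" "a \<in> D" shows "c a = d a"
proof -
  have "real_of_int (c a - d a) = 0"
  proof (rule indep[of "\<lambda>a. real_of_int (c a - d a)", OF _ assms(2)])
    fix g
    have "pr (cmb c) g = pr (cmb d) g" using assms(1) by (rule arg_cong)
    then show "(\<Sum>a\<in>D. real_of_int (c a - d a) * pr a g) = 0"
      unfolding pr_cmb by (simp add: left_diff_distrib sum_subtractf)
  qed
  then show ?thesis by simp
qed

lemma cmb_add: "cmb c + cmb d = cmb (\<lambda>a. c a + d a)" and cmb_diff: "cmb c - cmb d = cmb (\<lambda>a. c a - d a)"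
  and cmb_neg: "- cmb c = cmb (\<lambda>a. - c a)" and cmb_mult: "of_int k * cmb c = cmb (\<lambda>a. k * c a)"
  by (simp_all add: distrib_right left_diff_distrib sum.distrib sum_subtractf sum_negf sum_distrib_left mult.assoc)

definition unit :: "'w => 'w => int" where "unit a = (\<lambda>b. if b = a then 1 else 0)"

lemma cmb_unit: "r \<in> D ==> cmb (unit r) = r"
proof -
  assume a: "r \<in> D"
  have "cmb (unit r) = (\<Sum>b\<in>D. if b = r then b else 0)"
    unfolding unit_def by (intro sum.cong) auto
  then show ?thesis using a finD by simp
qed

definition pos :: "'w set" where "pos = {g \<in> R. \<exists>c. g = cmb c \<and> (\<forall>a\<in>D. c a \<ge> 0)}"

lemma pos_R: "g \<in> pos ==> g \<in> R" by (simp add: pos_def)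

lemma posI: "cmb c \<in> R ==> (!!a. a \<in> D ==> c a \<ge> 0) ==> cmb c \<in> pos"
  unfolding pos_def by blast

lemma D_pos: "r \<in> D ==> r \<in> pos"
proof -
  assume a: "r \<in> D"
  have "cmb (unit r) \<in> pos" by (rule posI) (use a D_R cmb_unit[OF a] in "auto simp: unit_def")
  then show ?thesis using cmb_unit[OF a] by simp
qed

lemma posE: assumes "g \<in> pos" obtains c where "g = cmb c" "!!a. a \<in> D ==> c a \<ge> 0"
  using assms unfolding pos_def by blast

lemma cmb_sign: "cmb c \<in> R ==> (\<forall>a\<in>D. c a \<ge> 0) \<or> (\<forall>a\<in>D. c a \<le> 0)"
proof -
  assume "cmb c \<in> R"
  from base[OF this] obtain d where d: "cmb c = cmb d" "(\<forall>a\<in>D. d a \<ge> 0) \<or> (\<forall>a\<in>D. d a \<le> 0)" by blast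
  have "c a = d a" if "a \<in> D" for a by (rule cmb_indep[OF d(1) that])
  then show ?thesis using d(2) by simp
qed

lemma mixed_not_root: "a \<in> D ==> b \<in> D ==> c a > 0 ==> c b < 0 ==> cmb c \<notin> R"
  using cmb_sign[of c] by force

lemma v_killed: "g \<in> pos ==> X g v = 0"
  using v_high unfolding pos_def by blast

text \<open>The canonical form built from all coroots; reflections permute \<open>R\<close>, so it
  is invariant under them.\<close>

definition ip :: "'w => 'w => real" where "ip m n = (\<Sum>g\<in>R. pr m g * pr n g)"

abbreviation ref :: "'w => 'w => 'w" where "ref d g \<equiv> g - of_int \<lfloor>pr g d\<rfloor> * d"

lemma fl: "g \<in> R ==> d \<in> R ==> real_of_int \<lfloor>pr g d\<rfloor> = pr g d"
  using pr_int[of g d] by (auto elim: Ints_cases)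

lemma pr_ref: "g \<in> R ==> d \<in> R ==> pr (ref d g) e = pr g e - pr g d * pr d e"
  by (simp add: pr_diff pr_of_int fl)

lemma ref_ref: assumes "g \<in> R" "d \<in> R" shows "ref d (ref d g) = g"
proof -
  have "pr (ref d g) d = - pr g d" using pr_ref[OF assms, of d] pr_self[OF assms(2)] by simp
  then have "\<lfloor>pr (ref d g) d\<rfloor> = - \<lfloor>pr g d\<rfloor>" using fl[OF assms] by (metis floor_of_int of_int_minus)
  then show ?thesis by simp
qed

lemma ref_bij: assumes d: "t \<in> R" shows "bij_betw (ref t) R R"
proof (rule bij_betw_byWitness[of _ "ref t"])
  show "\<forall>a\<in>R. ref t (ref t a) = a" "\<forall>a\<in>R. ref t (ref t a) = a" using ref_ref[OF _ d] by blast+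
  show "ref t ` R \<subseteq> R" "ref t ` R \<subseteq> R" using refl_R[OF _ d] by blast+
qed

lemma ip_sym: "ip m n = ip n m" by (simp add: ip_def mult.commute)

lemma ip_add: "ip (m + n) g = ip m g + ip n g" and ip_diff: "ip (m - n) g = ip m g - ip n g"
  by (simp_all add: ip_def pr_add pr_diff algebra_simps sum.distrib sum_subtractf)

lemma ip_add': "ip g (m + n) = ip g m + ip g n" and ip_diff': "ip g (m - n) = ip g m - ip g n"
  using ip_add ip_diff ip_sym by simp_all

lemma ip_of_int: "ip (of_int k * m) n = real_of_int k * ip m n"
  by (simp add: ip_def pr_of_int sum_distrib_left mult.assoc)

text \<open>Reindexing the sum by the reflection in \<open>t\<close> changes the sign of
  \<open>pr t g\<close> and replaces \<open>pr m g\<close> by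
  \<open>pr m g - pr t g * pr m t\<close>; comparing with the original sum gives the
  relation.\<close>

lemma ip_pr: assumes d: "t \<in> R" shows "pr m t * ip t t = 2 * ip m t"
proof -
  have "ip m t = (\<Sum>g\<in>R. pr m (ref t g) * pr t (ref t g))"
    unfolding ip_def by (rule sum.reindex_bij_betw[OF ref_bij[OF d], symmetric])
  also have "\<dots> = (\<Sum>g\<in>R. (pr m g - pr t g * pr m t) * (- pr t g))"
    by (intro sum.cong refl) (simp add: co_refl d pr_self)
  also have "\<dots> = - ip m t + pr m t * ip t t"
    by (simp add: ip_def algebra_simps sum.distrib sum_subtractf sum_distrib_left sum_negf)
  finally show ?thesis by simp
qed

lemma ip_nonneg: "ip m m \<ge> 0"
  unfolding ip_def by (intro sum_nonneg) auto

lemma ip_zero: assumes "ip m m = 0" "g \<in> R" shows "pr m g = 0"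
proof -
  have "\<forall>g\<in>R. pr m g * pr m g = 0"
    using assms(1) finR unfolding ip_def by (subst (asm) sum_nonneg_eq_0_iff) auto
  then show ?thesis using assms(2) by simp
qed

lemma ip_pos: assumes d: "t \<in> R" shows "ip t t > 0"
  using ip_nonneg[of t] ip_zero[of t t] pr_self[OF d] d by fastforce

lemma pr_ip: "d \<in> R ==> pr m d = 2 * ip m d / ip d d"
  using ip_pr[of d m] ip_pos[of d] by (simp add: field_simps)

lemma pr_sgn: assumes "g \<in> R" "d \<in> R"
  shows "pr g d = 0 \<longleftrightarrow> pr d g = 0" "pr g d < 0 \<longleftrightarrow> pr d g < 0" "pr g d > 0 \<longleftrightarrow> pr d g > 0"
  using ip_pos[OF assms(1)] ip_pos[OF assms(2)] ip_sym[of g d]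
  by (simp_all add: pr_ip assms zero_less_divide_iff divide_less_0_iff)

text \<open>The double sum is a sum of squares over \<open>R\<close>, and \<open>indep\<close> keeps
  them from all vanishing.\<close>

lemma ip_form_pos:
  fixes x :: "'w => real"
  assumes "a \<in> D" "x a ~= 0"
  shows "(\<Sum>b\<in>D. \<Sum>g\<in>D. x b * x g * ip b g) > 0"
proof -
  have "(\<Sum>b\<in>D. \<Sum>g\<in>D. x b * x g * ip b g) = (\<Sum>b\<in>D. \<Sum>g\<in>D. \<Sum>t\<in>R. (x b * pr b t) * (x g * pr g t))"
    by (simp add: ip_def sum_distrib_left mult_ac)
  also have "\<dots> = (\<Sum>b\<in>D. \<Sum>t\<in>R. \<Sum>g\<in>D. (x b * pr b t) * (x g * pr g t))"
    by (intro sum.cong refl sum.swap)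
  also have "\<dots> = (\<Sum>t\<in>R. \<Sum>b\<in>D. \<Sum>g\<in>D. (x b * pr b t) * (x g * pr g t))"
    by (rule sum.swap)
  also have "\<dots> = (\<Sum>t\<in>R. (\<Sum>b\<in>D. x b * pr b t)\<^sup>2)"
    by (simp add: power2_eq_square sum_product)
  finally have e: "(\<Sum>b\<in>D. \<Sum>g\<in>D. x b * x g * ip b g) = (\<Sum>t\<in>R. (\<Sum>b\<in>D. x b * pr b t)\<^sup>2)" .
  have "\<exists>t\<in>R. (\<Sum>b\<in>D. x b * pr b t) ~= 0"
    using indep[of x a] assms by blast
  then obtain t where d: "t \<in> R" "(\<Sum>b\<in>D. x b * pr b t) ~= 0" by blast
  show ?thesis unfolding e using d finR by (intro sum_pos2[of _ t]) auto
qed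

section \<open>Multiplicities\<close>

lemma weight_dim_reflect:
  assumes g: "r \<in> R" and k: "pr m r = real_of_int k" shows "V.dim (M m) \<le> V.dim (M (m - of_int k * r))"
proof -
  interpret s: sl2 scaleV BasisV "X r" "X (- r)" "\<lambda>x. X r (X (- r) x) - X (- r) (X r x)" by (rule X_sl2[OF g])
  have pow: "(X d ^^ n) x \<in> M (m + of_nat n * d)" if "d \<in> R" "x \<in> M m" for d x n
  proof (induction n)
    case (Suc n)
    have "X d ((X d ^^ n) x) \<in> M (m + of_nat n * d + d)" by (rule X_M[OF that(1) Suc])
    then show ?case by (simp add: algebra_simps)
  qed (use that in simp)
  show ?thesis
  proof (cases "k \<ge> 0")
    case True
    have eq: "m + of_nat (nat k) * (- r) = m - of_int k * r" using True by (simp add: of_nat_nat)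
    show ?thesis
    proof (rule V.inj_dim_le[OF V.lin_pow[OF X_lin, of "nat k" "- r"] M_sub])
      fix x assume x: "x \<in> M m"
      show "(X (- r) ^^ nat k) x \<in> M (m - of_int k * r)" using pow[OF R_neg[OF g] x, of "nat k"] unfolding eq .
      assume "(X (- r) ^^ nat k) x = 0"
      then show "x = 0" using s.F_pow_inj[of x "nat k" "nat k"] X_opp[OF g x] k True by (simp add: of_nat_nat)
    qed
  next
    case False
    have eq: "m + of_nat (nat (- k)) * r = m - of_int k * r" using False by (simp add: of_nat_nat)
    show ?thesis
    proof (rule V.inj_dim_le[OF V.lin_pow[OF X_lin, of "nat (- k)" r] M_sub])
      fix x assume x: "x \<in> M m"
      show "(X r ^^ nat (- k)) x \<in> M (m - of_int k * r)" using pow[OF g x, of "nat (- k)"] unfolding eq .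
      assume "(X r ^^ nat (- k)) x = 0"
      then show "x = 0" using s.E_pow_inj[of x "nat (- k)" "nat (- k)"] X_opp[OF g x] k False by (simp add: of_nat_nat)
    qed
  qed
qed

lemma label_nat: assumes g: "r \<in> pos" shows "\<exists>n. pr \<omega> r = real n"
proof -
  have gR: "r \<in> R" using g pos_R by blast
  interpret s: sl2 scaleV BasisV "X r" "X (- r)" "\<lambda>x. X r (X (- r) x) - X (- r) (X r x)" by (rule X_sl2[OF gR])
  obtain n where "complex_of_real (pr \<omega> r) = of_nat n"
    using s.highest_weight_nat[OF X_opp[OF gR v_M] v_nz v_killed[OF g]] by blast
  then have "pr \<omega> r = real n" by (metis of_real_eq_iff of_real_of_nat_eq)
  then show ?thesis by blast
qed

primrec wd :: "'w list => 'v" where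
  "wd [] = v"
| "wd (g # w) = X (- g) (wd w)"

lemma wd_M: "set w \<subseteq> R ==> wd w \<in> M (\<omega> - sum_list w)"
proof (induction w)
  case (Cons g w)
  then have "X (- g) (wd w) \<in> M (\<omega> - sum_list w + - g)" by (intro X_M R_neg) auto
  then show ?case by (simp add: algebra_simps)
qed (use v_M in simp)

definition pi_system :: "(nat => 'w) => nat => bool" where
  "pi_system g n \<longleftrightarrow> (\<forall>i<n. g i \<in> pos) \<and> (\<forall>i<n. \<forall>j<n. i ~= j \<longrightarrow> g i ~= g j \<and> g i - g j \<notin> R)"

definition pi_data :: "(nat => 'w) => nat => (nat => nat => int) => (nat => int) => bool" where
  "pi_data g n C m \<longleftrightarrow> pi_system g n \<and> (\<forall>i<n. \<forall>j<n. pr (g i) (g j) = of_int (C i j)) \<and> (\<forall>i<n. pr \<omega> (g i) = of_int (m i))"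

abbreviation gw :: "(nat => 'w) => nat list => 'v" where "gw g w \<equiv> wd (map g w)"

lemma lower_wd:
  assumes p: "pi_data g n C m" and i: "i < n" and w: "set w \<subseteq> {..<n}"
  shows "X (g i) (gw g w) = sum_list (map (\<lambda>(c, u). of_int c *v gw g u) (lower C m i w))"
  using w
proof (induction w)
  case Nil
  then show ?case using p i v_killed by (simp add: pi_data_def pi_system_def)
next
  case (Cons j w)
  have gR: "g k \<in> R" if "k < n" for k using p that pos_R by (simp add: pi_data_def pi_system_def)
  have j: "j < n" and w: "set w \<subseteq> {..<n}" using Cons.prems by auto
  let ?x = "gw g w"
  have lx: "X (- g j) (sum_list (map (\<lambda>(c, u). of_int c *v gw g u) L)) =
    sum_list (map (\<lambda>(c, u). of_int c *v gw g u) (map (\<lambda>(c, u). (c, j # u)) L))" for L :: "(int \<times> nat list) list"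
    by (induction L) (auto simp: V.lin_zero[OF X_lin] V.lin_add[OF X_lin] V.lin_scale[OF X_lin])
  show ?case
  proof (cases "i = j")
    case True
    have "set (map g w) \<subseteq> R" using w gR by auto
    then have xM: "?x \<in> M (\<omega> - sum_list (map g w))" by (rule wd_M)
    have "pr (sum_list (map g w)) (g i) = of_int (sum_list (map (\<lambda>k. C k i) w))"
      using w p i by (induction w) (auto simp: pr_0 pr_add pi_data_def)
    then have pk: "pr (\<omega> - sum_list (map g w)) (g i) = real_of_int (m i - sum_list (map (\<lambda>k. C k i) w))"
      using p i by (simp add: pr_diff pi_data_def)
    have "X (g i) (X (- g i) ?x) = of_int (m i - sum_list (map (\<lambda>k. C k i) w)) *v ?x + X (- g i) (X (g i) ?x)"
      using X_opp[OF gR[OF i] xM] unfolding pk diff_eq_eq of_real_of_int_eq .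
    then show ?thesis using Cons.IH[OF w] lx True by simp
  next
    case False
    have "g i + - g j \<notin> R" "g i + - g j ~= 0" using p i j False unfolding pi_data_def pi_system_def by auto
    then have "X (g i) (X (- g j) ?x) = X (- g j) (X (g i) ?x)" by (rule X_comm[OF gR[OF i] R_neg[OF gR[OF j]]])
    then show ?thesis using Cons.IH[OF w] lx False by simp
  qed
qed

primrec up :: "(nat => 'w) => nat list => 'v => 'v" where
  "up g [] x = x"
| "up g (i # e) x = up g e (X (g i) x)"

lemma up_lin: "V.lin (up g e)"
proof (induction e)
  case Nil
  have "up g [] = (\<lambda>x. x)" by (rule ext) simp
  then show ?case using V.lin_id by simp
next
  case (Cons i e)
  have "up g (i # e) = (\<lambda>x. up g e (X (g i) x))" by (rule ext) simp
  then show ?case using V.lin_comp[OF Cons X_lin[of "g i"]] by simp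
qed

lemma up_wd:
  assumes p: "pi_data g n C m"
  shows "set e \<subseteq> {..<n} ==> set w \<subseteq> {..<n} ==> length e = length w ==> up g e (gw g w) = of_int (pairing C m e w) *v v"
proof (induction e arbitrary: w)
  case Nil
  then show ?case by simp
next
  case (Cons i e)
  have i: "i < n" and e: "set e \<subseteq> {..<n}" using Cons.prems by auto
  note IH = Cons.IH[OF e]
  have L: "up g e (sum_list (map (\<lambda>(c, u). of_int c *v gw g u) L)) = of_int (sum_list (map (\<lambda>(c, u). c * pairing C m e u) L)) *v v"
    if "\<forall>(c, u) \<in> set L. set u \<subseteq> {..<n} \<and> length e = length u" for L
    using that
  proof (induction L)
    case Nil
    then show ?case by (simp add: V.lin_zero[OF up_lin])
  next
    case (Cons p L)
    obtain c u where p: "p = (c, u)" by force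
    have "up g e (gw g u) = of_int (pairing C m e u) *v v" using Cons.prems p by (intro IH) auto
    then show ?case using Cons p by (simp add: V.lin_add[OF up_lin] V.lin_scale[OF up_lin] V.scale_left_distrib)
  qed
  have "up g (i # e) (gw g w) = up g e (sum_list (map (\<lambda>(c, u). of_int c *v gw g u) (lower C m i w)))"
    using lower_wd[OF p i Cons.prems(2)] by simp
  also have "\<dots> = of_int (pairing C m (i # e) w) *v v"
    using Cons.prems(2,3) lower_length lower_set by (subst L) fastforce+
  finally show ?case .
qed

lemma three_dependent:
  assumes a: "a \<in> S" "b \<in> S" "c \<in> S" and d: "V.dim S \<le> 2"
  shows "\<exists>x y z. (x ~= 0 \<or> y ~= 0 \<or> z ~= 0) \<and> x *v a + y *v b + z *v c = 0"
proof (rule ccontr)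
  assume n: "\<not> ?thesis"
  have ne: "a ~= b" "a ~= c" "b ~= c"
  proof -
    have w: "x *v a + y *v b + z *v c ~= 0" if "x ~= 0 \<or> y ~= 0 \<or> z ~= 0" for x y z using n that by blast
    show "a ~= b" using w[of 1 "-1" 0] by auto
    show "a ~= c" using w[of 1 0 "-1"] by auto
    show "b ~= c" using w[of 0 1 "-1"] by auto
  qed
  have "V.independent {a, b, c}"
  proof (rule V.independent_if_scalars_zero)
    fix f x assume s: "(\<Sum>x\<in>{a, b, c}. f x *v x) = 0" and x: "x \<in> {a, b, c}"
    have "f a *v a + f b *v b + f c *v c = 0" using s ne by (simp add: add.assoc)
    then have "f a = 0 \<and> f b = 0 \<and> f c = 0" using n by blast
    then show "f x = 0" using x by auto
  qed simp
  then have "card {a, b, c} \<le> V.dim S" using V.independent_card_le_dim[of "{a, b, c}" S] a by simp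
  then show False using ne d by simp
qed

text \<open>Words with the same letters have the same weight, so three of them satisfy a linear
  relation. Applying the raising words of the rows turns it into a relation between the columns of
  the pairing matrix.\<close>

theorem gram_contradiction:
  assumes p: "pi_data g n C m"
    and w: "set a \<subseteq> {..<n}" "set b \<subseteq> {..<n}" "set c \<subseteq> {..<n}"
    and ms: "mset b = mset a" "mset c = mset a" and det: "gram3 C m a b c ~= 0"
  shows False
proof -
  have len: "length b = length a" "length c = length a" using ms by (metis size_mset)+
  have gR: "g k \<in> R" if "k < n" for k using p that pos_R by (simp add: pi_data_def pi_system_def)
  have sl: "sum_list (map g u) = sum_list (map g a)" if "mset u = mset a" for u
    using that by (metis mset_map sum_mset_sum_list)
  let ?S = "M (\<omega> - sum_list (map g a))"
  have inS: "gw g u \<in> ?S" if "mset u = mset a" "set u \<subseteq> {..<n}" for u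
  proof -
    have "set (map g u) \<subseteq> R" using that(2) gR by auto
    from wd_M[OF this] show ?thesis unfolding sl[OF that(1)] .
  qed
  obtain x y z where xyz: "x ~= 0 \<or> y ~= 0 \<or> z ~= 0" "x *v gw g a + y *v gw g b + z *v gw g c = 0"
    using three_dependent[OF inS[OF _ w(1)] inS[OF ms(1) w(2)] inS[OF ms(2) w(3)] dim_le] by auto
  let ?P = "pairing C m"
  have eq: "x * of_int (?P e a) + y * of_int (?P e b) + z * of_int (?P e c) = 0"
    if e: "set e \<subseteq> {..<n}" "length e = length a" for e
  proof -
    have "up g e (x *v gw g a + y *v gw g b + z *v gw g c) = 0" unfolding xyz(2) by (rule V.lin_zero[OF up_lin])
    then have "(x * of_int (?P e a) + y * of_int (?P e b) + z * of_int (?P e c)) *v v = 0"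
      using up_wd[OF p e(1) w(1)] up_wd[OF p e(1) w(2)] up_wd[OF p e(1) w(3)] len e(2)
      by (simp add: V.lin_add[OF up_lin] V.lin_scale[OF up_lin] V.scale_left_distrib)
    then show ?thesis using v_nz by simp
  qed
  define A where "A i j = complex_of_int (?P i j)" for i j
  note E = eq[OF w(1) refl, folded A_def] eq[OF w(2) len(1), folded A_def] eq[OF w(3) len(2), folded A_def]
  let ?D = "A a a * (A b b * A c c - A b c * A c b) - A a b * (A b a * A c c - A b c * A c a) + A a c * (A b a * A c b - A b b * A c a)"
  have "?D = of_int (gram3 C m a b c)" by (simp add: gram3_def Let_def A_def)
  then have D: "?D ~= 0" using det by simp
  \<comment> \<open>Cramer's rule: the three relations are combined with the cofactors of each
    column.\<close>
  have "x * ?D = (x * A a a + y * A a b + z * A a c) * (A b b * A c c - A b c * A c b)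
     - (x * A b a + y * A b b + z * A b c) * (A a b * A c c - A a c * A c b)
     + (x * A c a + y * A c b + z * A c c) * (A a b * A b c - A a c * A b b)" by (simp add: algebra_simps)
  then have "x = 0" using E D by simp
  have "y * ?D = - (x * A a a + y * A a b + z * A a c) * (A b a * A c c - A b c * A c a)
     + (x * A b a + y * A b b + z * A b c) * (A a a * A c c - A a c * A c a)
     - (x * A c a + y * A c b + z * A c c) * (A a a * A b c - A a c * A b a)" by (simp add: algebra_simps)
  then have "y = 0" using E D by simp
  have "z * ?D = (x * A a a + y * A a b + z * A a c) * (A b a * A c b - A b b * A c a)
     - (x * A b a + y * A b b + z * A b c) * (A a a * A c b - A a b * A c a)
     + (x * A c a + y * A c b + z * A c c) * (A a a * A b b - A a b * A b a)" by (simp add: algebra_simps)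
  then have "z = 0" using E D by simp
  show False using xyz(1) \<open>x = 0\<close> \<open>y = 0\<close> \<open>z = 0\<close> by blast
qed

end

text \<open>Equal words are merged after each raising operator, so the list stays as short as the
  number of distinct words instead of following every expansion path. The numeric minors with long
  words are evaluated this way.\<close>

fun add_term :: "int \<times> nat list => (int \<times> nat list) list => (int \<times> nat list) list" where
  "add_term (c, u) [] = (if c = 0 then [] else [(c, u)])"
| "add_term (c, u) ((d, w) # L) = (if u = w then (if c + d = 0 then L else (c + d, w) # L) else (d, w) # add_term (c, u) L)"

primrec pairings :: "(nat => nat => int) => (nat => int) => nat list => (int \<times> nat list) list => int" where
  "pairings C m [] L = sum_list (map fst L)"
| "pairings C m (i # e) L = pairings C m e
     (foldr add_term (concat (map (\<lambda>(c, u). map (\<lambda>(d, t). (c * d, t)) (lower C m i u)) L)) [])"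

lemma pairings_eq: "pairings C m e L = sum_list (map (\<lambda>(c, u). c * pairing C m e u) L)"
proof (induction e arbitrary: L)
  case Nil
  show ?case by (induction L) auto
next
  case (Cons i e)
  let ?S = "\<lambda>L. sum_list (map (\<lambda>(c, u). c * pairing C m e u) L)"
  have add: "?S (add_term p L) = ?S [p] + ?S L" for p L
    by (induction p L rule: add_term.induct) (auto simp: algebra_simps simp flip: distrib_right)
  have fold: "?S (foldr add_term K L) = ?S K + ?S L" for K L
    by (induction K) (auto simp: add)
  have sc: "?S (map (\<lambda>(d, t). (c * d, t)) K) = c * ?S K" for c K
    by (induction K) (auto simp: algebra_simps)
  have "?S (concat (map (\<lambda>(c, u). map (\<lambda>(d, t). (c * d, t)) (lower C m i u)) L))
      = sum_list (map (\<lambda>(c, u). c * pairing C m (i # e) u) L)"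
    by (induction L) (auto simp: sc simp del: map_map)
  then show ?case using Cons fold by simp
qed

lemma gram3_pairings: "gram3 C m a b c = (let P = \<lambda>e w. pairings C m e [(1, w)] in
     P a a * (P b b * P c c - P b c * P c b) - P a b * (P b a * P c c - P b c * P c a) +
     P a c * (P b a * P c b - P b b * P c a))"
  by (simp add: gram3_def pairings_eq)

definition "mat L = (\<lambda>i j. (L :: int list list) ! i ! j)"
definition "vec L = (\<lambda>i. (L :: int list) ! i)"

lemmas gram3_simps = gram3_def Let_def mat_def vec_def
lemmas pos_intros = add_pos_nonneg mult_nonneg_nonneg add_nonneg_nonneg

text \<open>Off-diagonal entries are written \<open>- p\<close> and so on to make every parameter
  non-negative. The end labels split off as \<open>x x z z\<close>, and the remaining factor has
  positive coefficients and contains \<open>p q r s s\<close>; hence any bond strengths and a middle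
  label 0 are covered.\<close>

lemma gram_path:
  assumes "p > 0" "q > 0" "r > 0" "s > 0" "x > 0" "y \<ge> 0" "z > 0"
  shows "gram3 (mat [[2, - p, 0], [- q, 2, - r], [0, - s, 2]]) (vec [x, y, z]) [0, 1, 2] [1, 0, 2] [2, 1, 0] > 0"
proof -
  have "gram3 (mat [[2, - p, 0], [- q, 2, - r], [0, - s, 2]]) (vec [x, y, z]) [0, 1, 2] [1, 0, 2] [2, 1, 0] =
    x * x * z * z * (p * q * r * s * s + (x * y * y * p * r + x * y * p * p * r + x * y * z * p * s + x * y * p * r * s
      + x * p * p * r * s + y * y * y * q * r + 2 * y * y * p * q * r + y * p * p * q * r + y * y * z * q * s + y * z * p * q * s
      + 2 * y * y * q * r * s + 3 * y * p * q * r * s + p * p * q * r * s + y * z * q * s * s + z * p * q * s * s + y * q * r * s * s))"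
    by (simp add: gram3_def Let_def mat_def vec_def) (simp add: algebra_simps)
  also have "\<dots> > 0"
    using assms by (intro mult_pos_pos add_pos_nonneg add_nonneg_nonneg mult_nonneg_nonneg) auto
  finally show ?thesis .
qed

text \<open>The letters add up to twice the highest root, where the multiplicity reaches 3 once both
  labels are at least 2. The shift by 2 leaves non-negative coefficients and a positive constant
  term.\<close>

lemma gram_A2: "0 \<le> x ==> 0 \<le> y ==> gram3 (mat [[2, -1], [-1, 2]]) (vec [2 + x, 2 + y])
    [1, 1, 0, 0]
    [0, 1, 0, 1]
    [1, 0, 1, 0] > 0"
  by (simp add: gram3_simps) (simp add: algebra_simps, intro pos_intros; simp)

lemma gram_A3_ab: "0 \<le> x ==> gram3 (mat [[2, -1, 0], [-1, 2, -1], [0, -1, 2]]) (vec [2 + x, 1, 0])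
    [1, 0, 0, 2, 1]
    [2, 0, 1, 1, 0]
    [2, 1, 1, 0, 0] > 0"
  by (simp add: gram3_simps) (simp add: algebra_simps, intro pos_intros; simp)

lemma gram_A3_ba: "0 \<le> x ==> gram3 (mat [[2, -1, 0], [-1, 2, -1], [0, -1, 2]]) (vec [1, 2 + x, 0])
    [2, 1, 1, 0]
    [0, 2, 1, 1]
    [1, 0, 2, 1] > 0"
  by (simp add: gram3_simps) (simp add: algebra_simps, intro pos_intros; simp)

text \<open>At \<open>x = 0\<close> the letters add up to the highest weight, \<open>2, 4, 2\<close>
  in simple roots, so the minor sits on the zero weight space. The words of
  \<open>gram_A4_adj\<close>, \<open>gram_A5_mid\<close>, \<open>gram_D4_outer\<close>,
  \<open>gram_G2_short\<close>, \<open>gram_B2_long\<close>, \<open>gram_B2_short\<close>,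
  \<open>gram_B3_first\<close>, \<open>gram_B3_spin\<close>, \<open>gram_C3_1\<close>,
  \<open>gram_C3_3\<close>, \<open>gram_C4_2\<close>, \<open>gram_C5_4\<close>,
  \<open>gram_C6_6\<close> and \<open>gram_F4_1\<close> arise in the same way from the smallest
  labels of their families.\<close>

lemma gram_A3_mid: "0 \<le> x ==> gram3 (mat [[2, -1, 0], [-1, 2, -1], [0, -1, 2]]) (vec [0, 4 + x, 0])
    [1, 1, 2, 2, 0, 0, 1, 1]
    [0, 1, 2, 1, 1, 2, 0, 1]
    [2, 0, 1, 1, 0, 2, 1, 1] > 0"
  by (simp add: gram3_simps) (simp add: algebra_simps, intro pos_intros; simp)

lemma gram_A4_adj: "gram3 (mat [[2, -1, 0, 0], [-1, 2, -1, 0], [0, -1, 2, -1], [0, 0, -1, 2]]) (vec [0, 1, 1, 0])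
    [0, 1, 2, 1, 3, 2]
    [0, 1, 2, 3, 2, 1]
    [3, 2, 1, 0, 2, 1] > 0"
  unfolding gram3_pairings mat_def vec_def by code_simp

lemma gram_A4_mid: "0 \<le> x ==> gram3 (mat [[2, -1, 0, 0], [-1, 2, -1, 0], [0, -1, 2, -1], [0, 0, -1, 2]]) (vec [0, 3 + x, 0, 0])
    [3, 2, 1, 2, 0, 1, 1]
    [2, 1, 0, 1, 3, 2, 1]
    [2, 3, 0, 1, 1, 2, 1] > 0"
  by (simp add: gram3_simps) (simp add: algebra_simps, intro pos_intros; simp)

lemma gram_A5_mid: "0 \<le> x ==> gram3 (mat [[2, -1, 0, 0, 0], [-1, 2, -1, 0, 0], [0, -1, 2, -1, 0], [0, 0, -1, 2, -1], [0, 0, 0, -1, 2]]) (vec [0, 0, 2 + x, 0, 0])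
    [1, 2, 4, 3, 3, 0, 2, 1, 2]
    [3, 2, 4, 1, 2, 3, 0, 1, 2]
    [3, 2, 4, 3, 0, 1, 1, 2, 2] > 0"
  by (simp add: gram3_simps) (simp add: algebra_simps, intro pos_intros; simp)

lemma gram_D4_outer: "0 \<le> x ==> gram3 (mat [[2, -1, 0, 0], [-1, 2, -1, -1], [0, -1, 2, 0], [0, -1, 0, 2]]) (vec [2 + x, 0, 0, 0])
    [0, 1, 3, 2, 1, 0]
    [2, 1, 0, 3, 1, 0]
    [1, 2, 3, 0, 1, 0] > 0"
  by (simp add: gram3_simps)

lemma gram_G2_both: "0 \<le> x ==> gram3 (mat [[2, -1], [-3, 2]]) (vec [1 + x, 1])
    [0, 0, 1, 1, 0]
    [0, 1, 0, 0, 1]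
    [1, 0, 0, 0, 1] > 0"
  by (simp add: gram3_simps) (simp add: algebra_simps, intro pos_intros; simp)

lemma gram_G2_short: "0 \<le> x ==> gram3 (mat [[2, -1], [-3, 2]]) (vec [2 + x, 0])
    [0, 1, 0, 0, 1, 0]
    [0, 0, 1, 1, 0, 0]
    [1, 0, 0, 0, 1, 0] > 0"
  by (simp add: gram3_simps) (simp add: algebra_simps, intro pos_intros; simp)

lemma gram_B2_both: "0 \<le> x ==> 0 \<le> y ==> gram3 (mat [[2, -2], [-1, 2]]) (vec [1 + x, 2 + y])
    [0, 1, 1]
    [1, 1, 0]
    [1, 0, 1] > 0"
  by (simp add: gram3_simps) (simp add: algebra_simps, intro pos_intros; simp)

lemma gram_B2_both1: "0 \<le> x ==> gram3 (mat [[2, -2], [-1, 2]]) (vec [2 + x, 1])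
    [1, 1, 0, 0]
    [0, 1, 1, 0]
    [1, 0, 0, 1] > 0"
  by (simp add: gram3_simps) (simp add: algebra_simps, intro pos_intros; simp)

lemma gram_B2_long: "0 \<le> x ==> gram3 (mat [[2, -2], [-1, 2]]) (vec [4 + x, 0])
    [1, 1, 1, 1, 0, 0, 0, 0]
    [0, 1, 1, 0, 1, 0, 1, 0]
    [0, 1, 1, 0, 0, 1, 1, 0] > 0"
  by (simp add: gram3_simps) (simp add: algebra_simps, intro pos_intros; simp)

lemma gram_B2_short: "0 \<le> x ==> gram3 (mat [[2, -2], [-1, 2]]) (vec [0, 4 + x])
    [0, 1, 1, 0, 1, 1]
    [1, 1, 0, 0, 1, 1]
    [1, 0, 1, 1, 0, 1] > 0"
  by (simp add: gram3_simps) (simp add: algebra_simps, intro pos_intros; simp)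

lemma gram_B3_first: "0 \<le> x ==> gram3 (mat [[2, -1, 0], [-1, 2, -2], [0, -1, 2]]) (vec [2 + x, 0, 0])
    [2, 1, 0, 2, 1, 0]
    [0, 1, 2, 2, 1, 0]
    [1, 0, 2, 2, 1, 0] > 0"
  by (simp add: gram3_simps) (simp add: algebra_simps, intro pos_intros; simp)

lemma gram_B3_spin: "0 \<le> x ==> gram3 (mat [[2, -1, 0], [-1, 2, -2], [0, -1, 2]]) (vec [0, 0, 2 + x])
    [1, 2, 2, 0, 1, 2]
    [2, 1, 0, 2, 1, 2]
    [2, 0, 1, 1, 2, 2] > 0"
  by (simp add: gram3_simps) (simp add: algebra_simps, intro pos_intros; simp)

lemma gram_C3_12: "0 \<le> x ==> 0 \<le> y ==> gram3 (mat [[2, -1, 0], [-1, 2, -1], [0, -2, 2]]) (vec [1 + x, 1 + y, 0])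
    [1, 2, 1, 0]
    [2, 1, 1, 0]
    [0, 1, 2, 1] > 0"
  by (simp add: gram3_simps) (simp add: algebra_simps, intro pos_intros; simp)

lemma gram_C3_23: "gram3 (mat [[2, -1, 0], [-1, 2, -1], [0, -2, 2]]) (vec [0, 1, 1])
    [0, 1, 2, 1]
    [1, 0, 1, 2]
    [1, 0, 2, 1] > 0"
  unfolding gram3_pairings mat_def vec_def by code_simp

lemma gram_C3_1: "0 \<le> x ==> gram3 (mat [[2, -1, 0], [-1, 2, -1], [0, -2, 2]]) (vec [2 + x, 0, 0])
    [1, 2, 0, 1, 0]
    [0, 1, 2, 1, 0]
    [2, 1, 1, 0, 0] > 0"
  by (simp add: gram3_simps) (simp add: algebra_simps, intro pos_intros; simp)

lemma gram_C3_2: "0 \<le> x ==> gram3 (mat [[2, -1, 0], [-1, 2, -1], [0, -2, 2]]) (vec [0, 2 + x, 0])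
    [0, 1, 2, 1]
    [1, 0, 2, 1]
    [0, 2, 1, 1] > 0"
  by (simp add: gram3_simps) (simp add: algebra_simps, intro pos_intros; simp)

lemma gram_C3_3: "0 \<le> x ==> gram3 (mat [[2, -1, 0], [-1, 2, -1], [0, -2, 2]]) (vec [0, 0, 2 + x])
    [0, 1, 2, 1, 0, 1, 2, 1, 2]
    [1, 2, 0, 1, 2, 1, 0, 1, 2]
    [1, 2, 0, 1, 0, 1, 1, 2, 2] > 0"
  by (simp add: gram3_simps) (simp add: algebra_simps, intro pos_intros; simp)

text \<open>In the k-th fundamental representation of \<open>C_n\<close>, the weight with index
  \<open>k - 2 j\<close> has multiplicity
  \<open>binom (n - k + 2 j) j - binom (n - k + 2 j) (j - 1)\<close>. At weight zero this is 3 here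
  and 5 in both \<open>gram_C5_4\<close> and \<open>gram_C6_6\<close>, while it is 2 for the weight
  \<open>\<omega>_1\<close> below the last fundamental weight of \<open>C_5\<close>.\<close>

lemma gram_C4_2: "gram3 (mat [[2, -1, 0, 0], [-1, 2, -1, 0], [0, -1, 2, -1], [0, 0, -2, 2]]) (vec [0, 1, 0, 0])
    [2, 1, 3, 2, 0, 1]
    [1, 2, 0, 3, 2, 1]
    [0, 1, 2, 3, 2, 1] > 0"
  unfolding gram3_pairings mat_def vec_def by code_simp

lemma gram_C5_4: "gram3 (mat [[2, -1, 0, 0, 0], [-1, 2, -1, 0, 0], [0, -1, 2, -1, 0], [0, 0, -1, 2, -1], [0, 0, 0, -2, 2]]) (vec [0, 0, 0, 1, 0])
    [1, 3, 2, 2, 0, 1, 4, 3, 3, 4, 2, 3]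
    [0, 2, 1, 1, 3, 4, 3, 2, 2, 3, 4, 3]
    [3, 0, 2, 1, 1, 4, 3, 2, 2, 3, 4, 3] > 0"
  unfolding gram3_pairings mat_def vec_def by code_simp

lemma gram_C6_6: "gram3 (mat [[2, -1, 0, 0, 0, 0], [-1, 2, -1, 0, 0, 0], [0, -1, 2, -1, 0, 0], [0, 0, -1, 2, -1, 0], [0, 0, 0, -1, 2, -1], [0, 0, 0, 0, -2, 2]]) (vec [0, 0, 0, 0, 0, 1])
    [3, 2, 1, 0, 4, 5, 4, 1, 3, 2, 2, 4, 3, 3, 5, 4, 4, 5]
    [0, 1, 2, 1, 3, 4, 3, 2, 2, 5, 4, 4, 5, 3, 3, 4, 4, 5]
    [3, 2, 4, 1, 0, 2, 1, 3, 5, 2, 4, 4, 3, 3, 5, 4, 4, 5] > 0"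
  unfolding gram3_pairings mat_def vec_def by code_simp

lemma gram_F4_1: "gram3 (mat [[2, -1, 0, 0], [-1, 2, -2, 0], [0, -1, 2, -1], [0, 0, -1, 2]]) (vec [1, 0, 0, 0])
    [1, 2, 2, 3, 3, 0, 1, 2, 2, 1, 0]
    [3, 2, 1, 2, 3, 0, 1, 2, 2, 1, 0]
    [0, 1, 2, 2, 3, 3, 1, 2, 2, 1, 0] > 0"
  unfolding gram3_pairings mat_def vec_def by code_simp

lemma gram_F4_3: "gram3 (mat [[2, -1, 0, 0], [-1, 2, -2, 0], [0, -1, 2, -1], [0, 0, -1, 2]]) (vec [0, 0, 1, 0])
    [0, 1, 2, 2, 3, 1, 2]
    [2, 3, 1, 2, 0, 1, 2]
    [3, 2, 1, 0, 2, 1, 2] > 0"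
  unfolding gram3_pairings mat_def vec_def by code_simp

section \<open>Dynkin diagrams: chains, cycles and branch nodes\<close>

section \<open>Chains of simple roots\<close>

context hwm
begin

lemma cmb_units: "a \<in> D ==> b \<in> D ==> cmb (\<lambda>g. unit a g - unit b g) = a - b"
  unfolding cmb_diff[symmetric] by (simp only: cmb_unit)

lemma simple_diff: assumes "a \<in> D" "b \<in> D" "a ~= b" shows "a - b \<notin> R"
proof -
  have "cmb (\<lambda>g. unit a g - unit b g) \<notin> R"
    by (rule mixed_not_root[OF assms(1,2)]) (use assms(3) in "auto simp: unit_def")
  then show ?thesis unfolding cmb_units[OF assms(1,2)] .
qed

lemma DR: "a \<in> D ==> a \<in> R" using D_R by blast

lemma string_minus: assumes "g \<in> R" "d \<in> R" "pr g d > 0" "g ~= d" shows "g - d \<in> R"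
  using string[OF assms(1) R_neg[OF assms(2)]] assms by (simp add: pr_neg)

lemma pr_simple: assumes "a \<in> D" "b \<in> D" "a ~= b" shows "pr a b \<le> 0"
  using string_minus[OF DR[OF assms(1)] DR[OF assms(2)]] simple_diff[OF assms] assms(3) by force

lemma pr_adj: assumes "a \<in> D" "b \<in> D" "a ~= b" "pr a b ~= 0" shows "pr a b \<le> -1"
proof -
  obtain k where k: "pr a b = real_of_int k" using pr_int[OF DR DR] assms(1,2) Ints_cases by metis
  then have "k < 0" using pr_simple[OF assms(1-3)] assms(4) by simp
  then show ?thesis using k by simp
qed

lemma pr_sym0: assumes "a \<in> D" "b \<in> D" shows "pr a b = 0 \<longleftrightarrow> pr b a = 0"
  using pr_sgn(1)[OF DR DR] assms by blast

text \<open>The form would be non-positive on the combination with coefficients \<open>n\<close>.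
  Distinct simple roots pair non-positively, so the row of \<open>a\<close> may be tested on any
  subset \<open>T\<close> containing \<open>a\<close>; the omitted terms only lower it.\<close>

lemma neg_form:
  fixes n :: "'w => real"
  assumes S: "S \<subseteq> D" and n: "!!a. a \<in> S ==> n a > 0" "S ~= {}"
    and le: "!!a. a \<in> S ==> \<exists>T\<subseteq>S. a \<in> T \<and> (\<Sum>b\<in>T. n b * pr b a) \<le> 0"
  shows False
proof -
  define m where "m a = (if a \<in> S then n a else 0)" for a
  obtain a0 where a0: "a0 \<in> S" using n(2) by blast
  have fS: "finite S" using S finD finite_subset by blast
  have sum_le: "(\<Sum>b\<in>S. n b * pr b a) \<le> 0" if a: "a \<in> S" for a
  proof -
    obtain T where T: "T \<subseteq> S" "a \<in> T" "(\<Sum>b\<in>T. n b * pr b a) \<le> 0" using le[OF a] by blast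
    have "(\<Sum>b\<in>S. n b * pr b a) = (\<Sum>b\<in>T. n b * pr b a) + (\<Sum>b\<in>S-T. n b * pr b a)"
      using sum.subset_diff[OF T(1) fS, of "\<lambda>b. n b * pr b a"] by simp
    moreover have "(\<Sum>b\<in>S-T. n b * pr b a) \<le> 0"
    proof (rule sum_nonpos)
      fix b assume b: "b \<in> S - T"
      then have "pr b a \<le> 0" using pr_simple[of b a] S a T by blast
      then show "n b * pr b a \<le> 0" using n(1)[of b] b by (simp add: mult_nonneg_nonpos)
    qed
    ultimately show ?thesis using T(3) by linarith
  qed
  have "(\<Sum>a\<in>D. \<Sum>b\<in>D. m a * m b * ip a b) = (\<Sum>a\<in>S. \<Sum>b\<in>S. m a * m b * ip a b)"
  proof (rule sum.mono_neutral_cong_right[OF finD S])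
    show "\<forall>i\<in>D - S. (\<Sum>b\<in>D. m i * m b * ip i b) = 0" by (simp add: m_def)
    fix a assume "a \<in> S"
    show "(\<Sum>b\<in>D. m a * m b * ip a b) = (\<Sum>b\<in>S. m a * m b * ip a b)"
      by (rule sum.mono_neutral_right[OF finD S]) (simp add: m_def)
  qed
  also have "\<dots> \<le> 0"
  proof (rule sum_nonpos)
    fix a assume a: "a \<in> S"
    then have aR: "a \<in> R" using S D_R by blast
    have "(\<Sum>b\<in>S. m a * m b * ip a b) = n a * (ip a a / 2) * (\<Sum>b\<in>S. n b * pr b a)"
      unfolding sum_distrib_left
    proof (rule sum.cong)
      fix b assume "b \<in> S"
      then show "m a * m b * ip a b = n a * (ip a a / 2) * (n b * pr b a)"
        using ip_pr[OF aR, of b] a by (simp add: m_def ip_sym[of a b] mult.commute)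
    qed simp
    also have "\<dots> \<le> 0" using sum_le[OF a] n(1)[OF a] ip_pos[OF aR] by (intro mult_nonneg_nonpos) auto
    finally show "(\<Sum>b\<in>S. m a * m b * ip a b) \<le> 0" .
  qed
  finally show False using ip_form_pos[of a0 m] a0 S n(1)[OF a0] by (auto simp: m_def)
qed

lemma bond_lt_4: assumes "r \<in> D" "t \<in> D" "r ~= t" shows "pr r t * pr t r < 4"
proof (rule ccontr)
  assume ge: "\<not> ?thesis"
  then have nz: "pr t r ~= 0" by auto
  \<comment> \<open>The weight of \<open>r\<close> makes its own row vanish; the row of
    \<open>t\<close> becomes \<open>4 - pr r t * pr t r\<close>.\<close>
  let ?n = "\<lambda>g. if g = r then - pr t r else 2"
  show False
  proof (rule neg_form[of "{r, t}" ?n])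
    fix a assume "a \<in> {r, t}"
    moreover have "(\<Sum>b\<in>{r, t}. ?n b * pr b r) \<le> 0" using assms pr_self DR by simp
    moreover have "(\<Sum>b\<in>{r, t}. ?n b * pr b t) \<le> 0" using assms pr_self DR ge by (simp add: mult.commute)
    ultimately show "\<exists>T\<subseteq>{r, t}. a \<in> T \<and> (\<Sum>b\<in>T. ?n b * pr b a) \<le> 0" by blast
  qed (use assms pr_simple[OF assms(2,1)] nz in auto)
qed

definition chain :: "(nat => 'w) => nat => bool" where
  "chain p n \<longleftrightarrow> (\<forall>i<n. p i \<in> D) \<and> inj_on p {..<n} \<and> (\<forall>i. Suc i < n \<longrightarrow> pr (p i) (p (Suc i)) ~= 0)"

lemma chain_D: "chain p n ==> i < n ==> p i \<in> D" by (simp add: chain_def)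

lemma chain_R: "chain p n ==> i < n ==> p i \<in> R" using chain_D DR by blast

lemma chain_inj: "chain p n ==> i < n ==> j < n ==> p i = p j \<longleftrightarrow> i = j"
  unfolding chain_def inj_on_def by blast

lemma chain_adj:
  assumes c: "chain p n" and i: "Suc i < n"
  shows "pr (p i) (p (Suc i)) \<le> -1" "pr (p (Suc i)) (p i) \<le> -1"
proof -
  have d: "p i \<in> D" "p (Suc i) \<in> D" "p i ~= p (Suc i)"
    using chain_D[OF c] chain_inj[OF c, of i "Suc i"] i by auto
  have "pr (p i) (p (Suc i)) ~= 0" using c i by (simp add: chain_def)
  then show "pr (p i) (p (Suc i)) \<le> -1" "pr (p (Suc i)) (p i) \<le> -1"
    using pr_adj[OF d] pr_adj[OF d(2,1)] d(3) pr_sym0[OF d(1,2)] by auto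
qed

lemma chain_self: "chain p n ==> i < n ==> pr (p i) (p i) = 2" using chain_R pr_self by blast

lemma chain_sub: assumes "chain p n" "k + m \<le> n" shows "chain (\<lambda>i. p (k + i)) m"
  unfolding chain_def
proof (intro conjI allI impI)
  show "inj_on (\<lambda>i. p (k + i)) {..<m}"
    by (rule inj_onI) (use chain_inj[OF assms(1)] assms(2) in auto)
qed (use assms in "auto simp: chain_def")

lemma chain_rev: assumes c: "chain p n" shows "chain (\<lambda>i. p (n - Suc i)) n"
  unfolding chain_def
proof (intro conjI allI impI)
  show "p (n - Suc i) \<in> D" if "i < n" for i using chain_D[OF c] that by simp
  show "inj_on (\<lambda>i. p (n - Suc i)) {..<n}"
    by (rule inj_onI) (use chain_inj[OF c] in auto)
  fix i assume i: "Suc i < n"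
  then have "Suc (n - Suc (Suc i)) = n - Suc i" by simp
  then show "pr (p (n - Suc i)) (p (n - Suc (Suc i))) ~= 0"
    using chain_adj(2)[OF c, of "n - Suc (Suc i)"] i by simp
qed

lemma chain_extend:
  assumes c: "chain p n" and e: "e \<in> D" "e \<notin> p ` {..<n}" and a: "n > 0 ==> pr (p (n - 1)) e ~= 0"
  shows "chain (p(n := e)) (Suc n)"
  unfolding chain_def
proof (intro conjI allI impI)
  show "(p(n := e)) i \<in> D" if "i < Suc n" for i using chain_D[OF c] e that by (auto simp: less_Suc_eq)
  show "inj_on (p(n := e)) {..<Suc n}"
    using c e(2) unfolding chain_def inj_on_def by (force simp: less_Suc_eq)
  fix i assume "Suc i < Suc n"
  then show "pr ((p(n := e)) i) ((p(n := e)) (Suc i)) ~= 0"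
    using chain_adj(1)[OF c, of i] a by (cases "Suc i = n") auto
qed

text \<open>A closing bond gives the affine diagram of type A. With all marks 1, each row is at most
  \<open>2 - 1 - 1\<close>.\<close>

lemma chain_cycle: assumes c: "chain p n" and n: "n \<ge> 3" shows "pr (p 0) (p (n - 1)) = 0"
proof (rule ccontr)
  assume cl: "pr (p 0) (p (n - 1)) ~= 0"
  have cl': "pr (p 0) (p (n - 1)) \<le> -1" "pr (p (n - 1)) (p 0) \<le> -1"
    using pr_adj[of "p 0" "p (n - 1)"] pr_adj[of "p (n - 1)" "p 0"] cl pr_sym0[of "p 0" "p (n - 1)"]
      chain_D[OF c] chain_inj[OF c, of 0 "n - 1"] n by auto
  define s where "s i = (if Suc i = n then 0 else Suc i)" for i
  define t where "t i = (if i = 0 then n - 1 else i - 1)" for i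
  show False
  proof (rule neg_form[of "p ` {..<n}" "\<lambda>_. 1"])
    fix a assume "a \<in> p ` {..<n}"
    then obtain i where i: "i < n" "a = p i" by blast
    have st: "s i < n" "t i < n" "s i ~= i" "t i ~= i" "s i ~= t i" using i(1) n by (auto simp: s_def t_def)
    have a1: "pr (p (s i)) (p i) \<le> -1"
      using cl'(1) chain_adj(2)[OF c, of i] i by (cases "Suc i = n") (auto simp: s_def)
    have a2: "pr (p (t i)) (p i) \<le> -1"
      using cl'(2) chain_adj(1)[OF c, of "i - 1"] i by (cases "i = 0") (auto simp: t_def)
    have "(\<Sum>b\<in>{p i, p (s i), p (t i)}. 1 * pr b a) = pr (p i) (p i) + (pr (p (s i)) (p i) + pr (p (t i)) (p i))"
      using chain_inj[OF c] st i by simp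
    then have "(\<Sum>b\<in>{p i, p (s i), p (t i)}. 1 * pr b a) \<le> 0" using a1 a2 chain_self[OF c i(1)] by simp
    then show "\<exists>T\<subseteq>p ` {..<n}. a \<in> T \<and> (\<Sum>b\<in>T. 1 * pr b a) \<le> 0"
      using i st by (intro exI[of _ "{p i, p (s i), p (t i)}"]) auto
  qed (use chain_D[OF c] n in "auto simp: lessThan_empty_iff")
qed

lemma chain_far: assumes c: "chain p n" and ij: "Suc i < j" "j < n" shows "pr (p i) (p j) = 0" "pr (p j) (p i) = 0"
proof -
  have "chain (\<lambda>k. p (i + k)) (Suc (j - i))" by (rule chain_sub[OF c]) (use ij in simp)
  from chain_cycle[OF this] show e: "pr (p i) (p j) = 0" using ij by simp
  then show "pr (p j) (p i) = 0" using pr_sym0 chain_D[OF c] ij by simp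
qed

text \<open>Two bonds from the chain to \<open>e\<close> would close a cycle through
  \<open>e\<close>.\<close>

lemma chain_outside:
  assumes c: "chain p n" and e: "e \<in> D" "e \<notin> p ` {..<n}" and ij: "i < j" "j < n" and a: "pr (p i) e ~= 0"
  shows "pr (p j) e = 0"
proof (rule ccontr)
  assume b: "pr (p j) e ~= 0"
  let ?q = "\<lambda>k. p (i + k)" and ?m = "Suc (j - i)"
  have q: "chain ?q ?m" by (rule chain_sub[OF c]) (use ij in simp)
  have "e \<notin> ?q ` {..<?m}" using e(2) ij by auto
  then have x: "chain (?q(?m := e)) (Suc ?m)" using e(1) b ij by (intro chain_extend[OF q]) auto
  have "Suc ?m \<ge> 3" using ij by simp
  from chain_cycle[OF x this] show False using a by simp
qed

lemma chain_outside':
  assumes c: "chain p n" and e: "e \<in> D" "e \<notin> p ` {..<n}" and ij: "i ~= j" "i < n" "j < n" and a: "pr (p i) e ~= 0"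
  shows "pr (p j) e = 0"
  using chain_outside[OF c e] ij a by (metis linorder_neqE_nat)

text \<open>The nodes reachable by chains from \<open>a\<close> are closed under bonds, so
  \<open>conn\<close> forces them to exhaust \<open>D\<close>. Reaching a node already on a chain
  just truncates that chain.\<close>

lemma chain_connect:
  assumes a: "a \<in> D" "b \<in> D"
  obtains p n where "chain p n" "n > 0" "p 0 = a" "p (n - 1) = b"
proof -
  define A where "A = {x. \<exists>p n. chain p n \<and> n > 0 \<and> p 0 = a \<and> p (n - 1) = x}"
  have AD: "A \<subseteq> D" using chain_D by (fastforce simp: A_def)
  have "chain (\<lambda>_. a) 1" using a by (simp add: chain_def inj_on_def)
  then have aA: "a \<in> A" unfolding A_def using zero_less_one by blast
  have "D - A = {}"
  proof (rule ccontr)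
    assume ne: "D - A ~= {}"
    have "\<exists>x\<in>A. \<exists>y\<in>D - A. pr x y ~= 0"
      by (rule conn) (use AD aA ne in auto)
    then obtain x y where xy: "x \<in> A" "y \<in> D" "y \<notin> A" "pr x y ~= 0" by blast
    obtain p n where p: "chain p n" "n > 0" "p 0 = a" "p (n - 1) = x" using xy(1) unfolding A_def by blast
    show False
    proof (cases "y \<in> p ` {..<n}")
      case True
      then obtain j where j: "j < n" "y = p j" by blast
      have "chain (\<lambda>i. p (0 + i)) (Suc j)" by (rule chain_sub[OF p(1)]) (use j in simp)
      then have "chain p (Suc j)" by simp
      then have "y \<in> A" unfolding A_def using p(3) j(2) by force
      then show False using xy(3) by blast
    next
      case False
      have "chain (p(n := y)) (Suc n)" by (rule chain_extend[OF p(1) xy(2) False]) (use p xy in simp)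
      moreover have "(p(n := y)) 0 = a" "(p(n := y)) (Suc n - 1) = y" using p by auto
      ultimately have "y \<in> A" unfolding A_def by blast
      then show False using xy(3) by blast
    qed
  qed
  then have "b \<in> A" using a(2) by blast
  then show thesis using that unfolding A_def by blast
qed

lemma chain_card: "chain p n ==> n \<le> card D"
  using card_inj_on_le[of p "{..<n}" D] finD by (auto simp: chain_def)

text \<open>A longest chain either covers \<open>D\<close>, or connectivity attaches an outside root
  to one of its nodes. By maximality this is not an end node, so it has three neighbours.\<close>

lemma chain_or_branch:
  assumes ne: "D ~= {}"
  obtains (chain) p n where "chain p n" "p ` {..<n} = D" "n > 0"
  | (branch) t a b c where "t \<in> D" "a \<in> D" "b \<in> D" "c \<in> D" "distinct [t, a, b, c]" "pr t a ~= 0" "pr t b ~= 0" "pr t c ~= 0"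
proof -
  obtain s where s: "s \<in> D" using ne by blast
  let ?P = "\<lambda>n. \<exists>p. chain p n"
  have P1: "?P 1" using s by (intro exI[of _ "\<lambda>_. s"]) (simp add: chain_def inj_on_def)
  define n where "n = (GREATEST n. ?P n)"
  have bd: "\<forall>y. ?P y \<longrightarrow> y \<le> card D" using chain_card by blast
  have Pn: "?P n" unfolding n_def by (rule GreatestI_nat[of ?P, OF P1]) (use bd in blast)
  have mx: "m \<le> n" if "?P m" for m unfolding n_def by (rule Greatest_le_nat[of ?P, OF that]) (use bd in blast)
  have n0: "n > 0" using mx[OF P1] by simp
  obtain p where p: "chain p n" using Pn by blast
  have pD: "p ` {..<n} \<subseteq> D" using chain_D[OF p] by blast
  show thesis
  proof (cases "p ` {..<n} = D")
    case True
    then show thesis using chain[OF p _ n0] by blast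
  next
    case False
    have "\<exists>x\<in>p ` {..<n}. \<exists>e\<in>D - p ` {..<n}. pr x e ~= 0"
      by (rule conn) (use False pD n0 in "auto simp: lessThan_empty_iff")
    then obtain i e where i: "i < n" "e \<in> D" "e \<notin> p ` {..<n}" "pr (p i) e ~= 0" by blast
    have "i ~= n - 1"
    proof
      assume "i = n - 1"
      then have "chain (p(n := e)) (Suc n)" using i by (intro chain_extend[OF p]) auto
      then show False using mx by force
    qed
    moreover have "i ~= 0"
    proof
      assume i0: "i = 0"
      let ?q = "\<lambda>i. p (n - Suc i)"
      have "e \<notin> ?q ` {..<n}" using i(3) by auto
      then have "chain (?q(n := e)) (Suc n)" using i i0 n0 by (intro chain_extend[OF chain_rev[OF p]]) auto
      then show False using mx by force
    qed
    ultimately have ii: "Suc i < n" "Suc (i - 1) = i" "i - 1 < n" using i(1) by auto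
    show thesis
    proof (rule branch[of "p i" e "p (i - 1)" "p (Suc i)"])
      show "distinct [p i, e, p (i - 1), p (Suc i)]" using i chain_inj[OF p] ii by auto
      show "pr (p i) (p (i - 1)) ~= 0" using chain_adj(2)[OF p, of "i - 1"] ii i(1) by simp
      show "pr (p i) (p (Suc i)) ~= 0" using chain_adj(1)[OF p, of i] ii by simp
    qed (use i ii chain_D[OF p] in auto)
  qed
qed

section \<open>Upper bounds: weights below the highest weight\<close>

section \<open>Weights below the highest weight\<close>

text \<open>When a weight vector is split along the spanning family, the part with other weights is
  itself of the given weight, and independence of the weight spaces makes it 0.\<close>

lemma spanning_weight_vectors:
  assumes u: "!!i. i \<in> I ==> u i \<in> M (\<omega> - cmb (k i))" and sp: "V.span (u ` I) = UNIV"
  shows "M (\<omega> - cmb c) \<subseteq> V.span (u ` {i \<in> I. cmb (k i) = cmb c})"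
proof
  fix x assume x: "x \<in> M (\<omega> - cmb c)"
  let ?J = "{i \<in> I. cmb (k i) = cmb c}" and ?E = "{\<omega> - cmb c |c. True}"
  let ?K = "?E - {\<omega> - cmb c}"
  have "u ` I = u ` ?J \<union> u ` (I - ?J)" by auto
  then have "x \<in> V.span (u ` ?J \<union> u ` (I - ?J))" using sp by simp
  then obtain a b where ab: "x = a + b" "a \<in> V.span (u ` ?J)" "b \<in> V.span (u ` (I - ?J))"
    unfolding V.span_Un by blast
  have "u ` ?J \<subseteq> M (\<omega> - cmb c)" using u by force
  then have "a \<in> M (\<omega> - cmb c)" using ab(2) V.span_minimal[OF _ M_sub] by blast
  then have bM: "b \<in> M (\<omega> - cmb c)" using V.subspace_diff[OF M_sub x] ab(1) by force
  have "u ` (I - ?J) \<subseteq> (\<Union>n\<in>?K. M n)"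
  proof
    fix y assume "y \<in> u ` (I - ?J)"
    then obtain i where i: "i \<in> I" "cmb (k i) ~= cmb c" "y = u i" by blast
    have "\<omega> - cmb (k i) ~= \<omega> - cmb c" using i(2) by simp
    then have "\<omega> - cmb (k i) \<in> ?K" by blast
    then show "y \<in> (\<Union>n\<in>?K. M n)" using u[OF i(1)] i(3) by blast
  qed
  then have "b \<in> V.span (\<Union>n\<in>?K. M n)" using ab(3) V.span_mono by blast
  then have "b = 0"
    by (intro V.indep_span_disjoint[OF M_indep M_sub _ _ _ bM, of ?K]) blast+
  then show "x \<in> V.span (u ` ?J)" using ab by simp
qed

lemma sum_list_cmb: "set w \<subseteq> D ==> sum_list w = cmb (\<lambda>a. int (count_list w a))"
proof (induction w)
  case (Cons b w)
  have "cmb (\<lambda>a. int (count_list (b # w) a)) = cmb (\<lambda>a. unit b a + int (count_list w a))"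
    by (rule sum.cong) (auto simp: unit_def)
  also have "\<dots> = b + sum_list w" unfolding cmb_add[symmetric] using Cons cmb_unit by simp
  finally show ?case by simp
qed simp

lemma words_UNIV: "V.span (wd ` {w. set w \<subseteq> D}) = UNIV"
proof (rule gen)
  let ?S = "wd ` {w. set w \<subseteq> D}"
  have "wd [] \<in> ?S" by (rule imageI) simp
  then show "v \<in> V.span ?S" using V.span_base by simp
  fix r x assume a: "r \<in> D" and x: "x \<in> V.span ?S"
  show "X (- r) x \<in> V.span ?S"
  proof (rule V.lin_span_image[OF X_lin _ V.subspace_span x])
    fix y assume "y \<in> ?S"
    then obtain w where w: "set w \<subseteq> D" "y = wd w" by blast
    then have "X (- r) y = wd (r # w)" "set (r # w) \<subseteq> D" using a by simp_all
    then have "X (- r) y \<in> ?S" by blast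
    then show "X (- r) y \<in> V.span ?S" by (rule V.span_base)
  qed
qed (rule V.subspace_span)

definition wm :: "('w => int) => nat" where "wm c = V.dim (M (\<omega> - cmb c))"

lemma M_words: "M (\<omega> - cmb c) \<subseteq> V.span (wd ` {w \<in> {w. set w \<subseteq> D}. cmb (\<lambda>a. int (count_list w a)) = cmb c})"
proof (rule spanning_weight_vectors[OF _ words_UNIV])
  fix w assume "w \<in> {w. set w \<subseteq> D}"
  then have w: "set w \<subseteq> D" by simp
  have "set w \<subseteq> R" using w D_R by blast
  from wd_M[OF this] show "wd w \<in> M (\<omega> - cmb (\<lambda>a. int (count_list w a)))" unfolding sum_list_cmb[OF w] .
qed

lemma mult_neg: assumes a: "r \<in> D" "c r < 0" shows "wm c = 0"
proof -
  let ?W = "{w \<in> {w. set w \<subseteq> D}. cmb (\<lambda>a. int (count_list w a)) = cmb c}"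
  have "?W = {}"
  proof (rule ccontr)
    assume "?W ~= {}"
    then obtain w where "cmb (\<lambda>a. int (count_list w a)) = cmb c" by blast
    from cmb_indep[OF this a(1)] show False using a(2) by simp
  qed
  then have "V.span (wd ` ?W) = {0}" by (simp only: image_empty V.span_empty)
  then have "M (\<omega> - cmb c) \<subseteq> {0}" using M_words[of c] by (simp only:)
  then show ?thesis by (simp add: wm_def)
qed

lemma mult_cong: "(!!a. a \<in> D ==> c a = d a) ==> wm c = wm d"
proof -
  assume "!!a. a \<in> D ==> c a = d a"
  then have "cmb c = cmb d" by (intro sum.cong) auto
  then show ?thesis unfolding wm_def by (rule arg_cong)
qed

lemma mult_0: assumes z: "!!a. a \<in> D ==> c a = 0" shows "wm c \<le> 1"
proof -
  have e: "cmb c = cmb (\<lambda>_. 0)" by (rule sum.cong) (auto simp: z)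
  have "{w \<in> {w. set w \<subseteq> D}. cmb (\<lambda>a. int (count_list w a)) = cmb c} \<subseteq> {[]}"
  proof clarify
    fix w assume w: "set w \<subseteq> D" "cmb (\<lambda>a. int (count_list w a)) = cmb c"
    have "count_list w a = 0" if "a \<in> D" for a using cmb_indep[OF w(2) that] z[OF that] by simp
    then show "w = []" using w(1) by (cases w) fastforce+
  qed
  then have "wd ` {w \<in> {w. set w \<subseteq> D}. cmb (\<lambda>a. int (count_list w a)) = cmb c} \<subseteq> {v}" by auto
  then have "M (\<omega> - cmb c) \<subseteq> V.span {v}" using M_words[of c] V.span_mono by blast
  then show ?thesis unfolding wm_def using V.dim_le_card[of "M (\<omega> - cmb c)" "{v}"] by simp
qed

lemma mult_2: "wm c \<le> 2" unfolding wm_def by (rule dim_le)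

lemma shift: assumes "r = cmb g" shows "\<omega> - cmb c - of_int k * r = \<omega> - cmb (\<lambda>a. c a + k * g a)"
  unfolding assms cmb_mult diff_diff_add cmb_add ..

lemma mult_reflect:
  assumes g: "r \<in> R" "r = cmb g" and k: "pr (\<omega> - cmb c) r = real_of_int k"
  shows "wm c \<le> wm (\<lambda>a. c a + k * g a)"
  using weight_dim_reflect[OF g(1) k] unfolding shift[OF g(2)] wm_def .

lemma mult_reflect_simple:
  assumes a: "r \<in> D" and k: "pr (\<omega> - cmb c) r = real_of_int k"
  shows "wm c \<le> wm (c(r := c r + k))"
proof -
  have "wm c \<le> wm (\<lambda>a. c a + k * unit r a)"
    by (rule mult_reflect[OF DR[OF a] cmb_unit[OF a, symmetric] k])
  also have "(\<lambda>a. c a + k * unit r a) = c(r := c r + k)" by (rule ext) (simp add: unit_def)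
  finally show ?thesis .
qed

lemma cmb_upd: assumes a: "r \<in> D" shows "cmb (c(r := k)) = cmb c - of_int (c r - k) * r"
proof -
  have "cmb (c(r := k)) = cmb (\<lambda>a. c a - (c r - k) * unit r a)" by (rule sum.cong) (auto simp: unit_def)
  also have "\<dots> = cmb c - of_int (c r - k) * cmb (unit r)" unfolding cmb_diff[symmetric] cmb_mult ..
  finally show ?thesis unfolding cmb_unit[OF a] .
qed

lemma raise_M: assumes a: "r \<in> D" and x: "x \<in> M (\<omega> - cmb c)" shows "X r x \<in> M (\<omega> - cmb (c(r := c r - 1)))"
proof -
  have "\<omega> - cmb (c(r := c r - 1)) = \<omega> - cmb c + r" unfolding cmb_upd[OF a] by simp
  from X_M[OF DR[OF a] x, folded this] show ?thesis .
qed

lemma mult_zeroD: assumes "wm c = 0" "x \<in> M (\<omega> - cmb c)" shows "x = 0"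
proof -
  have "M (\<omega> - cmb c) \<subseteq> {0}" using assms(1) unfolding wm_def V.dim_eq_0 .
  then show ?thesis using assms(2) by blast
qed

text \<open>A vector killed by \<open>X r0\<close> is killed by every simple raising operator, the
  other raised weight spaces being zero, so \<open>prim\<close> would place it at
  \<open>\<omega>\<close>. Hence \<open>X r0\<close> is injective.\<close>

lemma mult_up:
  assumes nz: "b \<in> D" "c b ~= 0" and a: "!!r. r \<in> D ==> r ~= r0 ==> wm (c(r := c r - 1)) = 0" and a0: "r0 \<in> D"
  shows "wm c \<le> wm (c(r0 := c r0 - 1))"
proof (cases "\<forall>r\<in>D. c r \<ge> 0")
  case False
  then obtain r where "r \<in> D" "c r < 0" by force
  then have "wm c = 0" by (rule mult_neg)
  then show ?thesis by simp
next
  case True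
  show ?thesis unfolding wm_def
  proof (rule V.inj_dim_le[OF X_lin[of r0] M_sub])
    fix x assume x: "x \<in> M (\<omega> - cmb c)"
    show "X r0 x \<in> M (\<omega> - cmb (c(r0 := c r0 - 1)))" by (rule raise_M[OF a0 x])
    assume z: "X r0 x = 0"
    show "x = 0"
    proof (rule ccontr)
      assume x0: "x ~= 0"
      have "cmb c = 0"
      proof (rule prim[OF x x0])
        fix r assume al: "r \<in> D"
        show "X r x = 0" using z mult_zeroD[OF a[OF al] raise_M[OF al x]] by (cases "r = r0") auto
      qed (use True in blast)
      then have "cmb c = cmb (\<lambda>_. 0)" by simp
      from cmb_indep[OF this nz(1)] show False using nz(2) by simp
    qed
  qed
qed

lemma label_int: assumes "a \<in> D" shows "pr \<omega> a = real_of_int \<lfloor>pr \<omega> a\<rfloor>" "pr \<omega> a \<ge> 0"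
  using label_nat[OF D_pos[OF assms]] by auto

lemma pr_cmb_int: assumes "g \<in> R" shows "\<exists>k. pr (cmb c) g = real_of_int k"
proof -
  have "pr (cmb c) g \<in> \<int>" unfolding pr_cmb by (intro Ints_sum Ints_mult Ints_of_int pr_int DR assms)
  then show ?thesis by (auto elim: Ints_cases)
qed

lemma pr_weight_int: assumes "a \<in> D" shows "\<exists>k. pr (\<omega> - cmb c) a = real_of_int k"
proof -
  obtain k where "pr (cmb c) a = real_of_int k" using pr_cmb_int[OF DR[OF assms]] by blast
  then have "pr (\<omega> - cmb c) a = real_of_int (\<lfloor>pr \<omega> a\<rfloor> - k)" using label_int(1)[OF assms] unfolding pr_diff by simp
  then show ?thesis by blast
qed

text \<open>Take \<open>c\<close> of least height among the weights of multiplicity 2. A negative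
  pairing with a simple root would reflect it to a smaller height without lowering the
  multiplicity.\<close>

lemma dominant_mult_2:
  obtains c where "wm c = 2" "!!r. c r \<ge> 0" "\<exists>r\<in>D. c r ~= 0"
    "!!r. r \<in> D ==> pr (cmb c) r \<le> pr \<omega> r"
    "!!r. r \<in> D ==> wm (c(r := c r - 1)) \<le> 1"
proof -
  have nn: "c r \<ge> 0" if "wm c > 0" "r \<in> D" for c r using that mult_neg[of r c] by force
  define h where "h c = nat (\<Sum>r\<in>D. c r)" for c :: "'w => int"
  have "\<exists>c. wm c = 2" using dim_2 unfolding wm_def .
  then obtain c where c: "wm c = 2" and mn: "!!d. wm d = 2 ==> h c \<le> h d"
    using ex_has_least_nat[of "\<lambda>c. wm c = 2" _ h] by blast
  have lower: "h (c(r := k)) < h c" if "r \<in> D" "k < c r" "k \<ge> 0" for r k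
  proof -
    have "(\<Sum>a\<in>D. (c(r := k)) a) = k + (\<Sum>a\<in>D - {r}. c a)"
      using finD that(1) by (simp add: sum.remove[of D r])
    moreover have "(\<Sum>a\<in>D. c a) = c r + (\<Sum>a\<in>D - {r}. c a)"
      using finD that(1) by (simp add: sum.remove[of D r])
    moreover have "(\<Sum>a\<in>D - {r}. c a) \<ge> 0" using nn c by (intro sum_nonneg) auto
    ultimately show ?thesis using that unfolding h_def by simp
  qed
  have low1: "wm (c(r := k)) \<le> 1" if "r \<in> D" "k < c r" for r k
  proof (cases "k \<ge> 0")
    case True
    then show ?thesis using mn[of "c(r := k)"] lower[OF that] mult_2[of "c(r := k)"] by linarith
  next
    case False
    then show ?thesis using mult_neg[OF that(1), of "c(r := k)"] by simp
  qed
  have dom: "pr (cmb c) r \<le> pr \<omega> r" if a: "r \<in> D" for r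
  proof (rule ccontr)
    assume "\<not> ?thesis"
    then have neg: "pr (\<omega> - cmb c) r < 0" unfolding pr_diff by simp
    obtain k where k: "pr (\<omega> - cmb c) r = real_of_int k" using pr_weight_int[OF a] by blast
    have "wm c \<le> wm (c(r := c r + k))" by (rule mult_reflect_simple[OF a k])
    moreover have "wm (c(r := c r + k)) \<le> 1" using neg k by (intro low1[OF a]) simp
    ultimately show False using c by simp
  qed
  \<comment> \<open>Values outside \<open>D\<close> do not enter \<open>cmb\<close>; setting them to
    0 makes the coefficients non-negative everywhere.\<close>
  define c' where "c' = (\<lambda>r. if r \<in> D then c r else 0)"
  have e: "c' r = c r" if "r \<in> D" for r using that by (simp add: c'_def)
  have ec: "cmb c' = cmb c" by (rule sum.cong) (auto simp: e)
  show thesis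
  proof (rule that[of c'])
    show "wm c' = 2" using c ec unfolding wm_def by simp
    show "c' r \<ge> 0" for r using nn[of c r] c by (simp add: c'_def)
    show "\<exists>r\<in>D. c' r ~= 0"
    proof (rule ccontr)
      assume "\<not> ?thesis"
      then have "wm c' \<le> 1" by (intro mult_0) blast
      then show False using c ec unfolding wm_def by simp
    qed
    show "pr (cmb c') r \<le> pr \<omega> r" if "r \<in> D" for r using dom[OF that] unfolding ec .
    show "wm (c'(r := c' r - 1)) \<le> 1" if "r \<in> D" for r
    proof -
      have "wm (c'(r := c' r - 1)) = wm (c(r := c r - 1))" by (rule mult_cong) (simp add: e that)
      then show ?thesis using low1[OF that, of "c r - 1"] by simp
    qed
  qed
qed

text \<open>Going down from \<open>\<omega>\<close> by simple roots, every weight is the reflection of an earlier one.\<close>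

lemma not_minuscule: assumes le: "!!s. s \<in> pos ==> pr \<omega> s \<le> 1" shows False
proof -
  have R_pos: "s \<in> pos \<or> - s \<in> pos" if g: "s \<in> R" for s
  proof -
    obtain c where c: "s = cmb c" "(\<forall>r\<in>D. c r \<ge> 0) \<or> (\<forall>r\<in>D. c r \<le> 0)" using base[OF g] by blast
    show ?thesis
    proof (cases "\<forall>r\<in>D. c r \<ge> 0")
      case True
      then show ?thesis using posI[of c] c(1) g by blast
    next
      case False
      have "- s \<in> pos" using posI[of "\<lambda>a. - c a"] R_neg[OF g] False c unfolding c(1) cmb_neg by force
      then show ?thesis ..
    qed
  qed
  have le': "\<bar>pr \<omega> s\<bar> \<le> 1" if g: "s \<in> R" for s
    using R_pos[OF g] le[of s] le[of "- s"] label_nat[of s] label_nat[of "- s"] pr_neg[OF g, of \<omega>] by fastforce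
  have key: "wm c \<le> 1 \<and> (wm c > 0 \<longrightarrow> (\<forall>s\<in>R. \<bar>pr (\<omega> - cmb c) s\<bar> \<le> 1))" if "(\<Sum>r\<in>D. c r) = int n" for c n
    using that
  proof (induction n arbitrary: c rule: less_induct)
    case (less n)
    show ?case
    proof (cases "wm c = 0")
      case False
      then have nn: "c r \<ge> 0" if "r \<in> D" for r using that mult_neg[of r c] by force
      show ?thesis
      proof (cases "\<forall>r\<in>D. c r = 0")
        case True
        have "cmb c = 0" using True by (intro sum.neutral) auto
        then have "\<forall>s\<in>R. \<bar>pr (\<omega> - cmb c) s\<bar> \<le> 1" using le' by simp
        then show ?thesis using mult_0[of c] True by blast
      next
        case nz: False
        then obtain b where b: "b \<in> D" "c b ~= 0" by blast
        have "\<exists>r\<in>D. wm (c(r := c r - 1)) ~= 0"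
        proof (rule ccontr)
          assume n: "\<not> ?thesis"
          have "wm c \<le> wm (c(b := c b - 1))" by (rule mult_up[of b]) (use b n in auto)
          then show False using n b(1) False by simp
        qed
        then obtain r where a: "r \<in> D" "wm (c(r := c r - 1)) > 0" by blast
        let ?d = "c(r := c r - 1)"
        have sm: "(\<Sum>a\<in>D. (c(r := k)) a) = int n - (c r - k)" for k
          using less.prems finD a(1) by (simp add: sum.remove[of D r])
        have sn: "0 \<le> (\<Sum>a\<in>D. (c(r := k)) a)" if "k \<ge> 0" for k
          using nn that by (intro sum_nonneg) auto
        define P where "P k s = pr (\<omega> - cmb (c(r := k))) s" for k s
        have small: "\<forall>s\<in>R. \<bar>P k s\<bar> \<le> 1" "wm (c(r := k)) \<le> 1" if "k < c r" "wm (c(r := k)) > 0" for k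
        proof -
          have k: "k \<ge> 0" using that mult_neg[OF a(1), of "c(r := k)"] by force
          have "nat (\<Sum>a\<in>D. (c(r := k)) a) < n" using sm[of k] sn[OF k] that(1) by linarith
          moreover have "(\<Sum>a\<in>D. (c(r := k)) a) = int (nat (\<Sum>a\<in>D. (c(r := k)) a))" using sn[OF k] by (rule nat_0_le[symmetric])
          ultimately have "wm (c(r := k)) \<le> 1 \<and> (wm (c(r := k)) > 0 \<longrightarrow> (\<forall>s\<in>R. \<bar>pr (\<omega> - cmb (c(r := k))) s\<bar> \<le> 1))"
            by (rule less.IH)
          then show "\<forall>s\<in>R. \<bar>P k s\<bar> \<le> 1" "wm (c(r := k)) \<le> 1"
            using that(2) unfolding P_def by blast+
        qed
        note cm = cmb_upd[OF a(1)]
        have pk: "P k s = pr (\<omega> - cmb c) s + real_of_int (c r - k) * pr r s" for k s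
          unfolding P_def cm pr_diff pr_of_int by simp
        have aR: "r \<in> R" by (rule DR[OF a(1)])
        obtain j where j: "pr (\<omega> - cmb c) r = real_of_int j" using pr_weight_int[OF a(1)] by blast
        \<comment> \<open>The weight one step up pairs to \<open>j + 2\<close> with
          \<open>r\<close>, so \<open>j\<close> is -3, -2 or -1 and the reflected weight has smaller
          height. Its own pairing \<open>- j\<close> then leaves only \<open>j = -1\<close>.\<close>
        have j1: "\<bar>j + 2\<bar> \<le> 1"
        proof -
          have "\<bar>pr (\<omega> - cmb c) r + 2\<bar> \<le> 1"
            using small(1)[of "c r - 1"] a(2) aR pk[of "c r - 1" r] pr_self[OF aR] by force
          then show ?thesis unfolding j by linarith
        qed
        have rf: "wm c \<le> wm (c(r := c r + j))" by (rule mult_reflect_simple[OF a(1) j])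
        have S: "\<forall>s\<in>R. \<bar>P (c r + j) s\<bar> \<le> 1" "wm (c(r := c r + j)) \<le> 1"
          using small[of "c r + j"] j1 rf False by auto
        have "\<bar>j + - j * 2\<bar> \<le> 1"
        proof -
          have "\<bar>pr (\<omega> - cmb c) r + real_of_int (- j) * 2\<bar> \<le> 1"
            using S(1) aR pk[of "c r + j" r] pr_self[OF aR] by force
          then show ?thesis unfolding j by linarith
        qed
        then have jm: "j = -1" using j1 by linarith
        \<comment> \<open>Pairing the weight with \<open>s\<close> is the same as pairing the
          reflected weight with the reflected root, for which the bound is known.\<close>
        have "\<bar>pr (\<omega> - cmb c) s\<bar> \<le> 1" if g: "s \<in> R" for s
        proof -
          let ?g = "s - of_int \<lfloor>pr s r\<rfloor> * r"
          have gR: "?g \<in> R" by (rule refl_R[OF g aR])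
          have "P (c r + j) ?g = pr (\<omega> - cmb c) s"
            unfolding co_refl[OF g aR] pk pr_self[OF aR] j jm by simp
          then show ?thesis using S(1) gR by force
        qed
        then show ?thesis using rf S(2) by auto
      qed
    qed simp
  qed
  obtain c where c: "wm c = 2" "!!r. c r \<ge> 0" by (rule dominant_mult_2) blast
  have "(\<Sum>r\<in>D. c r) = int (nat (\<Sum>r\<in>D. c r))" using c(2) by (simp add: sum_nonneg)
  from key[OF this] show False using c(1) by simp
qed

section \<open>Contracting consecutive nodes, and minors on the contracted diagrams\<close>

section \<open>Sums of consecutive simple roots\<close>

text \<open>The difference has coefficients of opposite signs at \<open>a\<close> and
  \<open>b\<close>, which no root allows.\<close>

lemma not_root:
  assumes "g = cmb c" "t = cmb d" "a \<in> D" "c a > d a" "b \<in> D" "c b < d b"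
  shows "g - t \<notin> R" "t - g \<notin> R" "g ~= t"
proof -
  show 1: "g - t \<notin> R" unfolding assms(1,2) cmb_diff by (rule mixed_not_root[OF assms(3,5)]) (use assms in auto)
  show "t - g \<notin> R" using 1 R_neg[of "t - g"] by auto
  show "g ~= t" using cmb_indep[of c d a] assms by auto
qed

lemma pos_add: assumes "g \<in> pos" "t \<in> pos" "pr g t < 0" shows "g + t \<in> pos"
proof -
  have R: "g \<in> R" "t \<in> R" using assms pos_R by auto
  obtain c where c: "g = cmb c" "!!r. r \<in> D ==> c r \<ge> 0" by (rule posE[OF assms(1)]) blast
  obtain d where d: "t = cmb d" "!!r. r \<in> D ==> d r \<ge> 0" by (rule posE[OF assms(2)]) blast
  have s: "g + t = cmb (\<lambda>a. c a + d a)" unfolding c(1) d(1) cmb_add ..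
  have "g ~= - t"
  proof
    assume "g = - t"
    then have e: "cmb (\<lambda>a. c a + d a) = cmb (\<lambda>_. 0)" using s by simp
    have z: "c r + d r = 0" if "r \<in> D" for r by (rule cmb_indep[OF e that])
    have "c r = 0" if "r \<in> D" for r using z[OF that] c(2)[OF that] d(2)[OF that] by linarith
    then have "g = 0" unfolding c(1) by (intro sum.neutral) auto
    then show False using R R0 by simp
  qed
  then have "g + t \<in> R" using string[OF R assms(3)] by blast
  then show ?thesis unfolding s using c(2) d(2) by (intro posI) auto
qed

lemma co_add:
  assumes "g \<in> R" "d \<in> R" "pr g d = -1" "pr d g = -1" shows "pr m (g + d) = pr m g + pr m d"
proof -
  have "\<lfloor>- 1 :: real\<rfloor> = - 1" by linarith
  then show ?thesis using co_refl[OF assms(1,2), of m] assms(3,4) by simp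
qed

definition seg :: "(nat => 'w) => nat => nat => 'w" where "seg p i j = (\<Sum>k=i..<j. p k)"

lemma seg_Suc: "i \<le> j ==> seg p i (Suc j) = seg p i j + p j" by (simp add: seg_def)

lemma seg_one: "seg p i (Suc i) = p i" by (simp add: seg_def)

lemma pr_seg: "pr (seg p i j) g = (\<Sum>k=i..<j. pr (p k) g)" by (simp add: seg_def pr_sum)

lemma seg_cmb:
  assumes c: "chain p n" and j: "j \<le> n" shows "seg p i j = cmb (\<lambda>a. if a \<in> p ` {i..<j} then 1 else 0)"
proof -
  have "seg p i j = (\<Sum>a\<in>p ` {i..<j}. a)"
    unfolding seg_def using chain_inj[OF c] j by (subst sum.reindex) (auto simp: inj_on_def)
  also have "\<dots> = (\<Sum>a\<in>D. if a \<in> p ` {i..<j} then a else 0)"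
    by (subst sum.inter_restrict[OF finD, symmetric])
       (use chain_D[OF c] j in "auto intro!: sum.cong")
  also have "\<dots> = cmb (\<lambda>a. if a \<in> p ` {i..<j} then 1 else 0)" by (rule sum.cong) auto
  finally show ?thesis .
qed

lemma seg_last: assumes c: "chain p n" and ij: "i < j" "j < n" shows "pr (seg p i j) (p j) = pr (p (j - 1)) (p j)"
proof -
  have "(\<Sum>k=i..<j. pr (p k) (p j)) = (\<Sum>k\<in>{j - 1}. pr (p k) (p j))"
  proof (rule sum.mono_neutral_right)
    show "\<forall>k\<in>{i..<j} - {j - 1}. pr (p k) (p j) = 0"
    proof
      fix k assume "k \<in> {i..<j} - {j - 1}"
      then have "Suc k < j" by auto
      then show "pr (p k) (p j) = 0" by (rule chain_far(1)[OF c _ ij(2)])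
    qed
  qed (use ij in auto)
  then show ?thesis by (simp add: pr_seg)
qed

lemma seg_pos: assumes c: "chain p n" and ij: "i < j" "j \<le> n" shows "seg p i j \<in> pos"
  using Suc_leI[OF ij(1)] ij(2)
proof (induction j rule: dec_induct)
  case base
  then show ?case using D_pos chain_D[OF c, of i] by (simp add: seg_one)
next
  case (step j)
  have "pr (seg p i j) (p j) < 0" using seg_last[OF c, of i j] chain_adj(1)[OF c, of "j - 1"] step by simp
  then have "seg p i j + p j \<in> pos" using step D_pos chain_D[OF c, of j] by (intro pos_add) auto
  then show ?case using seg_Suc[of i j p] step by simp
qed

definition simple_bonds :: "(nat => 'w) => nat => nat => bool" where
  "simple_bonds p i j \<longleftrightarrow> (\<forall>k. i \<le> k \<and> Suc k < j \<longrightarrow> pr (p k) (p (Suc k)) = -1 \<and> pr (p (Suc k)) (p k) = -1)"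

text \<open>Appending \<open>p j\<close> is a reflection with both pairings -1, so the coroots add
  as the roots do. Across a multiple bond the coroot would get unequal coefficients, hence
  \<open>simple_bonds\<close>.\<close>

lemma seg_co:
  assumes c: "chain p n" and ij: "i < j" "j \<le> n" and s: "simple_bonds p i j"
  shows "pr m (seg p i j) = (\<Sum>k=i..<j. pr m (p k))"
  using Suc_leI[OF ij(1)] ij(2) s
proof (induction j arbitrary: m rule: dec_induct)
  case base
  then show ?case by (simp add: seg_one)
next
  case (step j)
  have s': "simple_bonds p i j" using step by (simp add: simple_bonds_def)
  have b: "pr (p (j - 1)) (p j) = -1" "pr (p j) (p (j - 1)) = -1"
    using step.prems(2) step.hyps unfolding simple_bonds_def by (auto dest!: spec[of _ "j - 1"])
  have IH: "pr m (seg p i j) = (\<Sum>k=i..<j. pr m (p k))" for m using step s' by simp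
  have 1: "pr (seg p i j) (p j) = -1" using seg_last[OF c, of i j] step b by simp
  have "(\<Sum>k=i..<j. pr (p j) (p k)) = (\<Sum>k\<in>{j - 1}. pr (p j) (p k))"
  proof (rule sum.mono_neutral_right)
    show "\<forall>k\<in>{i..<j} - {j - 1}. pr (p j) (p k) = 0"
    proof
      fix k assume "k \<in> {i..<j} - {j - 1}"
      then have "Suc k < j" by auto
      then show "pr (p j) (p k) = 0" by (rule chain_far(2)[OF c]) (use step in simp)
    qed
  qed (use step in auto)
  then have "pr (p j) (seg p i j) = -1" using b by (simp add: IH)
  with 1 have "pr m (seg p i j + p j) = pr m (seg p i j) + pr m (p j)"
    using seg_pos[OF c, of i j] chain_R[OF c, of j] pos_R step by (intro co_add) auto
  then show ?case using seg_Suc[of i j p] step IH by simp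
qed

text \<open>Only the two nodes at the common boundary contribute. It is the coroot of the second
  argument that is expanded, so the bonds inside that segment are the ones required to be
  simple.\<close>

lemma seg_seg:
  assumes c: "chain p n" and ij: "i < j" "j < k" "k \<le> n"
  shows "simple_bonds p j k ==> pr (seg p i j) (seg p j k) = pr (p (j - 1)) (p j)"
    and "simple_bonds p i j ==> pr (seg p j k) (seg p i j) = pr (p j) (p (j - 1))"
proof -
  assume s: "simple_bonds p j k"
  have "pr (seg p i j) (seg p j k) = (\<Sum>l=j..<k. pr (seg p i j) (p l))" by (rule seg_co[OF c ij(2,3) s])
  also have "\<dots> = (\<Sum>l\<in>{j}. pr (seg p i j) (p l))"
  proof (rule sum.mono_neutral_right)
    show "\<forall>l\<in>{j..<k} - {j}. pr (seg p i j) (p l) = 0"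
      unfolding pr_seg using chain_far(1)[OF c] ij by (auto intro!: sum.neutral)
  qed (use ij in auto)
  finally show "pr (seg p i j) (seg p j k) = pr (p (j - 1)) (p j)" using seg_last[OF c ij(1)] ij by simp
next
  assume s: "simple_bonds p i j"
  have "pr (seg p j k) (seg p i j) = (\<Sum>l=i..<j. pr (seg p j k) (p l))" using ij by (intro seg_co[OF c _ _ s]) auto
  also have "\<dots> = (\<Sum>l\<in>{j - 1}. pr (seg p j k) (p l))"
  proof (rule sum.mono_neutral_right)
    show "\<forall>l\<in>{i..<j} - {j - 1}. pr (seg p j k) (p l) = 0"
    proof
      fix l assume "l \<in> {i..<j} - {j - 1}"
      then have "Suc l < j" by auto
      then show "pr (seg p j k) (p l) = 0" unfolding pr_seg using chain_far(2)[OF c] ij by (auto intro!: sum.neutral)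
    qed
  qed (use ij in auto)
  also have "\<dots> = (\<Sum>l=j..<k. pr (p l) (p (j - 1)))" by (simp add: pr_seg)
  also have "\<dots> = (\<Sum>l\<in>{j}. pr (p l) (p (j - 1)))"
  proof (rule sum.mono_neutral_right)
    show "\<forall>l\<in>{j..<k} - {j}. pr (p l) (p (j - 1)) = 0" using chain_far(2)[OF c] ij by auto
  qed (use ij in auto)
  finally show "pr (seg p j k) (seg p i j) = pr (p j) (p (j - 1))" by simp
qed

text \<open>Computed with the bilinear form \<open>ip\<close> instead of coroots, so the segments
  may contain multiple bonds.\<close>

lemma seg_far:
  assumes c: "chain p n" and ij: "i < j" "j < k" "k < l" "l \<le> n"
  shows "pr (seg p i j) (seg p k l) = 0" "pr (seg p k l) (seg p i j) = 0"
proof -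
  have "ip (seg p i j) (seg p k l) = (\<Sum>a=i..<j. \<Sum>b=k..<l. ip (p a) (p b))"
  proof -
    have s: "ip (\<Sum>a\<in>A. f a) q = (\<Sum>a\<in>A. ip (f a) q)" for A :: "nat set" and f q
      by (induction A rule: infinite_finite_induct) (auto simp: ip_add, simp_all add: ip_def pr_0)
    have "ip q (\<Sum>a\<in>A. f a) = (\<Sum>a\<in>A. ip q (f a))" for A :: "nat set" and f q
      using s by (simp add: ip_sym[of q])
    then show ?thesis unfolding seg_def s by simp
  qed
  also have "\<dots> = 0"
  proof (intro sum.neutral ballI)
    fix a b assume "a \<in> {i..<j}" "b \<in> {k..<l}"
    then have "pr (p a) (p b) = 0" "p b \<in> R" using chain_far(1)[OF c, of a b] chain_R[OF c, of b] ij by auto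
    then show "ip (p a) (p b) = 0" using ip_pr[of "p b" "p a"] by simp
  qed
  finally have z: "ip (seg p i j) (seg p k l) = 0" .
  have "seg p i j \<in> R" "seg p k l \<in> R" using seg_pos[OF c] pos_R ij by auto
  then show "pr (seg p i j) (seg p k l) = 0" "pr (seg p k l) (seg p i j) = 0"
    using z z[unfolded ip_sym[of "seg p i j" "seg p k l"]] by (simp_all add: pr_ip)
qed

lemma seg_not_root:
  assumes c: "chain p n" and ij: "i < j" "j \<le> k" "k < l" "l \<le> n"
  shows "seg p i j - seg p k l \<notin> R" "seg p k l - seg p i j \<notin> R" "seg p i j ~= seg p k l"
proof -
  have 1: "p i \<notin> p ` {k..<l}" "p k \<notin> p ` {i..<j}" using chain_inj[OF c] ij by auto
  have e: "seg p i j = cmb (\<lambda>a. if a \<in> p ` {i..<j} then 1 else 0)" "seg p k l = cmb (\<lambda>a. if a \<in> p ` {k..<l} then 1 else 0)"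
    using seg_cmb[OF c] ij by auto
  have D: "p i \<in> D" "p k \<in> D" using chain_D[OF c] ij by auto
  have 2: "(if p i \<in> p ` {k..<l} then 1 else 0) < (if p i \<in> p ` {i..<j} then 1 else (0::int))"
    "(if p k \<in> p ` {i..<j} then 1 else 0) < (if p k \<in> p ` {k..<l} then 1 else (0::int))"
    using 1 ij by auto
  show "seg p i j - seg p k l \<notin> R" "seg p k l - seg p i j \<notin> R" "seg p i j ~= seg p k l"
    using not_root[OF e D(1) 2(1) D(2) 2(2)] by blast+
qed

section \<open>Applications of the Gram matrices\<close>

lemma gram_list:
  assumes pos: "\<forall>i<n. gs i \<in> pos" and d: "\<forall>i<n. \<forall>j<i. gs i - gs j \<notin> R \<and> gs i ~= gs j"
    and C: "\<forall>i<n. \<forall>j<n. pr (gs i) (gs j) = real_of_int (L ! i ! j)" and l: "\<forall>i<n. pr \<omega> (gs i) = real_of_int (l ! i)"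
    and w: "set a \<subseteq> {..<n}" "mset b = mset a" "mset c = mset a" and det: "gram3 (mat L) (vec l) a b c > 0"
  shows False
proof (rule gram_contradiction[of gs n "mat L" "vec l"])
  have "gs i ~= gs j \<and> gs i - gs j \<notin> R" if "i < n" "j < n" "i ~= j" for i j
  proof (cases "j < i")
    case True
    then show ?thesis using d that by blast
  next
    case False
    then have "gs j - gs i \<notin> R \<and> gs j ~= gs i" using d that by force
    then show ?thesis using R_neg[of "gs i - gs j"] by auto
  qed
  then show "pi_data gs n (mat L) (vec l)" using pos C l by (simp add: pi_data_def pi_system_def mat_def vec_def)
  show "set a \<subseteq> {..<n}" "set b \<subseteq> {..<n}" "set c \<subseteq> {..<n}" using w by (metis mset_eq_setD)+
qed (use w det in auto)

text \<open>The signs of the pairings already give the matrix the shape demanded by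
  \<open>gram_path\<close>, whatever the strength of the two bonds.\<close>

lemma three_roots:
  assumes pos: "x \<in> pos" "y \<in> pos" "z \<in> pos" and d: "x - y \<notin> R" "y - z \<notin> R" "x - z \<notin> R"
    and p: "pr x z = 0" "pr x y < 0" "pr y z < 0" and l: "pr \<omega> x > 0" "pr \<omega> z > 0"
  shows False
proof -
  have R: "x \<in> R" "y \<in> R" "z \<in> R" using pos pos_R by auto
  have sg: "pr z x = 0" "pr y x < 0" "pr z y < 0" using p pr_sgn R by blast+
  have ne: "x ~= y" "y ~= z" "x ~= z" using p pr_self R by auto
  have fl': "pr g t = real_of_int \<lfloor>pr g t\<rfloor>" if "g \<in> R" "t \<in> R" for g t by (rule fl[OF that, symmetric])
  have fw: "pr \<omega> g = real_of_int \<lfloor>pr \<omega> g\<rfloor>" "\<lfloor>pr \<omega> g\<rfloor> \<ge> 0" if "g \<in> pos" for g using label_nat[OF that] by auto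
  let ?L = "[[2, - (- \<lfloor>pr x y\<rfloor>), 0], [- (- \<lfloor>pr y x\<rfloor>), 2, - (- \<lfloor>pr y z\<rfloor>)], [0, - (- \<lfloor>pr z y\<rfloor>), 2]]"
  let ?l = "[\<lfloor>pr \<omega> x\<rfloor>, \<lfloor>pr \<omega> y\<rfloor>, \<lfloor>pr \<omega> z\<rfloor>]"
  have nd: "y - x \<notin> R" "z - y \<notin> R" "z - x \<notin> R" using d R_neg[of "y - x"] R_neg[of "z - y"] R_neg[of "z - x"] by auto
  show False
  proof (rule gram_list[of 3 "\<lambda>i. [x, y, z] ! i" ?L ?l "[0, 1, 2]" "[1, 0, 2]" "[2, 1, 0]"])
    show "gram3 (mat ?L) (vec ?l) [0, 1, 2] [1, 0, 2] [2, 1, 0] > 0"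
    proof (rule gram_path)
      show "0 < - \<lfloor>pr x y\<rfloor>" "0 < - \<lfloor>pr y x\<rfloor>" "0 < - \<lfloor>pr y z\<rfloor>" "0 < - \<lfloor>pr z y\<rfloor>"
        using p sg by (simp_all add: floor_less_iff)
      show "0 < \<lfloor>pr \<omega> x\<rfloor>" "0 < \<lfloor>pr \<omega> z\<rfloor>" using l fw(1)[OF pos(1)] fw(1)[OF pos(3)] by linarith+
      show "0 \<le> \<lfloor>pr \<omega> y\<rfloor>" by (rule fw(2)[OF pos(2)])
    qed
    show "\<forall>i<3. \<forall>j<3. pr ([x, y, z] ! i) ([x, y, z] ! j) = real_of_int (?L ! i ! j)"
      using p(1) sg(1) pr_self R fl'[OF R(1,2)] fl'[OF R(2,1)] fl'[OF R(2,3)] fl'[OF R(3,2)]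
      by (simp add: eval_nat_numeral All_less_Suc)
    show "\<forall>i<3. pr \<omega> ([x, y, z] ! i) = real_of_int (?l ! i)"
      using fw(1)[OF pos(1)] fw(1)[OF pos(2)] fw(1)[OF pos(3)] by (simp add: eval_nat_numeral All_less_Suc)
  qed (use pos nd ne in "auto simp: eval_nat_numeral All_less_Suc")
qed

text \<open>The boundaries \<open>bs\<close> cut the chain into blocks, each contracted to the sum of its simple roots.\<close>

lemma chain_gram:
  assumes c: "chain p n" and bs: "\<forall>i<m. bs ! i < bs ! Suc i" "bs ! m \<le> n" and s: "\<forall>i<m. simple_bonds p (bs ! i) (bs ! Suc i)"
    and L: "\<forall>i<m. L ! i ! i = 2" "\<forall>i<m. \<forall>j<m. Suc i < j \<longrightarrow> L ! i ! j = 0 \<and> L ! j ! i = 0"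
      "\<forall>i<m - 1. pr (p (bs ! Suc i - 1)) (p (bs ! Suc i)) = real_of_int (L ! i ! Suc i) \<and>
        pr (p (bs ! Suc i)) (p (bs ! Suc i - 1)) = real_of_int (L ! Suc i ! i)"
    and l: "\<forall>i<m. (\<Sum>k=bs ! i..<bs ! Suc i. pr \<omega> (p k)) = real_of_int (l ! i)"
    and w: "set a \<subseteq> {..<m}" "mset b = mset a" "mset c' = mset a" and det: "gram3 (mat L) (vec l) a b c' > 0"
  shows False
proof -
  define g where "g i = seg p (bs ! i) (bs ! Suc i)" for i
  have le: "bs ! i \<le> bs ! j" if "i \<le> j" "j \<le> m" for i j
    using that
  proof (induction j rule: dec_induct)
    case (step j)
    then have "bs ! j < bs ! Suc j" using bs(1) by simp
    then show ?case using step by simp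
  qed simp
  have n: "bs ! i \<le> n" if "i \<le> m" for i using le[OF that order_refl] bs(2) by simp
  have lt: "bs ! i < bs ! Suc i" if "i < m" for i using bs(1) that by blast
  have gp: "g i \<in> pos" if "i < m" for i unfolding g_def using lt[OF that] n[of "Suc i"] that by (intro seg_pos[OF c]) auto
  have gn: "g i - g j \<notin> R \<and> g i ~= g j" if "i < m" "j < i" for i j
    using seg_not_root[OF c, of "bs ! j" "bs ! Suc j" "bs ! i" "bs ! Suc i"] lt[of j] lt[of i] le[of "Suc j" i] n[of "Suc i"] that
    unfolding g_def by simp
  have gC: "pr (g i) (g j) = real_of_int (L ! i ! j) \<and> pr (g j) (g i) = real_of_int (L ! j ! i)" if ij: "i \<le> j" "j < m" for i j
  proof -
    consider "i = j" | "j = Suc i" | "Suc i < j" using ij(1) by linarith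
    then show ?thesis
    proof cases
      case 1
      then show ?thesis using pr_self[OF pos_R[OF gp[OF ij(2)]]] L(1) ij by simp
    next
      case 2
      have "pr (g i) (g j) = pr (p (bs ! Suc i - 1)) (p (bs ! Suc i))"
        unfolding g_def 2 using 2 ij s lt n seg_seg(1)[OF c] by simp
      moreover have "pr (g j) (g i) = pr (p (bs ! Suc i)) (p (bs ! Suc i - 1))"
        unfolding g_def 2 using 2 ij s lt n seg_seg(2)[OF c] by simp
      ultimately show ?thesis using L(3) 2 ij by auto
    next
      case 3
      have "bs ! Suc i < bs ! j" using le[of "Suc (Suc i)" j] lt[of "Suc i"] 3 ij by simp
      then have "pr (g i) (g j) = 0 \<and> pr (g j) (g i) = 0"
        using seg_far[OF c, of "bs ! i" "bs ! Suc i" "bs ! j" "bs ! Suc j"] lt[of i] lt[of j] n[of "Suc j"] 3 ij unfolding g_def by simp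
      then show ?thesis using L(2) 3 ij by simp
    qed
  qed
  have gl: "pr \<omega> (g i) = real_of_int (l ! i)" if "i < m" for i
    unfolding g_def using seg_co[OF c, of "bs ! i" "bs ! Suc i" \<omega>] lt[OF that] n[of "Suc i"] s l that by simp
  show False
  proof (rule gram_list[of m g L l a b c'])
    show "\<forall>i<m. \<forall>j<m. pr (g i) (g j) = real_of_int (L ! i ! j)" using gC by (meson nle_le)
  qed (use gp gn gl w det in auto)
qed

section \<open>Excluded diagrams\<close>

section \<open>Excluded diagrams\<close>

text \<open>The weights \<open>m\<close> on the chain and \<open>q\<close> on the neighbours \<open>E\<close> of its first node are the marks of an
  affine diagram.\<close>

lemma chain_marks:
  fixes m :: "nat => real"
  assumes c: "chain p n" and n: "n > 0" and E: "E \<subseteq> D" "E \<inter> p ` {..<n} = {}"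
    and m: "!!i. i < n ==> m i > 0" and q: "!!e. e \<in> E ==> q e > 0" "!!e. e \<in> E ==> 2 * q e + m 0 * pr (p 0) e \<le> 0"
    and le: "!!i. i < n ==> 2 * m i + (if i > 0 then m (i - 1) * pr (p (i - 1)) (p i) else (\<Sum>e\<in>E. q e * pr e (p 0))) +
      (if Suc i < n then m (Suc i) * pr (p (Suc i)) (p i) else 0) \<le> 0"
  shows False
proof -
  define f where "f a = (if a \<in> E then q a else m (inv_into {..<n} p a))" for a
  have inj: "inj_on p {..<n}" using c by (simp add: chain_def)
  have fp: "f (p i) = m i" if "i < n" for i using E(2) that inv_into_f_f[OF inj] by (auto simp: f_def)
  have fE: "f e = q e" if "e \<in> E" for e using that by (simp add: f_def)
  have finE: "finite E" using E(1) finD finite_subset by blast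
  show False
  proof (rule neg_form[of "E \<union> p ` {..<n}" f])
    show "E \<union> p ` {..<n} \<subseteq> D" using E chain_D[OF c] by auto
    show "f a > 0" if "a \<in> E \<union> p ` {..<n}" for a using that fE fp m q(1) by auto
    show "E \<union> p ` {..<n} ~= {}" using n by auto
    fix a assume "a \<in> E \<union> p ` {..<n}"
    then consider "a \<in> E" | i where "i < n" "a = p i" by blast
    then show "\<exists>T\<subseteq>E \<union> p ` {..<n}. a \<in> T \<and> (\<Sum>b\<in>T. f b * pr b a) \<le> 0"
    proof cases
      case 1
      have "a ~= p 0" using 1 E(2) n by auto
      then have "(\<Sum>b\<in>{a, p 0}. f b * pr b a) \<le> 0" using q(2)[OF 1] fE[OF 1] fp[OF n] pr_self[of a] DR E(1) 1 by (auto simp: mult.commute)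
      then show ?thesis using 1 n by (intro exI[of _ "{a, p 0}"]) auto
    next
      case 2
      let ?A = "if i > 0 then {p (i - 1)} else E" and ?B = "if Suc i < n then {p (Suc i)} else {}"
      have d: "p i \<notin> ?A" "p i \<notin> ?B" "?A \<inter> ?B = {}" "finite ?A" "finite ?B"
        using 2 E(2) chain_inj[OF c] finE by (auto split: if_splits)
      have "(\<Sum>b\<in>insert (p i) (?A \<union> ?B). f b * pr b a) = 2 * m i + (\<Sum>b\<in>?A. f b * pr b a) + (\<Sum>b\<in>?B. f b * pr b a)"
        using d chain_self[OF c 2(1)] fp[OF 2(1)] 2(2) by (simp add: sum.union_disjoint)
      also have "(\<Sum>b\<in>?A. f b * pr b a) = (if i > 0 then m (i - 1) * pr (p (i - 1)) (p i) else (\<Sum>e\<in>E. q e * pr e (p 0)))"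
        using 2 fp[of "i - 1"] fE by auto
      also have "(\<Sum>b\<in>?B. f b * pr b a) = (if Suc i < n then m (Suc i) * pr (p (Suc i)) (p i) else 0)"
        using 2 fp[of "Suc i"] by auto
      finally have "(\<Sum>b\<in>insert (p i) (?A \<union> ?B). f b * pr b a) \<le> 0" using le[OF 2(1)] by simp
      then show ?thesis using 2 by (intro exI[of _ "insert (p i) (?A \<union> ?B)"]) (auto split: if_splits)
    qed
  qed
qed

abbreviation bond :: "(nat => 'w) => nat => real" where "bond p k \<equiv> pr (p k) (p (Suc k)) * pr (p (Suc k)) (p k)"

lemma bond_ge_1: assumes "a \<in> D" "b \<in> D" "a ~= b" "pr a b ~= 0" shows "pr a b * pr b a \<ge> 1"
proof -
  have "pr a b \<le> -1" "pr b a \<le> -1" using pr_adj assms pr_sym0[OF assms(1,2)] by auto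
  then have "1 * 1 \<le> (- pr a b) * (- pr b a)" by (intro mult_mono) auto
  then show ?thesis by simp
qed

text \<open>Inner marks are 2; the marks of \<open>e1\<close>, \<open>e2\<close> and the last node
  are the negated pairings that make their own rows vanish. The remaining rows follow from
  \<open>bond_ge_1\<close> at the fork and from the multiple bond at the other end, for either
  direction of the arrow. With a double bond and a simple fork these are affine diagrams.\<close>

lemma no_double_branch:
  assumes c: "chain p n" and n: "n \<ge> 2" and b: "bond p (n - 2) \<ge> 2"
    and e: "e1 \<in> D" "e2 \<in> D" "e1 ~= e2" "e1 \<notin> p ` {..<n}" "e2 \<notin> p ` {..<n}" "pr (p 0) e1 ~= 0" "pr (p 0) e2 ~= 0"
  shows False
proof (rule chain_marks[OF c, of "{e1, e2}" "\<lambda>i. if Suc i < n then 2 else - pr (p (n - 2)) (p (n - 1))" "\<lambda>e. - pr (p 0) e"])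
  have p0: "p 0 \<in> D" using chain_D[OF c] n by simp
  have ne: "e1 ~= p 0" "e2 ~= p 0" using e n by auto
  have S: "Suc (n - 2) = n - 1" using n by simp
  show "0 < (if Suc i < n then 2 else - pr (p (n - 2)) (p (n - 1)))" if "i < n" for i
    using chain_adj(1)[OF c, of "n - 2"] n S by auto
  show "0 < - pr (p 0) e" if "e \<in> {e1, e2}" for e
    using that pr_adj[OF p0 e(1)] pr_adj[OF p0 e(2)] ne e by fastforce
  show "2 * - pr (p 0) e + (if Suc 0 < n then 2 else - pr (p (n - 2)) (p (n - 1))) * pr (p 0) e \<le> 0" for e using n by simp
  have E: "(\<Sum>e\<in>{e1, e2}. - pr (p 0) e * pr e (p 0)) \<le> -2"
    using bond_ge_1[OF p0 e(1)] bond_ge_1[OF p0 e(2)] ne e by simp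
  fix i assume i: "i < n"
  show "2 * (if Suc i < n then 2 else - pr (p (n - 2)) (p (n - 1))) +
      (if i > 0 then (if Suc (i - 1) < n then 2 else - pr (p (n - 2)) (p (n - 1))) * pr (p (i - 1)) (p i) else (\<Sum>e\<in>{e1, e2}. - pr (p 0) e * pr e (p 0))) +
      (if Suc i < n then (if Suc (Suc i) < n then 2 else - pr (p (n - 2)) (p (n - 1))) * pr (p (Suc i)) (p i) else 0) \<le> 0"
  proof -
    have A: "(if i > 0 then (if Suc (i - 1) < n then 2 else - pr (p (n - 2)) (p (n - 1))) * pr (p (i - 1)) (p i) else (\<Sum>e\<in>{e1, e2}. - pr (p 0) e * pr e (p 0))) \<le> -2"
      using E chain_adj(1)[OF c, of "i - 1"] i by auto
    show ?thesis
    proof (cases "Suc i < n")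
      case True
      have "(if Suc (Suc i) < n then 2 else - pr (p (n - 2)) (p (n - 1))) * pr (p (Suc i)) (p i) \<le> -2"
      proof (cases "Suc (Suc i) < n")
        case False
        then have "i = n - 2" using True by simp
        then show ?thesis using b S False by (simp add: mult.commute)
      qed (use chain_adj(2)[OF c True] in simp)
      then show ?thesis using A True by simp
    next
      case False
      then obtain k where "n = Suc (Suc k)" "i = Suc k" using i n by (metis Suc_lessI add_2_eq_Suc le_Suc_ex nat.inject)
      then show ?thesis by simp
    qed
  qed
qed (use e n in auto)

text \<open>The fork of \<open>no_double_branch\<close> is replaced by a second multiple bond, with
  an end mark chosen by the same rule.\<close>

lemma no_two_double:
  assumes c: "chain p n" and n: "n \<ge> 3" and b: "bond p (n - 2) \<ge> 2" "bond p 0 \<ge> 2"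
  shows False
proof -
  let ?m = "\<lambda>i. if i = 0 then - pr (p 1) (p 0) else if Suc i < n then 2 else - pr (p (n - 2)) (p (n - 1))"
  have S: "Suc (n - 2) = n - 1" using n by simp
  show False
  proof (rule chain_marks[OF c, of "{}" ?m "\<lambda>_. 1"])
    show "0 < ?m i" if "i < n" for i using chain_adj(1)[OF c, of "n - 2"] chain_adj(2)[OF c, of 0] n S by auto
    fix i assume i: "i < n"
    consider "i = 0" | "i = n - 1" | "i > 0" "Suc i < n" using i by linarith
    then show "2 * ?m i + (if i > 0 then ?m (i - 1) * pr (p (i - 1)) (p i) else (\<Sum>e\<in>{}. 1 * pr e (p 0))) +
      (if Suc i < n then ?m (Suc i) * pr (p (Suc i)) (p i) else 0) \<le> 0"
    proof cases
      case 3
      have "?m (i - 1) * pr (p (i - 1)) (p i) \<le> -2"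
      proof (cases "i = 1")
        case True
        then show ?thesis using b(2) by (simp add: mult.commute)
      next
        case False
        then show ?thesis using 3 chain_adj(1)[OF c, of "i - 1"] by simp
      qed
      moreover have "?m (Suc i) * pr (p (Suc i)) (p i) \<le> -2"
      proof (cases "Suc (Suc i) < n")
        case True
        then show ?thesis using 3 chain_adj(2)[OF c, of i] by simp
      next
        case False
        then have "i = n - 2" using 3 by simp
        then show ?thesis using b(1) S False 3 by (simp add: mult.commute)
      qed
      ultimately show ?thesis using 3 by simp
    next
      case 1
      then show ?thesis using n by simp
    next
      case 2
      then obtain k where "n = Suc (Suc (Suc k))" "i = Suc (Suc k)" using n
        by (metis add_diff_cancel_left' le_Suc_ex numeral_3_eq_3 plus_1_eq_Suc add_Suc)
      then show ?thesis by simp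
    qed
  qed (use n in auto)
qed

text \<open>The end marks make the end rows vanish, and the middle row becomes 4 minus the two bond
  strengths, at most \<open>4 - 3 - 1\<close>.\<close>

lemma no_triple:
  assumes c: "chain p 3" and b: "bond p 0 \<ge> 3" shows False
proof -
  let ?m = "\<lambda>i. if i = 0 then - pr (p 1) (p 0) else if i = 1 then 2 else - pr (p 1) (p 2)"
  have a: "pr (p 0) (p 1) \<le> -1" "pr (p 1) (p 0) \<le> -1" "pr (p 1) (p 2) \<le> -1" "pr (p 2) (p 1) \<le> -1"
    using chain_adj[OF c, of 0] chain_adj[OF c, of 1] by (simp_all add: eval_nat_numeral)
  have "1 * 1 \<le> (- pr (p 1) (p 2)) * (- pr (p 2) (p 1))" using a by (intro mult_mono) auto
  then have b2: "pr (p 1) (p 2) * pr (p 2) (p 1) \<ge> 1" by simp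
  show False
  proof (rule chain_marks[OF c, of "{}" ?m "\<lambda>_. 1"])
    show "0 < ?m i" if "i < 3" for i using a by auto
    fix i :: nat assume i: "i < 3"
    then consider "i = 0" | "i = 1" | "i = 2" by linarith
    then show "2 * ?m i + (if i > 0 then ?m (i - 1) * pr (p (i - 1)) (p i) else (\<Sum>e\<in>{}. 1 * pr e (p 0))) +
      (if Suc i < 3 then ?m (Suc i) * pr (p (Suc i)) (p i) else 0) \<le> 0"
      using b b2 by cases (auto simp: mult.commute eval_nat_numeral)
  qed auto
qed

lemma no_F4_affine:
  assumes c: "chain p 5" and b: "bond p 1 \<ge> 2"
  shows False
proof -
  have a: "pr (p 0) (p 1) \<le> -1" "pr (p 1) (p 0) \<le> -1" "pr (p 1) (p 2) \<le> -1" "pr (p 2) (p 1) \<le> -1"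
    "pr (p 2) (p 3) \<le> -1" "pr (p 3) (p 2) \<le> -1" "pr (p 3) (p 4) \<le> -1" "pr (p 4) (p 3) \<le> -1"
    using chain_adj[OF c, of 0] chain_adj[OF c, of 1] chain_adj[OF c, of 2] chain_adj[OF c, of 3] by (simp_all add: eval_nat_numeral)
  have D: "p 1 \<in> R" "p 2 \<in> R" using chain_R[OF c, of 1] chain_R[OF c, of 2] by auto
  obtain k l where k: "pr (p 1) (p 2) = real_of_int k" and l: "pr (p 2) (p 1) = real_of_int l"
    using pr_int[OF D] pr_int[OF D(2,1)] by (auto elim!: Ints_cases)
  have "real_of_int (k * l) \<ge> 2" using b k l by (simp add: eval_nat_numeral)
  then have "k * l \<ge> 2" by linarith
  then have kl: "k \<le> -2 \<or> l \<le> -2" using a(3,4) k l by (cases "k = -1") auto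
  \<comment> \<open>\<open>1, 2, 3, 2, 1\<close> and \<open>2, 4, 3, 2, 1\<close> are the marks for
    the two directions of the arrow between \<open>p 1\<close> and \<open>p 2\<close>.\<close>
  let ?m = "\<lambda>i. [if k \<le> -2 then 1 else 2, if k \<le> -2 then 2 else 4, 3, 2, 1::real] ! i"
  show False
  proof (rule chain_marks[OF c, of "{}" ?m "\<lambda>_. 1"])
    show "0 < ?m i" if "i < 5" for i using that by (auto simp: less_Suc_eq eval_nat_numeral)
    fix i :: nat assume i: "i < 5"
    then consider "i = 0" | "i = 1" | "i = 2" | "i = 3" | "i = 4" by linarith
    then show "2 * ?m i + (if i > 0 then ?m (i - 1) * pr (p (i - 1)) (p i) else (\<Sum>e\<in>{}. 1 * pr e (p 0))) +
      (if Suc i < 5 then ?m (Suc i) * pr (p (Suc i)) (p i) else 0) \<le> 0"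
      using a kl k l by cases (auto simp: eval_nat_numeral)
  qed auto
qed

text \<open>A chain has no chords, so it contains at most its second node among the three neighbours
  of its first node \<open>t\<close>.\<close>

lemma branch_off:
  assumes t: "t \<in> D" "a \<in> D" "b \<in> D" "c \<in> D" "distinct [t, a, b, c]" "pr t a ~= 0" "pr t b ~= 0" "pr t c ~= 0"
    and p: "chain p n" "p 0 = t"
  obtains e1 e2 where "e1 \<in> D" "e2 \<in> D" "e1 ~= e2" "e1 \<notin> p ` {..<n}" "e2 \<notin> p ` {..<n}" "pr t e1 ~= 0" "pr t e2 ~= 0"
proof -
  have on: "s = p 1" if s: "s \<in> p ` {..<n}" "s ~= t" "pr t s ~= 0" for s
  proof -
    obtain i where i: "i < n" "s = p i" using s(1) by blast
    have "\<not> Suc 0 < i" using chain_far(1)[OF p(1), of 0 i] i p(2) s(3) by auto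
    then show ?thesis using i s(2) p(2) by (cases i) auto
  qed
  consider "a \<notin> p ` {..<n}" "b \<notin> p ` {..<n}" | "a \<notin> p ` {..<n}" "c \<notin> p ` {..<n}" | "b \<notin> p ` {..<n}" "c \<notin> p ` {..<n}"
  proof -
    have "a ~= b" "a ~= c" "b ~= c" using t(5) by auto
    moreover have "a \<in> p ` {..<n} ==> a = p 1" "b \<in> p ` {..<n} ==> b = p 1" "c \<in> p ` {..<n} ==> c = p 1" using on t by auto
    ultimately show ?thesis using that by metis
  qed
  then show thesis by cases (use that t in auto)
qed

text \<open>A chain from the branch node to one end of the multiple bond either already ends with
  that bond or can be extended across it; the fork at \<open>t\<close> completes the diagram of
  \<open>no_double_branch\<close>.\<close>

lemma double_with_branch:
  assumes t: "t \<in> D" "a \<in> D" "b \<in> D" "c \<in> D" "distinct [t, a, b, c]" "pr t a ~= 0" "pr t b ~= 0" "pr t c ~= 0"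
    and d: "x \<in> D" "y \<in> D" "x ~= y" "pr x y * pr y x \<ge> 2"
  shows False
proof -
  have key: False if p: "chain p n" "n \<ge> 2" "p 0 = t" "bond p (n - 2) \<ge> 2" for p n
  proof -
    obtain e1 e2 where "e1 \<in> D" "e2 \<in> D" "e1 ~= e2" "e1 \<notin> p ` {..<n}" "e2 \<notin> p ` {..<n}" "pr t e1 ~= 0" "pr t e2 ~= 0"
      by (rule branch_off[OF t p(1,3)]) blast
    then show False using no_double_branch[OF p(1,2,4)] p(3) by blast
  qed
  obtain p n where p: "chain p n" "n > 0" "p 0 = t" "p (n - 1) = x" using chain_connect[OF t(1) d(1)] by blast
  have nz: "pr x y ~= 0" using d(4) by auto
  show False
  proof (cases "y \<in> p ` {..<n}")
    case True
    then obtain j where j: "j < n" "y = p j" by blast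
    have "\<not> Suc j < n - 1" using chain_far(2)[OF p(1), of j "n - 1"] nz p j by auto
    moreover have "j ~= n - 1" using d(3) p(4) j by auto
    ultimately have "j = n - 2" "n \<ge> 2" "Suc (n - 2) = n - 1" using j by auto
    then show False using key[OF p(1) _ p(3)] d(4) p(4) j by (simp add: mult.commute)
  next
    case False
    let ?q = "p(n := y)"
    have q: "chain ?q (Suc n)" by (rule chain_extend[OF p(1) d(2) False]) (use p nz in simp)
    have "Suc (Suc n - 2) = n" "Suc n - 2 = n - 1" "n - 1 ~= n" using p(2) by auto
    then show False using key[OF q] p d(4) by auto
  qed
qed

section \<open>The support of the highest weight\<close>

lemma simple_bonds_one: "j \<le> Suc i ==> simple_bonds p i j" by (auto simp: simple_bonds_def)

text \<open>On a chain between two orthogonal support nodes, the sum of the inner nodes is bonded to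
  both of them, and \<open>three_roots\<close> applies with the support nodes as ends.\<close>

lemma support_adj:
  assumes s: "s \<in> D" "s' \<in> D" "pr \<omega> s > 0" "pr \<omega> s' > 0" "s ~= s'" shows "pr s s' ~= 0"
proof
  assume z: "pr s s' = 0"
  obtain p n where p: "chain p n" "n > 0" "p 0 = s" "p (n - 1) = s'" using chain_connect[OF s(1,2)] by blast
  have "n ~= 1" using p s(5) by auto
  moreover have "n ~= 2" using p z chain_adj(1)[OF p(1), of 0] by auto
  ultimately have n: "n \<ge> 3" using p(2) by linarith
  let ?y = "seg p 1 (n - 1)"
  have S: "Suc (n - 1) = n" using n by simp
  have e: "s = seg p 0 1" "s' = seg p (n - 1) n" using p(3,4) seg_one[of p 0] seg_one[of p "n - 1"] S by simp_all
  have y: "?y \<in> pos" using seg_pos[OF p(1), of 1 "n - 1"] n by simp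
  have sp: "s \<in> pos" "s' \<in> pos" using D_pos s by auto
  have "pr ?y s = pr (p 1) (p 0)" unfolding e(1) using seg_seg(2)[OF p(1), of 0 1 "n - 1"] n by (simp add: simple_bonds_one)
  then have y1: "pr ?y s < 0" using chain_adj(2)[OF p(1), of 0] n by simp
  have "pr ?y s' = pr (p (n - 1 - 1)) (p (n - 1))"
    unfolding e(2) using seg_seg(1)[OF p(1), of 1 "n - 1" n] n by (simp add: simple_bonds_one)
  then have y2: "pr ?y s' < 0" proof -
    have "Suc (n - 1 - 1) = n - 1" using n by simp
    then show ?thesis using chain_adj(1)[OF p(1), of "n - 1 - 1"] n \<open>pr ?y s' = _\<close> by simp
  qed
  show False
  proof (rule three_roots[of s ?y s'])
    show "s - ?y \<notin> R" unfolding e(1) using seg_not_root(1)[OF p(1), of 0 1 1 "n - 1"] n by simp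
    show "?y - s' \<notin> R" unfolding e(2) using seg_not_root(1)[OF p(1), of 1 "n - 1" "n - 1" n] n by simp
    show "s - s' \<notin> R" by (rule simple_diff[OF s(1,2,5)])
    show "pr s ?y < 0" using y1 pr_sgn(2) pos_R y sp by blast
  qed (use sp y z y2 s in auto)
qed

lemma ip_cmb: "ip (cmb c) n = (\<Sum>r\<in>D. real_of_int (c r) * ip r n)"
proof -
  have "ip (\<Sum>a\<in>A. f a) n = (\<Sum>a\<in>A. ip (f a) n)" for A :: "'w set" and f
    by (induction A rule: infinite_finite_induct) (auto simp: ip_add, simp_all add: ip_def pr_0)
  then show ?thesis by (simp add: ip_of_int)
qed

text \<open>With all labels 0, \<open>\<omega>\<close> is orthogonal to every root, a case of
  \<open>not_minuscule\<close>.\<close>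

lemma support_ex: obtains s where "s \<in> D" "pr \<omega> s > 0"
proof -
  have "\<exists>s\<in>D. pr \<omega> s > 0"
  proof (rule ccontr)
    assume "\<not> ?thesis"
    then have z: "pr \<omega> a = 0" if "a \<in> D" for a using that label_int(2)[OF that] by force
    have "pr \<omega> r \<le> 1" if g: "r \<in> pos" for r
    proof -
      obtain c where c: "r = cmb c" by (rule posE[OF g]) blast
      have "ip a \<omega> = 0" if "a \<in> D" for a using ip_pr[OF DR[OF that], of \<omega>] z[OF that] ip_sym[of a \<omega>] by simp
      then have "ip r \<omega> = 0" unfolding c ip_cmb by simp
      then show ?thesis using pr_ip[OF pos_R[OF g], of \<omega>] ip_sym[of r \<omega>] by simp
    qed
    then show False by (rule not_minuscule)
  qed
  then show thesis using that by blast
qed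

section \<open>Simply laced diagrams\<close>

definition simply_laced :: bool where
  "simply_laced \<longleftrightarrow> (\<forall>a\<in>D. \<forall>b\<in>D. a ~= b \<longrightarrow> pr a b * pr b a < 2)"

lemma sl_pr: assumes "simply_laced" "a \<in> D" "b \<in> D" "a ~= b" "pr a b ~= 0" shows "pr a b = -1"
proof -
  obtain k l where k: "pr a b = real_of_int k" and l: "pr b a = real_of_int l"
    using pr_int[OF DR DR] assms(2,3) by (metis Ints_cases)
  have "pr a b \<le> -1" "pr b a \<le> -1" using pr_adj assms pr_sym0[OF assms(2,3)] by auto
  then have kl: "k \<le> -1" "l \<le> -1" unfolding k l by linarith+
  have "real_of_int (k * l) < 2" using assms(1-4) k l unfolding simply_laced_def by force
  then have "k * l < 2" by linarith
  moreover have "(- k) * 1 \<le> (- k) * (- l)" using kl by (intro mult_left_mono) auto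
  ultimately have "k = -1" using kl by simp
  then show ?thesis using k by simp
qed

text \<open>\<open>ip s s\<close> is positive and a non-negative combination of the values
  \<open>ip r s\<close>, so one of them is positive. Since the only positive root proportional to
  \<open>r\<close> is \<open>r\<close>, another coefficient of \<open>s\<close> is positive; the
  reflection leaves it unchanged, so the image is positive.\<close>

lemma pos_descent:
  assumes g: "s = cmb c" "s \<in> pos" "s \<notin> D"
  obtains r where "r \<in> D" "pr s r > 0" "ref r s \<in> pos" "ref r s = cmb (c(r := c r - \<lfloor>pr s r\<rfloor>))"
proof -
  have R: "s \<in> R" using g pos_R by auto
  obtain d where d: "s = cmb d" "!!r. r \<in> D ==> d r \<ge> 0" by (rule posE[OF g(2)]) blast
  have cd: "c r = d r" if "r \<in> D" for r by (rule cmb_indep[OF _ that]) (use g(1) d(1) in simp)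
  have c0: "c r \<ge> 0" if "r \<in> D" for r using d(2)[OF that] cd[OF that] by simp
  have "\<exists>r\<in>D. ip r s > 0"
  proof (rule ccontr)
    assume n: "\<not> ?thesis"
    have "ip s s = (\<Sum>r\<in>D. real_of_int (c r) * ip r s)" using ip_cmb[of c s] unfolding g(1)[symmetric] .
    also have "\<dots> \<le> 0" using n c0 by (intro sum_nonpos mult_nonneg_nonpos) (auto simp: not_less)
    finally show False using ip_pos[OF R] by simp
  qed
  then obtain r where a: "r \<in> D" "ip r s > 0" by blast
  have aR: "r \<in> R" by (rule DR[OF a(1)])
  have pa: "pr s r > 0" using a(2) ip_pos[OF aR] ip_sym[of r s] by (simp add: pr_ip[OF aR])
  have e: "ref r s = cmb (c(r := c r - \<lfloor>pr s r\<rfloor>))"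
    unfolding cmb_upd[OF a(1)] g(1)[symmetric] by simp
  have "\<exists>t\<in>D. t ~= r \<and> c t > 0"
  proof (rule ccontr)
    assume "\<not> ?thesis"
    then have z: "c t = 0" if "t \<in> D" "t ~= r" for t using c0[OF that(1)] that by force
    have "s = cmb (\<lambda>a. c r * unit r a)" unfolding g(1) by (rule sum.cong) (auto simp: unit_def z)
    then have ga: "s = of_int (c r) * r" unfolding cmb_mult[symmetric] cmb_unit[OF a(1)] .
    have k0: "c r > 0"
    proof (rule ccontr)
      assume "\<not> ?thesis"
      then have "c r = 0" using c0[OF a(1)] by simp
      then show False using ga R R0 by simp
    qed
    have "pr s s = real_of_int (c r) * pr r s" by (subst (1) ga) (rule pr_of_int)
    then have m: "real_of_int (c r) * pr r s = 2" using pr_self[OF R] by simp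
    obtain l where l: "pr r s = real_of_int l" using pr_int[OF aR R] by (metis Ints_cases)
    have "real_of_int (c r * l) = real_of_int 2" using m l by simp
    then have "c r * l = 2" by (simp only: of_int_eq_iff)
    then have "c r dvd 2" by (metis dvd_triv_left)
    then have "c r \<le> 2" by (rule zdvd_imp_le) simp
    then consider "c r = 1" | "c r = 2" using k0 by linarith
    then show False
    proof cases
      case 1
      then show ?thesis using ga g(3) a(1) by simp
    next
      case 2
      then have "s = r + r" using ga by (simp add: mult_2)
      then show ?thesis using R_double[OF aR] R by simp
    qed
  qed
  then obtain t where b: "t \<in> D" "t ~= r" "c t > 0" by blast
  have rR: "ref r s \<in> R" by (rule refl_R[OF R aR])
  then have "cmb (c(r := c r - \<lfloor>pr s r\<rfloor>)) \<in> R" unfolding e .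
  from cmb_sign[OF this] have "\<forall>a\<in>D. (c(r := c r - \<lfloor>pr s r\<rfloor>)) a \<ge> 0" using b by force
  then have "cmb (c(r := c r - \<lfloor>pr s r\<rfloor>)) \<in> pos" using rR unfolding e by (intro posI) auto
  then have "ref r s \<in> pos" unfolding e .
  then show thesis by (rule that[OF a(1) pa _ e])
qed

lemma sum_upd: assumes "r \<in> D" shows "(\<Sum>a\<in>D. (c(r := k)) a) = (\<Sum>a\<in>D. c a) - (c r - (k :: int))"
  using finD assms by (simp add: sum.remove[of D r])

lemma ip_of_int': "ip n (of_int k * m) = real_of_int k * ip n m"
  unfolding ip_sym[of n] by (rule ip_of_int)

lemma ip_ref: assumes "g \<in> R" "a \<in> R" shows "ip (ref a g) (ref a g) = ip g g"
proof -
  have "ip (ref a g) (ref a g) = ip g g - 2 * (pr g a * ip g a) + pr g a * (pr g a * ip a a)"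
    unfolding ip_diff ip_diff' ip_of_int ip_of_int' fl[OF assms] ip_sym[of a g] by (simp add: algebra_simps)
  then show ?thesis unfolding ip_pr[OF assms(2)] by simp
qed

text \<open>A simple bond equates the lengths of its ends, connectivity spreads this over
  \<open>D\<close>, and \<open>pos_descent\<close> brings every positive root to a simple one by
  reflections, which preserve length.\<close>

lemma sl_norm:
  assumes sl: "simply_laced" and s: "s \<in> D" and g: "u \<in> R" shows "ip u u = ip s s"
proof -
  have simple: "ip a a = ip s s" if a: "a \<in> D" for a
  proof (rule ccontr)
    assume n: "ip a a ~= ip s s"
    have "\<exists>x\<in>{x \<in> D. ip x x = ip s s}. \<exists>y\<in>{y \<in> D. ip y y ~= ip s s}. pr x y ~= 0"
      by (rule conn) (use s a n in auto)
    then obtain x y where xy: "x \<in> D" "y \<in> D" "ip x x = ip s s" "ip y y ~= ip s s" "pr x y ~= 0" by blast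
    then have "x ~= y" by auto
    have nz: "pr y x ~= 0" using xy pr_sym0[of x y] by simp
    have "pr x y = -1" "pr y x = -1" using sl_pr[OF sl xy(1,2) \<open>x ~= y\<close> xy(5)] sl_pr[OF sl xy(2,1) _ nz] \<open>x ~= y\<close> by auto
    then have "ip x x = ip y y" using ip_pr[OF DR[OF xy(1)], of y] ip_pr[OF DR[OF xy(2)], of x] ip_sym[of x y] by simp
    then show False using xy by simp
  qed
  have pos: "ip u u = ip s s" if "u = cmb c" "u \<in> pos" "(\<Sum>a\<in>D. c a) = int n" for c n u
    using that
  proof (induction n arbitrary: c u rule: less_induct)
    case (less n)
    show ?case
    proof (cases "u \<in> D")
      case False
      obtain r where a: "r \<in> D" "pr u r > 0" "ref r u \<in> pos" "ref r u = cmb (c(r := c r - \<lfloor>pr u r\<rfloor>))"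
        by (rule pos_descent[OF less.prems(1,2) False]) blast
      have R: "u \<in> R" "r \<in> R" using less.prems pos_R a DR by auto
      let ?c = "c(r := c r - \<lfloor>pr u r\<rfloor>)"
      have fpos: "\<lfloor>pr u r\<rfloor> > 0" using a(2) fl[OF R] by linarith
      obtain d where d: "ref r u = cmb d" "!!r. r \<in> D ==> d r \<ge> 0" by (rule posE[OF a(3)]) blast
      have "?c b = d b" if "b \<in> D" for b using cmb_indep[OF _ that, of ?c d] a(4) d(1) by simp
      then have "(\<Sum>b\<in>D. ?c b) \<ge> 0" using d(2) by (intro sum_nonneg) simp
      then have i: "(\<Sum>b\<in>D. ?c b) = int (nat (\<Sum>b\<in>D. ?c b))" by (rule nat_0_le[symmetric])
      have "(\<Sum>b\<in>D. ?c b) < int n" unfolding sum_upd[OF a(1)] less.prems(3) using fpos by simp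
      then have "nat (\<Sum>b\<in>D. ?c b) < n" using i by linarith
      from less.IH[OF this a(4,3) i] show ?thesis using ip_ref[OF R] by simp
    qed (use simple in simp)
  qed
  have pos': "ip u u = ip s s" if g: "u \<in> pos" for u
  proof -
    obtain c where c: "u = cmb c" "!!r. r \<in> D ==> c r \<ge> 0" by (rule posE[OF g]) blast
    show ?thesis by (rule pos[OF c(1) g, of "nat (\<Sum>a\<in>D. c a)"]) (simp add: c(2) sum_nonneg)
  qed
  obtain c where c: "u = cmb c" "(\<forall>r\<in>D. c r \<ge> 0) \<or> (\<forall>r\<in>D. c r \<le> 0)" using base[OF g] by blast
  from c(2) show ?thesis
  proof
    assume "\<forall>r\<in>D. c r \<ge> 0"
    then show ?thesis using pos'[of u] posI[of c] g c(1) by blast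
  next
    assume "\<forall>r\<in>D. c r \<le> 0"
    then have "- u \<in> pos" using posI[of "\<lambda>a. - c a"] R_neg[OF g] unfolding c(1) cmb_neg by force
    from pos'[OF this] show ?thesis by (simp add: ip_def pr_minus)
  qed
qed

text \<open>Suppose that some \<open>\<gamma>\<close> pairs to at least 2 with \<open>\<omega>\<close>. A minimal such \<open>\<gamma>\<close> is orthogonal to all simple roots below it
  except \<open>s\<close>, and removing \<open>s\<close> and a neighbour \<open>t\<close> of \<open>s\<close> from it gives the chain \<open>\<gamma> - s - t, t, s\<close>.\<close>

lemma sl_single_label:
  assumes sl: "simply_laced" and s: "s \<in> D" "pr \<omega> s = 1" and z: "!!a. a \<in> D ==> a ~= s ==> pr \<omega> a = 0"
  shows False
proof -
  define N where "N = ip s s"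
  have N: "ip q q = N" if "q \<in> R" for q unfolding N_def by (rule sl_norm[OF sl s(1) that])
  have N0: "N > 0" unfolding N_def by (rule ip_pos[OF DR[OF s(1)]])
  have pr_N: "pr \<mu> q * N = 2 * ip \<mu> q" if "q \<in> R" for \<mu> q using ip_pr[OF that] N[OF that] by simp
  have prs: "pr q \<delta> = pr \<delta> q" if "q \<in> R" "\<delta> \<in> R" for q \<delta>
    using pr_N[OF that(1), of \<delta>] pr_N[OF that(2), of q] ip_sym[of q \<delta>] N0 by (metis mult_right_cancel order_less_irrefl)
  \<comment> \<open>With all roots of equal length, a coroot has the same coefficients as its root,
    so pairing with \<open>\<omega>\<close> reads off the coefficient at \<open>s\<close>.\<close>
  have coef: "pr \<omega> q = real_of_int (c s)" if g: "q \<in> R" "q = cmb c" for q c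
  proof -
    have "ip a \<omega> = 0" if "a \<in> D" "a ~= s" for a using ip_pr[OF DR[OF that(1)], of \<omega>] z[OF that] ip_sym[of a \<omega>] by simp
    then have "ip q \<omega> = (\<Sum>a\<in>D. if a = s then real_of_int (c s) * ip s \<omega> else 0)"
      unfolding g(2) ip_cmb by (intro sum.cong) auto
    then have "ip q \<omega> = real_of_int (c s) * ip s \<omega>" using finD s(1) by simp
    moreover have "2 * ip s \<omega> = N" using pr_N[OF DR[OF s(1)], of \<omega>] s(2) ip_sym[of s \<omega>] by simp
    ultimately have "pr \<omega> q * N = real_of_int (c s) * N" using pr_N[OF g(1), of \<omega>] ip_sym[of q \<omega>] by (simp add: algebra_simps)
    then show ?thesis using N0 by simp
  qed
  define Q where "Q n \<longleftrightarrow> (\<exists>c. cmb c \<in> pos \<and> c s \<ge> 2 \<and> (\<Sum>a\<in>D. c a) = int n)" for n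
  have "\<exists>n. Q n"
  proof -
    obtain q where g: "q \<in> pos" "pr \<omega> q > 1" using not_minuscule by force
    obtain c where c: "q = cmb c" "!!u. u \<in> D ==> c u \<ge> 0" by (rule posE[OF g(1)]) blast
    have "c s \<ge> 2" using coef[OF pos_R[OF g(1)] c(1)] g(2) by linarith
    moreover have "(\<Sum>a\<in>D. c a) = int (nat (\<Sum>a\<in>D. c a))" using c(2) by (simp add: sum_nonneg)
    moreover have "cmb c \<in> pos" using g(1) unfolding c(1) .
    ultimately show ?thesis unfolding Q_def by blast
  qed
  then obtain n where n: "Q n" "!!m. m < n ==> \<not> Q m" using exists_least_iff[of Q] by blast
  then obtain c where c: "cmb c \<in> pos" "c s \<ge> 2" "(\<Sum>a\<in>D. c a) = int n" unfolding Q_def by blast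
  define q where "q = cmb c"
  have gp: "q \<in> pos" using c(1) unfolding q_def .
  have gR: "q \<in> R" by (rule pos_R[OF gp])
  obtain d where d: "q = cmb d" "!!u. u \<in> D ==> d u \<ge> 0" by (rule posE[OF gp]) blast
  have "c u = d u" if "u \<in> D" for u by (rule cmb_indep[OF _ that]) (use d(1) in "simp add: q_def")
  then have c0: "c u \<ge> 0" if "u \<in> D" for u using d(2) that by simp
  have sR: "s \<in> R" by (rule DR[OF s(1)])
  have sub1: "\<mu> - u = cmb (f(u := f u - 1))" if "u \<in> D" "\<mu> = cmb f" for u \<mu> f
    unfolding that(2) cmb_upd[OF that(1)] by simp
  have sub_pos: "\<mu> - u \<in> pos" if "\<mu> - u \<in> R" "u \<in> D" "\<mu> = cmb f" "(f(u := f u - 1)) s > 0" for \<mu> u f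
  proof -
    have R: "cmb (f(u := f u - 1)) \<in> R" using that(1) sub1[OF that(2,3)] by simp
    from cmb_sign[OF this] have "\<forall>a\<in>D. (f(u := f u - 1)) a \<ge> 0" using that(4) s(1) by force
    then have "cmb (f(u := f u - 1)) \<in> pos" using R by (intro posI) auto
    then show ?thesis unfolding sub1[OF that(2,3)] .
  qed
  have gn: "q ~= u" if a: "u \<in> D" for u
  proof
    assume "q = u"
    then have "cmb c = cmb (unit u)" using cmb_unit[OF a] unfolding q_def by simp
    from cmb_indep[OF this s(1)] show False using c(2) by (simp add: unit_def split: if_splits)
  qed
  \<comment> \<open>Subtracting such a \<open>u\<close> gives a positive root of smaller height, so
    by minimality its coefficient at \<open>s\<close> must have dropped below 2.\<close>
  have desc: "u = s \<and> c s = 2" if a: "u \<in> D" "pr q u > 0" for u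
  proof (rule ccontr)
    assume h: "\<not> ?thesis"
    have "q - u \<in> R" by (rule string_minus[OF gR DR[OF a(1)] a(2) gn[OF a(1)]])
    moreover have c2: "(c(u := c u - 1)) s \<ge> 2" using h c(2) by auto
    ultimately have p: "cmb (c(u := c u - 1)) \<in> pos" using sub_pos[of q u c] a(1) sub1[OF a(1) q_def] q_def by simp
    have "n > 0"
    proof (rule ccontr)
      assume "\<not> n > 0"
      then have "(\<Sum>a\<in>D. c a) = 0" using c(3) by simp
      then have "c s = 0" using c0 finD s(1) by (subst (asm) sum_nonneg_eq_0_iff) auto
      then show False using c(2) by simp
    qed
    moreover have "(\<Sum>a\<in>D. (c(u := c u - 1)) a) = int (n - 1)" unfolding sum_upd[OF a(1)] c(3) using \<open>n > 0\<close> by simp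
    ultimately have "Q (n - 1)" "n > 0" unfolding Q_def using p c2 by blast+
    then show False using n(2)[of "n - 1"] by simp
  qed
  have exp: "pr q \<delta> = (\<Sum>a\<in>D. real_of_int (c a) * pr a \<delta>)" for \<delta> unfolding q_def by (rule pr_cmb)
  have split: "(\<Sum>a\<in>D. f a) = f s + (\<Sum>a\<in>D - {s}. f a)" for f :: "'w => real"
    using finD s(1) by (simp add: sum.remove)
  have gs1: "pr q s \<le> 1"
  proof (rule ccontr)
    assume n1: "\<not> ?thesis"
    then have "ip (q - s) (q - s) \<le> 0"
      using pr_N[OF sR, of q] N[OF gR] N[OF sR] N0 pr_int[OF gR sR] ip_sym[of s q] mult_right_mono[of 2 "pr q s" N]
      by (fastforce simp: ip_diff ip_diff' elim!: Ints_cases)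
    moreover have "q - s \<in> R" using n1 by (intro string_minus[OF gR sR _ gn[OF s(1)]]) simp
    ultimately show False using ip_pos by force
  qed
  have nonpos: "real_of_int (c a) * pr a q \<le> 0" if "a \<in> D - {s}" for a
  proof -
    have "pr q a \<le> 0" using desc[of a] that by force
    then have "pr a q \<le> 0" using prs[OF gR DR] that by simp
    then show ?thesis using c0[of a] that by (intro mult_nonneg_nonpos) auto
  qed
  \<comment> \<open>\<open>q\<close> paired with itself. All terms off \<open>s\<close> are
    non-positive and the term at \<open>s\<close> turns out to be at most 2; equality then makes
    \<open>q\<close> orthogonal to every other simple root occurring in it.\<close>
  have two: "2 = real_of_int (c s) * pr s q + (\<Sum>a\<in>D - {s}. real_of_int (c a) * pr a q)"
    using exp[of q] pr_self[OF gR] unfolding split[of "\<lambda>a. real_of_int (c a) * pr a q"] by simp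
  have rest: "(\<Sum>a\<in>D - {s}. real_of_int (c a) * pr a q) \<le> 0" by (rule sum_nonpos[OF nonpos])
  have sg: "pr s q = pr q s" by (rule prs[OF sR gR])
  have "pr q s > 0"
  proof (rule ccontr)
    assume "\<not> ?thesis"
    then have "real_of_int (c s) * pr s q \<le> 0" using sg c(2) by (intro mult_nonneg_nonpos) auto
    then show False using two rest by linarith
  qed
  then have cs: "c s = 2" using desc[OF s(1)] by blast
  have gs: "pr q s = 1" using two rest gs1 unfolding cs sg by simp
  then have "(\<Sum>a\<in>D - {s}. real_of_int (c a) * pr a q) = 0" using two cs sg by simp
  then have orth0: "\<forall>a\<in>D - {s}. - (real_of_int (c a) * pr a q) = 0"
    using nonpos finD by (subst sum_nonneg_eq_0_iff[symmetric]) (auto simp: sum_negf)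
  have "\<exists>t\<in>D - {s}. c t ~= 0 \<and> pr t s ~= 0"
  proof (rule ccontr)
    assume "\<not> ?thesis"
    then have "(\<Sum>a\<in>D - {s}. real_of_int (c a) * pr a s) = 0" by (intro sum.neutral) auto
    then have "pr q s = 4" using exp[of s] pr_self[OF sR] cs unfolding split[of "\<lambda>a. real_of_int (c a) * pr a s"] by simp
    then show False using gs by simp
  qed
  then obtain t where t: "t \<in> D" "t ~= s" "c t ~= 0" "pr t s ~= 0" by blast
  have tR: "t \<in> R" by (rule DR[OF t(1)])
  have ts: "pr t s = -1" by (rule sl_pr[OF sl t(1) s(1) t(2,4)])
  have st: "pr s t = -1" using prs[OF sR tR] ts by simp
  have gt: "pr q t = 0" using orth0 t prs[OF gR tR] by auto
  let ?c1 = "c(s := c s - 1)"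
  have g1R: "q - s \<in> R" by (rule string_minus[OF gR sR _ gn[OF s(1)]]) (simp add: gs)
  have g1: "q - s = cmb ?c1" by (rule sub1[OF s(1) q_def])
  have g1t: "pr (q - s) t = 1" unfolding pr_diff gt st by simp
  have "q - s ~= t"
  proof
    assume "q - s = t"
    then have "cmb ?c1 = cmb (unit t)" unfolding g1 cmb_unit[OF t(1)] .
    from cmb_indep[OF this s(1)] show False using cs t(2) by (simp add: unit_def)
  qed
  then have xR: "q - s - t \<in> R" by (intro string_minus[OF g1R tR]) (simp_all add: g1t)
  let ?x = "q - s - t"
  have xp: "?x \<in> pos" using sub_pos[OF xR t(1) g1] cs t(2) by simp
  have xc: "?x = cmb (?c1(t := ?c1 t - 1))" by (rule sub1[OF t(1) g1])
  have "pr \<omega> ?x = 1" using coef[OF xR xc] cs t(2) by simp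
  moreover have xt: "pr ?x t = -1" unfolding pr_diff gt st pr_self[OF tR] by simp
  moreover have xs: "pr ?x s = 0" unfolding pr_diff gs pr_self[OF sR] ts by simp
  moreover have "?x - s \<notin> R"
  proof
    assume r: "?x - s \<in> R"
    have "ip (?x - s) (?x - s) = N + N" using pr_N[OF sR, of ?x] xs N[OF xR] N[OF sR] ip_sym[of s ?x] unfolding ip_diff[of ?x] ip_diff'[of _ ?x] by simp
    then show False using N[OF r] N0 by simp
  qed
  moreover have "?x - t \<notin> R"
  proof
    assume r: "?x - t \<in> R"
    have "ip (?x - t) (?x - t) = N + N + N" using pr_N[OF tR, of ?x] xt N[OF xR] N[OF tR] ip_sym[of t ?x] unfolding ip_diff[of ?x] ip_diff'[of _ ?x] by simp
    then show False using N[OF r] N0 by simp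
  qed
  ultimately show False
    using three_roots[of ?x t s] xp D_pos t(1) s ts simple_diff[OF t(1) s(1) t(2)] by simp
qed

section \<open>Branched diagrams\<close>

lemma off_chain:
  assumes c: "chain q n" and n: "n > 0" and e: "e \<in> D" "e \<notin> q ` {..<n}" "pr (q 0) e ~= 0"
  shows "0 < k ==> k < n ==> pr (q k) e = 0" "0 < k ==> k < n ==> pr e (q k) = 0"
proof -
  show "pr (q k) e = 0" if "0 < k" "k < n" using chain_outside[OF c e(1,2) that e(3)] .
  then show "0 < k ==> k < n ==> pr e (q k) = 0" using pr_sym0 e(1) chain_D[OF c] by blast
qed

text \<open>Of the whole segment only the first node is bonded to \<open>e\<close>; equal root
  lengths give the pairing in the other order.\<close>

lemma off_seg:
  assumes sl: "simply_laced" and c: "chain q n" and n: "n > 0" and e: "e \<in> D" "e \<notin> q ` {..<n}" "pr (q 0) e ~= 0"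
    and j: "0 < j" "j \<le> n"
  shows "pr (seg q 0 j) e = -1" "pr e (seg q 0 j) = -1"
proof -
  have q0: "q 0 \<in> D" "q 0 ~= e" using chain_D[OF c n] e(2) n by auto
  have "(\<Sum>k=0..<j. pr (q k) e) = (\<Sum>k\<in>{0}. pr (q k) e)"
    by (rule sum.mono_neutral_right) (use off_chain(1)[OF c n e] j in auto)
  then show a: "pr (seg q 0 j) e = -1" using sl_pr[OF sl q0(1) e(1) q0(2) e(3)] by (simp add: pr_seg)
  have s: "seg q 0 j \<in> R" by (rule pos_R[OF seg_pos[OF c j]])
  have "pr e (seg q 0 j) * ip e e = -1 * ip e e"
    using a ip_pr[OF s, of e] ip_pr[OF DR[OF e(1)], of "seg q 0 j"] sl_norm[OF sl e(1) s] ip_sym[of e "seg q 0 j"] by simp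
  then show "pr e (seg q 0 j) = -1" using ip_pos[OF DR[OF e(1)]] by (simp only: mult_right_cancel less_imp_neq[THEN not_sym] simp_thms)
qed

lemma sl_simple_bonds: assumes sl: "simply_laced" and c: "chain q n" shows "j \<le> n ==> simple_bonds q i j"
  unfolding simple_bonds_def
proof (intro allI impI)
  fix k assume "j \<le> n" "i \<le> k \<and> Suc k < j"
  then have k: "Suc k < n" by simp
  have d: "q k \<in> D" "q (Suc k) \<in> D" "q k ~= q (Suc k)" using chain_D[OF c] chain_inj[OF c, of k "Suc k"] k by auto
  have "pr (q k) (q (Suc k)) ~= 0" "pr (q (Suc k)) (q k) ~= 0" using chain_adj[OF c k] by auto
  then show "pr (q k) (q (Suc k)) = -1 \<and> pr (q (Suc k)) (q k) = -1"
    using sl_pr[OF sl d] sl_pr[OF sl d(2,1)] d(3) by auto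
qed

lemma seg_label:
  assumes sl: "simply_laced" and c: "chain q n" and ij: "i < j" "j \<le> n" and k: "i \<le> k" "k < j"
  shows "pr \<omega> (seg q i j) \<ge> pr \<omega> (q k)"
proof -
  have "pr \<omega> (seg q i j) = (\<Sum>k=i..<j. pr \<omega> (q k))" by (rule seg_co[OF c ij sl_simple_bonds[OF sl c ij(2)]])
  also have "\<dots> \<ge> pr \<omega> (q k)"
    by (rule member_le_sum) (use label_int(2) chain_D[OF c] k ij in auto)
  finally show ?thesis .
qed

text \<open>Let \<open>?P\<close> be the sum of the first \<open>n\<close> nodes and
  \<open>?x\<close> that of all \<open>n + 1\<close>. Then \<open>?x\<close>, \<open>e\<close>,
  \<open>?P + f\<close> is a chain with orthogonal ends, because \<open>?x\<close> pairs to 1 with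
  \<open>?P\<close> and to -1 with \<open>f\<close>. Both ends contain the support node
  \<open>q k\<close>, which is the reason for \<open>k < n\<close>.\<close>

lemma branch_center:
  assumes sl: "simply_laced" and t: "t \<in> D" "a \<in> D" "b \<in> D" "c \<in> D" "distinct [t, a, b, c]" "pr t a ~= 0" "pr t b ~= 0" "pr t c ~= 0"
    and q: "chain q (Suc n)" "n > 0" "q 0 = t" and k: "k < n" "pr \<omega> (q k) > 0"
  shows False
proof -
  obtain e f where e: "e \<in> D" "f \<in> D" "e ~= f" "e \<notin> q ` {..<Suc n}" "f \<notin> q ` {..<Suc n}" "pr t e ~= 0" "pr t f ~= 0"
    by (rule branch_off[OF t q(1,3)]) blast
  have e0: "pr (q 0) e ~= 0" "pr (q 0) f ~= 0" using e q(3) by auto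
  let ?P = "seg q 0 n" and ?x = "seg q 0 (Suc n)"
  have P: "?P \<in> pos" "?x \<in> pos" using seg_pos[OF q(1)] q(2) by auto
  have R: "?P \<in> R" "?x \<in> R" "e \<in> R" "f \<in> R" using P pos_R e DR by auto
  have Pe: "pr ?P e = -1" "pr e ?P = -1" using off_seg[OF sl q(1) _ e(1,4) e0(1), of n] q(2) by auto
  have Pf: "pr ?P f = -1" "pr f ?P = -1" using off_seg[OF sl q(1) _ e(2,5) e0(2), of n] q(2) by auto
  have xe: "pr ?x e = -1" using off_seg(1)[OF sl q(1) _ e(1,4) e0(1), of "Suc n"] by simp
  have xf: "pr ?x f = -1" using off_seg(1)[OF sl q(1) _ e(2,5) e0(2), of "Suc n"] by simp
  have zp: "?P + f \<in> pos" using Pf D_pos[OF e(2)] by (intro pos_add[OF P(1)]) auto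
  have co: "pr m (?P + f) = pr m ?P + pr m f" for m by (rule co_add[OF R(1,4) Pf])
  have xs: "?x = ?P + q n" by (simp add: seg_Suc)
  have qn: "q n \<in> D" "q n ~= f" using chain_D[OF q(1), of n] e(5) by auto
  have "pr (q n) ?P = -1"
  proof -
    have "pr (q n) ?P = pr (q n) (q (n - 1))"
      using seg_seg(2)[OF q(1), of 0 n "Suc n"] seg_one[of q n] q(2) sl_simple_bonds[OF sl q(1), of n 0] by simp
    then show ?thesis using sl_simple_bonds[OF sl q(1), of "Suc n" 0] q(2) unfolding simple_bonds_def by (auto dest!: spec[of _ "n - 1"])
  qed
  then have xP: "pr ?x ?P = 1" unfolding xs pr_add using pr_self[OF R(1)] by simp
  have ef: "pr e f = 0"
  proof -
    have cs: "chain (q(1 := e)) 2"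
      using t(1) q(3) e(1,4) e0(1) unfolding chain_def inj_on_def by (auto simp: less_2_cases_iff)
    have "f \<notin> (q(1 := e)) ` {..<2}" using e(3,5) by (auto simp: less_2_cases_iff)
    from off_chain(1)[OF cs _ e(2) this, of 1] e0(2) show ?thesis by simp
  qed
  have cP: "?P = cmb (\<lambda>a. if a \<in> q ` {0..<n} then 1 else 0)" "?x = cmb (\<lambda>a. if a \<in> q ` {0..<Suc n} then 1 else 0)"
    using seg_cmb[OF q(1)] by auto
  show False
  proof (rule three_roots[of ?x e "?P + f"])
    have eu: "e = cmb (unit e)" "f = cmb (unit f)" using cmb_unit e by auto
    have eq: "e \<notin> q ` {0..<Suc n}" "f \<notin> q ` {0..<n}" "e \<notin> q ` {0..<n}" using e(4,5) by auto
    have tq: "t \<in> q ` {0..<Suc n}" "t \<in> q ` {0..<n}" "t ~= e" using q e(4) by auto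
    show "?x - e \<notin> R" by (rule not_root(1)[OF cP(2) eu(1) t(1) _ e(1)]) (use eq tq in "auto simp: unit_def")
    have c2: "?P + f = cmb (\<lambda>a. (if a \<in> q ` {0..<n} then 1 else 0) + unit f a)" unfolding cP(1) cmb_add[symmetric] cmb_unit[OF e(2)] ..
    show "e - (?P + f) \<notin> R" by (rule not_root(2)[OF c2 eu(1) t(1) _ e(1)]) (use eq tq e in "auto simp: unit_def")
    show "?x - (?P + f) \<notin> R" using simple_diff[OF qn(1) e(2) qn(2)] unfolding xs by simp
    show "pr ?x (?P + f) = 0" unfolding co xP xf by simp
    show "pr e (?P + f) < 0" unfolding co Pe ef by simp
    show "pr \<omega> ?x > 0" using seg_label[OF sl q(1), of 0 "Suc n" k] k by simp
    have "pr \<omega> ?P > 0" using seg_label[OF sl q(1), of 0 n k] k q(2) by simp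
    then show "pr \<omega> (?P + f) > 0" unfolding co using label_int(2)[OF e(2)] by simp
  qed (use P D_pos e zp xe in auto)
qed

text \<open>\<open>branch_center\<close> needs a chain reaching one node beyond a support node,
  which exists if two nodes carry labels or if the branch node carries the only one. For a single
  label of at least 2 elsewhere, the nodes from the support to the neighbour of the branch node are
  contracted, which leaves \<open>D_4\<close> labelled at an outer node.\<close>

lemma no_branch:
  assumes sl: "simply_laced" and t: "t \<in> D" "a \<in> D" "b \<in> D" "c \<in> D" "distinct [t, a, b, c]" "pr t a ~= 0" "pr t b ~= 0" "pr t c ~= 0"
  shows False
proof -
  obtain s where s: "s \<in> D" "pr \<omega> s > 0" using support_ex by blast
  obtain p n where p: "chain p n" "n > 0" "p 0 = t" "p (n - 1) = s" using chain_connect[OF t(1) s(1)] by blast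
  have S: "Suc (n - 1) = n" using p(2) by simp
  show False
  proof (cases "\<exists>s'\<in>D. s' ~= s \<and> pr \<omega> s' > 0")
    case True
    then obtain s' where s': "s' \<in> D" "s' ~= s" "pr \<omega> s' > 0" by blast
    have adj: "pr s s' ~= 0" using support_adj[OF s(1) s'(1) s(2) s'(3)] s'(2) by blast
    show False
    proof (cases "s' \<in> p ` {..<n}")
      case True
      then obtain j where j: "j < n" "s' = p j" by blast
      have "j ~= n - 1" using j p(4) s'(2) by auto
      then have jn: "j < n - 1" using j by simp
      have "chain p (Suc (n - 1))" using p(1) S by simp
      moreover have "n - 1 > 0" "pr \<omega> (p j) > 0" using jn j(2) s'(3) by auto
      ultimately show False using branch_center[OF sl t, of p "n - 1" j] p(3) jn by blast
    next
      case False
      have q: "chain (p(n := s')) (Suc n)" by (rule chain_extend[OF p(1) s'(1) False]) (use adj p(4) in simp)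
      have "(p(n := s')) 0 = t" "(p(n := s')) (n - 1) = s" "n - 1 < n" using p by auto
      then show False using branch_center[OF sl t, of "p(n := s')" n "n - 1"] q p(2) s(2) by simp
    qed
  next
    case False
    then have z: "pr \<omega> a = 0" if "a \<in> D" "a ~= s" for a using that label_int(2)[OF that(1)] by force
    show False
    proof (cases "n = 1")
      case True
      then have ts: "s = t" using p by simp
      have "chain (\<lambda>i. if i = 0 then t else a) (Suc 1)"
        using t(1,2,5,6) unfolding chain_def inj_on_def by auto
      then show False using branch_center[OF sl t, of "\<lambda>i. if i = 0 then t else a" 1 0] s(2) ts by simp
    next
      case False
      then have n2: "n \<ge> 2" using p(2) by linarith
      obtain m where m: "pr \<omega> s = real m" using label_nat[OF D_pos[OF s(1)]] by blast
      have m2: "m \<ge> 2"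
      proof (rule ccontr)
        assume "\<not> ?thesis"
        then have "pr \<omega> s = 1" using m s(2) by (cases "m = 1") auto
        then show False using sl_single_label[OF sl s(1)] z by blast
      qed
      obtain e f where e: "e \<in> D" "f \<in> D" "e ~= f" "e \<notin> p ` {..<n}" "f \<notin> p ` {..<n}" "pr t e ~= 0" "pr t f ~= 0"
        by (rule branch_off[OF t p(1,3)]) blast
      have e0: "pr (p 0) e ~= 0" "pr (p 0) f ~= 0" using e p(3) by auto
      let ?Q = "seg p 1 n"
      let ?g = "\<lambda>i. [?Q, t, e, f] ! i"
      have Q: "?Q \<in> pos" using seg_pos[OF p(1), of 1 n] n2 by simp
      have QR: "?Q \<in> R" by (rule pos_R[OF Q])
      have one: "t = seg p 0 1" using seg_one[of p 0] p(3) by simp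
      have b01: "pr (p 0) (p 1) = -1" "pr (p 1) (p 0) = -1"
        using sl_simple_bonds[OF sl p(1), of n 0] n2 unfolding simple_bonds_def by auto
      have Qt: "pr ?Q t = -1" "pr t ?Q = -1"
        using seg_seg[OF p(1), of 0 1 n] n2 b01 sl_simple_bonds[OF sl p(1)] unfolding one by auto
      have Qo: "pr ?Q g = 0 \<and> pr g ?Q = 0" if "g \<in> D" "g \<notin> p ` {..<n}" "pr (p 0) g ~= 0" for g
      proof -
        have "pr ?Q g = 0" unfolding pr_seg by (rule sum.neutral) (use off_chain(1)[OF p(1,2) that] in auto)
        then show ?thesis using pr_sgn(1)[OF QR DR[OF that(1)]] by simp
      qed
      have ef: "pr e f = 0"
      proof -
        have cs: "chain (p(1 := e)) 2"
          using t(1) p(2,3) e(1,4) e0(1) unfolding chain_def inj_on_def by (auto simp: less_2_cases_iff)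
        have "f \<notin> (p(1 := e)) ` {..<2}" using e(3,5) p(2) by (auto simp: less_2_cases_iff)
        from off_chain(1)[OF cs _ e(2) this, of 1] e0(2) show ?thesis by simp
      qed
      have fe: "pr f e = 0" using ef pr_sym0 e by blast
      have te: "pr t e = -1" "pr e t = -1" "pr t f = -1" "pr f t = -1" "t ~= e" "t ~= f"
      proof -
        show ne: "t ~= e" "t ~= f" using e(4,5) p(2,3) by auto
        show "pr t e = -1" "pr e t = -1" "pr t f = -1" "pr f t = -1"
          using sl_pr[OF sl] t(1) e ne pr_sym0 by metis+
      qed
      have Qn: "?Q - g \<notin> R \<and> g - ?Q \<notin> R \<and> g ~= ?Q" if g: "g \<in> D" "g \<notin> p ` {1..<n}" for g
      proof -
        have "p 1 \<in> p ` {1..<n}" "p 1 \<in> D" using n2 chain_D[OF p(1), of 1] by auto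
        moreover from this have "p 1 ~= g" using g by auto
        ultimately have "?Q - g \<notin> R \<and> g - ?Q \<notin> R \<and> ?Q ~= g"
          using not_root[OF seg_cmb[OF p(1) order_refl, of 1] cmb_unit[OF g(1), symmetric], of "p 1" g] g by (simp add: unit_def)
        then show ?thesis by blast
      qed
      have qe: "t \<notin> p ` {1..<n}" "e \<notin> p ` {1..<n}" "f \<notin> p ` {1..<n}"
      proof -
        have "p k ~= p 0" if "k \<in> {1..<n}" for k using chain_inj[OF p(1), of k 0] that by auto
        then show "t \<notin> p ` {1..<n}" using p(3) by (metis imageE)
      qed (use e(4,5) in auto)
      have lQ: "pr \<omega> ?Q = real m"
      proof -
        have "pr \<omega> ?Q = (\<Sum>k=1..<n. pr \<omega> (p k))" using n2 by (intro seg_co[OF p(1) _ _ sl_simple_bonds[OF sl p(1)]]) auto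
        also have "\<dots> = (\<Sum>k\<in>{n - 1}. pr \<omega> (p k))"
        proof (rule sum.mono_neutral_right)
          show "\<forall>k\<in>{1..<n} - {n - 1}. pr \<omega> (p k) = 0"
          proof
            fix k assume k: "k \<in> {1..<n} - {n - 1}"
            then have "p k ~= s" using chain_inj[OF p(1), of k "n - 1"] p(4) by auto
            then show "pr \<omega> (p k) = 0" using z chain_D[OF p(1), of k] k by simp
          qed
        qed (use n2 in auto)
        finally show ?thesis using p(4) m by simp
      qed
      have "t ~= s" using p chain_inj[OF p(1), of 0 "n - 1"] n2 by auto
      moreover have "e ~= s" "f ~= s" using e(4,5) p(2,4) by auto
      ultimately have lz: "pr \<omega> t = 0" "pr \<omega> e = 0" "pr \<omega> f = 0" using z t(1) e by auto
      have d: "t - e \<notin> R" "t - f \<notin> R" "e - f \<notin> R" "e - t \<notin> R" "f - t \<notin> R" "f - e \<notin> R"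
        using simple_diff t(1) e te(5,6) by metis+
      have pos: "?Q \<in> pos" "t \<in> pos" "e \<in> pos" "f \<in> pos" using Q D_pos t(1) e by auto
      show False
      proof (rule gram_list[of 4 ?g "[[2, -1, 0, 0], [-1, 2, -1, -1], [0, -1, 2, 0], [0, -1, 0, 2]]" "[2 + (int m - 2), 0, 0, 0]",
            OF _ _ _ _ _ _ _ gram_D4_outer])
        show "\<forall>i<4. \<forall>j<4. pr (?g i) (?g j) = real_of_int ([[2, -1, 0, 0], [-1, 2, -1, -1], [0, -1, 2, 0], [0, -1, 0, 2]] ! i ! j)"
          using pr_self pos pos_R Qt Qo[OF e(1,4) e0(1)] Qo[OF e(2,5) e0(2)] ef fe te by (simp add: eval_nat_numeral All_less_Suc)
        show "\<forall>i<4. pr \<omega> (?g i) = real_of_int ([2 + (int m - 2), 0, 0, 0] ! i)"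
          using lQ lz by (simp add: eval_nat_numeral All_less_Suc)
        show "\<forall>i<4. \<forall>j<i. ?g i - ?g j \<notin> R \<and> ?g i ~= ?g j"
          using Qn[OF t(1) qe(1)] Qn[OF e(1) qe(2)] Qn[OF e(2) qe(3)] d te(5,6) e(3) by (simp add: eval_nat_numeral All_less_Suc)
        show "\<forall>i<4. ?g i \<in> pos" using pos by (simp add: eval_nat_numeral All_less_Suc)
      qed (use m2 in auto)
    qed
  qed
qed

end

section \<open>Multiplicity-free cases: natural, spin and symmetric power representations\<close>

section \<open>Multiplicity-free representations\<close>

text \<open>Slopes increase and end at a value at most 0, so \<open>d\<close> decreases. Then
  \<open>2 * d 0 \<le> d 1 + 1\<close> gives \<open>d 0 \<le> 1\<close>, and \<open>d 0 = 1\<close>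
  makes the first slope 0, hence all of them. The inequalities are the dominance conditions on the
  coefficients of a weight along a chain.\<close>

lemma convex_sequence:
  fixes d :: "nat => int"
  assumes n: "n \<ge> 2" and nn: "!!i. i < n ==> d i \<ge> 0" and cv: "!!i. Suc (Suc i) < n ==> 2 * d (Suc i) \<le> d i + d (Suc (Suc i))"
    and e: "d (n - 1) \<le> d (n - 2)" and b: "2 * d 0 \<le> d 1 + 1"
  shows "(\<forall>i<n. d i = 0) \<or> (\<forall>i<n. d i = 1)"
proof -
  have A': "d (Suc i) \<le> d i" if "i \<le> n - 2" for i
    using that
  proof (induction i rule: inc_induct)
    case base
    have "Suc (n - 2) = n - 1" using n by simp
    then show ?case using e by simp
  next
    case (step i)
    then have "Suc (Suc i) < n" by linarith
    from cv[OF this] step.IH show ?case by linarith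
  qed
  have A: "d (Suc i) \<le> d i" if "Suc i < n" for i by (rule A') (use that in linarith)
  have B: "d 1 - d 0 \<le> d (Suc i) - d i" if "Suc i < n" for i
    using that
  proof (induction i)
    case (Suc i)
    then show ?case using cv[of i] by simp
  qed simp
  have C: "d i \<le> d 0" if "i < n" for i
    using that
  proof (induction i)
    case (Suc i)
    then show ?case using A[of i] by simp
  qed simp
  have d0: "d 0 \<ge> 0" "d 1 \<le> d 0" using nn[of 0] A[of 0] n by auto
  show ?thesis
  proof (cases "d 0 = 0")
    case True
    then show ?thesis using C nn by (metis order_antisym)
  next
    case False
    then have d01: "d 0 = 1" "d 1 = 1" using d0 b by linarith+
    have "d i = 1" if "i < n" for i
      using that
    proof (induction i)
      case (Suc i)
      then show ?case using A[of i] B[of i] d01 by simp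
    qed (use d01 in simp)
    then show ?thesis by blast
  qed
qed

context hwm
begin

lemma pr_chain:
  assumes c: "chain p n" "p ` {..<n} = D" and i: "i < n"
  shows "pr (cmb d) (p i) = 2 * d (p i) + (if i > 0 then d (p (i - 1)) * pr (p (i - 1)) (p i) else 0) +
    (if Suc i < n then d (p (Suc i)) * pr (p (Suc i)) (p i) else 0)"
proof -
  let ?f = "\<lambda>k. d (p k) * pr (p k) (p i)"
  let ?A = "if i > 0 then {i - 1} else {}" and ?B = "if Suc i < n then {Suc i} else {}"
  have "pr (cmb d) (p i) = (\<Sum>a\<in>p ` {..<n}. d a * pr a (p i))" unfolding c(2) by (rule pr_cmb)
  also have "\<dots> = (\<Sum>k<n. ?f k)"
    using c(1) by (subst sum.reindex) (auto simp: chain_def)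
  also have "(\<Sum>k<n. ?f k) = (\<Sum>k\<in>insert i (?A \<union> ?B). ?f k)"
  proof (rule sum.mono_neutral_right)
    show "\<forall>k\<in>{..<n} - insert i (?A \<union> ?B). ?f k = 0"
    proof
      fix k assume k: "k \<in> {..<n} - insert i (?A \<union> ?B)"
      then have "k < n" "k ~= i" by auto
      moreover have "Suc k ~= i" "k ~= Suc i" using k i by (auto split: if_splits)
      ultimately have "pr (p k) (p i) = 0" using chain_far[OF c(1), of k i] chain_far[OF c(1), of i k] i by (metis Suc_lessI linorder_neqE_nat)
      then show "?f k = 0" by simp
    qed
  qed (use i in auto)
  also have "\<dots> = ?f i + (\<Sum>k\<in>?A. ?f k) + (\<Sum>k\<in>?B. ?f k)"
    by (subst sum.insert) (auto simp: sum.union_disjoint)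
  finally show ?thesis using chain_self[OF c(1) i] by simp
qed

text \<open>Computed with \<open>ip\<close>, because the segment may contain the multiple bond,
  across which coroots do not simply add.\<close>

lemma label_seg_0:
  assumes c: "chain p n" and ij: "i < j" "j \<le> n" and z: "!!k. i \<le> k ==> k < j ==> pr \<omega> (p k) = 0"
  shows "pr \<omega> (seg p i j) = 0"
proof -
  have g: "seg p i j \<in> R" by (rule pos_R[OF seg_pos[OF c ij]])
  have "ip (seg p i j) \<omega> = (\<Sum>a\<in>D. real_of_int (if a \<in> p ` {i..<j} then 1 else 0) * ip a \<omega>)"
    unfolding seg_cmb[OF c ij(2)] by (rule ip_cmb)
  also have "\<dots> = 0"
  proof (rule sum.neutral, rule ballI)
    fix a assume a: "a \<in> D"
    show "real_of_int (if a \<in> p ` {i..<j} then 1 else 0) * ip a \<omega> = 0"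
    proof (cases "a \<in> p ` {i..<j}")
      case True
      then have "pr \<omega> a = 0" using z by auto
      then show ?thesis using ip_pr[OF DR[OF a], of \<omega>] ip_sym[of a \<omega>] by simp
    qed simp
  qed
  finally show ?thesis using pr_ip[OF g, of \<omega>] ip_sym[of \<omega> "seg p i j"] by simp
qed

text \<open>By \<open>mult_up\<close> the multiplicity 2 would persist one step up along
  \<open>r0\<close>, where it is at most 1.\<close>

lemma raise_one:
  assumes c2: "wm c = 2" and nz: "\<exists>r\<in>D. c r ~= 0" and le: "!!r. r \<in> D ==> wm (c(r := c r - 1)) \<le> 1"
    and a: "r0 \<in> D" "!!r. r \<in> D ==> r ~= r0 ==> wm (c(r := c r - 1)) = 0"
  shows False
proof -
  obtain b where b: "b \<in> D" "c b ~= 0" using nz by blast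
  have "wm c \<le> wm (c(r0 := c r0 - 1))" by (rule mult_up[of b]) (use b a in auto)
  then show False using le[OF a(1)] c2 by simp
qed

lemma reflect_neg:
  assumes a: "r \<in> D" and k: "pr (\<omega> - cmb c) r = real_of_int k" "c r + k < 0" shows "wm c = 0"
  using mult_reflect_simple[OF a k(1)] mult_neg[OF a, of "c(r := c r + k)"] k(2) by simp

text \<open>Dominance leaves the weight 0 with all coefficients 1, and only the last simple root,
  the short one, leads up from it to a weight.\<close>

lemma B_natural:
  assumes c: "chain p n" "p ` {..<n} = D" and n: "n \<ge> 2"
    and b: "!!k. Suc k < n ==> pr (p k) (p (Suc k)) = (if Suc (Suc k) = n then -2 else -1)"
      "!!k. Suc k < n ==> pr (p (Suc k)) (p k) = -1"
    and l: "pr \<omega> (p 0) = 1" "!!k. 0 < k ==> k < n ==> pr \<omega> (p k) = 0"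
  shows False
proof -
  obtain d where d: "wm d = 2" "!!r. d r \<ge> 0" "\<exists>r\<in>D. d r ~= 0" "!!r. r \<in> D ==> pr (cmb d) r \<le> pr \<omega> r"
    "!!r. r \<in> D ==> wm (d(r := d r - 1)) \<le> 1" by (rule dominant_mult_2) blast
  have pd: "pr (cmb d) (p i) \<le> pr \<omega> (p i)" if "i < n" for i using d(4) chain_D[OF c(1) that] by blast
  have pin: "p i \<in> D" if "i < n" for i using chain_D[OF c(1) that] .
  have S: "Suc (n - 2) = n - 1" using n by simp
  have "(\<forall>i<n. d (p i) = 0) \<or> (\<forall>i<n. d (p i) = 1)"
  proof (rule convex_sequence[OF n])
    show "d (p i) \<ge> 0" for i using d(2) by blast
    show "2 * d (p (Suc i)) \<le> d (p i) + d (p (Suc (Suc i)))" if i: "Suc (Suc i) < n" for i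
      using pd[of "Suc i"] b(1)[of i] b(2)[of "Suc i"] l(2)[of "Suc i"] i unfolding pr_chain[OF c Suc_lessD[OF i]] by simp
    have "Suc (Suc (n - 2)) = n" "n - 1 - 1 = n - 2" "\<not> Suc (n - 1) < n" "0 < n - 1" "n - 1 < n" using n by auto
    then show "d (p (n - 1)) \<le> d (p (n - 2))"
      using pd[of "n - 1"] b(1)[of "n - 2"] l(2)[of "n - 1"] S pr_chain[OF c \<open>n - 1 < n\<close>, of d] by simp
    show "2 * d (p 0) \<le> d (p 1) + 1" using pd[of 0] b(2)[of 0] l(1) n pr_chain[OF c, of 0 d] by simp
  qed
  moreover have "\<not> (\<forall>i<n. d (p i) = 0)" using d(3) unfolding c(2)[symmetric] by blast
  ultimately have d1: "!!i. i < n ==> d (p i) = 1" by blast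
  show False
  proof (rule raise_one[OF d(1,3,5), of "p (n - 1)"])
    show "p (n - 1) \<in> D" using pin n by simp
    fix r assume a: "r \<in> D" "r ~= p (n - 1)"
    obtain i where i: "i < n" "r = p i" using a(1) unfolding c(2)[symmetric] by blast
    have "i ~= n - 1" using a(2) i by auto
    then have i1: "Suc i < n" using i by simp
    let ?g = "\<lambda>a. if a \<in> p ` {Suc i..<n} then 1 else 0 :: int" and ?d = "d(r := d r - 1)"
    have g: "seg p (Suc i) n = cmb ?g" by (rule seg_cmb[OF c(1) order_refl])
    have gR: "seg p (Suc i) n \<in> R" using seg_pos[OF c(1) i1] pos_R by simp
    \<comment> \<open>Without node \<open>i\<close> the sum of all nodes splits into two orthogonal
      segments. The one after \<open>i\<close> pairs to 2 with itself, so reflecting in it produces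
      the coefficient -1 at the last node.\<close>
    have "cmb ?d = seg p 0 i + seg p (Suc i) n"
    proof -
      have "seg p 0 i = cmb (\<lambda>a. if a \<in> p ` {0..<i} then 1 else 0)" by (rule seg_cmb[OF c(1)]) (use i in simp)
      moreover have "cmb ?d = cmb (\<lambda>a. (if a \<in> p ` {0..<i} then 1 else 0) + ?g a)"
      proof (rule sum.cong)
        fix a assume "a \<in> D"
        then obtain j where j: "j < n" "a = p j" unfolding c(2)[symmetric] by blast
        have mem: "p j \<in> p ` A \<longleftrightarrow> j \<in> A" if "A \<subseteq> {..<n}" for A using chain_inj[OF c(1) j(1)] that by auto
        have "{0..<i} \<subseteq> {..<n}" "{Suc i..<n} \<subseteq> {..<n}" using i by auto
        then have "(p j \<in> p ` {0..<i} \<longleftrightarrow> j < i) \<and> (p j \<in> p ` {Suc i..<n} \<longleftrightarrow> i < j)" using j(1) by (simp only: mem) auto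
        moreover have "p j = p i \<longleftrightarrow> j = i" by (rule chain_inj[OF c(1) j(1) i(1)])
        ultimately show "of_int (?d a) * a = of_int ((if a \<in> p ` {0..<i} then 1 else 0) + ?g a) * a"
          using d1 i j by auto
      qed simp
      ultimately show ?thesis unfolding g by (simp only: cmb_add)
    qed
    moreover have "pr (seg p 0 i) (seg p (Suc i) n) = 0"
      using seg_far(1)[OF c(1), of 0 i "Suc i" n] i1 by (cases "i = 0") (auto simp: seg_def pr_0)
    moreover have "pr \<omega> (seg p (Suc i) n) = 0" by (rule label_seg_0[OF c(1) i1 order_refl]) (use l(2) in auto)
    ultimately have "pr (\<omega> - cmb ?d) (seg p (Suc i) n) = real_of_int (- 2)"
      using pr_self[OF gR] by (simp add: pr_diff pr_add)
    from mult_reflect[OF gR g this] have "wm ?d \<le> wm (\<lambda>a. ?d a + - 2 * ?g a)" .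
    moreover have "wm (\<lambda>a. ?d a + - 2 * ?g a) = 0"
    proof (rule mult_neg[of "p (n - 1)"])
      have "p (n - 1) \<in> p ` {Suc i..<n}" using i1 by auto
      then show "?d (p (n - 1)) + - 2 * ?g (p (n - 1)) < 0" using d1[of "n - 1"] n a(2) by auto
    qed (use pin n in simp)
    ultimately show "wm ?d = 0" by simp
  qed
qed

text \<open>The first label is 0 here, so the constant solution 1 of \<open>convex_sequence\<close>
  is impossible and no dominant weight lies strictly below \<open>\<omega>\<close>.\<close>

lemma B_spin:
  assumes c: "chain p n" "p ` {..<n} = D" and n: "n \<ge> 2"
    and b: "!!k. Suc k < n ==> pr (p k) (p (Suc k)) = (if Suc (Suc k) = n then -2 else -1)"
      "!!k. Suc k < n ==> pr (p (Suc k)) (p k) = -1"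
    and l: "pr \<omega> (p (n - 1)) = 1" "!!k. Suc k < n ==> pr \<omega> (p k) = 0"
  shows False
proof -
  obtain d where d: "wm d = 2" "!!a. d a \<ge> 0" "\<exists>a\<in>D. d a ~= 0" "!!a. a \<in> D ==> pr (cmb d) a \<le> pr \<omega> a"
    by (rule dominant_mult_2) blast
  have pd: "pr (cmb d) (p i) \<le> pr \<omega> (p i)" if "i < n" for i using d(4) chain_D[OF c(1) that] by blast
  have S: "Suc (n - 2) = n - 1" using n by simp
  have z: "2 * d (p 0) \<le> d (p 1)" using pd[of 0] b(2)[of 0] l(2)[of 0] n pr_chain[OF c, of 0 d] by simp
  have "(\<forall>i<n. d (p i) = 0) \<or> (\<forall>i<n. d (p i) = 1)"
  proof (rule convex_sequence[OF n])
    show "d (p i) \<ge> 0" for i using d(2) by blast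
    show "2 * d (p (Suc i)) \<le> d (p i) + d (p (Suc (Suc i)))" if i: "Suc (Suc i) < n" for i
      using pd[of "Suc i"] b(1)[of i] b(2)[of "Suc i"] l(2)[of "Suc i"] i unfolding pr_chain[OF c Suc_lessD[OF i]] by simp
    have "Suc (Suc (n - 2)) = n" "n - 1 - 1 = n - 2" "\<not> Suc (n - 1) < n" "0 < n - 1" "n - 1 < n" using n by auto
    then show "d (p (n - 1)) \<le> d (p (n - 2))"
      using pd[of "n - 1"] b(1)[of "n - 2"] l(1) S pr_chain[OF c \<open>n - 1 < n\<close>, of d] by simp
    show "2 * d (p 0) \<le> d (p 1) + 1" using z by simp
  qed
  moreover have "\<not> (\<forall>i<n. d (p i) = 0)" using d(3) unfolding c(2)[symmetric] by blast
  ultimately show False using z n by force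
qed

lemma C_natural:
  assumes c: "chain p n" "p ` {..<n} = D" and n: "n \<ge> 3"
    and b: "!!k. Suc k < n ==> pr (p (Suc k)) (p k) = (if Suc (Suc k) = n then -2 else -1)"
      "!!k. Suc k < n ==> pr (p k) (p (Suc k)) = -1"
    and l: "pr \<omega> (p 0) = 1" "!!k. 0 < k ==> k < n ==> pr \<omega> (p k) = 0"
  shows False
proof -
  obtain d where d: "wm d = 2" "!!a. d a \<ge> 0" "\<exists>a\<in>D. d a ~= 0" "!!a. a \<in> D ==> pr (cmb d) a \<le> pr \<omega> a"
    by (rule dominant_mult_2) blast
  have pd: "pr (cmb d) (p i) \<le> pr \<omega> (p i)" if "i < n" for i using d(4) chain_D[OF c(1) that] by blast
  \<comment> \<open>Doubling the last coefficient absorbs the double bond and makes the sequence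
    convex; its last entry is then even, which rules out the constant 1.\<close>
  define e where "e i = (if Suc i = n then 2 * d (p i) else d (p i))" for i
  have "(\<forall>i<n. e i = 0) \<or> (\<forall>i<n. e i = 1)"
  proof (rule convex_sequence)
    show "n \<ge> 2" using n by simp
    show "e i \<ge> 0" for i using d(2)[of "p i"] by (simp add: e_def)
    show "2 * e (Suc i) \<le> e i + e (Suc (Suc i))" if i: "Suc (Suc i) < n" for i
      using pd[of "Suc i"] b(2)[of i] b(1)[of "Suc i"] l(2)[of "Suc i"] i unfolding pr_chain[OF c Suc_lessD[OF i]] by (simp add: e_def mult.commute split: if_splits)
    have s: "Suc (n - 2) = n - 1" "n - 1 ~= n" "Suc (n - 1) = n" "n - 1 - 1 = n - 2" "\<not> Suc (n - 1) < n" "0 < n - 1" "n - 1 < n" using n by auto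
    then show "e (n - 1) \<le> e (n - 2)"
      using pd[of "n - 1"] b(2)[of "n - 2"] l(2)[of "n - 1"] pr_chain[OF c \<open>n - 1 < n\<close>, of d] by (simp add: e_def)
    show "2 * e 0 \<le> e 1 + 1"
      using pd[of 0] b(1)[of 0] l(1) n pr_chain[OF c, of 0 d] by (auto simp: e_def mult.commute split: if_splits)
  qed
  moreover have "e (n - 1) ~= 1" unfolding e_def using n by simp presburger
  ultimately have e0: "\<forall>i<n. e i = 0" using n by (metis diff_less less_le_trans zero_less_numeral zero_less_one)
  have "d (p i) = 0" if "i < n" for i using e0[rule_format, OF that] by (simp add: e_def split: if_splits)
  then show False using d(3) unfolding c(2)[symmetric] by blast
qed

text \<open>Dominance leaves the coefficients \<open>0, 1, 1\<close>. Raising by \<open>p 0\<close>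
  gives a negative coefficient, and raising by \<open>p 2\<close> does so after a reflection in
  \<open>p 1\<close>.\<close>

lemma C3_last:
  assumes c: "chain p 3" "p ` {..<3} = D"
    and b: "pr (p 0) (p 1) = -1" "pr (p 1) (p 0) = -1" "pr (p 1) (p 2) = -1" "pr (p 2) (p 1) = -2"
    and l: "pr \<omega> (p 0) = 0" "pr \<omega> (p 1) = 0" "pr \<omega> (p 2) = 1"
  shows False
proof -
  obtain d where d: "wm d = 2" "!!r. d r \<ge> 0" "\<exists>r\<in>D. d r ~= 0" "!!r. r \<in> D ==> pr (cmb d) r \<le> pr \<omega> r"
    "!!r. r \<in> D ==> wm (d(r := d r - 1)) \<le> 1" by (rule dominant_mult_2) blast
  have D: "p 0 \<in> D" "p 1 \<in> D" "p 2 \<in> D" using chain_D[OF c(1)] by auto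
  have De: "D = {p 0, p 1, p 2}" unfolding c(2)[symmetric] by (auto simp: less_Suc_eq eval_nat_numeral)
  have ne: "p 0 ~= p 1" "p 0 ~= p 2" "p 1 ~= p 2" using chain_inj[OF c(1)] by auto
  have pc: "pr (cmb f) (p 0) = 2 * f (p 0) - f (p 1)" "pr (cmb f) (p 1) = 2 * f (p 1) - f (p 0) - 2 * f (p 2)"
    "pr (cmb f) (p 2) = 2 * f (p 2) - f (p 1)" for f
    using pr_chain[OF c, of 0 f] pr_chain[OF c, of 1 f] pr_chain[OF c, of 2 f] b by (auto simp: eval_nat_numeral)
  have i: "2 * d (p 0) \<le> d (p 1)" "2 * d (p 1) \<le> d (p 0) + 2 * d (p 2)" "2 * d (p 2) \<le> d (p 1) + 1"
    using d(4)[OF D(1)] d(4)[OF D(2)] d(4)[OF D(3)] l unfolding pc by linarith+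
  have "\<not> (d (p 0) = 0 \<and> d (p 1) = 0 \<and> d (p 2) = 0)" using d(3) De by auto
  then have e: "d (p 0) = 0" "d (p 1) = 1" "d (p 2) = 1" using i d(2)[of "p 0"] d(2)[of "p 1"] d(2)[of "p 2"] by presburger+
  show False
  proof (rule raise_one[OF d(1,3,5) D(2)])
    fix r assume a: "r \<in> D" "r ~= p 1"
    then consider "r = p 0" | "r = p 2" using De by blast
    then show "wm (d(r := d r - 1)) = 0"
    proof cases
      case 1
      then show ?thesis using mult_neg[OF a(1), of "d(r := d r - 1)"] e by simp
    next
      case 2
      have "pr (\<omega> - cmb (d(r := d r - 1))) (p 1) = real_of_int (- 2)" unfolding pr_diff pc using 2 ne e l by simp
      then show ?thesis by (rule reflect_neg[OF D(2)]) (use 2 ne e in simp)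
    qed
  qed
qed

text \<open>Dominance leaves \<open>2, 1\<close>, the zero weight. Raising it by the long root
  \<open>p 1\<close> gives the pairing -3 with \<open>p 0\<close>, and the reflection there has the
  coefficient -1.\<close>

lemma G2_natural:
  assumes c: "chain p 2" "p ` {..<2} = D"
    and b: "pr (p 0) (p 1) = -1" "pr (p 1) (p 0) = -3"
    and l: "pr \<omega> (p 0) = 1" "pr \<omega> (p 1) = 0"
  shows False
proof -
  obtain d where d: "wm d = 2" "!!r. d r \<ge> 0" "\<exists>r\<in>D. d r ~= 0" "!!r. r \<in> D ==> pr (cmb d) r \<le> pr \<omega> r"
    "!!r. r \<in> D ==> wm (d(r := d r - 1)) \<le> 1" by (rule dominant_mult_2) blast
  have D: "p 0 \<in> D" "p 1 \<in> D" using chain_D[OF c(1)] by auto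
  have De: "D = {p 0, p 1}" unfolding c(2)[symmetric] by (auto simp: less_Suc_eq eval_nat_numeral)
  have ne: "p 0 ~= p 1" using chain_inj[OF c(1)] by auto
  have pc: "pr (cmb f) (p 0) = 2 * f (p 0) - 3 * f (p 1)" "pr (cmb f) (p 1) = 2 * f (p 1) - f (p 0)" for f
    using pr_chain[OF c, of 0 f] pr_chain[OF c, of 1 f] b by (auto simp: eval_nat_numeral)
  have i: "2 * d (p 0) \<le> 3 * d (p 1) + 1" "2 * d (p 1) \<le> d (p 0)"
    using d(4)[OF D(1)] d(4)[OF D(2)] l unfolding pc by linarith+
  have "\<not> (d (p 0) = 0 \<and> d (p 1) = 0)" using d(3) De by auto
  then have e: "d (p 0) = 2" "d (p 1) = 1" using i d(2)[of "p 0"] d(2)[of "p 1"] by presburger+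
  show False
  proof (rule raise_one[OF d(1,3,5) D(1)])
    fix r assume a: "r \<in> D" "r ~= p 0"
    then have a1: "r = p 1" using De by blast
    have "pr (\<omega> - cmb (d(r := d r - 1))) (p 0) = real_of_int (- 3)" unfolding pr_diff pc using a1 ne e l by simp
    then show "wm (d(r := d r - 1)) = 0" by (rule reflect_neg[OF D(1)]) (use a1 ne e in simp)
  qed
qed

subsection \<open>Multiples of the first fundamental weight in type A\<close>

lemma orth_sum: assumes "a \<in> D" "b \<in> D" "a ~= b" "pr a b = 0" shows "a + b \<notin> R"
proof
  assume r: "a + b \<in> R"
  have "pr (a + b) a = 2" using assms pr_sym0 pr_self DR by (simp add: pr_add)
  then have "a + b - of_int 2 * a \<in> R" using refl_R[OF r DR[OF assms(1)]] by simp
  moreover have "a + b - of_int 2 * a = b - a" by (simp add: algebra_simps)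
  ultimately show False using simple_diff[OF assms(2,1)] assms(3) by simp
qed

lemma serre_sum: assumes "a \<in> D" "b \<in> D" "a ~= b" "pr b a = -1" shows "a + b + a \<notin> R"
proof
  assume r: "a + b + a \<in> R"
  have "pr (a + b + a) a = 3" unfolding pr_add using assms pr_self DR by simp
  then have "a + b + a - of_int 3 * a \<in> R" using refl_R[OF r DR[OF assms(1)]] by simp
  moreover have "a + b + a - of_int 3 * a = b - a" by (simp add: algebra_simps)
  ultimately show False using simple_diff[OF assms(2,1)] assms(3) by simp
qed

lemma sum_nz: assumes "a \<in> pos" "b \<in> pos" shows "a + b ~= 0"
proof
  assume z: "a + b = 0"
  then have "pr a b = - 2" using pr_self[OF pos_R[OF assms(2)]] pr_minus[of b b] by (simp add: eq_neg_iff_add_eq_0[symmetric])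
  then have "a + b \<in> pos" by (intro pos_add[OF assms]) simp
  then show False using z R0 pos_R by auto
qed

lemma lowering_comm: assumes "a \<in> D" "b \<in> D" "a ~= b" "pr a b = 0" shows "X (- a) (X (- b) x) = X (- b) (X (- a) x)"
proof (rule X_comm[OF R_neg[OF DR[OF assms(1)]] R_neg[OF DR[OF assms(2)]]])
  show "- a + - b \<notin> R" using orth_sum[OF assms] R_neg[of "- a + - b"] by (auto simp: add.commute)
  show "- a + - b ~= 0" using sum_nz[OF D_pos[OF assms(1)] D_pos[OF assms(2)]] by (metis add.inverse_distrib_swap add.commute neg_equal_0_iff_equal)
qed

text \<open>\<open>T\<close> commutes with \<open>f\<close> and \<open>g\<close>. Moving
  \<open>f\<close> past \<open>g ^^ b\<close> costs \<open>b\<close> copies of \<open>T\<close>, and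
  moving \<open>g\<close> past \<open>f ^^ Suc a\<close> onto \<open>y\<close>, which it kills,
  costs \<open>a + 1\<close>; eliminating \<open>T\<close> between the two leaves one ordered
  monomial.\<close>

lemma straighten:
  fixes f g T :: "'v => 'v"
  assumes lin: "V.lin f" "V.lin g" and T: "!!x. T x = g (f x) - f (g x)"
    and comm: "!!x. T (f x) = f (T x)" "!!x. T (g x) = g (T x)" and y: "g y = 0"
  shows "of_nat (Suc a) *v f ((g ^^ b) ((f ^^ a) y)) = (of_nat (Suc a) - of_nat b) *v (g ^^ b) ((f ^^ Suc a) y)"
proof -
  have pl: "V.lin (f ^^ k)" "V.lin (g ^^ k)" for k using V.lin_pow lin by auto
  have gf: "g ((f ^^ Suc k) y) = of_nat (Suc k) *v (f ^^ k) (T y)" for k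
  proof (induction k)
    case 0
    then show ?case using T[of y] y V.lin_zero[OF lin(1)] by simp
  next
    case (Suc k)
    have Tf: "T ((f ^^ j) x) = (f ^^ j) (T x)" for j x by (induction j) (simp_all add: comm)
    have "g ((f ^^ Suc (Suc k)) y) = f (g ((f ^^ Suc k) y)) + T ((f ^^ Suc k) y)" using T[of "(f ^^ Suc k) y"] by simp
    also have "\<dots> = of_nat (Suc k) *v (f ^^ Suc k) (T y) + (f ^^ Suc k) (T y)" unfolding Suc Tf by (simp add: V.lin_scale[OF lin(1)])
    also have "\<dots> = (of_nat (Suc k) + 1) *v (f ^^ Suc k) (T y)" unfolding V.scale_left_distrib V.scale_one ..
    finally show ?case by (simp add: add.commute)
  qed
  have Tf: "T ((f ^^ j) x) = (f ^^ j) (T x)" for j x by (induction j) (simp_all add: comm)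
  have fg: "f ((g ^^ Suc k) w) = (g ^^ Suc k) (f w) - of_nat (Suc k) *v (g ^^ k) (T w)" for k w
  proof (induction k)
    case 0
    then show ?case using T[of w] by simp
  next
    case (Suc k)
    have Tg: "T ((g ^^ j) x) = (g ^^ j) (T x)" for j x by (induction j) (simp_all add: comm)
    have "f ((g ^^ Suc (Suc k)) w) = g (f ((g ^^ Suc k) w)) - T ((g ^^ Suc k) w)" using T[of "(g ^^ Suc k) w"] by simp
    also have "\<dots> = (g ^^ Suc (Suc k)) (f w) - (of_nat (Suc k) *v (g ^^ Suc k) (T w) + (g ^^ Suc k) (T w))"
      unfolding Suc Tg by (simp add: V.lin_scale[OF lin(2)] V.lin_diff[OF lin(2)])
    also have "of_nat (Suc k) *v (g ^^ Suc k) (T w) + (g ^^ Suc k) (T w) = (of_nat (Suc k) + 1) *v (g ^^ Suc k) (T w)"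
      unfolding V.scale_left_distrib V.scale_one ..
    finally show ?case by (simp add: add.commute)
  qed
  show ?thesis
  proof (cases b)
    case 0
    then show ?thesis by simp
  next
    case (Suc k)
    have g2: "(g ^^ b) ((f ^^ Suc a) y) = of_nat (Suc a) *v (g ^^ k) ((f ^^ a) (T y))"
    proof -
      have "(g ^^ b) ((f ^^ Suc a) y) = (g ^^ k) (g ((f ^^ Suc a) y))" unfolding Suc by (simp only: funpow_Suc_right comp_apply)
      then show ?thesis unfolding gf V.lin_scale[OF pl(2)] .
    qed
    have "f ((g ^^ b) ((f ^^ a) y)) = (g ^^ b) ((f ^^ Suc a) y) - of_nat b *v (g ^^ k) ((f ^^ a) (T y))"
      unfolding Suc fg Tf by simp
    then have "of_nat (Suc a) *v f ((g ^^ b) ((f ^^ a) y)) =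
        of_nat (Suc a) *v (g ^^ b) ((f ^^ Suc a) y) - of_nat b *v (of_nat (Suc a) *v (g ^^ k) ((f ^^ a) (T y)))"
      by (simp add: V.scale_right_diff_distrib mult.commute)
    also have "\<dots> = (of_nat (Suc a) - of_nat b) *v (g ^^ b) ((f ^^ Suc a) y)"
      unfolding g2[symmetric] V.scale_left_diff_distrib ..
    finally show ?thesis .
  qed
qed

text \<open>An operator \<open>f j\<close> applied to an ordered monomial meets one obstacle, its
  neighbour \<open>f (Suc j)\<close>. There \<open>straighten\<close> applies, because
  \<open>f (Suc j)\<close> kills the part of the monomial built from indices below \<open>j\<close>.
  The exponents are determined by the weight, so each weight space is spanned by one
  monomial.\<close>

lemma A_end:
  assumes c: "chain p n" "p ` {..<n} = D" and b: "simple_bonds p 0 n"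
    and l: "!!k. 0 < k ==> k < n ==> pr \<omega> (p k) = 0"
  shows False
proof -
  define f where "f i = X (- p i)" for i
  define wp where "wp k = rec_nat v (\<lambda>i x. (f i ^^ k i) x)" for k :: "nat => nat"
  have wp0: "wp k 0 = v" and wpS: "wp k (Suc i) = (f i ^^ k i) (wp k i)" for k i by (simp_all add: wp_def)
  have fl: "V.lin (f i)" for i unfolding f_def by (rule X_lin)
  have fpl: "V.lin (f i ^^ k)" for i k by (rule V.lin_pow[OF fl])
  have pin: "p i \<in> D" if "i < n" for i by (rule chain_D[OF c(1) that])
  have comm: "f i (f j x) = f j (f i x)" if "Suc i < j" "j < n" for i j x
    unfolding f_def using chain_far(1)[OF c(1) that] chain_inj[OF c(1), of i j] that pin by (intro lowering_comm) auto
  have comm': "f i ((f j ^^ k) x) = (f j ^^ k) (f i x)" if "Suc i < j" "j < n" for i j k x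
    by (induction k) (simp_all add: comm[OF that])
  have comm'': "f j ((f i ^^ k) x) = (f i ^^ k) (f j x)" if "Suc i < j" "j < n" for i j k x
    by (induction k) (simp_all add: comm[OF that, symmetric])
  have cong: "wp k i = wp k' i" if "!!j. j < i ==> k j = k' j" for k k' i
    using that by (induction i) (simp_all add: wp0 wpS)
  have fv: "f j v = 0" if j: "0 < j" "j < n" for j
  proof (rule mult_zeroD[of "unit (p j)"])
    have pj: "pr (\<omega> - cmb (unit (p j))) (p j) = real_of_int (- 2)"
      unfolding cmb_unit[OF pin[OF j(2)]] pr_diff l[OF j] chain_self[OF c(1) j(2)] by simp
    show "wm (unit (p j)) = 0" by (rule reflect_neg[OF pin[OF j(2)] pj]) (simp add: unit_def)
    have "X (- p j) v \<in> M (\<omega> + - p j)" by (rule X_M[OF R_neg[OF DR[OF pin[OF j(2)]]] v_M])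
    then show "f j v \<in> M (\<omega> - cmb (unit (p j)))" unfolding cmb_unit[OF pin[OF j(2)]] f_def by simp
  qed
  have kill: "f j (wp k i) = 0" if "i < j" "j < n" for j k i
    using that
  proof (induction i)
    case 0
    then show ?case using fv by (simp add: wp0)
  next
    case (Suc i)
    then show ?case using comm''[of i j "k i"] V.lin_zero[OF fpl] by (simp add: wpS)
  qed
  have step: "\<exists>r. f j (wp k m) = r *v wp (k(j := Suc (k j))) m" if "Suc j \<le> m" "m \<le> n" for j k m
    using that
  proof (induction m rule: dec_induct)
    case base
    have "f j (wp k (Suc j)) = wp (k(j := Suc (k j))) (Suc j)"
      using cong[of j k "k(j := Suc (k j))"] by (simp add: wpS)
    then have "f j (wp k (Suc j)) = 1 *v wp (k(j := Suc (k j))) (Suc j)" by simp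
    then show ?case ..
  next
    case (step m)
    let ?k = "k(j := Suc (k j))"
    show ?case
    proof (cases "m = Suc j")
      case True
      have jn: "Suc j < n" using step True by simp
      let ?y = "wp k j"
      let ?T = "\<lambda>x. f (Suc j) (f j x) - f j (f (Suc j) x)"
      have bd: "pr (p j) (p (Suc j)) = -1" "pr (p (Suc j)) (p j) = -1" using b jn by (auto simp: simple_bonds_def)
      have ne: "p j ~= p (Suc j)" using chain_inj[OF c(1), of j "Suc j"] jn by simp
      have P: "p j \<in> D" "p (Suc j) \<in> D" using pin jn by auto
      have nR: "- g \<notin> R" if "g \<notin> R" for g using that R_neg[of "- g"] by auto
      have p2: "p j + p (Suc j) \<in> pos" by (rule pos_add[OF D_pos[OF P(1)] D_pos[OF P(2)]]) (simp add: bd)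
      have s1: "- p (Suc j) + - p j + - p j \<notin> R" "- p (Suc j) + - p j + - p j ~= 0"
      proof -
        have e: "- p (Suc j) + - p j + - p j = - (p j + p (Suc j) + p j)" by simp
        show "- p (Suc j) + - p j + - p j \<notin> R" unfolding e by (rule nR[OF serre_sum[OF P ne bd(2)]])
        show "- p (Suc j) + - p j + - p j ~= 0" unfolding e using sum_nz[OF p2 D_pos[OF P(1)]] by (simp only: neg_equal_0_iff_equal not_False_eq_True)
      qed
      have s2: "- p (Suc j) + - p j + - p (Suc j) \<notin> R" "- p (Suc j) + - p j + - p (Suc j) ~= 0"
      proof -
        have e: "- p (Suc j) + - p j + - p (Suc j) = - (p (Suc j) + p j + p (Suc j))" by simp
        have e': "p (Suc j) + p j + p (Suc j) = p j + p (Suc j) + p (Suc j)" by (simp add: algebra_simps)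
        show "- p (Suc j) + - p j + - p (Suc j) \<notin> R" unfolding e by (rule nR[OF serre_sum[OF P(2,1) ne[symmetric] bd(1)]])
        show "- p (Suc j) + - p j + - p (Suc j) ~= 0" unfolding e e' using sum_nz[OF p2 D_pos[OF P(2)]] by (simp only: neg_equal_0_iff_equal not_False_eq_True)
      qed
      note N = R_neg[OF DR[OF P(1)]] R_neg[OF DR[OF P(2)]]
      have "of_nat (Suc (k j)) *v f j ((f (Suc j) ^^ k (Suc j)) ((f j ^^ k j) ?y)) =
          (of_nat (Suc (k j)) - of_nat (k (Suc j))) *v (f (Suc j) ^^ k (Suc j)) ((f j ^^ Suc (k j)) ?y)"
      proof (rule straighten[of "f j" "f (Suc j)" ?T])
        show "?T (f j x) = f j (?T x)" for x unfolding f_def by (rule X_serre[OF N(2,1,1) s1])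
        show "?T (f (Suc j) x) = f (Suc j) (?T x)" for x unfolding f_def by (rule X_serre[OF N(2,1,2) s2])
        show "f (Suc j) ?y = 0" by (rule kill) (use jn in auto)
      qed (rule fl refl)+
      moreover have "wp ?k j = ?y" by (rule cong) simp
      ultimately have e: "of_nat (Suc (k j)) *v f j (wp k (Suc m)) = (of_nat (Suc (k j)) - of_nat (k (Suc j))) *v wp ?k (Suc m)"
        unfolding True wpS by simp
      have "f j (wp k (Suc m)) = inverse (of_nat (Suc (k j))) *v (of_nat (Suc (k j)) *v f j (wp k (Suc m)))"
        by (simp del: of_nat_Suc)
      also have "\<dots> = (inverse (of_nat (Suc (k j))) * (of_nat (Suc (k j)) - of_nat (k (Suc j)))) *v wp ?k (Suc m)"
        unfolding e by (rule V.scale_scale)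
      finally show ?thesis by blast
    next
      case False
      have "m \<le> n" using step.prems by simp
      then obtain r where r: "f j (wp k m) = r *v wp ?k m" using step.IH by blast
      have "f j (wp k (Suc m)) = (f m ^^ k m) (f j (wp k m))" unfolding wpS by (rule comm') (use step False in auto)
      also have "\<dots> = r *v wp ?k (Suc m)" unfolding r V.lin_scale[OF fpl] using False step by (simp add: wpS)
      finally show ?thesis by blast
    qed
  qed
  define t where "t k a = int (k (inv_into {..<n} p a))" for k :: "nat => nat" and a
  have inj: "inj_on p {..<n}" using c(1) by (simp add: chain_def)
  have tp: "t k (p i) = int (k i)" if "i < n" for k i using inv_into_f_f[OF inj] that by (simp add: t_def)
  have wpM: "wp k m \<in> M (\<omega> - (\<Sum>i<m. of_nat (k i) * p i))" if "m \<le> n" for k m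
    using that
  proof (induction m)
    case 0
    then show ?case using v_M by (simp add: wp0)
  next
    case (Suc m)
    have "(f m ^^ j) x \<in> M (w - of_nat j * p m)" if "x \<in> M w" for j x w
    proof (induction j)
      case (Suc j)
      have "X (- p m) ((f m ^^ j) x) \<in> M (w - of_nat j * p m + - p m)"
        by (rule X_M[OF R_neg[OF DR[OF pin]] Suc]) (use \<open>Suc m \<le> n\<close> in simp)
      moreover have e: "w - of_nat j * p m + - p m = w - of_nat (Suc j) * p m" by (simp add: algebra_simps)
      ultimately show ?case unfolding e f_def funpow.simps comp_apply by blast
    qed (use that in simp)
    from this[OF Suc.IH] Suc.prems have "wp k (Suc m) \<in> M (\<omega> - (\<Sum>i<m. of_nat (k i) * p i) - of_nat (k m) * p m)"
      unfolding wpS by simp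
    then show ?case by (simp add: algebra_simps)
  qed
  have cm: "(\<Sum>i<n. of_nat (k i) * p i) = cmb (t k)" for k
  proof -
    have "cmb (t k) = (\<Sum>i<n. of_int (t k (p i)) * p i)" unfolding c(2)[symmetric] by (subst sum.reindex[OF inj]) simp
    also have "\<dots> = (\<Sum>i<n. of_nat (k i) * p i)" by (rule sum.cong) (simp_all add: tp)
    finally show ?thesis ..
  qed
  have sp: "V.span (range (\<lambda>k. wp k n)) = UNIV"
  proof (rule gen)
    have "wp (\<lambda>_. 0) i = v" for i by (induction i) (simp_all add: wp0 wpS)
    then show "v \<in> V.span (range (\<lambda>k. wp k n))" by (metis V.span_base rangeI)
    fix s x assume a: "s \<in> D" and x: "x \<in> V.span (range (\<lambda>k. wp k n))"
    obtain j where j: "j < n" "s = p j" using a unfolding c(2)[symmetric] by blast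
    show "X (- s) x \<in> V.span (range (\<lambda>k. wp k n))"
    proof (rule V.lin_span_image[OF X_lin _ V.subspace_span x])
      fix y assume "y \<in> range (\<lambda>k. wp k n)"
      then obtain k where k: "y = wp k n" by blast
      obtain r where "f j (wp k n) = r *v wp (k(j := Suc (k j))) n" using step[of j n k] j by auto
      then have "X (- s) y = r *v wp (k(j := Suc (k j))) n" by (simp add: f_def j k)
      then show "X (- s) y \<in> V.span (range (\<lambda>k. wp k n))" by (metis V.span_base V.span_scale rangeI)
    qed
  qed (rule V.subspace_span)
  obtain d where d: "wm d = 2" by (rule dominant_mult_2) blast
  have sub: "M (\<omega> - cmb d) \<subseteq> V.span ((\<lambda>k. wp k n) ` {k \<in> UNIV. cmb (t k) = cmb d})"
    by (rule spanning_weight_vectors[OF _ sp]) (use wpM[OF order_refl] in "simp only: cm")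
  have "(\<lambda>k. wp k n) ` {k \<in> UNIV. cmb (t k) = cmb d} \<subseteq> {wp (\<lambda>i. nat (d (p i))) n}"
  proof clarify
    fix k assume k: "cmb (t k) = cmb d"
    have "k i = nat (d (p i))" if "i < n" for i using cmb_indep[OF k pin[OF that]] tp[OF that, of k] by simp
    then show "wp k n = wp (\<lambda>i. nat (d (p i))) n" by (intro cong) simp
  qed
  then have "M (\<omega> - cmb d) \<subseteq> V.span {wp (\<lambda>i. nat (d (p i))) n}" using sub V.span_mono by blast
  then have "wm d \<le> 1" unfolding wm_def using V.dim_le_card[of "M (\<omega> - cmb d)" "{wp (\<lambda>i. nat (d (p i))) n}"] by simp
  then show False using d by simp
qed

end

section \<open>From diagrams and labels to the list of types\<close>

section \<open>The list of highest weights\<close>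

text \<open>A weight is given by the list of the pairs \<open>(i, a)\<close> of its non-zero labels.\<close>

definition allowed :: "lie_type => (nat \<times> nat) list => bool" where
  "allowed t L \<longleftrightarrow>
     t = TypeA 2 \<and> (\<exists>a\<ge>1. L \<in> {[(1, 1), (2, a)], [(1, a), (2, 1)]})
   \<or> t = TypeA 3 \<and> L \<in> {[(1, 1), (2, 1)], [(2, 1), (3, 1)], [(2, 2)], [(2, 3)]}
   \<or> (\<exists>n>3. t = TypeA n \<and> L \<in> {[(1, 1), (2, 1)], [(n - 1, 1), (n, 1)], [(2, 2)], [(n - 1, 2)]})
   \<or> t = TypeB 2 \<and> L \<in> {[(1, 1), (2, 1)], [(2, 2)], [(1, 2)], [(2, 3)], [(1, 3)]}
   \<or> t = TypeC 3 \<and> L = [(2, 1)]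
   \<or> t = TypeC 4 \<and> L \<in> {[(4, 1)], [(3, 1)]}
   \<or> t = TypeC 5 \<and> L = [(5, 1)]
   \<or> t = TypeF4 \<and> L = [(4, 1)]
   \<or> t = TypeG2 \<and> L = [(2, 1)]"

definition coef :: "(nat \<times> nat) list => nat => int" where
  "coef L i = (\<Sum>(k, a)\<leftarrow>L. if k = i then int a else 0)"

abbreviation one_at :: "nat => int => nat => int" where "one_at s a \<equiv> \<lambda>k. if k = s then a else 0"

abbreviation two_at :: "nat => int => int => nat => int" where
  "two_at s a b \<equiv> \<lambda>k. (if k = s then a else 0) + (if k = Suc s then b else 0)"

text \<open>A bond is kept in both directions, \<open>u\<close> forwards and \<open>w\<close>
  backwards along the chain, so the matrix also serves sub-diagrams listed in reverse.\<close>

definition path_matrix :: "(nat => int) => (nat => int) => nat => nat => int" where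
  "path_matrix u w i j = (if i = j then 2 else if j = Suc i then u i else if i = Suc j then w j else 0)"

context hwm
begin

definition classified :: bool where
  "classified \<longleftrightarrow> (\<exists>t L c. allowed t L \<and> simple_type t \<and> bij_betw c {1..lie_rank t} D \<and>
     (\<forall>i\<in>{1..lie_rank t}. \<forall>j\<in>{1..lie_rank t}. pr (c i) (c j) = of_int (cartan_matrix t i j)) \<and>
     (\<forall>i\<in>{1..lie_rank t}. pr \<omega> (c i) = of_int (coef L i)))"

definition bonds :: "(nat => 'w) => nat => (nat => int) => (nat => int) => bool" where
  "bonds p n u w \<longleftrightarrow> (\<forall>k. Suc k < n \<longrightarrow> pr (p k) (p (Suc k)) = of_int (u k) \<and> pr (p (Suc k)) (p k) = of_int (w k))"

definition labels :: "(nat => 'w) => nat => (nat => int) => bool" where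
  "labels p n l \<longleftrightarrow> (\<forall>k<n. pr \<omega> (p k) = of_int (l k))"

lemma pr_bonds:
  assumes c: "chain p n" and b: "bonds p n u w" and ij: "i < n" "j < n"
  shows "pr (p i) (p j) = of_int (path_matrix u w i j)"
proof -
  consider "i = j" | "j = Suc i" | "i = Suc j" | "Suc i < j" | "Suc j < i" by linarith
  then show ?thesis
    by cases (use b ij chain_self[OF c] chain_far[OF c] in "auto simp: path_matrix_def bonds_def")
qed

lemma classifiedI:
  assumes c: "chain p n" "p ` {..<n} = D" and b: "bonds p n u w" and l: "labels p n l"
    and t: "allowed t L" "simple_type t" "lie_rank t = n"
    and m: "!!i j. i < n ==> j < n ==> cartan_matrix t (Suc i) (Suc j) = path_matrix u w i j"
    and k: "!!i. i < n ==> l i = coef L (Suc i)"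
  shows classified
  unfolding classified_def
proof (intro exI conjI ballI)
  \<comment> \<open>Chains are indexed from 0, Bourbaki's numbering from 1.\<close>
  let ?c = "\<lambda>i. p (i - 1)"
  show "allowed t L" "simple_type t" by (rule t)+
  have "bij_betw p {..<n} D" using c by (simp add: bij_betw_def chain_def)
  moreover have "bij_betw (\<lambda>i. i - 1) {1..n} {..<n}" by (rule bij_betw_byWitness[of _ Suc]) auto
  ultimately have "bij_betw (p \<circ> (\<lambda>i. i - 1)) {1..n} D" by (rule bij_betw_trans[rotated])
  then show "bij_betw ?c {1..lie_rank t} D" by (simp add: comp_def t)
  fix i assume i: "i \<in> {1..lie_rank t}"
  then have i': "i - 1 < n" "Suc (i - 1) = i" using t by auto
  show "pr \<omega> (?c i) = of_int (coef L i)" using l k[OF i'(1)] i' by (simp add: labels_def)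
  fix j assume j: "j \<in> {1..lie_rank t}"
  then have j': "j - 1 < n" "Suc (j - 1) = j" using t by auto
  show "pr (?c i) (?c j) = of_int (cartan_matrix t i j)"
    using pr_bonds[OF c(1) b i'(1) j'(1)] m[OF i'(1) j'(1)] unfolding i'(2) j'(2) by simp
qed

lemma rev_chain:
  assumes c: "chain p n" "p ` {..<n} = D" and b: "bonds p n u w" and l: "labels p n l"
  shows "chain (\<lambda>i. p (n - Suc i)) n" "(\<lambda>i. p (n - Suc i)) ` {..<n} = D"
    "bonds (\<lambda>i. p (n - Suc i)) n (\<lambda>k. w (n - Suc (Suc k))) (\<lambda>k. u (n - Suc (Suc k)))"
    "labels (\<lambda>i. p (n - Suc i)) n (\<lambda>k. l (n - Suc k))"
proof -
  show "chain (\<lambda>i. p (n - Suc i)) n" by (rule chain_rev[OF c(1)])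
  have "p i \<in> (\<lambda>i. p (n - Suc i)) ` {..<n}" if "i < n" for i
    using that by (intro image_eqI[of _ _ "n - Suc i"]) auto
  then show "(\<lambda>i. p (n - Suc i)) ` {..<n} = D" unfolding c(2)[symmetric] by auto
  have "Suc (n - Suc (Suc k)) = n - Suc k" "n - Suc k < n" if "Suc k < n" for k using that by auto
  then show "bonds (\<lambda>i. p (n - Suc i)) n (\<lambda>k. w (n - Suc (Suc k))) (\<lambda>k. u (n - Suc (Suc k)))"
    using b unfolding bonds_def by metis
  show "labels (\<lambda>i. p (n - Suc i)) n (\<lambda>k. l (n - Suc k))" using l unfolding labels_def by auto
qed

lemma labels_cong: "labels p n l ==> (!!k. k < n ==> l k = l' k) ==> labels p n l'" by (simp add: labels_def)

lemma bonds_cong: "bonds p n u w ==> (!!k. Suc k < n ==> u k = u' k \<and> w k = w' k) ==> bonds p n u' w'" by (simp add: bonds_def)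

text \<open>Simple roots never differ by a root, so any selection \<open>ks\<close> of nodes, in any
  order, is admissible for a minor.\<close>

lemma node_gram:
  assumes det: "gram3 (mat L) (vec lab) a b d > 0" and c: "chain p n" and bo: "bonds p n u w" and l: "labels p n l"
    and ks: "distinct ks" "\<forall>i\<in>set ks. i < n"
    and L: "\<forall>i<length ks. \<forall>j<length ks. path_matrix u w (ks ! i) (ks ! j) = L ! i ! j" "\<forall>i<length ks. l (ks ! i) = lab ! i"
    and w: "set a \<subseteq> {..<length ks}" "mset b = mset a" "mset d = mset a"
  shows False
proof (rule gram_list[of "length ks" "\<lambda>i. p (ks ! i)" L lab a b d])
  have k: "ks ! i < n" if "i < length ks" for i using ks(2) that by auto
  show "\<forall>i<length ks. p (ks ! i) \<in> pos" using k chain_D[OF c] D_pos by blast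
  show "\<forall>i<length ks. \<forall>j<i. p (ks ! i) - p (ks ! j) \<notin> R \<and> p (ks ! i) ~= p (ks ! j)"
  proof (intro allI impI)
    fix i j assume ij: "i < length ks" "j < i"
    then have "ks ! i ~= ks ! j" using ks(1) nth_eq_iff_index_eq by fastforce
    then have "p (ks ! i) ~= p (ks ! j)" using chain_inj[OF c] k ij by simp
    then show "p (ks ! i) - p (ks ! j) \<notin> R \<and> p (ks ! i) ~= p (ks ! j)" using simple_diff chain_D[OF c] k ij by simp
  qed
  show "\<forall>i<length ks. \<forall>j<length ks. pr (p (ks ! i)) (p (ks ! j)) = real_of_int (L ! i ! j)"
    using pr_bonds[OF c bo] k L(1) by simp
  show "\<forall>i<length ks. pr \<omega> (p (ks ! i)) = real_of_int (lab ! i)" using l k L(2) by (simp add: labels_def)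
qed (use w det in auto)

text \<open>The boundaries may begin after 0 and end before \<open>n\<close>, so restriction to a
  sub-chain and contraction of its blocks happen in one step. Bonds within blocks have to be simple
  for the labels to add.\<close>

lemma block_gram:
  assumes det: "gram3 (mat L) (vec lab) a b d > 0" and c: "chain p n" and bo: "bonds p n u w" and l: "labels p n l"
    and m: "length bs = Suc m" and bs: "\<forall>i<m. bs ! i < bs ! Suc i" "bs ! m \<le> n"
    and s: "\<forall>i<m. \<forall>k. bs ! i \<le> k \<longrightarrow> Suc k < bs ! Suc i \<longrightarrow> u k = -1 \<and> w k = -1"
    and L: "\<forall>i<m. L ! i ! i = 2" "\<forall>i<m. \<forall>j<m. Suc i < j \<longrightarrow> L ! i ! j = 0 \<and> L ! j ! i = 0"
      "\<forall>i<m - 1. u (bs ! Suc i - 1) = L ! i ! Suc i \<and> w (bs ! Suc i - 1) = L ! Suc i ! i"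
    and lab: "\<forall>i<m. (\<Sum>k=bs ! i..<bs ! Suc i. l k) = lab ! i"
    and w: "set a \<subseteq> {..<m}" "mset b = mset a" "mset d = mset a"
  shows False
proof (rule chain_gram[OF c bs _ L(1,2) _ _ w det])
  have le: "bs ! i \<le> bs ! j" if "i \<le> j" "j \<le> m" for i j
    using that
  proof (induction j rule: dec_induct)
    case (step j)
    then have "bs ! j < bs ! Suc j" using bs(1) by simp
    then show ?case using step by simp
  qed simp
  have n: "bs ! i \<le> n" if "i \<le> m" for i using le[OF that order_refl] bs(2) by simp
  show "\<forall>i<m. simple_bonds p (bs ! i) (bs ! Suc i)"
  proof (intro allI impI)
    fix i assume i: "i < m"
    show "simple_bonds p (bs ! i) (bs ! Suc i)"
      unfolding simple_bonds_def using s[rule_format, OF i] bo n[of "Suc i"] i by (simp add: bonds_def)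
  qed
  show "\<forall>i<m - 1. pr (p (bs ! Suc i - 1)) (p (bs ! Suc i)) = real_of_int (L ! i ! Suc i) \<and>
      pr (p (bs ! Suc i)) (p (bs ! Suc i - 1)) = real_of_int (L ! Suc i ! i)"
  proof (intro allI impI)
    fix i assume i: "i < m - 1"
    then have "bs ! Suc i < bs ! Suc (Suc i)" "bs ! i < bs ! Suc i" using bs(1) by auto
    moreover have "Suc (Suc i) \<le> m" using i by linarith
    ultimately have "Suc (bs ! Suc i - 1) = bs ! Suc i" "bs ! Suc i < n" using n[of "Suc (Suc i)"] by auto
    then show "pr (p (bs ! Suc i - 1)) (p (bs ! Suc i)) = real_of_int (L ! i ! Suc i) \<and>
      pr (p (bs ! Suc i)) (p (bs ! Suc i - 1)) = real_of_int (L ! Suc i ! i)"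
      using L(3) i bo unfolding bonds_def by metis
  qed
  show "\<forall>i<m. (\<Sum>k=bs ! i..<bs ! Suc i. pr \<omega> (p k)) = real_of_int (lab ! i)"
  proof (intro allI impI)
    fix i assume i: "i < m"
    have "(\<Sum>k=bs ! i..<bs ! Suc i. pr \<omega> (p k)) = (\<Sum>k=bs ! i..<bs ! Suc i. real_of_int (l k))"
      by (rule sum.cong) (use l n[of "Suc i"] i in "auto simp: labels_def")
    then show "(\<Sum>k=bs ! i..<bs ! Suc i. pr \<omega> (p k)) = real_of_int (lab ! i)" using lab i by (simp flip: of_int_sum)
  qed
qed

text \<open>By \<open>support_adj\<close> any two labelled nodes are adjacent, and a chain contains
  no triangle.\<close>

lemma chain_labels:
  assumes c: "chain p n" "p ` {..<n} = D"
  obtains (one) s a where "s < n" "a \<ge> 1" "labels p n (one_at s a)"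
  | (two) s a b where "Suc s < n" "a \<ge> 1" "b \<ge> 1" "labels p n (two_at s a b)"
proof -
  define l where "l k = \<lfloor>pr \<omega> (p k)\<rfloor>" for k
  have l: "pr \<omega> (p k) = of_int (l k)" "l k \<ge> 0" if "k < n" for k
    using label_int[OF chain_D[OF c(1) that]] unfolding l_def by auto
  have ll: "labels p n l" using l(1) by (simp add: labels_def)
  have adj: "j = Suc i \<or> i = Suc j" if "i < n" "j < n" "i ~= j" "l i > 0" "l j > 0" for i j
  proof (rule ccontr)
    assume "\<not> ?thesis"
    then have "Suc i < j \<or> Suc j < i" using that(3) by linarith
    then have "pr (p i) (p j) = 0" using chain_far[OF c(1)] that by blast
    moreover have "pr (p i) (p j) ~= 0"
      by (rule support_adj) (use that chain_D[OF c(1)] chain_inj[OF c(1)] l in auto)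
    ultimately show False by blast
  qed
  obtain s where s: "s < n" "l s > 0"
  proof -
    obtain a where a: "a \<in> D" "pr \<omega> a > 0" by (rule support_ex)
    then obtain s where "s < n" "a = p s" unfolding c(2)[symmetric] by blast
    then show ?thesis using that a l(1)[of s] by simp
  qed
  show thesis
  proof (cases "\<exists>j<n. j ~= s \<and> l j > 0")
    case False
    then have "l k = one_at s (l s) k" if "k < n" for k using l(2)[OF that] that by force
    then have "labels p n (one_at s (l s))" by (intro labels_cong[OF ll]) auto
    then show ?thesis using one[OF s(1), of "l s"] s(2) by simp
  next
    case True
    then obtain j where j: "j < n" "j ~= s" "l j > 0" by blast
    define r where "r = min s j"
    have r: "Suc r < n" "l r > 0" "l (Suc r) > 0" using adj[OF s(1) j(1)] j s unfolding r_def by (auto simp: min_def)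
    have "l k = two_at r (l r) (l (Suc r)) k" if "k < n" for k
    proof (cases "l k > 0")
      case True
      have "k = r \<or> k = Suc r"
      proof (rule ccontr)
        assume "\<not> ?thesis"
        then show False using adj[of k r] adj[of k "Suc r"] that r True by auto
      qed
      then show ?thesis by auto
    next
      case False
      then show ?thesis using l(2)[OF that] r by auto
    qed
    then have "labels p n (two_at r (l r) (l (Suc r)))" by (intro labels_cong[OF ll]) auto
    then show ?thesis using two[OF r(1), of "l r" "l (Suc r)"] r by simp
  qed
qed

lemmas expand = All_less_Suc eval_nat_numeral path_matrix_def

section \<open>Type A\<close>

lemma A_simply_laced:
  assumes c: "chain p n" "p ` {..<n} = D" and b: "bonds p n (\<lambda>_. -1) (\<lambda>_. -1)" shows simply_laced
  unfolding simply_laced_def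
proof (intro ballI impI)
  fix x y assume "x \<in> D" "y \<in> D" "x ~= y"
  then obtain i j where "i < n" "x = p i" "j < n" "y = p j" "i ~= j" unfolding c(2)[symmetric] by auto
  then show "pr x y * pr y x < 2" using pr_bonds[OF c(1) b, of i j] pr_bonds[OF c(1) b, of j i] by (simp add: path_matrix_def)
qed

lemma bonds_simple: "bonds p n (\<lambda>_. -1) (\<lambda>_. -1) ==> simple_bonds p 0 n" by (simp add: bonds_def simple_bonds_def)

lemma A_first: assumes c: "chain p n" "p ` {..<n} = D" and b: "bonds p n (\<lambda>_. -1) (\<lambda>_. -1)" and l: "labels p n (one_at 0 a)" shows False
  by (rule A_end[OF c bonds_simple[OF b]]) (use l in "simp add: labels_def")

lemma A_inner:
  assumes c: "chain p n" and b: "bonds p n (\<lambda>_. -1) (\<lambda>_. -1)" and s: "Suc (Suc (Suc s)) < n" and l: "labels p n (one_at (Suc s) a)"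
  shows "a < 3"
proof (rule ccontr)
  assume "\<not> a < 3"
  then show False
    by (intro node_gram[OF gram_A4_mid[of "a - 3"] c b l, of "[s, Suc s, Suc (Suc s), Suc (Suc (Suc s))]"])
       (use s in "simp_all add: expand")
qed

lemma A_pair:
  assumes c: "chain p n" and b: "bonds p n (\<lambda>_. -1) (\<lambda>_. -1)" and s: "Suc (Suc s) < n"
    and l: "labels p n (two_at s x y)" and xy: "x \<ge> 1" "y \<ge> 1" "x = 1 \<or> y = 1"
  shows "x = 1 \<and> y = 1"
proof (rule ccontr)
  assume "\<not> ?thesis"
  then consider "x \<ge> 2" "y = 1" | "x = 1" "y \<ge> 2" using xy by linarith
  then show False
  proof cases
    case 1
    then show ?thesis
      by (intro node_gram[OF gram_A3_ab[of "x - 2"] c b l, of "[s, Suc s, Suc (Suc s)]"]) (use s in "simp_all add: expand")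
  next
    case 2
    then show ?thesis
      by (intro node_gram[OF gram_A3_ba[of "y - 2"] c b l, of "[s, Suc s, Suc (Suc s)]"]) (use s in "simp_all add: expand")
  qed
qed

lemma A_cartan: "i < n ==> j < n ==> cartan_matrix (TypeA n) (Suc i) (Suc j) = path_matrix (\<lambda>_. -1) (\<lambda>_. -1) i j"
  by (simp add: path_matrix_def)

lemma type_A:
  assumes c: "chain p n" "p ` {..<n} = D" and n: "n > 0" and b: "bonds p n (\<lambda>_. -1) (\<lambda>_. -1)"
  shows classified
proof -
  let ?p = "\<lambda>i. p (n - Suc i)"
  note I = classifiedI[OF c b _ _ _ _ A_cartan]
  show ?thesis
  proof (cases rule: chain_labels[OF c, case_names one two])
    case (one s a)
    note rv = rev_chain[OF c b one(3)]
    have lr: "labels ?p n (one_at (n - Suc s) a)" by (rule labels_cong[OF rv(4)]) (use one in auto)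
    have "s ~= 0"
    proof
      assume "s = 0"
      then show False using A_first[OF c b, of a] one(3) by simp
    qed
    moreover have "n - Suc s ~= 0"
    proof
      assume "n - Suc s = 0"
      then have "labels ?p n (one_at 0 a)" using lr by (simp only:)
      then show False by (rule A_first[OF rv(1,2,3)])
    qed
    ultimately have s: "0 < s" "Suc s < n" using one by auto
    \<comment> \<open>A single label 1 in a simply laced diagram falls under
      \<open>sl_single_label\<close>.\<close>
    have "a ~= 1"
    proof
      assume a: "a = 1"
      have "pr \<omega> x = 0" if "x \<in> D" "x ~= p s" for x
        using that one(3) unfolding c(2)[symmetric] labels_def by auto
      then show False using sl_single_label[OF A_simply_laced[OF c b] chain_D[OF c(1) one(1)]] one a by (simp add: labels_def)
    qed
    then have a2: "a \<ge> 2" using one by simp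
    obtain r where r: "s = Suc r" using s(1) by (cases s) auto
    have a4: "a < 4"
    proof (rule ccontr)
      assume "\<not> a < 4"
      then show False
        by (intro node_gram[OF gram_A3_mid[of "a - 4"] c(1) b one(3), of "[r, Suc r, Suc (Suc r)]"]) (use s r in "simp_all add: expand")
    qed
    show ?thesis
    proof (cases "n = 3")
      case True
      then have s1: "s = 1" using s by simp
      show ?thesis
        by (rule I[OF one(3), of n "[(2, nat a)]"])
           (use True s1 a2 a4 in "auto simp: allowed_def coef_def")
    next
      case False
      \<comment> \<open>With at least four nodes, an inner node has two further nodes on at least
        one side; the reversed chain covers the other side.\<close>
      have a3: "a < 3"
      proof (cases "Suc (Suc s) < n")
        case True
        then show ?thesis using A_inner[OF c(1) b, of r a] one(3) r by simp
      next
        case F: False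
        then obtain q where q: "n - Suc s = Suc q" "Suc (Suc (Suc q)) < n" using s False 
            by (cases "n - Suc s") auto
        then show ?thesis using A_inner[OF rv(1,3), of q a] lr by simp
      qed
      \<comment> \<open>Otherwise two nodes remain on either side and the support is the middle of
        an \<open>A_5\<close>, where the label 2 is already too large.\<close>
      have "s = 1 \<or> Suc (Suc s) = n"
      proof (rule ccontr)
        assume h: "\<not> ?thesis"
        then obtain q where q: "s = Suc (Suc q)" using r by (cases r) auto
        show False
          by (rule node_gram[OF gram_A5_mid[of "a - 2"] c(1) b one(3), of "[q, Suc q, Suc (Suc q), Suc (Suc (Suc q)), Suc (Suc (Suc (Suc q)))]"])
             (use h q a2 s in "simp_all add: expand")
      qed
      then show ?thesis
      proof
        assume s1: "s = 1"
        show ?thesis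
          by (rule I[OF one(3), of n "[(2, 2)]"]) (use False s s1 a2 a3 in "auto simp: allowed_def coef_def")
      next
        assume s1: "Suc (Suc s) = n"
        show ?thesis
          by (rule I[OF one(3), of n "[(n - 1, 2)]"]) (use False s s1 a2 a3 in "auto simp: allowed_def coef_def")
      qed
    qed
  next
    case (two s x y)
    note rv = rev_chain[OF c b two(4)]
    have lr: "labels ?p n (two_at (n - Suc (Suc s)) y x)"
    proof (rule labels_cong[OF rv(4)])
      fix k assume "k < n"
      then have "(n - Suc k = s) = (k = Suc (n - Suc (Suc s)))" "(n - Suc k = Suc s) = (k = n - Suc (Suc s))"
        using two(1) by linarith+
      then show "two_at s x y (n - Suc k) = two_at (n - Suc (Suc s)) y x k" by simp
    qed
    have one: "x = 1 \<or> y = 1"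
    proof (rule ccontr)
      assume "\<not> ?thesis"
      then show False
        by (intro node_gram[OF gram_A2[of "x - 2" "y - 2"] c(1) b two(4), of "[s, Suc s]"]) (use two in "simp_all add: expand")
    qed
    show ?thesis
    proof (cases "n = 2")
      case True
      then have s0: "s = 0" using two by simp
      have al: "allowed (TypeA n) [(1, nat x), (2, nat y)]"
      proof (cases "x = 1")
        case True
        then show ?thesis unfolding allowed_def using \<open>n = 2\<close> two by (intro disjI1 conjI exI[of _ "nat y"]) auto
      next
        case False
        then show ?thesis unfolding allowed_def using \<open>n = 2\<close> two one by (intro disjI1 conjI exI[of _ "nat x"]) auto
      qed
      show ?thesis
        by (rule I[OF two(4), of n "[(1, nat x), (2, nat y)]"])
           (use True s0 two al in "auto simp: coef_def")
    next
      case False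
      have xy: "x = 1" "y = 1"
      proof -
        have "x = 1 \<and> y = 1"
        proof (cases "Suc (Suc s) < n")
          case True
          then show ?thesis using A_pair[OF c(1) b True two(4)] two one by blast
        next
          case F: False
          have "Suc (Suc (n - Suc (Suc s))) < n" using F False two(1) by linarith
          from A_pair[OF rv(1,3) this lr] show ?thesis using two one by blast
        qed
        then show "x = 1" "y = 1" by auto
      qed
      show ?thesis
      proof (cases "s = 0 \<or> Suc (Suc s) = n")
        case True
        show ?thesis
        proof (cases "s = 0")
          case s0: True
          show ?thesis
            by (rule I[OF two(4), of n "[(1, 1), (2, 1)]"]) (use False s0 xy two(1) in "auto simp: allowed_def coef_def")
        next
          case False
          then have "Suc (Suc s) = n" using True by blast
          then show ?thesis
            by (intro I[OF two(4), of n "[(n - 1, 1), (n, 1)]"]) (use False xy two(1) in "auto simp: allowed_def coef_def")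
        qed
      next
        case False
        then obtain r where r: "s = Suc r" "Suc (Suc (Suc r)) < n" using two(1) by (cases s) auto
        have False
          by (rule node_gram[OF gram_A4_adj c(1) b two(4), of "[r, Suc r, Suc (Suc r), Suc (Suc (Suc r))]"])
             (use r xy in "simp_all add: expand")
        then show ?thesis ..
      qed
    qed
  qed
qed

section \<open>Types B, C, F4 and G2\<close>

text \<open>If \<open>r\<close> is the short simple root, \<open>x\<close> the sum from the support to the root before \<open>r\<close>, and \<open>y\<close> the sum of the roots before
  the support, then \<open>x, y, x + 2r\<close> is a chain.\<close>

lemma not_before_double:
  assumes c: "chain p n" and b: "bonds p n u w" and m: "m < n" "u (m - 1) = -2" "w (m - 1) = -1"
    and s: "0 < s" "s < m" "!!k. Suc k < m ==> u k = -1 \<and> w k = -1" and l: "pr \<omega> (p s) > 0"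
  shows False
proof -
  let ?x = "seg p s m" and ?y = "seg p 0 s" and ?r = "p m"
  have mS: "Suc (m - 1) = m" using s by simp
  have sb: "simple_bonds p i j" if "j \<le> m" for i j
    using b s(3) that m(1) unfolding simple_bonds_def bonds_def by auto
  have xp: "?x \<in> pos" "?y \<in> pos" using seg_pos[OF c] s m by auto
  have xR: "?x \<in> R" "?y \<in> R" "?r \<in> R" using xp pos_R chain_R[OF c m(1)] by auto
  have pm: "pr (p (m - 1)) ?r = -2" "pr ?r (p (m - 1)) = -1" using b m mS unfolding bonds_def by (metis of_int_minus of_int_numeral of_int_1)+
  have xr: "pr ?x ?r = -2" using seg_last[OF c s(2) m(1)] pm by simp
  have rx: "pr ?r ?x = -1"
    using seg_seg(2)[OF c s(2), of "Suc m"] m(1) sb seg_one[of p m] pm by simp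
  let ?z = "?x + ?r + ?r"
  have rf: "\<lfloor>pr ?x ?r\<rfloor> = -2" unfolding xr by simp
  have z: "?x - of_int \<lfloor>pr ?x ?r\<rfloor> * ?r = ?z" unfolding rf by (simp add: algebra_simps)
  have zR: "?z \<in> R" using refl_R[OF xR(1,3)] unfolding z .
  have zc: "pr q ?z = pr q ?x + pr q ?r" for q using co_refl[OF xR(1,3), of q] unfolding z rx by simp
  have cx: "?x = cmb (\<lambda>a. if a \<in> p ` {s..<m} then 1 else 0)" "?y = cmb (\<lambda>a. if a \<in> p ` {0..<s} then 1 else 0)"
    using seg_cmb[OF c] m s by auto
  have D: "?r \<in> D" "p 0 \<in> D" using chain_D[OF c] m s by auto
  have cz: "?z = cmb (\<lambda>a. (if a \<in> p ` {s..<m} then 1 else 0) + unit ?r a + unit ?r a)"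
    unfolding cx(1) cmb_add[symmetric] cmb_unit[OF D(1)] ..
  have zp: "?z \<in> pos" using zR unfolding cz by (intro posI) (auto simp: unit_def)
  have yr: "pr ?y ?r = 0" unfolding pr_seg by (rule sum.neutral) (use chain_far(1)[OF c] s m in auto)
  have xy: "pr ?y ?x = pr (p (s - 1)) (p s)" by (rule seg_seg(1)[OF c]) (use s m sb in auto)
  have yx0: "pr ?y ?x < 0" using xy chain_adj(1)[OF c, of "s - 1"] s m by simp
  show False
  proof (rule three_roots[OF xp zp])
    show "?x - ?y \<notin> R" using seg_not_root(2)[OF c, of 0 s s m] s m by simp
    show "?y - ?z \<notin> R"
    proof (rule not_root(1)[OF cx(2) cz D(2) _ D(1)])
      have "p 0 \<in> p ` {0..<s}" "p 0 \<notin> p ` {s..<m}" "p 0 ~= ?r" "?r \<notin> p ` {0..<s}"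
        using chain_inj[OF c] s m by auto
      then show "(if p 0 \<in> p ` {s..<m} then 1 else 0) + unit ?r (p 0) + unit ?r (p 0) < (if p 0 \<in> p ` {0..<s} then 1 else (0 :: int))"
        "(if ?r \<in> p ` {0..<s} then 1 else (0 :: int)) < (if ?r \<in> p ` {s..<m} then 1 else 0) + unit ?r ?r + unit ?r ?r"
        by (auto simp: unit_def)
    qed
    show "?x - ?z \<notin> R"
    proof
      assume "?x - ?z \<in> R"
      then have "- (?x - ?z) \<in> R" by (rule R_neg)
      moreover have "- (?x - ?z) = ?r + ?r" by (simp add: algebra_simps)
      ultimately show False using R_double[OF xR(3)] by simp
    qed
    show "pr ?x ?z = 0" unfolding zc xr pr_self[OF xR(1)] by simp
    show "pr ?x ?y < 0" using yx0 pr_sgn(2)[OF xR(1,2)] by simp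
    show "pr ?y ?z < 0" unfolding zc yr using yx0 by simp
    have "pr \<omega> ?x = (\<Sum>k=s..<m. pr \<omega> (p k))" by (rule seg_co[OF c s(2)]) (use m sb in auto)
    also have "\<dots> \<ge> pr \<omega> (p s)" by (rule member_le_sum) (use label_int(2) chain_D[OF c] s m in auto)
    finally show "pr \<omega> ?x > 0" using l by simp
    then show "pr \<omega> ?z > 0" unfolding zc using label_int(2)[OF D(1)] by simp
  qed
qed

lemma labels_posD: "labels p n l ==> k < n ==> l k > 0 ==> pr \<omega> (p k) > 0" by (simp add: labels_def)

abbreviation B_u :: "nat => nat => int" where "B_u n k \<equiv> if Suc (Suc k) = n then -2 else -1"

text \<open>By \<open>not_before_double\<close> only the first and the last node can carry labels.
  For \<open>n \<ge> 3\<close> nothing survives: label 1 is the natural or the spin representation,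
  and larger labels reduce to \<open>B_3\<close>, by contracting the inner nodes in the first case
  and restricting to the last three nodes in the second.\<close>

lemma type_B:
  assumes c: "chain p n" "p ` {..<n} = D" and n: "n \<ge> 2" and b: "bonds p n (B_u n) (\<lambda>_. -1)"
  shows classified
proof -
  note nat = B_natural[OF c n] and spin = B_spin[OF c n]
  have bb: "pr (p k) (p (Suc k)) = (if Suc (Suc k) = n then -2 else -1)" "pr (p (Suc k)) (p k) = -1" if "Suc k < n" for k
    using b that by (auto simp: bonds_def)
  have nd: "k = 0 \<or> Suc k = n" if "labels p n l" "k < n" "l k > 0" for l k
  proof (rule ccontr)
    assume h: "\<not> ?thesis"
    show False
      by (rule not_before_double[OF c(1) b, of "n - 1" k]) (use h that labels_posD[OF that] in auto)
  qed
  show ?thesis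
  proof (cases "n = 2")
    case True
    note I = classifiedI[OF c b, of _ "TypeB 2"]
    have m: "cartan_matrix (TypeB 2) (Suc i) (Suc j) = path_matrix (B_u n) (\<lambda>_. -1) i j" if "i < n" "j < n" for i j
      using that True by (auto simp: path_matrix_def less_2_cases_iff)
    show ?thesis
    proof (cases rule: chain_labels[OF c, case_names one two])
      case (one s a)
      then consider "s = 0" | "s = 1" using True by linarith
      then show ?thesis
      proof cases
        case 1
        have "a ~= 1"
        proof
          assume "a = 1"
          then show False by (intro nat[OF bb]) (use one(3) 1 n in "auto simp: labels_def")
        qed
        moreover have "a < 4"
        proof (rule ccontr)
          assume "\<not> a < 4"
          then show False
            by (intro node_gram[OF gram_B2_long[of "a - 4"] c(1) b one(3), of "[0, Suc 0]"]) (use 1 True in "simp_all add: expand")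
        qed
        ultimately have a: "a = 2 \<or> a = 3" using one by linarith
        show ?thesis by (rule I[OF one(3), of "[(1, nat a)]"]) (use 1 True a m in "auto simp: allowed_def coef_def")
      next
        case 2
        have "a ~= 1"
        proof
          assume "a = 1"
          then show False by (intro spin[OF bb]) (use one(3) 2 True in "auto simp: labels_def")
        qed
        moreover have "a < 4"
        proof (rule ccontr)
          assume "\<not> a < 4"
          then show False
            by (intro node_gram[OF gram_B2_short[of "a - 4"] c(1) b one(3), of "[0, Suc 0]"]) (use 2 True in "simp_all add: expand")
        qed
        ultimately have a: "a = 2 \<or> a = 3" using one by linarith
        show ?thesis by (rule I[OF one(3), of "[(2, nat a)]"]) (use 2 True a m in "auto simp: allowed_def coef_def")
      qed
    next
      case (two s x y)
      then have s: "s = 0" using True by simp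
      have "y < 2"
      proof (rule ccontr)
        assume "\<not> y < 2"
        then show False
          by (intro node_gram[OF gram_B2_both[of "x - 1" "y - 2"] c(1) b two(4), of "[0, Suc 0]"]) (use s two True in "simp_all add: expand")
      qed
      then have y: "y = 1" using two by simp
      have "x < 2"
      proof (rule ccontr)
        assume "\<not> x < 2"
        then show False
          by (intro node_gram[OF gram_B2_both1[of "x - 2"] c(1) b two(4), of "[0, Suc 0]"]) (use s y two True in "simp_all add: expand")
      qed
      then have x: "x = 1" using two by simp
      show ?thesis by (rule I[OF two(4), of "[(1, 1), (2, 1)]"]) (use s x y True m in "auto simp: allowed_def coef_def")
    qed
  next
    case False
    then have n3: "n \<ge> 3" using n by simp
    have False
    proof (cases rule: chain_labels[OF c, case_names one two])
      case (one s a)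
      then have "s = 0 \<or> Suc s = n" using nd[OF one(3,1)] by simp
      then show ?thesis
      proof
        assume s: "s = 0"
        have "a ~= 1"
        proof
          assume "a = 1"
          then show False by (intro nat[OF bb]) (use one(3) s n in "auto simp: labels_def")
        qed
        then show False
          by (intro block_gram[OF gram_B3_first[of "a - 2"] c(1) b one(3), of "[0, Suc 0, n - 1, n]" 3])
             (use s n3 one in "auto simp: expand")
      next
        assume s: "Suc s = n"
        have "a ~= 1"
        proof
          assume "a = 1"
          then show False by (intro spin[OF bb]) (use one(3) s n in "auto simp: labels_def")
        qed
        define r where "r = n - 3"
        have r: "n = Suc (Suc (Suc r))" using n3 by (simp add: r_def)
        show False
          by (rule node_gram[OF gram_B3_spin[of "a - 2"] c(1) b one(3), of "[r, Suc r, Suc (Suc r)]"])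
             (use s r one \<open>a ~= 1\<close> in "simp_all add: expand")
      qed
    next
      case (two s x y)
      then show ?thesis using nd[OF two(4), of s] nd[OF two(4), of "Suc s"] n3 by simp
    qed
    then show ?thesis ..
  qed
qed

text \<open>All bonds before the last one are simple, so the nodes between the support and the long
  root can be contracted. Where the support is too close to the long root for that, the diagram is
  cut down to its last nodes, which is what bounds the rank by 4 and 5.\<close>

lemma type_C:
  assumes c: "chain p n" "p ` {..<n} = D" and n: "n \<ge> 3" and b: "bonds p n (\<lambda>_. -1) (B_u n)"
  shows classified
proof -
  have bb: "pr (p (Suc k)) (p k) = (if Suc (Suc k) = n then -2 else -1)" "pr (p k) (p (Suc k)) = -1" if "Suc k < n" for k
    using b that by (auto simp: bonds_def)
  have m: "cartan_matrix (TypeC n) (Suc i) (Suc j) = path_matrix (\<lambda>_. -1) (B_u n) i j" if "i < n" "j < n" for i j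
    using that n by (auto simp: path_matrix_def)
  define r where "r = n - 3"
  have r: "n = Suc (Suc (Suc r))" using n by (simp add: r_def)
  note I = classifiedI[OF c b, of _ "TypeC n"]
  show ?thesis
  proof (cases rule: chain_labels[OF c, case_names one two])
    case (one s a)
    consider "s = 0" | "0 < s" "Suc s < n" | "Suc s = n" using one(1) by linarith
    then show ?thesis
    proof cases
      case 1
      have "a ~= 1"
        proof
          assume "a = 1"
          then show False by (intro C_natural[OF c n bb]) (use one(3) 1 n in "auto simp: labels_def")
        qed
      then have False
        by (intro block_gram[OF gram_C3_1[of "a - 2"] c(1) b one(3), of "[0, Suc 0, n - 1, n]" 3])
           (use 1 n one in "auto simp: expand")
      then show ?thesis ..
    next
      case 2
      then obtain q where q: "s = Suc q" by (cases s) auto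
      \<comment> \<open>The block from the support to the last short node carries the label
        \<open>a\<close>, so the contracted diagram is \<open>C_3\<close> with its middle node
        labelled.\<close>
      have a: "a = 1"
      proof (rule ccontr)
        assume "a ~= 1"
        then show False
          by (intro block_gram[OF gram_C3_2[of "a - 2"] c(1) b one(3), of "[q, Suc q, n - 1, n]" 3])
             (use 2 q n one in "auto simp: expand")
      qed
      have s: "Suc (Suc s) = n"
      proof (rule ccontr)
        assume "Suc (Suc s) ~= n"
        then show False
          by (intro block_gram[OF gram_C4_2 c(1) b one(3), of "[q, Suc q, Suc (Suc q), n - 1, n]" 4])
             (use a 2 q n one in "auto simp: expand")
      qed
      have "n < 5"
      proof (rule ccontr)
        assume "\<not> n < 5"
        define k where "k = n - 5"
        have k: "n = Suc (Suc (Suc (Suc (Suc k))))" using \<open>\<not> n < 5\<close> by (simp add: k_def)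
        show False
          by (rule node_gram[OF gram_C5_4 c(1) b one(3), of "[k, Suc k, Suc (Suc k), Suc (Suc (Suc k)), Suc (Suc (Suc (Suc k)))]"])
             (use s k a in "simp_all add: expand")
      qed
      then have "n = 3 \<or> n = 4" using n by linarith
      then show ?thesis
      proof
        assume n3: "n = 3"
        show ?thesis by (rule I[OF one(3), of "[(2, 1)]"]) (use n3 s a m in "auto simp: allowed_def coef_def")
      next
        assume n4: "n = 4"
        show ?thesis by (rule I[OF one(3), of "[(3, 1)]"]) (use n4 s a m in "auto simp: allowed_def coef_def")
      qed
    next
      case 3
      have a: "a = 1"
      proof (rule ccontr)
        assume "a ~= 1"
        then show False
          by (intro node_gram[OF gram_C3_3[of "a - 2"] c(1) b one(3), of "[r, Suc r, Suc (Suc r)]"])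
             (use 3 r one in "simp_all add: expand")
      qed
      have "n ~= 3"
      proof
        assume n3: "n = 3"
        show False
          by (rule C3_last[of p]) (use bb[of 0] bb[of 1] c one(3) a 3 n3 in "simp_all add: labels_def eval_nat_numeral All_less_Suc")
      qed
      moreover have "n < 6"
      proof (rule ccontr)
        assume "\<not> n < 6"
        define k where "k = n - 6"
        have k: "n = Suc (Suc (Suc (Suc (Suc (Suc k)))))" using \<open>\<not> n < 6\<close> by (simp add: k_def)
        show False
          by (rule node_gram[OF gram_C6_6 c(1) b one(3), of "[k, Suc k, Suc (Suc k), Suc (Suc (Suc k)), Suc (Suc (Suc (Suc k))), Suc (Suc (Suc (Suc (Suc k))))]"])
             (use 3 k a in "simp_all add: expand")
      qed
      ultimately have "n = 4 \<or> n = 5" using n by linarith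
      then show ?thesis
      proof
        assume n4: "n = 4"
        show ?thesis by (rule I[OF one(3), of "[(4, 1)]"]) (use n4 3 a m in "auto simp: allowed_def coef_def")
      next
        assume n5: "n = 5"
        show ?thesis by (rule I[OF one(3), of "[(5, 1)]"]) (use n5 3 a m in "auto simp: allowed_def coef_def")
      qed
    qed
  next
    case (two s x y)
    have False
    proof (cases "Suc (Suc s) < n")
      case True
      show False
        by (rule block_gram[OF gram_C3_12[of "x - 1" "y - 1"] c(1) b two(4), of "[s, Suc s, n - 1, n]" 3])
           (use True two in "auto simp: expand sum.distrib")
    next
      case False
      then have s: "s = Suc r" using two(1) r by simp
      \<comment> \<open>The two labelled nodes form a \<open>B_2\<close>; they are listed with the
        long root, the last node, first.\<close>
      have x: "x = 1"
      proof (rule ccontr)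
        assume "x ~= 1"
        then show False
          by (intro node_gram[OF gram_B2_both[of "y - 1" "x - 2"] c(1) b two(4), of "[Suc (Suc r), Suc r]"])
             (use s r two in "simp_all add: expand")
      qed
      have y: "y = 1"
      proof (rule ccontr)
        assume "y ~= 1"
        then show False
          by (intro node_gram[OF gram_B2_both1[of "y - 2"] c(1) b two(4), of "[Suc (Suc r), Suc r]"])
             (use s r x two in "simp_all add: expand")
      qed
      show False
        by (rule node_gram[OF gram_C3_23 c(1) b two(4), of "[r, Suc r, Suc (Suc r)]"]) (use s r x y in "simp_all add: expand")
    qed
    then show ?thesis ..
  qed
qed

text \<open>Nodes \<open>0, 1, 2\<close> form \<open>B_3\<close> and nodes \<open>3, 2, 1\<close>
  form \<open>C_3\<close>, so most labels are excluded by the minors of these types; only two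
  fundamental weights require minors on the full diagram.\<close>

lemma type_F4:
  assumes c: "chain p 4" "p ` {..<4} = D" and b: "bonds p 4 (\<lambda>k. if k = 1 then -2 else -1) (\<lambda>_. -1)"
  shows classified
proof -
  have l1: "\<not> l 1 > 0" if "labels p 4 l" for l
    using not_before_double[OF c(1) b, of 2 1] labels_posD[OF that, of 1] by (auto simp: less_Suc_eq)
  note I = classifiedI[OF c b, of _ "TypeF4"]
  show ?thesis
  proof (cases rule: chain_labels[OF c, case_names one two])
    case (one s a)
    have "s ~= 1" using l1[OF one(3)] one(2) by auto
    then consider "s = 0" | "s = 2" | "s = 3" using one(1) by linarith
    then show ?thesis
    proof cases
      case 1
      have False
      proof (cases "a = 1")
        case True
        show False
          by (rule node_gram[OF gram_F4_1 c(1) b one(3), of "[0, 1, 2, 3]"]) (use 1 True in "simp_all add: expand")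
      next
        case False
        then show False
          by (intro node_gram[OF gram_B3_first[of "a - 2"] c(1) b one(3), of "[0, 1, 2]"]) (use 1 one in "simp_all add: expand")
      qed
      then show ?thesis ..
    next
      case 2
      have False
      proof (cases "a = 1")
        case True
        show False
          by (rule node_gram[OF gram_F4_3 c(1) b one(3), of "[0, 1, 2, 3]"]) (use 2 True in "simp_all add: expand")
      next
        case False
        then show False
          by (intro node_gram[OF gram_C3_2[of "a - 2"] c(1) b one(3), of "[3, 2, 1]"]) (use 2 one in "simp_all add: expand")
      qed
      then show ?thesis ..
    next
      case 3
      have a: "a = 1"
      proof (rule ccontr)
        assume "a ~= 1"
        then show False
          by (intro node_gram[OF gram_C3_1[of "a - 2"] c(1) b one(3), of "[3, 2, 1]"]) (use 3 one in "simp_all add: expand")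
      qed
      show ?thesis by (rule I[OF one(3), of "[(4, 1)]"]) (use 3 a in "auto simp: allowed_def coef_def path_matrix_def")
    qed
  next
    case (two s x y)
    have "s ~= 1" "s ~= 0" using l1[OF two(4)] two(2,3) by (auto split: if_splits)
    then have s: "s = 2" using two(1) by linarith
    have False
      by (rule node_gram[OF gram_C3_12[of "y - 1" "x - 1"] c(1) b two(4), of "[3, 2, 1]"]) (use s two in "simp_all add: expand")
    then show ?thesis ..
  qed
qed

lemma type_G2:
  assumes c: "chain p 2" "p ` {..<2} = D" and b: "bonds p 2 (\<lambda>_. -1) (\<lambda>_. -3)"
  shows classified
proof -
  have p01: "pr (p 0) (p 1) = -1" "pr (p 1) (p 0) = -3" using b by (auto simp: bonds_def)
  have D: "p 0 \<in> D" "p 1 \<in> D" using chain_D[OF c(1)] by auto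
  have Rs: "p 0 \<in> R" "p 1 \<in> R" using D DR by auto
  \<comment> \<open>The long roots \<open>p 1\<close> and \<open>p 1 + 3 p 0\<close> form a system
    of type \<open>A_2\<close>, and the label of the second is at least that of \<open>p 1\<close>,
    so \<open>gram_A2\<close> excludes the value 2.\<close>
  have long: "pr \<omega> (p 1) < 2"
  proof (rule ccontr)
    assume ge: "\<not> ?thesis"
    let ?z = "p 1 + of_int 3 * p 0"
    have f: "\<lfloor>pr (p 1) (p 0)\<rfloor> = -3" unfolding p01 by simp
    have z: "p 1 - of_int \<lfloor>pr (p 1) (p 0)\<rfloor> * p 0 = ?z" unfolding f by simp
    have zR: "?z \<in> R" using refl_R[OF Rs(2,1)] unfolding z .
    have zc: "pr m ?z = pr m (p 1) + pr m (p 0)" for m using co_refl[OF Rs(2,1), of m] unfolding z p01 by simp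
    have "?z = cmb (\<lambda>a. unit (p 1) a + 3 * unit (p 0) a)"
      unfolding cmb_add[symmetric] cmb_mult[symmetric] cmb_unit[OF D(1)] cmb_unit[OF D(2)] ..
    then have zp: "?z \<in> pos" using zR by (simp only:) (rule posI, auto simp: unit_def)
    have z1: "pr ?z (p 1) = -1" unfolding pr_add pr_of_int p01 pr_self[OF Rs(2)] by simp
    have zz: "pr (p 1) ?z = -1" unfolding zc p01 pr_self[OF Rs(2)] by simp
    \<comment> \<open>The difference is \<open>3 p 0\<close>; as a root it would pair with
      \<open>p 0\<close> to \<open>2 / 3\<close>.\<close>
    have d: "?z - p 1 \<notin> R"
    proof
      assume r: "?z - p 1 \<in> R"
      then have r3: "of_int 3 * p 0 \<in> R" by simp
      have "pr (p 0) (of_int 3 * p 0) * (3 * (3 * ip (p 0) (p 0))) = 2 * (3 * ip (p 0) (p 0))"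
        using ip_pr[OF r3, of "p 0"] unfolding ip_of_int ip_of_int' by simp
      then have "3 * pr (p 0) (of_int 3 * p 0) = 2" using ip_pos[OF Rs(1)] by simp
      moreover obtain k where "pr (p 0) (of_int 3 * p 0) = real_of_int k" using pr_int[OF Rs(1) r3] by (metis Ints_cases)
      ultimately have "real_of_int (3 * k) = real_of_int 2" by simp
      then have "3 * k = 2" by (simp only: of_int_eq_iff)
      then show False by presburger
    qed
    obtain x y where xy: "pr \<omega> (p 1) = real_of_int x" "pr \<omega> ?z = real_of_int y"
      using label_int(1)[OF D(1)] label_int(1)[OF D(2)] zc[of \<omega>] by (metis of_int_add)
    have "x \<ge> 2" "y \<ge> 2" using xy zc[of \<omega>] label_int(2)[OF D(1)] ge by linarith+
    moreover have "?z ~= p 1" using zz pr_self[OF Rs(2)] by auto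
    ultimately show False
      by (intro gram_list[of 2 "\<lambda>i. [p 1, ?z] ! i" "[[2, -1], [-1, 2]]" "[2 + (x - 2), 2 + (y - 2)]", OF _ _ _ _ _ _ _ gram_A2])
         (use zp D_pos[OF D(2)] d z1 zz xy pr_self[OF Rs(2)] pr_self[OF zR] in "simp_all add: expand")
  qed
  note I = classifiedI[OF c b, of _ "TypeG2"]
  show ?thesis
  proof (cases rule: chain_labels[OF c, case_names one two])
    case (one s a)
    then consider "s = 0" | "s = 1" by linarith
    then show ?thesis
    proof cases
      case 1
      have "a ~= 1"
        proof
          assume "a = 1"
          then show False by (intro G2_natural[OF c p01]) (use one(3) 1 in "auto simp: labels_def")
        qed
      then have False
        by (intro node_gram[OF gram_G2_short[of "a - 2"] c(1) b one(3), of "[0, Suc 0]"]) (use 1 one in "simp_all add: expand")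
      then show ?thesis ..
    next
      case 2
      have a: "a = 1" using long one by (auto simp: labels_def 2)
      show ?thesis by (rule I[OF one(3), of "[(2, 1)]"]) (use 2 a in "auto simp: allowed_def coef_def path_matrix_def less_2_cases_iff")
    qed
  next
    case (two s x y)
    then have s: "s = 0" by simp
    have y: "y = 1" using long two by (auto simp: labels_def s)
    have False
      by (rule node_gram[OF gram_G2_both[of "x - 1"] c(1) b two(4), of "[0, Suc 0]"]) (use s y two in "simp_all add: expand")
    then show ?thesis ..
  qed
qed

section \<open>The classification\<close>

lemma end_double:
  assumes c: "chain p n" "p ` {..<n} = D" and n: "n \<ge> 2" and b: "bonds p n u w"
    and s: "!!l. Suc (Suc l) < n ==> u l = -1 \<and> w l = -1"
    and d: "u (n - 2) = -2 \<and> w (n - 2) = -1 \<or> u (n - 2) = -1 \<and> w (n - 2) = -2"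
  shows classified
  using d
proof
  assume d: "u (n - 2) = -2 \<and> w (n - 2) = -1"
  have "bonds p n (B_u n) (\<lambda>_. -1)"
  proof (rule bonds_cong[OF b])
    fix k assume k: "Suc k < n"
    show "u k = B_u n k \<and> w k = -1"
    proof (cases "Suc (Suc k) = n")
      case True
      then have "k = n - 2" by simp
      then show ?thesis using d True by simp
    next
      case False
      then show ?thesis using s[of k] k by simp
    qed
  qed
  then show ?thesis by (rule type_B[OF c n])
next
  assume d: "u (n - 2) = -1 \<and> w (n - 2) = -2"
  show ?thesis
  \<comment> \<open>With two nodes this is \<open>B_2\<close> read backwards; \<open>TypeC\<close>
    is used from rank 3 on.\<close>
  proof (cases "n = 2")
    case True
    have "labels p n (\<lambda>k. \<lfloor>pr \<omega> (p k)\<rfloor>)" using label_int(1) chain_D[OF c(1)] by (simp add: labels_def)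
    note rv = rev_chain[OF c b this]
    have "bonds (\<lambda>i. p (n - Suc i)) n (B_u n) (\<lambda>_. -1)" by (rule bonds_cong[OF rv(3)]) (use True d in auto)
    then show ?thesis by (rule type_B[OF rv(1,2) n])
  next
    case False
    have "bonds p n (\<lambda>_. -1) (B_u n)"
    proof (rule bonds_cong[OF b])
      fix k assume k: "Suc k < n"
      show "u k = -1 \<and> w k = B_u n k"
      proof (cases "Suc (Suc k) = n")
        case True
        then have "k = n - 2" by simp
        then show ?thesis using d True by simp
      next
        case False
        then show ?thesis using s[of k] k by simp
      qed
    qed
    then show ?thesis by (intro type_C[OF c]) (use n False in simp)
  qed
qed

text \<open>Two multiple bonds would bound a chain excluded by \<open>no_two_double\<close>, so all
  other bonds are simple. A triple bond admits no further node by \<open>no_triple\<close>. A double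
  bond away from the ends has exactly one node on each side, since two on one side would give the
  five nodes of \<open>no_F4_affine\<close>.\<close>

lemma double_chain:
  assumes c: "chain p n" "p ` {..<n} = D" and k: "Suc k < n" "bond p k \<ge> 2"
  shows classified
proof -
  define u where "u l = \<lfloor>pr (p l) (p (Suc l))\<rfloor>" for l
  define w where "w l = \<lfloor>pr (p (Suc l)) (p l)\<rfloor>" for l
  have uw: "pr (p l) (p (Suc l)) = of_int (u l)" "pr (p (Suc l)) (p l) = of_int (w l)" if "Suc l < n" for l
    unfolding u_def w_def by (rule fl[symmetric], rule chain_R[OF c(1)], use that in simp, rule chain_R[OF c(1)], use that in simp)+
  have b: "bonds p n u w" using uw by (simp add: bonds_def)
  have lb: "labels p n (\<lambda>k. \<lfloor>pr \<omega> (p k)\<rfloor>)" using label_int(1) chain_D[OF c(1)] by (simp add: labels_def)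
  note rv = rev_chain[OF c b lb]
  have neg: "u l \<le> -1" "w l \<le> -1" if "Suc l < n" for l
    using chain_adj[OF c(1) that] unfolding uw[OF that] by linarith+
  have bond: "bond p l = of_int (u l * w l)" if "Suc l < n" for l using uw[OF that] by simp
  have lt4: "u l * w l < 4" if "Suc l < n" for l
  proof -
    have "bond p l < 4" by (rule bond_lt_4) (use chain_D[OF c(1)] chain_inj[OF c(1), of l "Suc l"] that in auto)
    then show ?thesis unfolding bond[OF that] by linarith
  qed
  have simple: "u l = -1 \<and> w l = -1" if l: "Suc l < n" "l ~= k" for l
  proof (rule ccontr)
    assume h: "\<not> ?thesis"
    have "u l * w l \<ge> 2"
    proof -
      have "(- u l) * 1 \<le> (- u l) * (- w l)" "1 * (- w l) \<le> (- u l) * (- w l)"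
        using neg[OF l(1)] by (intro mult_left_mono mult_right_mono; simp)+
      then have "- u l \<le> u l * w l" "- w l \<le> u l * w l" by simp_all
      moreover have "u l \<le> -2 \<or> w l \<le> -2" using h neg[OF l(1)] by linarith
      ultimately show ?thesis by linarith
    qed
    then have l2: "bond p l \<ge> 2" unfolding bond[OF l(1)] by linarith
    have key: False if ab: "a < b" "Suc b < n" "bond p a \<ge> 2" "bond p b \<ge> 2" for a b
    proof -
      let ?q = "\<lambda>i. p (a + i)" and ?m = "Suc (Suc (b - a))"
      have q: "chain ?q ?m" by (rule chain_sub[OF c(1)]) (use ab in simp)
      have "a + (?m - 2) = b" "a + Suc (?m - 2) = Suc b" "Suc 0 \<le> b - a" using ab by auto
      then show False using no_two_double[OF q] ab by simp
    qed
    show False using key[of l k] key[of k l] l l2 k by (metis linorder_neqE_nat)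
  qed
  have cases4: "(u k, w k) \<in> {(-1, -2), (-2, -1), (-1, -3), (-3, -1)}"
  proof -
    have "real_of_int (u k * w k) \<ge> 2" using k(2) unfolding bond[OF k(1)] .
    then have p: "u k * w k \<ge> 2" by linarith
    have "(- u k) * 1 \<le> (- u k) * (- w k)" "1 * (- w k) \<le> (- u k) * (- w k)"
      using neg[OF k(1)] by (intro mult_left_mono mult_right_mono; simp)+
    then have "- u k \<le> 3" "- w k \<le> 3" using lt4[OF k(1)] by simp_all
    then have "u k = -1 \<or> u k = -2 \<or> u k = -3" "w k = -1 \<or> w k = -2 \<or> w k = -3" using neg[OF k(1)] by linarith+
    then show ?thesis using p lt4[OF k(1)] by auto
  qed
  show ?thesis
  proof (cases "u k = -3 \<or> w k = -3")
    case True
    then have b3: "bond p k \<ge> 3" using cases4 unfolding bond[OF k(1)] by auto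
    have "\<not> Suc (Suc k) < n"
    proof
      assume "Suc (Suc k) < n"
      then have "chain (\<lambda>i. p (k + i)) 3" by (intro chain_sub[OF c(1)]) simp
      from no_triple[OF this] show False using b3 by simp
    qed
    moreover have "k = 0"
    proof (rule ccontr)
      assume "k ~= 0"
      then obtain j where j: "k = Suc j" by (cases k) auto
      have "chain (\<lambda>i. p (j + i)) 3" by (rule chain_sub[OF c(1)]) (use j k in simp)
      from chain_rev[OF this] have "chain (\<lambda>i. p (j + (3 - Suc i))) 3" .
      from no_triple[OF this] show False using b3 j by (simp add: mult.commute eval_nat_numeral)
    qed
    ultimately have n: "n = 2" "k = 0" using k by auto
    show ?thesis
    proof (cases "w k = -3")
      case True
      then have "bonds p 2 (\<lambda>_. -1) (\<lambda>_. -3)" by (intro bonds_cong[OF b[unfolded n]]) (use cases4 n in auto)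
      then show ?thesis using type_G2[of p] c n by simp
    next
      case False
      then have "bonds (\<lambda>i. p (2 - Suc i)) 2 (\<lambda>_. -1) (\<lambda>_. -3)"
        by (intro bonds_cong[OF rv(3)[unfolded n]]) (use True cases4 n in auto)
      then show ?thesis using type_G2[OF rv(1,2)[unfolded n]] by simp
    qed
  next
    case False
    then have uv: "u k = -2 \<and> w k = -1 \<or> u k = -1 \<and> w k = -2" using cases4 by auto
    consider "Suc (Suc k) = n" | "k = 0" "Suc (Suc k) < n" | "0 < k" "Suc (Suc k) < n" using k(1) by linarith
    then show ?thesis
    proof cases
      case 1
      then have "n - 2 = k" by simp
      then show ?thesis using uv simple 1 by (intro end_double[OF c _ b]) auto
    next
      case 2
      have "n - Suc (Suc (n - 2)) = k" using 2 by simp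
      moreover have "n - Suc (Suc l) ~= k" "Suc (n - Suc (Suc l)) < n" if "Suc (Suc l) < n" for l using 2 that by auto
      ultimately show ?thesis using uv simple 2 by (intro end_double[OF rv(1,2) _ rv(3)]) auto
    next
      case 3
      obtain j where j: "k = Suc j" using 3 by (cases k) auto
      have n4: "Suc (Suc (Suc k)) = n"
      proof (rule ccontr)
        assume "\<not> ?thesis"
        then have "chain (\<lambda>i. p (j + i)) 5" by (intro chain_sub[OF c(1)]) (use j 3 in simp)
        from no_F4_affine[OF this] show False using k(2) j by simp
      qed
      have k1: "k = 1"
      proof (rule ccontr)
        assume "k ~= 1"
        then obtain i where i: "k = Suc (Suc i)" using j by (cases j) auto
        have "chain (\<lambda>l. p (i + l)) 5" by (rule chain_sub[OF c(1)]) (use i n4 in simp)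
        from chain_rev[OF this] have "chain (\<lambda>l. p (i + (5 - Suc l))) 5" .
        from no_F4_affine[OF this] show False using k(2) i by (simp add: mult.commute eval_nat_numeral)
      qed
      then have n: "n = 4" using n4 by simp
      show ?thesis
        using uv
      proof
        assume d: "u k = -2 \<and> w k = -1"
        have "bonds p 4 (\<lambda>k. if k = 1 then -2 else -1) (\<lambda>_. -1)"
          by (rule bonds_cong[OF b[unfolded n]]) (use simple d k1 n in auto)
        then show ?thesis using type_F4[of p] c n by simp
      next
        assume d: "u k = -1 \<and> w k = -2"
        have "bonds (\<lambda>i. p (4 - Suc i)) 4 (\<lambda>k. if k = 1 then -2 else -1) (\<lambda>_. -1)"
        proof (rule bonds_cong[OF rv(3)[unfolded n]])
          fix l :: nat assume l: "Suc l < 4"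
          show "w (4 - Suc (Suc l)) = (if l = 1 then -2 else -1) \<and> u (4 - Suc (Suc l)) = -1"
          proof (cases "l = 1")
            case True
            then show ?thesis using d k1 by (simp add: eval_nat_numeral)
          next
            case False
            then show ?thesis using simple[of "4 - Suc (Suc l)"] k1 n l by auto
          qed
        qed
        then show ?thesis using type_F4[OF rv(1,2)[unfolded n]] by simp
      qed
    qed
  qed
qed

theorem classification: classified
proof -
  obtain s where s: "s \<in> D" by (rule support_ex)
  then have ne: "D ~= {}" by blast
  show ?thesis
  proof (cases rule: chain_or_branch[OF ne, case_names chain branch])
    case (chain p n)
    show ?thesis
    proof (cases "\<exists>k. Suc k < n \<and> bond p k \<ge> 2")
      case True
      then show ?thesis using double_chain[OF chain(1,2)] by blast
    next
      case False
      have "pr (p k) (p (Suc k)) = -1 \<and> pr (p (Suc k)) (p k) = -1" if k: "Suc k < n" for k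
      proof -
        have R: "p k \<in> R" "p (Suc k) \<in> R" using chain_R[OF chain(1)] k by auto
        obtain x y where x: "pr (p k) (p (Suc k)) = real_of_int x" and y: "pr (p (Suc k)) (p k) = real_of_int y"
          using pr_int[OF R] pr_int[OF R(2,1)] by (metis Ints_cases)
        have xy: "x \<le> -1" "y \<le> -1" using chain_adj[OF chain(1) k] unfolding x y by linarith+
        have "real_of_int (x * y) < 2" using False k x y by force
        then have "x * y < 2" by linarith
        moreover have "(- x) * 1 \<le> (- x) * (- y)" "1 * (- y) \<le> (- x) * (- y)"
          using xy by (intro mult_left_mono mult_right_mono; simp)+
        ultimately have "x = -1" "y = -1" using xy by linarith+
        then show ?thesis using x y by simp
      qed
      then have "bonds p n (\<lambda>_. -1) (\<lambda>_. -1)" by (simp add: bonds_def)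
      then show ?thesis by (rule type_A[OF chain])
    qed
  next
    case (branch t a b c)
    have False
    proof (cases simply_laced)
      case True
      then show ?thesis using no_branch branch by blast
    next
      case False
      then obtain x y where "x \<in> D" "y \<in> D" "x ~= y" "pr x y * pr y x \<ge> 2" unfolding simply_laced_def by force
      then show ?thesis by (rule double_with_branch[OF branch])
    qed
    then show ?thesis ..
  qed
qed

end

section \<open>The given representation as an instance of the abstract module\<close>

section \<open>Representations of maximal weight multiplicity two\<close>

locale mult2_rep = hw_rep scale br Basis H scaleV act BasisV D \<omega> u0
  for scale :: "complex => 'l::ab_group_add => 'l" (infixr \<open>*s\<close> 75) and br :: "'l => 'l => 'l" and Basis H
    and scaleV :: "complex => 'v::ab_group_add => 'v" (infixr \<open>*v\<close> 75) and act :: "'l => 'v => 'v" and BasisV D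
    and \<omega> :: "'l => complex" and u0 :: 'v +
  assumes mult: "max_weight_multiplicity H = 2"
begin

lemma om_weight: "\<omega> \<in> weights H"
  using om u0 by (auto simp: weights_def)

lemma weight_mult_set:
  "finite {V.dim (M m) |m. m \<in> weights H}" "{V.dim (M m) |m. m \<in> weights H} ~= {}"
proof -
  have "{V.dim (M m) |m. m \<in> weights H} \<subseteq> {..V.dimension}" using V.dim_subset_UNIV by auto
  then show "finite {V.dim (M m) |m. m \<in> weights H}" by (rule finite_subset) simp
  show "{V.dim (M m) |m. m \<in> weights H} ~= {}" using om_weight by blast
qed

lemma H_sub: "subspace H" using cartan by (simp add: cartan_subalgebra_def subalgebra_def)

lemma M_linear:
  assumes x: "x \<in> M m" "x ~= 0"
  shows "h \<in> H ==> k \<in> H ==> m (h + k) = m h + m k" "h \<in> H ==> m (c *s h) = c * m h"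
proof -
  show "m (h + k) = m h + m k" if hk: "h \<in> H" "k \<in> H"
  proof -
    have "m (h + k) *v x = act (h + k) x" using M_D[OF x(1) subspace_add[OF H_sub hk]] by simp
    also have "\<dots> = (m h + m k) *v x" unfolding act_linl M_D[OF x(1) hk(1)] M_D[OF x(1) hk(2)] V.scale_left_distrib ..
    finally show ?thesis using x(2) by (simp add: V.scale_cancel_right)
  qed
  show "m (c *s h) = c * m h" if h: "h \<in> H"
  proof -
    have "m (c *s h) *v x = act (c *s h) x" using M_D[OF x(1) subspace_scale[OF H_sub h]] by simp
    also have "\<dots> = (c * m h) *v x" unfolding act_linl M_D[OF x(1) h] by simp
    finally show ?thesis using x(2) by (simp add: V.scale_cancel_right)
  qed
qed

text \<open>A function on \<open>L\<close> is replaced by the linear form on \<open>H\<close> with the same values on a basis of \<open>H\<close>, so that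
  the pairing with coroots is bilinear on the whole type.\<close>

definition HB :: "'l set" where "HB = (SOME B. finite B \<and> independent B \<and> span B = H)"

lemma HB: "finite HB" "independent HB" "span HB = H"
proof -
  obtain B where "finite B" "independent B" "span B = H" using basis_subspace_exists[OF H_sub] by metis
  then have "finite B \<and> independent B \<and> span B = H" by simp
  then have "finite HB \<and> independent HB \<and> span HB = H" unfolding HB_def by (rule someI)
  then show "finite HB" "independent HB" "span HB = H" by auto
qed

definition lx :: "('l => complex) => 'l => complex" where "lx m h = (\<Sum>b\<in>HB. representation HB h b * m b)"

lemma lx_add: "lx (m + n) h = lx m h + lx n h"
  by (simp add: lx_def distrib_left sum.distrib)

lemma lx_diff: assumes "h \<in> H" "k \<in> H" shows "lx m (h - c *s k) = lx m h - c * lx m k"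
proof -
  have s: "h \<in> span HB" "k \<in> span HB" using assms unfolding HB(3) .
  have r: "representation HB (h - c *s k) b = representation HB h b - c * representation HB k b" for b
    using representation_diff[OF HB(2) span_scale[OF s(2)] s(1)] representation_scale[OF HB(2) s(2)] by simp
  show ?thesis unfolding lx_def r left_diff_distrib sum_subtractf sum_distrib_left mult.assoc ..
qed

lemma lx_eq:
  assumes a: "!!h k. h \<in> H ==> k \<in> H ==> m (h + k) = m h + m k" "!!h c. h \<in> H ==> m (c *s h) = c * m h" and h: "h \<in> H"
  shows "lx m h = m h"
proof -
  have z: "m 0 = 0" using a(2)[OF subspace_0[OF H_sub], of 0] by simp
  have "(\<Sum>b\<in>A. f b *s b) \<in> H \<and> m (\<Sum>b\<in>A. f b *s b) = (\<Sum>b\<in>A. f b * m b)" if "A \<subseteq> HB" for A f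
    using finite_subset[OF that HB(1)] that
  proof (induction A rule: finite_induct)
    case empty
    then show ?case using z subspace_0[OF H_sub] by simp
  next
    case (insert b A)
    have b: "b \<in> H" using insert HB(3) span_base by auto
    then show ?case using insert a(1)[of "f b *s b" "\<Sum>b\<in>A. f b *s b"] a(2)[OF b] subspace_scale[OF H_sub b] subspace_add[OF H_sub] by simp
  qed
  moreover have "(\<Sum>b\<in>HB. representation HB h b *s b) = h"
    by (rule sum_representation_eq[OF HB(2) _ HB(1) order_refl]) (use h HB(3) in simp)
  ultimately show ?thesis unfolding lx_def by (metis order_refl)
qed

lemma lx_dual: "m \<in> dual scale H ==> h \<in> H ==> lx m h = m h"
  by (rule lx_eq) (auto simp: dual_def)

lemma lx_root: "g \<in> R ==> d \<in> R ==> lx g (co d) = g (co d)"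
  using lx_dual[OF wts_dual co_H] by blast

lemma M_dim_le_2: "V.dim (M m) \<le> 2"
proof (cases "M m \<subseteq> {0}")
  case True
  then have "V.dim (M m) = 0" unfolding V.dim_eq_0 .
  then show ?thesis by (simp only:)
next
  case False
  then obtain x where x: "x \<in> M m" "x ~= 0" by blast
  \<comment> \<open>\<open>weights\<close> consists of linear forms vanishing outside
    \<open>H\<close>, whereas \<open>m\<close> is any function; changing it outside \<open>H\<close>
    does not affect the weight space.\<close>
  define n where "n h = (if h \<in> H then m h else 0)" for h
  have MM: "M n = M m" by (simp add: weight_space_def n_def)
  have "n \<in> dual scale H"
    using M_linear[OF x] subspace_add[OF H_sub] subspace_scale[OF H_sub] by (simp add: dual_def n_def)
  moreover have "M n ~= {0}" using x unfolding MM by blast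
  ultimately have "n \<in> weights H" by (simp add: weights_def)
  then have "V.dim (M m) \<in> {V.dim (M m) |m. m \<in> weights H}" unfolding MM[symmetric] by blast
  then have "V.dim (M m) \<le> max_weight_multiplicity H"
    unfolding max_weight_multiplicity_def by (rule Max_ge[OF weight_mult_set(1)])
  then show ?thesis using mult by simp
qed

lemma ev_high: assumes "g \<in> R" "g = cmb c" "!!a. a \<in> D ==> c a \<ge> 0" shows "act (ev g) u0 = 0"
proof (rule u0_killed)
  show "g \<in> positive_roots H D" using positive_cmb[of c] assms by simp
  show "ev g \<in> root_space H g" unfolding gw_root_space[OF R_ext[OF assms(1)]] by (rule ev_gw[OF assms(1)])
qed

lemma u0_simple: "a \<in> D ==> act (ev a) u0 = 0"
  by (rule ev_high[OF _ cmb_single[symmetric]]) (use base_R in auto)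

text \<open>The words from \<open>u0\<close> span, so a weight not congruent to
  \<open>\<omega>\<close> modulo the root lattice would have no weight vectors.\<close>

lemma M_2: "\<exists>c. V.dim (M (\<omega> - cmb c)) = 2"
proof -
  have "2 \<in> {V.dim (M q) |q. q \<in> weights H}"
    using Max_in[OF weight_mult_set] mult unfolding max_weight_multiplicity_def by simp
  then obtain q where m: "q \<in> weights H" "V.dim (M q) = 2" by auto
  let ?J = "{\<omega> - cmb c |c. True}"
  have "q \<in> ?J"
  proof (rule ccontr)
    assume n: "q \<notin> ?J"
    have "M q \<subseteq> {0}"
    proof
      fix x assume x: "x \<in> M q"
      have "{y. \<exists>r. words u0 \<omega> y r} \<subseteq> (\<Union>r\<in>?J. M r)"
      proof
        fix y assume "y \<in> {y. \<exists>r. words u0 \<omega> y r}"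
        then obtain r where w: "words u0 \<omega> y r" by blast
        obtain d where "r = \<omega> - cmb d" using words_weight[OF w] by blast
        then have "r \<in> ?J" by blast
        then show "y \<in> (\<Union>r\<in>?J. M r)" using words_M[OF w u0(1)] by blast
      qed
      then have s: "V.span {y. \<exists>r. words u0 \<omega> y r} \<subseteq> V.span (\<Union>r\<in>?J. M r)" by (rule V.span_mono)
      have "x \<in> V.span {y. \<exists>r. words u0 \<omega> y r}" by (simp only: words_span[OF u0 u0_simple] UNIV_I)
      from subsetD[OF s this] have xs: "x \<in> V.span (\<Union>r\<in>?J. M r)" .
      have J: "?J \<subseteq> ext" using ext_diff[OF om_ext cmb_ext] by blast
      have me: "q \<in> ext" using m(1) dual_ext by (auto simp: weights_def)
      have "x = 0" by (rule V.indep_span_disjoint[OF M_indep M_sub J me n x xs])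
      then show "x \<in> {0}" by simp
    qed
    then have "V.dim (M q) = 0" unfolding V.dim_eq_0 .
    then show False unfolding m(2) by simp
  qed
  then obtain c where "q = \<omega> - cmb c" by blast
  then show ?thesis using m(2) by (intro exI[of _ c]) (simp only:)
qed

lemma co_real: assumes "g \<in> R" "d \<in> R" obtains k :: int where "g (co d) = of_int k" "\<lfloor>Re (g (co d))\<rfloor> = k"
  using root_int[OF assms(2), of g] assms(1) by auto

text \<open>A non-zero vector of weight \<open>m\<close> forces \<open>m\<close> to be linear on
  \<open>H\<close>, so there \<open>lx m\<close> agrees with \<open>m\<close>; the value at a coroot
  is an integer, so the real part loses nothing.\<close>

lemma M_scalar: assumes "g \<in> R" "x \<in> M m" shows "m (co g) *v x = of_real (Re (lx m (co g))) *v x"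
proof (cases "x = 0")
  case False
  then obtain k :: int where "m (co g) = of_int k" using weight_int[OF assms] by blast
  moreover have "lx m (co g) = m (co g)" by (rule lx_eq[OF M_linear[OF assms(2) False] co_H[OF assms(1)]])
  ultimately show ?thesis by simp
qed simp

lemma ev_comm: assumes "g \<in> R" "d \<in> R" "g + d \<notin> R" "g + d ~= 0" shows "br (ev g) (ev d) = 0"
proof -
  have "g + d \<notin> wts" "g + d \<in> ext" using assms ext_add R_ext by auto
  then show ?thesis using gw_not_wts gw_br[OF ev_gw[OF assms(1)] ev_gw[OF assms(2)]] by blast
qed

lemma hwm: "hwm scaleV BasisV R D (\<lambda>m u. Re (lx m (co u))) (\<lambda>u. act (ev u)) M \<omega> u0"
proof (rule hwm.intro[OF V.fd_complex_axioms], rule hwm_axioms.intro)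
  show "finite R" using finite_wts by simp
  show "0 \<notin> R" by simp
  show "- u \<in> R" if "u \<in> R" for u by (rule R_neg[OF that])
  show "D \<subseteq> R" by (rule base_R)
  show "Re (lx (m + n) (co u)) = Re (lx m (co u)) + Re (lx n (co u))" for m n u by (simp add: lx_add)
  show "Re (lx u (co u)) = 2" if "u \<in> R" for u using co_self[OF that] lx_root[OF that that] by simp
  show "Re (lx u (co d)) \<in> \<int>" if g: "u \<in> R" "d \<in> R" for u d
  proof -
    obtain k :: int where "u (co d) = of_int k" by (rule co_real[OF g]) blast
    then show ?thesis using lx_root[OF g] by simp
  qed
  show "u - of_int \<lfloor>Re (lx u (co d))\<rfloor> * d \<in> R" if g: "u \<in> R" "d \<in> R" for u d
  proof -
    obtain k :: int where k: "u (co d) = of_int k" "\<lfloor>Re (u (co d))\<rfloor> = k" by (rule co_real[OF g]) blast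
    show ?thesis unfolding lx_root[OF g] k(2) by (rule root_reflect[OF g(2,1) k(1)])
  qed
  show "Re (lx m (co (u - of_int \<lfloor>Re (lx u (co d))\<rfloor> * d))) = Re (lx m (co u)) - Re (lx d (co u)) * Re (lx m (co d))"
    if g: "u \<in> R" "d \<in> R" for u d m
  proof -
    obtain k :: int where k: "u (co d) = of_int k" "\<lfloor>Re (u (co d))\<rfloor> = k" by (rule co_real[OF g]) blast
    obtain l :: int where l: "d (co u) = of_int l" by (rule co_real[OF g(2,1)]) blast
    have "co (u - of_int k * d) = co u - of_int l *s co d" unfolding co_reflect[OF g(2,1) k(1)] l ..
    moreover have "lx m (co u - of_int l *s co d) = lx m (co u) - of_int l * lx m (co d)"
      by (rule lx_diff[OF co_H[OF g(1)] co_H[OF g(2)]])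
    ultimately show ?thesis unfolding lx_root[OF g] lx_root[OF g(2,1)] k(2) l by simp
  qed
  show "u + d \<in> R" if g: "u \<in> R" "d \<in> R" "Re (lx u (co d)) < 0" "u ~= - d" for u d
  proof -
    obtain k :: int where k: "u (co d) = of_int k" "\<lfloor>Re (u (co d))\<rfloor> = k" by (rule co_real[OF g(1,2)]) blast
    have "k < 0" using g(3) k(1) lx_root[OF g(1,2)] by simp
    from root_string(1)[OF g(2,1) k(1) this g(4)] show ?thesis by (simp add: add.commute)
  qed
  show "u + u \<notin> R" if g: "u \<in> R" for u
  proof -
    \<comment> \<open>\<open>neg_root_dim\<close> speaks of multiples of the negative of a root, so
      it is applied to \<open>- u\<close>.\<close>
    have ng: "- u \<in> wts" "- u ~= 0" using R_neg[OF g] by auto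
    have "- (of_nat 2 * - u) \<notin> wts" by (rule neg_root_dim(2)[OF ng]) simp
    moreover have "- (of_nat 2 * - u) = u + u" by (rule ext) simp
    ultimately show ?thesis by simp
  qed
  show "\<exists>c. u = (\<Sum>r\<in>D. of_int (c r) * r) \<and> ((\<forall>r\<in>D. 0 \<le> c r) \<or> (\<forall>r\<in>D. c r \<le> 0))" if "u \<in> R" for u
    by (rule root_cmb[OF that])
  show "y r = 0" if "!!u. u \<in> R ==> (\<Sum>r\<in>D. y r * Re (lx r (co u))) = 0" "r \<in> D" for y r
      proof (rule H_indep_real[OF _ that(2)])
    fix u assume g: "u \<in> R"
    have "(\<Sum>r\<in>D. y r * Re (r (co u))) = (\<Sum>r\<in>D. y r * Re (lx r (co u)))"
    proof (rule sum.cong)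
      fix r assume "r \<in> D"
      then have "r \<in> R" using base_R by (rule subsetD[rotated])
      from lx_root[OF this g] show "y r * Re (r (co u)) = y r * Re (lx r (co u))" by simp
    qed simp
    then show "(\<Sum>r\<in>D. y r * Re (r (co u))) = 0" using that(1)[OF g] by simp
  qed
  show "\<exists>a\<in>A. \<exists>b\<in>B. Re (lx a (co b)) ~= 0" if AB: "A \<union> B = D" "A \<inter> B = {}" "A ~= {}" "B ~= {}" for A B
  proof -
    obtain a b where ab: "a \<in> A" "b \<in> B" "a (co b) ~= 0" using connected[OF AB] by blast
    have R: "a \<in> R" "b \<in> R" using ab AB(1) base_R by auto
    obtain k :: int where "a (co b) = of_int k" by (rule co_real[OF R]) blast
    then have "Re (lx a (co b)) ~= 0" using ab(3) lx_root[OF R] by simp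
    then show ?thesis using ab by blast
  qed
  show "V.lin (act (ev u))" for u by (rule act_linear)
  show "V.subspace (M m)" for m by (rule M_sub)
  show "act (ev u) x \<in> M (m + u)" if "u \<in> R" "x \<in> M m" for u x m by (rule act_ev[OF that])
  show "act (ev u) (act (ev (- u)) x) - act (ev (- u)) (act (ev u) x) = of_real (Re (lx m (co u))) *v x"
    if g: "u \<in> R" "x \<in> M m" for u x m
  proof -
    have "act (ev u) (act (ev (- u)) x) - act (ev (- u)) (act (ev u) x) = act (co u) x"
      using act_br[of "ev u" "ev (- u)" x] unfolding ev_br[OF g(1)] by simp
    also have "\<dots> = m (co u) *v x" by (rule M_D[OF g(2) co_H[OF g(1)]])
    finally show ?thesis unfolding M_scalar[OF g] .
  qed
  show "act (ev u) (act (ev d) x) = act (ev d) (act (ev u) x)" if "u \<in> R" "d \<in> R" "u + d \<notin> R" "u + d ~= 0" for u d x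
    using act_br[of "ev u" "ev d" x] unfolding ev_comm[OF that] by (simp add: act_simps)
  show "act (ev u) (act (ev d) (act (ev e) x)) - act (ev d) (act (ev u) (act (ev e) x)) =
      act (ev e) (act (ev u) (act (ev d) x) - act (ev d) (act (ev u) x))"
    if g: "u \<in> R" "d \<in> R" "e \<in> R" "u + d + e \<notin> R" "u + d + e ~= 0" for u d e x
  proof -
    have "br (br (ev u) (ev d)) (ev e) \<in> gw (u + d + e)" by (intro gw_br ev_gw g)
    moreover have "u + d + e \<notin> wts" "u + d + e \<in> ext" using g(4,5) ext_add[OF ext_add[OF R_ext R_ext] R_ext] g by auto
    ultimately have "br (br (ev u) (ev d)) (ev e) = 0" using gw_not_wts by blast
    then show ?thesis using act_br[of "br (ev u) (ev d)" "ev e" x] by (simp add: act_br act_simps)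
  qed
  show "sl2 scaleV BasisV (act (ev u)) (act (ev (- u))) (\<lambda>x. act (ev u) (act (ev (- u)) x) - act (ev (- u)) (act (ev u) x))"
    if g: "u \<in> R" for u
  proof -
    have "act (co u) = (\<lambda>x. act (ev u) (act (ev (- u)) x) - act (ev (- u)) (act (ev u) x))"
      using act_br[of "ev u" "ev (- u)"] unfolding ev_br[OF g] by (rule ext)
    then show ?thesis using triple_sl2[OF g triple_ev[OF g]] by simp
  qed
  show "V.indep_family {\<omega> - (\<Sum>r\<in>D. of_int (c r) * r) |c. True} M"
    by (rule V.indep_family_cong_subset[OF M_indep]) (use ext_diff[OF om_ext cmb_ext] in blast)+
  show "u0 \<in> M \<omega>" "u0 ~= 0" by (rule u0)+
  show "act (ev u) u0 = 0" if "u \<in> R" "u = (\<Sum>r\<in>D. of_int (c r) * r)" "!!r. r \<in> D ==> 0 \<le> c r" for u c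
    by (rule ev_high[OF that])
  show "W = UNIV" if W: "V.subspace W" "u0 \<in> W" "!!r x. r \<in> D ==> x \<in> W ==> act (ev (- r)) x \<in> W" for W
  proof -
    have "y \<in> W" if "words u0 \<omega> y n" for y n using that by (induction rule: words.induct) (use W in auto)
    then have "{y. \<exists>n. words u0 \<omega> y n} \<subseteq> W" by blast
    from V.span_minimal[OF this W(1)] have "UNIV \<subseteq> W" by (simp only: words_span[OF u0 u0_simple])
    then show ?thesis by (rule top.extremum_uniqueI)
  qed
  show "(\<Sum>r\<in>D. of_int (c r) * r) = 0"
    if "x \<in> M (\<omega> - (\<Sum>r\<in>D. of_int (c r) * r))" "x ~= 0" "!!r. r \<in> D ==> 0 \<le> c r" "!!r. r \<in> D ==> act (ev r) x = 0" for x c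
    by (rule diff_fixed[OF primitive[OF that(1,2,4,3), symmetric]])
  show "V.dim (M m) \<le> 2" for m by (rule M_dim_le_2)
  show "\<exists>c. V.dim (M (\<omega> - (\<Sum>r\<in>D. of_int (c r) * r))) = 2" by (rule M_2)
qed

end

section \<open>Fundamental weights\<close>

context mult2_rep
begin

interpretation W: hwm scaleV BasisV R D "\<lambda>m g. Re (lx m (co g))" "\<lambda>g. act (ev g)" M \<omega> u0 by (rule hwm)

lemma kil_sum_tt: assumes "h \<in> H" shows "kil (\<Sum>a\<in>D. f a *s tt a) h = (\<Sum>a\<in>D. f a * a h)"
proof -
  have "kil (\<Sum>a\<in>A. f a *s tt a) h = (\<Sum>a\<in>A. f a * a h)" if "A \<subseteq> D" for A
    using finite_subset[OF that base_finite] that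
  proof (induction A rule: finite_induct)
    case (insert a A)
    have "a \<in> R" using insert base_R by (intro subsetD[OF base_R]) simp
    from tt(2)[OF this assms] show ?case using insert by (simp add: kil_add kil_scale)
  qed (simp add: kil_0)
  then show ?thesis by blast
qed

text \<open>The vector \<open>tt u\<close> is the same combination of the \<open>tt r\<close> as
  \<open>u\<close> is of the simple roots, and each \<open>tt\<close> is a multiple of its
  coroot.\<close>

lemma co_span: assumes g: "u \<in> R" shows "co u \<in> span (co ` D)"
proof -
  obtain c where c: "u = cmb c" using root_cmb[OF g] by blast
  have DR: "r \<in> R" if "r \<in> D" for r using base_R that by (rule subsetD)
  let ?t = "\<Sum>r\<in>D. of_int (c r) *s tt r"
  have "?t \<in> H" by (intro subspace_sum[OF H_sub] subspace_scale[OF H_sub] tt(1) DR)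
  then have t: "?t = tt u"
  proof (rule tt_unique[OF g])
    fix h assume h: "h \<in> H"
    show "kil ?t h = u h" unfolding kil_sum_tt[OF h] c cmb_apply ..
  qed
  have "tt r \<in> span (co ` D)" if a: "r \<in> D" for r
  proof -
    have "tt r = (r (tt r) / 2) *s co r" unfolding co_eq[OF DR[OF a]] using tt(4)[OF DR[OF a]] by simp
    then show ?thesis using a by (metis span_scale span_base imageI)
  qed
  then have "?t \<in> span (co ` D)" by (intro span_sum span_scale)
  then show ?thesis unfolding t co_eq[OF g] by (rule span_scale)
qed

lemma span_co: "span (co ` D) = H"
proof
  have "co ` D \<subseteq> H" by (rule image_subsetI) (rule co_H, rule subsetD[OF base_R])
  then show "span (co ` D) \<subseteq> H" using H_sub by (rule span_minimal)
  have "co ` R \<subseteq> span (co ` D)" by (rule image_subsetI) (rule co_span)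
  from span_minimal[OF this subspace_span] show "H \<subseteq> span (co ` D)" using H_co by simp
qed

text \<open>A shared coroot would make two distinct simple roots pair to 2, but such pairings are at
  most 0.\<close>

lemma inj_co: "inj_on co D"
proof (rule inj_onI, rule ccontr)
  fix r b assume a: "r \<in> D" "b \<in> D" "co r = co b" "r ~= b"
  have R: "r \<in> R" using a base_R by (intro subsetD[OF base_R])
  have "Re (lx r (co b)) \<le> 0" by (rule W.pr_simple[OF a(1,2,4)])
  then show False using lx_root[OF R R] co_self[OF R] a(3) by simp
qed

lemma independent_co: "independent (co ` D)"
proof (rule independent_if_scalars_zero)
  show "finite (co ` D)" using base_finite by simp
  fix f x assume z: "(\<Sum>x\<in>co ` D. f x *s x) = 0" and x: "x \<in> co ` D"
  obtain t where b: "t \<in> D" "x = co t" using x by blast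
  have DR: "r \<in> R" if "r \<in> D" for r using base_R that by (rule subsetD)
  let ?g = "\<lambda>r. f (co r) * (2 / r (tt r))"
  have "(\<Sum>r\<in>D. ?g r *s tt r) = (\<Sum>r\<in>D. f (co r) *s co r)"
  proof (rule sum.cong)
    fix r assume a: "r \<in> D"
    show "?g r *s tt r = f (co r) *s co r" using co_eq[OF DR[OF a]] by (simp only: scale_scale)
  qed simp
  also have "\<dots> = 0" using z by (simp add: sum.reindex[OF inj_co])
  finally have s: "(\<Sum>r\<in>D. ?g r *s tt r) = 0" .
  have "?g t = 0"
  proof (rule base_indep[OF _ b(1)])
    fix h assume h: "h \<in> H"
    have "(\<Sum>r\<in>D. ?g r * r h) = kil 0 h" unfolding s[symmetric] by (rule kil_sum_tt[OF h, symmetric])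
    also have "\<dots> = 0" using kil_sum_tt[OF h, of "\<lambda>_. 0"] by simp
    finally show "(\<Sum>r\<in>D. ?g r * r h) = 0" .
  qed
  then show "f x = 0" using tt(4)[OF DR[OF b(1)]] b(2) by simp
qed

lemma dual_eqI:
  assumes f: "f \<in> dual scale H" and g: "g \<in> dual scale H" and e: "!!r. r \<in> D ==> f (co r) = g (co r)"
  shows "f = g"
proof
  fix h
  show "f h = g h"
  proof (cases "h \<in> H")
    case True
    then have "h \<in> span (co ` D)" unfolding span_co .
    then have "h \<in> H \<and> f h = g h"
    proof (induction rule: span_induct_alt)
      case base
      have "f (0 *s 0) = 0 * f 0" "g (0 *s 0) = 0 * g 0" using f g subspace_0[OF H_sub] unfolding dual_def by blast+
      then show ?case using subspace_0[OF H_sub] by simp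
    next
      case (step c x y)
      then obtain r where a: "r \<in> D" "x = co r" by blast
      have x: "x \<in> H" using a base_R co_H by blast
      then have cx: "c *s x \<in> H" by (rule subspace_scale[OF H_sub])
      have "f (c *s x + y) = c * f x + f y" "g (c *s x + y) = c * g x + g y"
        using f g x cx step by (simp_all add: dual_def)
      then show ?case using step e[OF a(1)] a(2) subspace_add[OF H_sub cx] by simp
    qed
    then show ?thesis ..
  next
    case False
    then show ?thesis using f g by (simp add: dual_def)
  qed
qed

text \<open>The simple coroots form a basis of \<open>H\<close>; the coordinate functions of this
  basis, extended by 0, are the unique solutions of the defining description.\<close>

lemma fundamental_weight:
  assumes c: "bij_betw c {1..n} D" and i: "i \<in> {1..n}"
  shows "fundamental_weight H c n i \<in> dual scale H"
    "j \<in> {1..n} ==> fundamental_weight H c n i (co (c j)) = (if i = j then 1 else 0)"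
proof -
  let ?P = "\<lambda>f. f \<in> dual scale H \<and> (\<forall>j\<in>{1..n}. f (co (c j)) = (if i = j then 1 else 0))"
  have cD: "c j \<in> D" if "j \<in> {1..n}" for j using c that by (auto simp: bij_betw_def)
  define f where "f h = (if h \<in> H then representation (co ` D) h (co (c i)) else 0)" for h
  have "?P f"
  proof (intro conjI ballI)
    show "f \<in> dual scale H"
      using representation_add[OF independent_co] representation_scale[OF independent_co]
      unfolding span_co by (simp add: dual_def f_def subspace_add[OF H_sub] subspace_scale[OF H_sub])
    fix j assume j: "j \<in> {1..n}"
    have "co (c j) \<in> co ` D" using cD[OF j] by blast
    then have "f (co (c j)) = (if co (c i) = co (c j) then 1 else 0)"
      using representation_basis[OF independent_co] span_co span_base by (auto simp: f_def)
    also have "co (c i) = co (c j) \<longleftrightarrow> i = j"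
      using inj_on_eq_iff[OF inj_co cD[OF i] cD[OF j]] inj_on_eq_iff[of c "{1..n}" i j] c i j by (simp add: bij_betw_def)
    finally show "f (co (c j)) = (if i = j then 1 else 0)" .
  qed
  moreover have "g = f" if "?P g" for g
  proof (rule dual_eqI)
    fix a assume "a \<in> D"
    then obtain j where "j \<in> {1..n}" "a = c j" using c by (auto simp: bij_betw_def)
    then show "g (co a) = f (co a)" using that \<open>?P f\<close> by simp
  qed (use that \<open>?P f\<close> in auto)
  ultimately have "?P (fundamental_weight H c n i)" unfolding fundamental_weight_def by (rule theI)
  then show "fundamental_weight H c n i \<in> dual scale H"
    "j \<in> {1..n} ==> fundamental_weight H c n i (co (c j)) = (if i = j then 1 else 0)" by auto
qed

lemma dual_closed: "0 \<in> dual scale H" "f \<in> dual scale H ==> g \<in> dual scale H ==> f + of_nat a * g \<in> dual scale H"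
  by (auto simp: dual_def algebra_simps)

text \<open>Both sides of the formula for \<open>\<omega>\<close> are linear forms on
  \<open>H\<close> with the same values at the simple coroots. The condition on \<open>L\<close>
  keeps every index in the range where \<open>fundamental_weight\<close> is characterized.\<close>

lemma numbering:
  obtains t L c where "allowed t L" "bourbaki_numbering H D t c"
    "(\<forall>x\<in>set L. fst x \<in> {1..lie_rank t}) ==>
      \<omega> = sum_list (map (\<lambda>(k, a). of_nat a * fundamental_weight H c (lie_rank t) k) L)"
proof -
  obtain t L c where t: "allowed t L" "simple_type t" and c: "bij_betw c {1..lie_rank t} D"
    and C: "\<forall>i\<in>{1..lie_rank t}. \<forall>j\<in>{1..lie_rank t}. Re (lx (c i) (co (c j))) = of_int (cartan_matrix t i j)"
    and l: "\<forall>i\<in>{1..lie_rank t}. Re (lx \<omega> (co (c i))) = of_int (coef L i)"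
    using W.classification unfolding W.classified_def by blast
  let ?n = "lie_rank t"
  have cR: "c i \<in> R" if "i \<in> {1..?n}" for i
    using subsetD[OF base_R bij_betwE[OF c, rule_format, OF that]] .
  have "bourbaki_numbering H D t c"
    unfolding bourbaki_numbering_def
  proof (intro conjI ballI t(2) c)
    fix i j assume ij: "i \<in> {1..?n}" "j \<in> {1..?n}"
    obtain k :: int where k: "c i (co (c j)) = of_int k" by (rule co_real[OF cR[OF ij(1)] cR[OF ij(2)]]) blast
    have "Re (c i (co (c j))) = of_int (cartan_matrix t i j)" using C[rule_format, OF ij] unfolding lx_root[OF cR[OF ij(1)] cR[OF ij(2)]] .
    then show "c i (co (c j)) = of_int (cartan_matrix t i j)" using k by simp
  qed
  moreover have "\<omega> = sum_list (map (\<lambda>(k, a). of_nat a * fundamental_weight H c ?n k) L)"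
    if L: "\<forall>x\<in>set L. fst x \<in> {1..?n}"
  proof (rule dual_eqI[OF om])
    let ?s = "\<lambda>L. sum_list (map (\<lambda>(k, a). of_nat a * fundamental_weight H c ?n k) L)"
    have s: "?s L \<in> dual scale H \<and> (\<forall>j\<in>{1..?n}. ?s L (co (c j)) = of_int (coef L j))"
      if "\<forall>x\<in>set L. fst x \<in> {1..?n}" for L
      using that
    proof (induction L)
      case Nil
      have "?s [] = 0" by simp
      then show ?case using dual_closed(1) by (simp only: coef_def) simp
    next
      case (Cons p L)
      obtain k a where p: "p = (k, a)" by force
      have k: "k \<in> {1..?n}" using Cons.prems p by (simp only: list.set) simp
      have pl: "\<forall>x\<in>set L. fst x \<in> {1..?n}" using Cons.prems by simp
      have IH: "?s L \<in> dual scale H" "\<forall>j\<in>{1..?n}. ?s L (co (c j)) = of_int (coef L j)"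
        using Cons.IH[OF pl] by blast+
      have e: "?s (p # L) = ?s L + of_nat a * fundamental_weight H c ?n k" by (simp add: p add.commute)
      show ?case unfolding e
      proof (intro conjI ballI)
        show "?s L + of_nat a * fundamental_weight H c ?n k \<in> dual scale H"
          by (rule dual_closed(2)[OF IH(1) fundamental_weight(1)[OF c k]])
        fix j assume j: "j \<in> {1..?n}"
        show "(?s L + of_nat a * fundamental_weight H c ?n k) (co (c j)) = of_int (coef (p # L) j)"
          unfolding plus_fun_apply times_fun_apply IH(2)[rule_format, OF j] fundamental_weight(2)[OF c k j] of_nat_fun_apply
          by (simp add: p coef_def)
      qed
    qed
    show "?s L \<in> dual scale H" using s[OF L] by blast
    fix r assume "r \<in> D"
    then obtain j where j: "j \<in> {1..?n}" "r = c j" using c by (auto simp: bij_betw_def)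
    have R: "c j \<in> R" by (rule cR[OF j(1)])
    obtain k :: int where k: "\<omega> (co (c j)) = of_int k" using weight_int[OF R u0] by blast
    have "Re (\<omega> (co (c j))) = of_int (coef L j)" using l[rule_format, OF j(1)] unfolding lx_dual[OF om co_H[OF R]] .
    then have "\<omega> (co (c j)) = of_int (coef L j)" using k by simp
    then show "\<omega> (co r) = ?s L (co r)" using s[OF L] j by simp
  qed
  ultimately show thesis using that[OF t(1)] by blast
qed

end

lemma (in vector_space) finite_dim_basis:
  assumes finite_dim obtains B where "finite_dimensional_vector_space scale B"
proof -
  obtain C where C: "finite C" "span C = UNIV" using assms unfolding finite_dim_def by blast
  obtain B where B: "B \<subseteq> C" "independent B" "C \<subseteq> span B" using maximal_independent_subset[of C] by blast
  have "span C \<subseteq> span B" using B(3) by (rule span_minimal) (rule subspace_span)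
  then have "span B = UNIV" using C(2) by (intro top.extremum_uniqueI) simp
  moreover have "finite B" using B(1) C(1) by (rule finite_subset)
  ultimately have "finite_dimensional_vector_space scale B"
    by (intro finite_dimensional_vector_space.intro finite_dimensional_vector_space_axioms.intro vector_space_axioms B(2))
  then show thesis by (rule that)
qed

theorem theorem1p1:
  fixes scale :: "complex \<Rightarrow> 'l::ab_group_add \<Rightarrow> 'l" and br :: "'l \<Rightarrow> 'l \<Rightarrow> 'l"
    and scaleV :: "complex \<Rightarrow> 'v::ab_group_add \<Rightarrow> 'v" and \<phi> :: "'l \<Rightarrow> 'v \<Rightarrow> 'v"
    and H :: "'l set" and \<Delta> :: "('l \<Rightarrow> complex) set" and \<omega> :: "'l \<Rightarrow> complex"
  assumes "lie_algebra scale br"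
    and "vector_space.finite_dim scale"
    and "lie_algebra.simple scale br"
    and "lie_algebra.cartan_subalgebra scale br H"
    and "lie_algebra.root_base scale br H \<Delta>"
    and "lie_representation scale br scaleV \<phi>"
    and "vector_space.finite_dim scaleV"
    and "lie_representation.irreducible scaleV \<phi>"
    and "lie_representation.highest_weight scale br scaleV \<phi> H \<Delta> \<omega>"
    and "lie_representation.max_weight_multiplicity scale scaleV \<phi> H = 2"
  shows "\<exists>t \<alpha>. lie_algebra.bourbaki_numbering scale br H \<Delta> t \<alpha> \<and>
    (let n = lie_rank t; \<omega>' = lie_algebra.fundamental_weight scale br H \<alpha> n in
       t = TypeA 2 \<and> (\<exists>a::nat\<ge>1. \<omega> \<in> {\<omega>' 1 + of_nat a * \<omega>' 2, of_nat a * \<omega>' 1 + \<omega>' 2})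
     \<or> t = TypeA 3 \<and> \<omega> \<in> {\<omega>' 1 + \<omega>' 2, \<omega>' 2 + \<omega>' 3, 2 * \<omega>' 2, 3 * \<omega>' 2}
     \<or> t = TypeA n \<and> n > 3 \<and>
         \<omega> \<in> {\<omega>' 1 + \<omega>' 2, \<omega>' (n - 1) + \<omega>' n, 2 * \<omega>' 2, 2 * \<omega>' (n - 1)}
     \<or> t = TypeB 2 \<and> \<omega> \<in> {\<omega>' 1 + \<omega>' 2, 2 * \<omega>' 2, 2 * \<omega>' 1, 3 * \<omega>' 2, 3 * \<omega>' 1}
     \<or> t = TypeC 3 \<and> \<omega> = \<omega>' 2
     \<or> t = TypeC 4 \<and> \<omega> \<in> {\<omega>' 4, \<omega>' 3}
     \<or> t = TypeC 5 \<and> \<omega> = \<omega>' 5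
     \<or> t = TypeF4 \<and> \<omega> = \<omega>' 4
     \<or> t = TypeG2 \<and> \<omega> = \<omega>' 2)"
proof -
  interpret L: lie_algebra scale br by fact
  interpret P: lie_representation scale br scaleV \<phi> by fact
  obtain B where B: "finite_dimensional_vector_space scale B" by (rule L.finite_dim_basis[OF assms(2)])
  obtain BV where BV: "finite_dimensional_vector_space scaleV BV" by (rule P.V.finite_dim_basis[OF assms(7)])
  obtain u where om: "\<omega> \<in> dual scale H" and u: "u \<in> weight_space scaleV \<phi> H \<omega>" "u \<noteq> 0"
    "\<And>\<beta> x. \<beta> \<in> L.positive_roots H \<Delta> \<Longrightarrow> x \<in> L.root_space H \<beta> \<Longrightarrow> \<phi> x u = 0"
    using assms(9) unfolding P.highest_weight_def by blast
  interpret S: simple_lie scale br B H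
    by (intro simple_lie.intro fd_complex.intro B simple_lie_axioms.intro assms)
  interpret D: based scale br B H \<Delta> by (intro based.intro S.simple_lie_axioms based_axioms.intro assms)
  interpret Q: rep scale br B H scaleV \<phi> BV
    by (intro rep.intro S.simple_lie_axioms assms fd_complex.intro BV)
  interpret U: hw_rep scale br B H scaleV \<phi> BV \<Delta> \<omega> u
    by (intro hw_rep.intro Q.rep_axioms D.based_axioms hw_rep_axioms.intro assms om u)
  interpret mult2_rep scale br B H scaleV \<phi> BV \<Delta> \<omega> u
    by (intro mult2_rep.intro U.hw_rep_axioms mult2_rep_axioms.intro assms)
  obtain t L \<alpha> where t: "allowed t L" "L.bourbaki_numbering H \<Delta> t \<alpha>"
    and \<omega>: "(\<forall>x\<in>set L. fst x \<in> {1..lie_rank t}) \<Longrightarrow>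
      \<omega> = sum_list (map (\<lambda>(k, a). of_nat a * L.fundamental_weight H \<alpha> (lie_rank t) k) L)"
    by (rule numbering) blast
  have "\<forall>x\<in>set L. fst x \<in> {1..lie_rank t}" using t(1) unfolding allowed_def by auto
  note \<omega> = \<omega>[OF this]
  show ?thesis
    unfolding Let_def
    by (rule exI[of _ t], rule exI[of _ \<alpha>], rule conjI[OF t(2)], insert t(1)[unfolded allowed_def],
      elim disjE conjE exE, insert \<omega>, auto)
qed

end
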